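(* For any small triangulated categories $\mathcal T_0,\mathcal T_1,\dots,\mathcal T_n$ and any Picard groupoid $\mathcal P$, pullback along the universal determinant, $\det^\ast\colon f\mapsto f\circ\det$, gives an equivalence of groupoids $$\mathrm{Det}(\mathcal T_0,\dots,\mathcal T_n;\mathcal P)\simeq\mathrm{Pic}^\times(V(\mathcal T_0),\dots,V(\mathcal T_n);\mathcal P).$$
   Context: **Picard groupoids.** A Picard groupoid is a groupoid $\mathcal P$ with a symmetric monoidal structure $(+,0)$ (not assumed strict) such that $x+(-)\colon\mathcal P\to\mathcal P$ is an equivalence for every object $x$. Write $\mathrm{coas}\colon(a+b)+(c+d)\to(a+c)+(b+d)$ for the canonical isomorphism built from associativity and symmetry. Morphisms of Picard groupoids are symmetric monoidal functors; transformations between them are monoidal natural transformations. A functor $F\colon\mathcal P_1\times\dots\times\mathcal P_n\to\mathcal P$ between Picard groupoids is *multiexact* if it is a (symmetric) monoidal functor in each variable, naturally in the others, and for every pair of variables (the others fixed and suppressed) the composite $F(a+b,c+d)\to F(a,c+d)+F(b,c+d)\to(F(a,c)+F(a,d))+(F(b,c)+F(b,d))\xrightarrow{\mathrm{coas}}(F(a,c)+F(b,c))+(F(a,d)+F(b,d))$ equals $F(a+b,c+d)\to F(a+b,c)+F(a+b,d)\to(F(a,c)+F(b,c))+(F(a,d)+F(b,d))$. $\mathrm{Pic}$ is the groupoid-enriched multicategory of Picard groupoids: $\mathrm{Pic}(\mathcal P_1,\dots,\mathcal P_n;\mathcal P)$ is the groupoid of multiexact functors and natural isomorphisms (monoidal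 in each variable). $\mathrm{Pic}^\times$ is the associated monoidal 2-category of lists of Picard groupoids; for a target list of length one, $\mathrm{Pic}^\times(\mathcal P_1,\dots,\mathcal P_n;\mathcal P)=\mathrm{Pic}(\mathcal P_1,\dots,\mathcal P_n;\mathcal P)$. **Determinant functors.** $\Sigma$ is the translation of a triangulated category, and $\mathrm{isom}(\mathcal T)$ is the category of isomorphisms of $\mathcal T$. A *determinant functor* $[-]\colon\mathcal T\to\mathcal P$ is a functor $[-]\colon\mathrm{isom}(\mathcal T)\to\mathcal P$ with additivity data: for each distinguished triangle $\Delta\colon x\to y\to z\to\Sigma x$ a morphism $[\Delta]\colon[z]+[x]\to[y]$, natural for isomorphisms of distinguished triangles, such that: (Commutativity) for the split triangles $\Delta_1\colon x\to x\oplus y\to y\to\Sigma x$ and $\Delta_2\colon y\to x\oplus y\to x\to\Sigma y$, $[\Delta_2]$ equals $[\Delta_1]$ precomposed with the symmetry $[x]+[y]\to[y]+[x]$; (Associativity) for every octahedron with triangles $\Delta_1\colon x\to y\to z'\to\Sigma x$, $\Delta_2\colon x\to z\to y'\to\Sigma x$, $\Delta_3\colon y\to z\to x'\to\Sigma y$, $\Delta_4\colon z'\to y'\to x'\to\Sigma z'$, one has $[\Delta_2]\circ([\Delta_4]+\mathrm{id})=[\Delta_3]\circ(\mathrm{id}+[\Delta_1])\circ\mathrm{assoc}$ as maps $([x']+[z'])+[x]\to[z]$. **Universal determinant functors.** A determinant functor $\det\colon\mathcal T\to V$ is *universal* if for every determinant functor $D\colon\mathcal T\to\mathcal P'$ there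 is a pair $(f,\alpha)$ of a morphism of Picard groupoids $f\colon V\to\mathcal P'$ and a natural transformation $\alpha\colon f\circ\det\Rightarrow D$ such that for each distinguished triangle $\Delta\colon x\to y\to z\to\Sigma x$, $\alpha_y$ composed with $f(\det z)+f(\det x)\to f(\det z+\det x)\xrightarrow{f(\det\Delta)}f(\det y)$ equals $D(\Delta)\circ(\alpha_z+\alpha_x)$; and for any other such pair $(f',\alpha')$ there is a unique natural transformation $\beta\colon f\Rightarrow f'$ with $\alpha'\circ(\beta\ast\det)=\alpha$. A universal determinant functor $\det\colon\mathcal T\to V(\mathcal T)$ is known to exist for every small triangulated category $\mathcal T$; one is fixed for each $\mathcal T$. The product $\mathcal T_0\times\dots\times\mathcal T_n\to V(\mathcal T_0)\times\dots\times V(\mathcal T_n)$ is also denoted $\det$. **Multi-determinant functors.** A *multi-determinant functor* $D\colon\mathcal T_1\times\dots\times\mathcal T_m\to\mathcal P$ is an $m$-functor $\mathrm{isom}(\mathcal T_1)\times\dots\times\mathrm{isom}(\mathcal T_m)\to\mathcal P$ that is a determinant functor in each variable and satisfies, for distinct $i,j$ (other variables fixed and suppressed): (Two Triangles, written for $i<j$) for distinguished triangles $\Delta_k\colon x_k\to y_k\to z_k\to\Sigma x_k$ in $\mathcal T_k$, $k=i,j$, one has $D(y_i,\Delta_j)\circ(D(\Delta_i,z_j)+D(\Delta_i,x_j))=D(\Delta_i,y_j)\circ(D(z_i,\Delta_j)+D(x_i,\Delta_j))\circ\mathrm{coas}$ as maps $(D(z_i,z_j)+D(x_i,z_j))+(D(z_i,x_j)+D(x_i,x_j))\to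 D(y_i,y_j)$; (Triangle-Function) for $f_i\colon a_i\to b_i$ in $\mathrm{isom}(\mathcal T_i)$ and a distinguished triangle $\Delta_j\colon x_j\to y_j\to z_j\to\Sigma x_j$ in $\mathcal T_j$, $D(f_i,y_j)\circ D(a_i,\Delta_j)=D(b_i,\Delta_j)\circ(D(f_i,z_j)+D(f_i,x_j))$. A *morphism* $\theta\colon d_1\Rightarrow d_2$ of multi-determinant functors is a natural transformation with $\theta_{y_i}\circ d_1(\Delta_i)=d_2(\Delta_i)\circ(\theta_{z_i}+\theta_{x_i})$ for every variable $i$ and distinguished triangle $\Delta_i$. $\mathrm{Det}(\mathcal T_1,\dots,\mathcal T_m;\mathcal P)$ is the groupoid of multi-determinant functors and their morphisms. For a multiexact $f$, $f\circ\det$ is a multi-determinant functor with additivity data $f(\det z)+f(\det x)\cong f(\det z+\det x)\to f(\det y)$ in each variable. *)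

theory Defs
  imports "HOL-Library.FuncSet" "HOL-Algebra.Group"
begin

section \<open>Categories, functors, natural transformations\<close>

text \<open>
  A category consists of carrier sets of objects and arrows inside arbitrary types, so every
  category below is small.  \<open>Cmp C g f\<close> is the composite of \<open>f\<close> followed by \<open>g\<close>; all axioms are
  relativised to the carriers and to composable arrows.
\<close>

record ('o, 'm) cat =
  Obj :: "'o set"
  Arr :: "'m set"
  Src :: "'m \<Rightarrow> 'o"
  Tgt :: "'m \<Rightarrow> 'o"
  Idn :: "'o \<Rightarrow> 'm"
  Cmp :: "'m \<Rightarrow> 'm \<Rightarrow> 'm" (infixr "\<cdot>\<index>" 70)

definition Hom :: "('o, 'm, 'z) cat_scheme \<Rightarrow> 'o \<Rightarrow> 'o \<Rightarrow> 'm set" where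
  "Hom C a b = {f \<in> Arr C. Src C f = a \<and> Tgt C f = b}"

definition category :: "('o, 'm, 'z) cat_scheme \<Rightarrow> bool" where
  "category C \<longleftrightarrow>
    (\<forall>f\<in>Arr C. Src C f \<in> Obj C \<and> Tgt C f \<in> Obj C) \<and>
    (\<forall>a\<in>Obj C. Idn C a \<in> Hom C a a) \<and>
    (\<forall>f\<in>Arr C. \<forall>g\<in>Arr C. Src C g = Tgt C f \<longrightarrow> g \<cdot>\<^bsub>C\<^esub> f \<in> Hom C (Src C f) (Tgt C g)) \<and>
    (\<forall>f\<in>Arr C. f \<cdot>\<^bsub>C\<^esub> Idn C (Src C f) = f \<and> Idn C (Tgt C f) \<cdot>\<^bsub>C\<^esub> f = f) \<and>
    (\<forall>f\<in>Arr C. \<forall>g\<in>Arr C. \<forall>h\<in>Arr C. Src C g = Tgt C f \<and> Src C h = Tgt C g \<longrightarrow>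
       (h \<cdot>\<^bsub>C\<^esub> g) \<cdot>\<^bsub>C\<^esub> f = h \<cdot>\<^bsub>C\<^esub> (g \<cdot>\<^bsub>C\<^esub> f))"

definition inverse_of :: "('o, 'm, 'z) cat_scheme \<Rightarrow> 'm \<Rightarrow> 'm \<Rightarrow> bool" where
  "inverse_of C f g \<longleftrightarrow> g \<in> Hom C (Tgt C f) (Src C f) \<and>
     g \<cdot>\<^bsub>C\<^esub> f = Idn C (Src C f) \<and> f \<cdot>\<^bsub>C\<^esub> g = Idn C (Tgt C f)"

definition is_iso :: "('o, 'm, 'z) cat_scheme \<Rightarrow> 'm \<Rightarrow> bool" where
  "is_iso C f \<longleftrightarrow> f \<in> Arr C \<and> (\<exists>g. inverse_of C f g)"

definition inv_arr :: "('o, 'm, 'z) cat_scheme \<Rightarrow> 'm \<Rightarrow> 'm" where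
  "inv_arr C f = (THE g. inverse_of C f g)"

definition groupoid :: "('o, 'm, 'z) cat_scheme \<Rightarrow> bool" where
  "groupoid C \<longleftrightarrow> category C \<and> (\<forall>f\<in>Arr C. is_iso C f)"

definition isom :: "('o, 'm, 'z) cat_scheme \<Rightarrow> ('o, 'm) cat" where
  "isom C = \<lparr>Obj = Obj C, Arr = {f. is_iso C f}, Src = Src C, Tgt = Tgt C, Idn = Idn C, Cmp = Cmp C\<rparr>"

text \<open>
  Products are indexed by a set \<open>I\<close>; objects and arrows are extensional families, so that
  \<open>x(i := a)\<close> puts \<open>a\<close> into the \<open>i\<close>-th place of a family \<open>x\<close> indexed by \<open>I - {i}\<close>.
\<close>

definition prod_cat :: "'i set \<Rightarrow> ('i \<Rightarrow> ('o, 'm, 'z) cat_scheme) \<Rightarrow> ('i \<Rightarrow> 'o, 'i \<Rightarrow> 'm) cat" where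
  "prod_cat I C =
    \<lparr>Obj = (\<Pi>\<^sub>E i\<in>I. Obj (C i)),
     Arr = (\<Pi>\<^sub>E i\<in>I. Arr (C i)),
     Src = (\<lambda>f. \<lambda>i\<in>I. Src (C i) (f i)),
     Tgt = (\<lambda>f. \<lambda>i\<in>I. Tgt (C i) (f i)),
     Idn = (\<lambda>x. \<lambda>i\<in>I. Idn (C i) (x i)),
     Cmp = (\<lambda>g f. \<lambda>i\<in>I. g i \<cdot>\<^bsub>C i\<^esub> f i)\<rparr>"

text \<open>The arrow of the product over \<open>I\<close> that is \<open>f\<close> in place \<open>i\<close> and the identity of \<open>x\<close> elsewhere.\<close>

definition at_place ::
  "'i set \<Rightarrow> ('i \<Rightarrow> ('o, 'm, 'z) cat_scheme) \<Rightarrow> ('i \<Rightarrow> 'o) \<Rightarrow> 'i \<Rightarrow> 'm \<Rightarrow> ('i \<Rightarrow> 'm)" where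
  "at_place I C x i f = (Idn (prod_cat (I - {i}) C) x)(i := f)"

record ('o, 'm, 'p, 'q) funct =
  fob :: "'o \<Rightarrow> 'p"
  far :: "'m \<Rightarrow> 'q"

definition is_functor ::
  "('o, 'm, 'y) cat_scheme \<Rightarrow> ('p, 'q, 'z) cat_scheme \<Rightarrow> ('o, 'm, 'p, 'q, 'x) funct_scheme \<Rightarrow> bool" where
  "is_functor C D F \<longleftrightarrow> category C \<and> category D \<and>
    (\<forall>a\<in>Obj C. fob F a \<in> Obj D) \<and>
    (\<forall>f\<in>Arr C. far F f \<in> Hom D (fob F (Src C f)) (fob F (Tgt C f))) \<and>
    (\<forall>a\<in>Obj C. far F (Idn C a) = Idn D (fob F a)) \<and>
    (\<forall>f\<in>Arr C. \<forall>g\<in>Arr C. Src C g = Tgt C f \<longrightarrow> far F (g \<cdot>\<^bsub>C\<^esub> f) = far F g \<cdot>\<^bsub>D\<^esub> far F f)"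

definition id_functor :: "('o, 'm, 'o, 'm) funct" where
  "id_functor = \<lparr>fob = (\<lambda>a. a), far = (\<lambda>f. f)\<rparr>"

definition comp_functor ::
  "('p, 'q, 'r, 's, 'x) funct_scheme \<Rightarrow> ('o, 'm, 'p, 'q, 'y) funct_scheme \<Rightarrow> ('o, 'm, 'r, 's) funct" where
  "comp_functor G F = \<lparr>fob = (\<lambda>a. fob G (fob F a)), far = (\<lambda>f. far G (far F f))\<rparr>"

text \<open>
  Transformations are extensional on the objects of the source, so that equality of
  transformations is equality of HOL functions.
\<close>

definition nat_trans ::
  "('o, 'm, 'y) cat_scheme \<Rightarrow> ('p, 'q, 'z) cat_scheme \<Rightarrow> ('o, 'm, 'p, 'q, 'x) funct_scheme \<Rightarrow>
   ('o, 'm, 'p, 'q, 'w) funct_scheme \<Rightarrow> ('o \<Rightarrow> 'q) \<Rightarrow> bool" where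
  "nat_trans C D F G \<eta> \<longleftrightarrow>
    \<eta> \<in> (\<Pi>\<^sub>E a\<in>Obj C. Hom D (fob F a) (fob G a)) \<and>
    (\<forall>f\<in>Arr C. far G f \<cdot>\<^bsub>D\<^esub> \<eta> (Src C f) = \<eta> (Tgt C f) \<cdot>\<^bsub>D\<^esub> far F f)"

definition nat_iso ::
  "('o, 'm, 'y) cat_scheme \<Rightarrow> ('p, 'q, 'z) cat_scheme \<Rightarrow> ('o, 'm, 'p, 'q, 'x) funct_scheme \<Rightarrow>
   ('o, 'm, 'p, 'q, 'w) funct_scheme \<Rightarrow> ('o \<Rightarrow> 'q) \<Rightarrow> bool" where
  "nat_iso C D F G \<eta> \<longleftrightarrow> nat_trans C D F G \<eta> \<and> (\<forall>a\<in>Obj C. is_iso D (\<eta> a))"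

definition is_equivalence ::
  "('o, 'm, 'y) cat_scheme \<Rightarrow> ('p, 'q, 'z) cat_scheme \<Rightarrow> ('o, 'm, 'p, 'q, 'x) funct_scheme \<Rightarrow> bool" where
  "is_equivalence C D F \<longleftrightarrow> is_functor C D F \<and>
    (\<exists>G :: ('p, 'q, 'o, 'm) funct. is_functor D C G \<and>
      (\<exists>\<eta>. nat_iso C C id_functor (comp_functor G F) \<eta>) \<and>
      (\<exists>\<epsilon>. nat_iso D D (comp_functor F G) id_functor \<epsilon>))"


section \<open>Picard groupoids\<close>

record ('o, 'm) moncat = "('o, 'm) cat" +
  osum :: "'o \<Rightarrow> 'o \<Rightarrow> 'o" (infixl "\<boxplus>\<index>" 75)
  asum :: "'m \<Rightarrow> 'm \<Rightarrow> 'm" (infixl "[+]\<index>" 75)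
  ounit :: "'o"
  assoc :: "'o \<Rightarrow> 'o \<Rightarrow> 'o \<Rightarrow> 'm"
  lunit :: "'o \<Rightarrow> 'm"
  runit :: "'o \<Rightarrow> 'm"
  symm :: "'o \<Rightarrow> 'o \<Rightarrow> 'm"

definition sym_moncat :: "('o, 'm, 'z) moncat_scheme \<Rightarrow> bool" where
  "sym_moncat P \<longleftrightarrow> category P \<and>
    \<comment> \<open>the sum is a functor of two variables\<close>
    (\<forall>a\<in>Obj P. \<forall>b\<in>Obj P. a \<boxplus>\<^bsub>P\<^esub> b \<in> Obj P) \<and>
    (\<forall>f\<in>Arr P. \<forall>g\<in>Arr P.
       f [+]\<^bsub>P\<^esub> g \<in> Hom P (Src P f \<boxplus>\<^bsub>P\<^esub> Src P g) (Tgt P f \<boxplus>\<^bsub>P\<^esub> Tgt P g)) \<and>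
    (\<forall>a\<in>Obj P. \<forall>b\<in>Obj P. Idn P a [+]\<^bsub>P\<^esub> Idn P b = Idn P (a \<boxplus>\<^bsub>P\<^esub> b)) \<and>
    (\<forall>f\<in>Arr P. \<forall>g\<in>Arr P. \<forall>f'\<in>Arr P. \<forall>g'\<in>Arr P. Src P f' = Tgt P f \<and> Src P g' = Tgt P g \<longrightarrow>
       (f' \<cdot>\<^bsub>P\<^esub> f) [+]\<^bsub>P\<^esub> (g' \<cdot>\<^bsub>P\<^esub> g) = (f' [+]\<^bsub>P\<^esub> g') \<cdot>\<^bsub>P\<^esub> (f [+]\<^bsub>P\<^esub> g)) \<and>
    ounit P \<in> Obj P \<and>
    \<comment> \<open>the structure isomorphisms\<close>
    (\<forall>a\<in>Obj P. \<forall>b\<in>Obj P. \<forall>c\<in>Obj P. is_iso P (assoc P a b c) \<and>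
       assoc P a b c \<in> Hom P ((a \<boxplus>\<^bsub>P\<^esub> b) \<boxplus>\<^bsub>P\<^esub> c) (a \<boxplus>\<^bsub>P\<^esub> (b \<boxplus>\<^bsub>P\<^esub> c))) \<and>
    (\<forall>a\<in>Obj P. is_iso P (lunit P a) \<and> lunit P a \<in> Hom P (ounit P \<boxplus>\<^bsub>P\<^esub> a) a) \<and>
    (\<forall>a\<in>Obj P. is_iso P (runit P a) \<and> runit P a \<in> Hom P (a \<boxplus>\<^bsub>P\<^esub> ounit P) a) \<and>
    (\<forall>a\<in>Obj P. \<forall>b\<in>Obj P. symm P a b \<in> Hom P (a \<boxplus>\<^bsub>P\<^esub> b) (b \<boxplus>\<^bsub>P\<^esub> a)) \<and>
    \<comment> \<open>their naturality\<close>
    (\<forall>f\<in>Arr P. \<forall>g\<in>Arr P. \<forall>h\<in>Arr P.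
       assoc P (Tgt P f) (Tgt P g) (Tgt P h) \<cdot>\<^bsub>P\<^esub> ((f [+]\<^bsub>P\<^esub> g) [+]\<^bsub>P\<^esub> h) =
       (f [+]\<^bsub>P\<^esub> (g [+]\<^bsub>P\<^esub> h)) \<cdot>\<^bsub>P\<^esub> assoc P (Src P f) (Src P g) (Src P h)) \<and>
    (\<forall>f\<in>Arr P. lunit P (Tgt P f) \<cdot>\<^bsub>P\<^esub> (Idn P (ounit P) [+]\<^bsub>P\<^esub> f) = f \<cdot>\<^bsub>P\<^esub> lunit P (Src P f)) \<and>
    (\<forall>f\<in>Arr P. runit P (Tgt P f) \<cdot>\<^bsub>P\<^esub> (f [+]\<^bsub>P\<^esub> Idn P (ounit P)) = f \<cdot>\<^bsub>P\<^esub> runit P (Src P f)) \<and>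
    (\<forall>f\<in>Arr P. \<forall>g\<in>Arr P.
       symm P (Tgt P f) (Tgt P g) \<cdot>\<^bsub>P\<^esub> (f [+]\<^bsub>P\<^esub> g) = (g [+]\<^bsub>P\<^esub> f) \<cdot>\<^bsub>P\<^esub> symm P (Src P f) (Src P g)) \<and>
    \<comment> \<open>pentagon, triangle, hexagon, symmetry\<close>
    (\<forall>a\<in>Obj P. \<forall>b\<in>Obj P. \<forall>c\<in>Obj P. \<forall>d\<in>Obj P.
       assoc P a b (c \<boxplus>\<^bsub>P\<^esub> d) \<cdot>\<^bsub>P\<^esub> assoc P (a \<boxplus>\<^bsub>P\<^esub> b) c d =
       (Idn P a [+]\<^bsub>P\<^esub> assoc P b c d) \<cdot>\<^bsub>P\<^esub> assoc P a (b \<boxplus>\<^bsub>P\<^esub> c) d \<cdot>\<^bsub>P\<^esub> (assoc P a b c [+]\<^bsub>P\<^esub> Idn P d)) \<and>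
    (\<forall>a\<in>Obj P. \<forall>b\<in>Obj P.
       (Idn P a [+]\<^bsub>P\<^esub> lunit P b) \<cdot>\<^bsub>P\<^esub> assoc P a (ounit P) b = runit P a [+]\<^bsub>P\<^esub> Idn P b) \<and>
    (\<forall>a\<in>Obj P. \<forall>b\<in>Obj P. \<forall>c\<in>Obj P.
       assoc P b c a \<cdot>\<^bsub>P\<^esub> symm P a (b \<boxplus>\<^bsub>P\<^esub> c) \<cdot>\<^bsub>P\<^esub> assoc P a b c =
       (Idn P b [+]\<^bsub>P\<^esub> symm P a c) \<cdot>\<^bsub>P\<^esub> assoc P b a c \<cdot>\<^bsub>P\<^esub> (symm P a b [+]\<^bsub>P\<^esub> Idn P c)) \<and>
    (\<forall>a\<in>Obj P. \<forall>b\<in>Obj P. symm P b a \<cdot>\<^bsub>P\<^esub> symm P a b = Idn P (a \<boxplus>\<^bsub>P\<^esub> b))"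

definition picard :: "('o, 'm, 'z) moncat_scheme \<Rightarrow> bool" where
  "picard P \<longleftrightarrow> groupoid P \<and> sym_moncat P \<and>
    (\<forall>x\<in>Obj P. is_equivalence P P
       \<lparr>fob = (\<lambda>a. x \<boxplus>\<^bsub>P\<^esub> a), far = (\<lambda>f. Idn P x [+]\<^bsub>P\<^esub> f)\<rparr>)"

text \<open>\<open>coas P a b c d : (a + b) + (c + d) \<rightarrow> (a + c) + (b + d)\<close>\<close>

definition coas :: "('o, 'm, 'z) moncat_scheme \<Rightarrow> 'o \<Rightarrow> 'o \<Rightarrow> 'o \<Rightarrow> 'o \<Rightarrow> 'm" where
  "coas P a b c d =
     inv_arr P (assoc P a c (b \<boxplus>\<^bsub>P\<^esub> d)) \<cdot>\<^bsub>P\<^esub>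
     (Idn P a [+]\<^bsub>P\<^esub> assoc P c b d) \<cdot>\<^bsub>P\<^esub>
     (Idn P a [+]\<^bsub>P\<^esub> (symm P b c [+]\<^bsub>P\<^esub> Idn P d)) \<cdot>\<^bsub>P\<^esub>
     (Idn P a [+]\<^bsub>P\<^esub> inv_arr P (assoc P b c d)) \<cdot>\<^bsub>P\<^esub>
     assoc P a b (c \<boxplus>\<^bsub>P\<^esub> d)"

text \<open>\<open>fadd F a b : F a + F b \<rightarrow> F (a + b)\<close> and \<open>funit F : 0 \<rightarrow> F 0\<close>\<close>

record ('o, 'm, 'p, 'q) smfunct = "('o, 'm, 'p, 'q) funct" +
  fadd :: "'o \<Rightarrow> 'o \<Rightarrow> 'q"
  funit :: "'q"

definition sm_functor ::
  "('o, 'm, 'y) moncat_scheme \<Rightarrow> ('p, 'q, 'z) moncat_scheme \<Rightarrow> ('o, 'm, 'p, 'q, 'x) smfunct_scheme \<Rightarrow> bool" where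
  "sm_functor V P F \<longleftrightarrow> is_functor V P F \<and>
    (\<forall>a\<in>Obj V. \<forall>b\<in>Obj V. is_iso P (fadd F a b) \<and>
       fadd F a b \<in> Hom P (fob F a \<boxplus>\<^bsub>P\<^esub> fob F b) (fob F (a \<boxplus>\<^bsub>V\<^esub> b))) \<and>
    is_iso P (funit F) \<and> funit F \<in> Hom P (ounit P) (fob F (ounit V)) \<and>
    (\<forall>f\<in>Arr V. \<forall>g\<in>Arr V.
       fadd F (Tgt V f) (Tgt V g) \<cdot>\<^bsub>P\<^esub> (far F f [+]\<^bsub>P\<^esub> far F g) =
       far F (f [+]\<^bsub>V\<^esub> g) \<cdot>\<^bsub>P\<^esub> fadd F (Src V f) (Src V g)) \<and>
    (\<forall>a\<in>Obj V. \<forall>b\<in>Obj V. \<forall>c\<in>Obj V.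
       far F (assoc V a b c) \<cdot>\<^bsub>P\<^esub> fadd F (a \<boxplus>\<^bsub>V\<^esub> b) c \<cdot>\<^bsub>P\<^esub> (fadd F a b [+]\<^bsub>P\<^esub> Idn P (fob F c)) =
       fadd F a (b \<boxplus>\<^bsub>V\<^esub> c) \<cdot>\<^bsub>P\<^esub> (Idn P (fob F a) [+]\<^bsub>P\<^esub> fadd F b c) \<cdot>\<^bsub>P\<^esub>
         assoc P (fob F a) (fob F b) (fob F c)) \<and>
    (\<forall>a\<in>Obj V. far F (lunit V a) \<cdot>\<^bsub>P\<^esub> fadd F (ounit V) a \<cdot>\<^bsub>P\<^esub> (funit F [+]\<^bsub>P\<^esub> Idn P (fob F a)) =
       lunit P (fob F a)) \<and>
    (\<forall>a\<in>Obj V. far F (runit V a) \<cdot>\<^bsub>P\<^esub> fadd F a (ounit V) \<cdot>\<^bsub>P\<^esub> (Idn P (fob F a) [+]\<^bsub>P\<^esub> funit F) =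
       runit P (fob F a)) \<and>
    (\<forall>a\<in>Obj V. \<forall>b\<in>Obj V.
       far F (symm V a b) \<cdot>\<^bsub>P\<^esub> fadd F a b = fadd F b a \<cdot>\<^bsub>P\<^esub> symm P (fob F a) (fob F b))"

definition mon_trans ::
  "('o, 'm, 'y) moncat_scheme \<Rightarrow> ('p, 'q, 'z) moncat_scheme \<Rightarrow> ('o, 'm, 'p, 'q, 'x) smfunct_scheme \<Rightarrow>
   ('o, 'm, 'p, 'q, 'w) smfunct_scheme \<Rightarrow> ('o \<Rightarrow> 'q) \<Rightarrow> bool" where
  "mon_trans V P F G \<eta> \<longleftrightarrow> nat_trans V P F G \<eta> \<and>
    (\<forall>a\<in>Obj V. \<forall>b\<in>Obj V.
       \<eta> (a \<boxplus>\<^bsub>V\<^esub> b) \<cdot>\<^bsub>P\<^esub> fadd F a b = fadd G a b \<cdot>\<^bsub>P\<^esub> (\<eta> a [+]\<^bsub>P\<^esub> \<eta> b)) \<and>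
    \<eta> (ounit V) \<cdot>\<^bsub>P\<^esub> funit F = funit G"

text \<open>
  In functors of several variables, the structure \<open>madd F i x a b : F(x, a) + F(x, b) \<rightarrow> F(x, a + b)\<close>
  and \<open>munit F i x : 0 \<rightarrow> F(x, 0)\<close> in the \<open>i\<close>-th variable is indexed by the family \<open>x\<close> of the values
  of the other variables.
\<close>

record ('i, 'o, 'm, 'p, 'q) mfunct = "('i \<Rightarrow> 'o, 'i \<Rightarrow> 'm, 'p, 'q) funct" +
  madd :: "'i \<Rightarrow> ('i \<Rightarrow> 'o) \<Rightarrow> 'o \<Rightarrow> 'o \<Rightarrow> 'q"
  munit :: "'i \<Rightarrow> ('i \<Rightarrow> 'o) \<Rightarrow> 'q"

definition sm_slice ::
  "'i set \<Rightarrow> ('i \<Rightarrow> ('o, 'm, 'z) cat_scheme) \<Rightarrow> ('i, 'o, 'm, 'p, 'q) mfunct \<Rightarrow> 'i \<Rightarrow> ('i \<Rightarrow> 'o) \<Rightarrow>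
   ('o, 'm, 'p, 'q) smfunct" where
  "sm_slice I V F i x =
    \<lparr>fob = (\<lambda>a. fob F (x(i := a))), far = (\<lambda>f. far F (at_place I V x i f)),
     fadd = madd F i x, funit = munit F i x\<rparr>"

definition multiexact ::
  "'i set \<Rightarrow> ('i \<Rightarrow> ('o, 'm, 'y) moncat_scheme) \<Rightarrow> ('p, 'q, 'z) moncat_scheme \<Rightarrow>
   ('i, 'o, 'm, 'p, 'q) mfunct \<Rightarrow> bool" where
  "multiexact I V P F \<longleftrightarrow> is_functor (prod_cat I V) P F \<and>
    (\<forall>i\<in>I. \<forall>x\<in>Obj (prod_cat (I - {i}) V). sm_functor (V i) P (sm_slice I V F i x)) \<and>
    \<comment> \<open>naturality of the structure in each variable with respect to the other variables\<close>
    (\<forall>i\<in>I. \<forall>g\<in>Arr (prod_cat (I - {i}) V).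
       let x = Src (prod_cat (I - {i}) V) g; x' = Tgt (prod_cat (I - {i}) V) g in
       (\<forall>a\<in>Obj (V i). \<forall>b\<in>Obj (V i).
          far F (g(i := Idn (V i) (a \<boxplus>\<^bsub>V i\<^esub> b))) \<cdot>\<^bsub>P\<^esub> madd F i x a b =
          madd F i x' a b \<cdot>\<^bsub>P\<^esub> (far F (g(i := Idn (V i) a)) [+]\<^bsub>P\<^esub> far F (g(i := Idn (V i) b)))) \<and>
       far F (g(i := Idn (V i) (ounit (V i)))) \<cdot>\<^bsub>P\<^esub> munit F i x = munit F i x') \<and>
    \<comment> \<open>compatibility of the additivity isomorphisms in two variables\<close>
    (\<forall>i\<in>I. \<forall>j\<in>I. i \<noteq> j \<longrightarrow> (\<forall>x\<in>Obj (prod_cat (I - {i, j}) V).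
      \<forall>a\<in>Obj (V i). \<forall>b\<in>Obj (V i). \<forall>c\<in>Obj (V j). \<forall>d\<in>Obj (V j).
       let F' = (\<lambda>a c. fob F (x(i := a, j := c)));
           split_i = (\<lambda>c. inv_arr P (madd F i (x(j := c)) a b));
           split_j = (\<lambda>a. inv_arr P (madd F j (x(i := a)) c d)) in
       coas P (F' a c) (F' a d) (F' b c) (F' b d) \<cdot>\<^bsub>P\<^esub>
         (split_j a [+]\<^bsub>P\<^esub> split_j b) \<cdot>\<^bsub>P\<^esub> split_i (c \<boxplus>\<^bsub>V j\<^esub> d) =
       (split_i c [+]\<^bsub>P\<^esub> split_i d) \<cdot>\<^bsub>P\<^esub> split_j (a \<boxplus>\<^bsub>V i\<^esub> b)))"

definition multi_mon_trans ::
  "'i set \<Rightarrow> ('i \<Rightarrow> ('o, 'm, 'y) moncat_scheme) \<Rightarrow> ('p, 'q, 'z) moncat_scheme \<Rightarrow>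
   ('i, 'o, 'm, 'p, 'q) mfunct \<Rightarrow> ('i, 'o, 'm, 'p, 'q) mfunct \<Rightarrow> (('i \<Rightarrow> 'o) \<Rightarrow> 'q) \<Rightarrow> bool" where
  "multi_mon_trans I V P F G \<eta> \<longleftrightarrow> nat_trans (prod_cat I V) P F G \<eta> \<and>
    (\<forall>i\<in>I. \<forall>x\<in>Obj (prod_cat (I - {i}) V).
       mon_trans (V i) P (sm_slice I V F i x) (sm_slice I V G i x) (\<lambda>a. \<eta> (x(i := a))))"

definition mfunct_extensional ::
  "'i set \<Rightarrow> ('i \<Rightarrow> ('o, 'm, 'y) moncat_scheme) \<Rightarrow> ('i, 'o, 'm, 'p, 'q) mfunct \<Rightarrow> bool" where
  "mfunct_extensional I V F \<longleftrightarrow>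
    fob F \<in> extensional (Obj (prod_cat I V)) \<and> far F \<in> extensional (Arr (prod_cat I V)) \<and>
    (\<forall>i x a b. \<not> (i \<in> I \<and> x \<in> Obj (prod_cat (I - {i}) V) \<and> a \<in> Obj (V i) \<and> b \<in> Obj (V i)) \<longrightarrow>
       madd F i x a b = undefined) \<and>
    (\<forall>i x. \<not> (i \<in> I \<and> x \<in> Obj (prod_cat (I - {i}) V)) \<longrightarrow> munit F i x = undefined)"

text \<open>
  Categories of functors \<open>F \<in> Fs\<close> from \<open>C\<close> to \<open>P\<close>: an arrow is a triple of source, target and
  transformation, composition is objectwise.
\<close>

definition trans_cat ::
  "('o, 'm, 'y) cat_scheme \<Rightarrow> ('p, 'q, 'z) cat_scheme \<Rightarrow> ('o, 'm, 'p, 'q, 'x) funct_scheme set \<Rightarrow>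
   (('o, 'm, 'p, 'q, 'x) funct_scheme \<Rightarrow> ('o, 'm, 'p, 'q, 'x) funct_scheme \<Rightarrow> ('o \<Rightarrow> 'q) \<Rightarrow> bool) \<Rightarrow>
   (('o, 'm, 'p, 'q, 'x) funct_scheme,
    ('o, 'm, 'p, 'q, 'x) funct_scheme \<times> ('o, 'm, 'p, 'q, 'x) funct_scheme \<times> ('o \<Rightarrow> 'q)) cat" where
  "trans_cat C P Fs Trans =
    \<lparr>Obj = Fs,
     Arr = {(F, G, \<eta>). F \<in> Fs \<and> G \<in> Fs \<and> Trans F G \<eta>},
     Src = (\<lambda>(F, G, \<eta>). F),
     Tgt = (\<lambda>(F, G, \<eta>). G),
     Idn = (\<lambda>F. (F, F, \<lambda>x\<in>Obj C. Idn P (fob F x))),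
     Cmp = (\<lambda>(G, H, \<theta>) (F, G', \<eta>). (F, H, \<lambda>x\<in>Obj C. \<theta> x \<cdot>\<^bsub>P\<^esub> \<eta> x))\<rparr>"

definition Pic ::
  "'i set \<Rightarrow> ('i \<Rightarrow> ('o, 'm, 'y) moncat_scheme) \<Rightarrow> ('p, 'q, 'z) moncat_scheme \<Rightarrow>
   (('i, 'o, 'm, 'p, 'q) mfunct,
    ('i, 'o, 'm, 'p, 'q) mfunct \<times> ('i, 'o, 'm, 'p, 'q) mfunct \<times> (('i \<Rightarrow> 'o) \<Rightarrow> 'q)) cat" where
  "Pic I V P = trans_cat (prod_cat I V) P
     {F. multiexact I V P F \<and> mfunct_extensional I V F} (multi_mon_trans I V P)"


section \<open>Triangulated categories\<close>

text \<open>
  The translation is an additive self-equivalence, which includes the case of an automorphism.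
  A triangle \<open>x \<rightarrow> y \<rightarrow> z \<rightarrow> \<Sigma> x\<close> is the triple of its arrows.
\<close>

type_synonym 'm triangle = "'m \<times> 'm \<times> 'm"

record ('o, 'm) tricat = "('o, 'm) cat" +
  hadd :: "'m \<Rightarrow> 'm \<Rightarrow> 'm"
  hzero :: "'o \<Rightarrow> 'o \<Rightarrow> 'm"
  shift :: "('o, 'm, 'o, 'm) funct"
  dist :: "'m triangle set"

definition hom_group :: "('o, 'm, 'z) tricat_scheme \<Rightarrow> 'o \<Rightarrow> 'o \<Rightarrow> 'm monoid" where
  "hom_group T a b = \<lparr>carrier = Hom T a b, mult = hadd T, one = hzero T a b\<rparr>"

definition preadditive :: "('o, 'm, 'z) tricat_scheme \<Rightarrow> bool" where
  "preadditive T \<longleftrightarrow> category T \<and>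
    (\<forall>a\<in>Obj T. \<forall>b\<in>Obj T. comm_group (hom_group T a b)) \<and>
    (\<forall>a\<in>Obj T. \<forall>b\<in>Obj T. \<forall>c\<in>Obj T.
      (\<forall>f\<in>Hom T a b. \<forall>g\<in>Hom T b c. \<forall>g'\<in>Hom T b c. hadd T g g' \<cdot>\<^bsub>T\<^esub> f = hadd T (g \<cdot>\<^bsub>T\<^esub> f) (g' \<cdot>\<^bsub>T\<^esub> f)) \<and>
      (\<forall>f\<in>Hom T a b. \<forall>f'\<in>Hom T a b. \<forall>g\<in>Hom T b c. g \<cdot>\<^bsub>T\<^esub> hadd T f f' = hadd T (g \<cdot>\<^bsub>T\<^esub> f) (g \<cdot>\<^bsub>T\<^esub> f')))"

definition zero_object :: "('o, 'm, 'z) cat_scheme \<Rightarrow> 'o \<Rightarrow> bool" where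
  "zero_object T z \<longleftrightarrow> z \<in> Obj T \<and>
     (\<forall>a\<in>Obj T. (\<exists>!f. f \<in> Hom T a z) \<and> (\<exists>!f. f \<in> Hom T z a))"

definition biproduct :: "('o, 'm, 'z) tricat_scheme \<Rightarrow> 'o \<Rightarrow> 'o \<Rightarrow> 'o \<Rightarrow> 'm \<Rightarrow> 'm \<Rightarrow> 'm \<Rightarrow> 'm \<Rightarrow> bool" where
  "biproduct T x y s i1 i2 p1 p2 \<longleftrightarrow> x \<in> Obj T \<and> y \<in> Obj T \<and> s \<in> Obj T \<and>
     i1 \<in> Hom T x s \<and> i2 \<in> Hom T y s \<and> p1 \<in> Hom T s x \<and> p2 \<in> Hom T s y \<and>
     p1 \<cdot>\<^bsub>T\<^esub> i1 = Idn T x \<and> p2 \<cdot>\<^bsub>T\<^esub> i2 = Idn T y \<and>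
     p2 \<cdot>\<^bsub>T\<^esub> i1 = hzero T x y \<and> p1 \<cdot>\<^bsub>T\<^esub> i2 = hzero T y x \<and>
     hadd T (i1 \<cdot>\<^bsub>T\<^esub> p1) (i2 \<cdot>\<^bsub>T\<^esub> p2) = Idn T s"

definition additive_category :: "('o, 'm, 'z) tricat_scheme \<Rightarrow> bool" where
  "additive_category T \<longleftrightarrow> preadditive T \<and> (\<exists>z. zero_object T z) \<and>
     (\<forall>x\<in>Obj T. \<forall>y\<in>Obj T. \<exists>s i1 i2 p1 p2. biproduct T x y s i1 i2 p1 p2)"

definition is_triangle :: "('o, 'm, 'z) tricat_scheme \<Rightarrow> 'm triangle \<Rightarrow> bool" where
  "is_triangle T = (\<lambda>(f, g, h). f \<in> Arr T \<and> g \<in> Arr T \<and> h \<in> Arr T \<and>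
     Src T g = Tgt T f \<and> Src T h = Tgt T g \<and> Tgt T h = fob (shift T) (Src T f))"

text \<open>The three vertices \<open>x\<close>, \<open>y\<close>, \<open>z\<close> of a triangle \<open>x \<rightarrow> y \<rightarrow> z \<rightarrow> \<Sigma> x\<close>.\<close>

definition vx :: "('o, 'm, 'z) cat_scheme \<Rightarrow> 'm triangle \<Rightarrow> 'o" where
  "vx T = (\<lambda>(f, g, h). Src T f)"

definition vy :: "('o, 'm, 'z) cat_scheme \<Rightarrow> 'm triangle \<Rightarrow> 'o" where
  "vy T = (\<lambda>(f, g, h). Tgt T f)"

definition vz :: "('o, 'm, 'z) cat_scheme \<Rightarrow> 'm triangle \<Rightarrow> 'o" where
  "vz T = (\<lambda>(f, g, h). Tgt T g)"

definition triangle_morphism ::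
  "('o, 'm, 'z) tricat_scheme \<Rightarrow> 'm triangle \<Rightarrow> 'm triangle \<Rightarrow> 'm \<Rightarrow> 'm \<Rightarrow> 'm \<Rightarrow> bool" where
  "triangle_morphism T = (\<lambda>(f, g, h) (f', g', h') u v w.
     u \<in> Hom T (Src T f) (Src T f') \<and> v \<in> Hom T (Tgt T f) (Tgt T f') \<and> w \<in> Hom T (Tgt T g) (Tgt T g') \<and>
     v \<cdot>\<^bsub>T\<^esub> f = f' \<cdot>\<^bsub>T\<^esub> u \<and> w \<cdot>\<^bsub>T\<^esub> g = g' \<cdot>\<^bsub>T\<^esub> v \<and> far (shift T) u \<cdot>\<^bsub>T\<^esub> h = h' \<cdot>\<^bsub>T\<^esub> w)"

definition triangle_iso ::
  "('o, 'm, 'z) tricat_scheme \<Rightarrow> 'm triangle \<Rightarrow> 'm triangle \<Rightarrow> 'm \<Rightarrow> 'm \<Rightarrow> 'm \<Rightarrow> bool" where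
  "triangle_iso T \<Delta> \<Delta>' u v w \<longleftrightarrow>
     triangle_morphism T \<Delta> \<Delta>' u v w \<and> is_iso T u \<and> is_iso T v \<and> is_iso T w"

text \<open>
  Octahedra on \<open>x \<rightarrow> y \<rightarrow> z\<close>, with triangles \<open>\<Delta>\<^sub>1 : x \<rightarrow> y \<rightarrow> z' \<rightarrow> \<Sigma> x\<close>, \<open>\<Delta>\<^sub>2 : x \<rightarrow> z \<rightarrow> y' \<rightarrow> \<Sigma> x\<close>,
  \<open>\<Delta>\<^sub>3 : y \<rightarrow> z \<rightarrow> x' \<rightarrow> \<Sigma> y\<close>, \<open>\<Delta>\<^sub>4 : z' \<rightarrow> y' \<rightarrow> x' \<rightarrow> \<Sigma> z'\<close>.
\<close>

definition octahedron ::
  "('o, 'm, 'z) tricat_scheme \<Rightarrow> 'm triangle \<Rightarrow> 'm triangle \<Rightarrow> 'm triangle \<Rightarrow> 'm triangle \<Rightarrow> bool" where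
  "octahedron T = (\<lambda>(f, a1, b1) (e, a2, b2) (g, a3, b3) (u, v, w).
     (f, a1, b1) \<in> dist T \<and> (e, a2, b2) \<in> dist T \<and> (g, a3, b3) \<in> dist T \<and> (u, v, w) \<in> dist T \<and>
     Src T g = Tgt T f \<and> e = g \<cdot>\<^bsub>T\<^esub> f \<and>
     Src T u = Tgt T a1 \<and> Tgt T u = Tgt T a2 \<and> Tgt T v = Tgt T a3 \<and>
     u \<cdot>\<^bsub>T\<^esub> a1 = a2 \<cdot>\<^bsub>T\<^esub> g \<and> b2 \<cdot>\<^bsub>T\<^esub> u = b1 \<and>
     v \<cdot>\<^bsub>T\<^esub> a2 = a3 \<and> b3 \<cdot>\<^bsub>T\<^esub> v = far (shift T) f \<cdot>\<^bsub>T\<^esub> b2 \<and>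
     w = far (shift T) a1 \<cdot>\<^bsub>T\<^esub> b3)"

definition triangulated :: "('o, 'm, 'z) tricat_scheme \<Rightarrow> bool" where
  "triangulated T \<longleftrightarrow> additive_category T \<and>
    is_equivalence T T (shift T) \<and>
    (\<forall>a\<in>Obj T. \<forall>b\<in>Obj T. \<forall>f\<in>Hom T a b. \<forall>g\<in>Hom T a b.
       far (shift T) (hadd T f g) = hadd T (far (shift T) f) (far (shift T) g)) \<and>
    (\<forall>\<Delta>\<in>dist T. is_triangle T \<Delta>) \<and>
    (\<forall>\<Delta>\<in>dist T. \<forall>\<Delta>' u v w. is_triangle T \<Delta>' \<and> triangle_iso T \<Delta> \<Delta>' u v w \<longrightarrow> \<Delta>' \<in> dist T) \<and>
    (\<forall>x\<in>Obj T. \<forall>z. zero_object T z \<longrightarrow> (Idn T x, hzero T x z, hzero T z (fob (shift T) x)) \<in> dist T) \<and>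
    (\<forall>f\<in>Arr T. \<exists>g h. (f, g, h) \<in> dist T) \<and>
    (\<forall>f g h. is_triangle T (f, g, h) \<longrightarrow>
       ((f, g, h) \<in> dist T \<longleftrightarrow>
        (g, h, inv\<^bsub>hom_group T (fob (shift T) (Src T f)) (fob (shift T) (Tgt T f))\<^esub> (far (shift T) f)) \<in> dist T)) \<and>
    (\<forall>f g h f' g' h' u v. (f, g, h) \<in> dist T \<and> (f', g', h') \<in> dist T \<and>
       u \<in> Hom T (Src T f) (Src T f') \<and> v \<in> Hom T (Tgt T f) (Tgt T f') \<and> v \<cdot>\<^bsub>T\<^esub> f = f' \<cdot>\<^bsub>T\<^esub> u \<longrightarrow>
       (\<exists>w. triangle_morphism T (f, g, h) (f', g', h') u v w)) \<and>
    (\<forall>f g a1 b1 a2 b2 a3 b3. Src T g = Tgt T f \<and>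
       (f, a1, b1) \<in> dist T \<and> (g \<cdot>\<^bsub>T\<^esub> f, a2, b2) \<in> dist T \<and> (g, a3, b3) \<in> dist T \<longrightarrow>
       (\<exists>\<Delta>. octahedron T (f, a1, b1) (g \<cdot>\<^bsub>T\<^esub> f, a2, b2) (g, a3, b3) \<Delta>))"


section \<open>Determinant functors\<close>

text \<open>\<open>dadd D \<Delta> : D z + D x \<rightarrow> D y\<close> for a distinguished triangle \<open>\<Delta> : x \<rightarrow> y \<rightarrow> z \<rightarrow> \<Sigma> x\<close>\<close>

record ('o, 'm, 'p, 'q) detfunct = "('o, 'm, 'p, 'q) funct" +
  dadd :: "'m triangle \<Rightarrow> 'q"

definition det_functor ::
  "('o, 'm, 'y) tricat_scheme \<Rightarrow> ('p, 'q, 'z) moncat_scheme \<Rightarrow> ('o, 'm, 'p, 'q, 'x) detfunct_scheme \<Rightarrow> bool" where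
  "det_functor T P D \<longleftrightarrow> is_functor (isom T) P D \<and>
    (\<forall>\<Delta>\<in>dist T. dadd D \<Delta> \<in> Hom P (fob D (vz T \<Delta>) \<boxplus>\<^bsub>P\<^esub> fob D (vx T \<Delta>)) (fob D (vy T \<Delta>))) \<and>
    (\<forall>\<Delta>\<in>dist T. \<forall>\<Delta>'\<in>dist T. \<forall>u v w. triangle_iso T \<Delta> \<Delta>' u v w \<longrightarrow>
       far D v \<cdot>\<^bsub>P\<^esub> dadd D \<Delta> = dadd D \<Delta>' \<cdot>\<^bsub>P\<^esub> (far D w [+]\<^bsub>P\<^esub> far D u)) \<and>
    \<comment> \<open>Commutativity\<close>
    (\<forall>x y s i1 i2 p1 p2. biproduct T x y s i1 i2 p1 p2 \<longrightarrow>
       dadd D (i2, p1, hzero T x (fob (shift T) y)) =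
       dadd D (i1, p2, hzero T y (fob (shift T) x)) \<cdot>\<^bsub>P\<^esub> symm P (fob D x) (fob D y)) \<and>
    \<comment> \<open>Associativity\<close>
    (\<forall>\<Delta>1 \<Delta>2 \<Delta>3 \<Delta>4. octahedron T \<Delta>1 \<Delta>2 \<Delta>3 \<Delta>4 \<longrightarrow>
       dadd D \<Delta>2 \<cdot>\<^bsub>P\<^esub> (dadd D \<Delta>4 [+]\<^bsub>P\<^esub> Idn P (fob D (vx T \<Delta>1))) =
       dadd D \<Delta>3 \<cdot>\<^bsub>P\<^esub> (Idn P (fob D (vz T \<Delta>3)) [+]\<^bsub>P\<^esub> dadd D \<Delta>1) \<cdot>\<^bsub>P\<^esub>
         assoc P (fob D (vz T \<Delta>3)) (fob D (vz T \<Delta>1)) (fob D (vx T \<Delta>1)))"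

text \<open>Pairs \<open>(f, \<alpha>)\<close> of a morphism \<open>f : V \<rightarrow> P\<close> and a transformation \<open>\<alpha> : f \<circ> d \<Rightarrow> D\<close> compatible with additivity.\<close>

definition det_factorization ::
  "('o, 'm, 'y) tricat_scheme \<Rightarrow> ('v, 'w, 'y1) moncat_scheme \<Rightarrow> ('o, 'm, 'v, 'w) detfunct \<Rightarrow>
   ('p, 'q, 'z) moncat_scheme \<Rightarrow> ('o, 'm, 'p, 'q) detfunct \<Rightarrow>
   ('v, 'w, 'p, 'q) smfunct \<Rightarrow> ('o \<Rightarrow> 'q) \<Rightarrow> bool" where
  "det_factorization T V d P D f \<alpha> \<longleftrightarrow> sm_functor V P f \<and>
    nat_trans (isom T) P (comp_functor f d) D \<alpha> \<and>
    (\<forall>\<Delta>\<in>dist T.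
       \<alpha> (vy T \<Delta>) \<cdot>\<^bsub>P\<^esub> far f (dadd d \<Delta>) \<cdot>\<^bsub>P\<^esub> fadd f (fob d (vz T \<Delta>)) (fob d (vx T \<Delta>)) =
       dadd D \<Delta> \<cdot>\<^bsub>P\<^esub> (\<alpha> (vz T \<Delta>) [+]\<^bsub>P\<^esub> \<alpha> (vx T \<Delta>)))"

text \<open>
  HOL cannot quantify over types inside a formula, so the types in which the test groupoids \<open>P\<close> live
  are a parameter (the first argument); a determinant functor is universal in the usual sense
  iff it satisfies this for all choices of these types.
\<close>

definition universal_det ::
  "('p \<times> 'q) itself \<Rightarrow> ('o, 'm) tricat \<Rightarrow> ('v, 'w) moncat \<Rightarrow> ('o, 'm, 'v, 'w) detfunct \<Rightarrow> bool" where
  "universal_det (_ :: ('p \<times> 'q) itself) T V d \<longleftrightarrow> picard V \<and> det_functor T V d \<and>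
    (\<forall>(P :: ('p, 'q) moncat) D. picard P \<and> det_functor T P D \<longrightarrow>
      (\<exists>f \<alpha>. det_factorization T V d P D f \<alpha> \<and>
        (\<forall>f' \<alpha>'. det_factorization T V d P D f' \<alpha>' \<longrightarrow>
          (\<exists>!\<beta>. mon_trans V P f f' \<beta> \<and> (\<forall>x\<in>Obj T. \<alpha>' x \<cdot>\<^bsub>P\<^esub> \<beta> (fob d x) = \<alpha> x)))))"


section \<open>Multi-determinant functors\<close>

text \<open>\<open>mdadd D i x \<Delta>\<close> is \<open>D(x, \<Delta>)\<close>, with \<open>\<Delta>\<close> in the \<open>i\<close>-th place and \<open>x\<close> a family of objects in the others.\<close>

record ('i, 'o, 'm, 'p, 'q) mdetfunct = "('i \<Rightarrow> 'o, 'i \<Rightarrow> 'm, 'p, 'q) funct" +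
  mdadd :: "'i \<Rightarrow> ('i \<Rightarrow> 'o) \<Rightarrow> 'm triangle \<Rightarrow> 'q"

abbreviation isoms :: "('i \<Rightarrow> ('o, 'm, 'z) cat_scheme) \<Rightarrow> 'i \<Rightarrow> ('o, 'm) cat" where
  "isoms T \<equiv> \<lambda>i. isom (T i)"

definition det_slice ::
  "'i set \<Rightarrow> ('i \<Rightarrow> ('o, 'm, 'z) cat_scheme) \<Rightarrow> ('i, 'o, 'm, 'p, 'q) mdetfunct \<Rightarrow> 'i \<Rightarrow> ('i \<Rightarrow> 'o) \<Rightarrow>
   ('o, 'm, 'p, 'q) detfunct" where
  "det_slice I T D i x =
    \<lparr>fob = (\<lambda>a. fob D (x(i := a))), far = (\<lambda>f. far D (at_place I (isoms T) x i f)),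
     dadd = mdadd D i x\<rparr>"

definition multi_det ::
  "'i set \<Rightarrow> ('i \<Rightarrow> ('o, 'm, 'y) tricat_scheme) \<Rightarrow> ('p, 'q, 'z) moncat_scheme \<Rightarrow>
   ('i, 'o, 'm, 'p, 'q) mdetfunct \<Rightarrow> bool" where
  "multi_det I T P D \<longleftrightarrow> is_functor (prod_cat I (isoms T)) P D \<and>
    (\<forall>i\<in>I. \<forall>x\<in>Obj (prod_cat (I - {i}) (isoms T)). det_functor (T i) P (det_slice I T D i x)) \<and>
    \<comment> \<open>Two Triangles\<close>
    (\<forall>i\<in>I. \<forall>j\<in>I. i \<noteq> j \<longrightarrow> (\<forall>x\<in>Obj (prod_cat (I - {i, j}) (isoms T)).
      \<forall>\<Delta>i\<in>dist (T i). \<forall>\<Delta>j\<in>dist (T j).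
       let xi = vx (T i) \<Delta>i; yi = vy (T i) \<Delta>i; zi = vz (T i) \<Delta>i;
           xj = vx (T j) \<Delta>j; yj = vy (T j) \<Delta>j; zj = vz (T j) \<Delta>j;
           D' = (\<lambda>a c. fob D (x(i := a, j := c)));
           Di = (\<lambda>c. mdadd D i (x(j := c)) \<Delta>i);
           Dj = (\<lambda>a. mdadd D j (x(i := a)) \<Delta>j) in
       Dj yi \<cdot>\<^bsub>P\<^esub> (Di zj [+]\<^bsub>P\<^esub> Di xj) =
       Di yj \<cdot>\<^bsub>P\<^esub> (Dj zi [+]\<^bsub>P\<^esub> Dj xi) \<cdot>\<^bsub>P\<^esub> coas P (D' zi zj) (D' xi zj) (D' zi xj) (D' xi xj))) \<and>
    \<comment> \<open>Triangle-Function\<close>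
    (\<forall>i\<in>I. \<forall>j\<in>I. i \<noteq> j \<longrightarrow> (\<forall>x\<in>Obj (prod_cat (I - {i, j}) (isoms T)).
      \<forall>f\<in>Arr (isom (T i)). \<forall>\<Delta>\<in>dist (T j).
       let Df = (\<lambda>c. far D (at_place I (isoms T) (x(j := c)) i f)) in
       Df (vy (T j) \<Delta>) \<cdot>\<^bsub>P\<^esub> mdadd D j (x(i := Src (T i) f)) \<Delta> =
       mdadd D j (x(i := Tgt (T i) f)) \<Delta> \<cdot>\<^bsub>P\<^esub> (Df (vz (T j) \<Delta>) [+]\<^bsub>P\<^esub> Df (vx (T j) \<Delta>))))"

definition multi_det_trans ::
  "'i set \<Rightarrow> ('i \<Rightarrow> ('o, 'm, 'y) tricat_scheme) \<Rightarrow> ('p, 'q, 'z) moncat_scheme \<Rightarrow>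
   ('i, 'o, 'm, 'p, 'q) mdetfunct \<Rightarrow> ('i, 'o, 'm, 'p, 'q) mdetfunct \<Rightarrow> (('i \<Rightarrow> 'o) \<Rightarrow> 'q) \<Rightarrow> bool" where
  "multi_det_trans I T P D E \<theta> \<longleftrightarrow> nat_trans (prod_cat I (isoms T)) P D E \<theta> \<and>
    (\<forall>i\<in>I. \<forall>x\<in>Obj (prod_cat (I - {i}) (isoms T)). \<forall>\<Delta>\<in>dist (T i).
       \<theta> (x(i := vy (T i) \<Delta>)) \<cdot>\<^bsub>P\<^esub> mdadd D i x \<Delta> =
       mdadd E i x \<Delta> \<cdot>\<^bsub>P\<^esub> (\<theta> (x(i := vz (T i) \<Delta>)) [+]\<^bsub>P\<^esub> \<theta> (x(i := vx (T i) \<Delta>))))"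

definition mdetfunct_extensional ::
  "'i set \<Rightarrow> ('i \<Rightarrow> ('o, 'm, 'y) tricat_scheme) \<Rightarrow> ('i, 'o, 'm, 'p, 'q) mdetfunct \<Rightarrow> bool" where
  "mdetfunct_extensional I T D \<longleftrightarrow>
    fob D \<in> extensional (Obj (prod_cat I (isoms T))) \<and> far D \<in> extensional (Arr (prod_cat I (isoms T))) \<and>
    (\<forall>i x \<Delta>. \<not> (i \<in> I \<and> x \<in> Obj (prod_cat (I - {i}) (isoms T)) \<and> \<Delta> \<in> dist (T i)) \<longrightarrow>
       mdadd D i x \<Delta> = undefined)"

definition Det ::
  "'i set \<Rightarrow> ('i \<Rightarrow> ('o, 'm, 'y) tricat_scheme) \<Rightarrow> ('p, 'q, 'z) moncat_scheme \<Rightarrow>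
   (('i, 'o, 'm, 'p, 'q) mdetfunct,
    ('i, 'o, 'm, 'p, 'q) mdetfunct \<times> ('i, 'o, 'm, 'p, 'q) mdetfunct \<times> (('i \<Rightarrow> 'o) \<Rightarrow> 'q)) cat" where
  "Det I T P = trans_cat (prod_cat I (isoms T)) P
     {D. multi_det I T P D \<and> mdetfunct_extensional I T D} (multi_det_trans I T P)"


section \<open>Pullback along determinant functors\<close>

text \<open>
  \<open>prod_det I d\<close> is the product of the functors \<open>d i\<close>, and \<open>pullback I T V d F = F \<circ> prod_det I d\<close>
  with additivity \<open>F(det z) + F(det x) \<rightarrow> F(det z + det x) \<rightarrow> F(det y)\<close> in each variable.
\<close>

definition prod_det ::
  "'i set \<Rightarrow> ('i \<Rightarrow> ('o, 'm, 'v, 'w) detfunct) \<Rightarrow> ('i \<Rightarrow> 'o, 'i \<Rightarrow> 'm, 'i \<Rightarrow> 'v, 'i \<Rightarrow> 'w) funct" where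
  "prod_det I d = \<lparr>fob = (\<lambda>x. \<lambda>i\<in>I. fob (d i) (x i)), far = (\<lambda>f. \<lambda>i\<in>I. far (d i) (f i))\<rparr>"

definition pullback ::
  "'i set \<Rightarrow> ('i \<Rightarrow> ('o, 'm, 'y) tricat_scheme) \<Rightarrow> ('i \<Rightarrow> ('v, 'w, 'y1) moncat_scheme) \<Rightarrow>
   ('p, 'q, 'z) moncat_scheme \<Rightarrow> ('i \<Rightarrow> ('o, 'm, 'v, 'w) detfunct) \<Rightarrow>
   ('i, 'v, 'w, 'p, 'q) mfunct \<Rightarrow> ('i, 'o, 'm, 'p, 'q) mdetfunct" where
  "pullback I T V P d F =
    \<lparr>fob = (\<lambda>x\<in>Obj (prod_cat I (isoms T)). fob F (fob (prod_det I d) x)),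
     far = (\<lambda>f\<in>Arr (prod_cat I (isoms T)). far F (far (prod_det I d) f)),
     mdadd = (\<lambda>i x \<Delta>.
       if i \<in> I \<and> x \<in> Obj (prod_cat (I - {i}) (isoms T)) \<and> \<Delta> \<in> dist (T i) then
         let x' = fob (prod_det (I - {i}) d) x in
         far F (at_place I V x' i (dadd (d i) \<Delta>)) \<cdot>\<^bsub>P\<^esub>
         madd F i x' (fob (d i) (vz (T i) \<Delta>)) (fob (d i) (vx (T i) \<Delta>))
       else undefined)\<rparr>"

definition det_pullback ::
  "'i set \<Rightarrow> ('i \<Rightarrow> ('o, 'm, 'y) tricat_scheme) \<Rightarrow> ('i \<Rightarrow> ('v, 'w, 'y1) moncat_scheme) \<Rightarrow>
   ('p, 'q, 'z) moncat_scheme \<Rightarrow> ('i \<Rightarrow> ('o, 'm, 'v, 'w) detfunct) \<Rightarrow>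
   (('i, 'v, 'w, 'p, 'q) mfunct,
    ('i, 'v, 'w, 'p, 'q) mfunct \<times> ('i, 'v, 'w, 'p, 'q) mfunct \<times> (('i \<Rightarrow> 'v) \<Rightarrow> 'q),
    ('i, 'o, 'm, 'p, 'q) mdetfunct,
    ('i, 'o, 'm, 'p, 'q) mdetfunct \<times> ('i, 'o, 'm, 'p, 'q) mdetfunct \<times> (('i \<Rightarrow> 'o) \<Rightarrow> 'q)) funct" where
  "det_pullback I T V P d =
    \<lparr>fob = pullback I T V P d,
     far = (\<lambda>(F, G, \<eta>). (pullback I T V P d F, pullback I T V P d G,
       \<lambda>x\<in>Obj (prod_cat I (isoms T)). \<eta> (fob (prod_det I d) x)))\<rparr>"

end

theory Submission
  imports Defs
begin

text \<open>
  Determinant functors on \<open>T\<close> and non-unital symmetric monoidal functors on \<open>V\<close> are treated alike, as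
  models in \<open>P\<close> of a presentation: a category together with formal triangles, each of which a model sends
  to an arrow \<open>F z + F x \<rightarrow> F y\<close>, subject to relations between formal composites. As \<open>P\<close> is symmetric
  monoidal, the pointwise sum of two models is again a model, its triangles being evaluated through
  \<open>coas\<close>. Fixing one variable of a functor of several variables therefore gives a diagram of models in
  that variable: the arrows and the triangles of the remaining variables act by morphisms of models, the
  two-triangles axiom being precisely the statement that the triangles do. Universality of
  \<open>det : T \<rightarrow> V\<close> says that pulling models on \<open>V\<close> back to \<open>T\<close> is full, faithful and essentially
  surjective, and hence lifts such a diagram from \<open>T\<close> to \<open>V\<close>, relations included. Replacing one
  variable at a time, induction over the finite set of variables yields the equivalence. Units play no
  role: in a Picard groupoid the unit constraint is determined by the rest of the structure and preserved
  by every morphism of models.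
\<close>

section \<open>Coherence in symmetric monoidal groupoids\<close>

text \<open>Relations survive the lift because a formal composite, evaluated pointwise, is itself a
  morphism between iterated sums of models: the associators and symmetries of \<open>P\<close> are
  morphisms between such sums. Two sides that agree on the image of \<open>det\<close> then agree
  everywhere by faithfulness. Universality is given as initiality among the factorizations of one
  determinant functor at a time. Fullness and faithfulness are extracted by comparing an initial
  factorization with the ones at hand, which uses that arrows of \<open>P\<close> are invertible.
  All variables of a family share one type, so a family with some variables in \<open>T\<close> and
  the others in \<open>V\<close> cannot be written down; the intermediate stage of the induction is
  instead a model in two variables over unrelated presentations, one of which bundles all remaining
  variables. Finally, the commutativity axiom speaks of split triangles, and these have to be
  distinguished for its relation to be well formed; this is derived from the axioms of a
  triangulated category.\<close>

declare Hom_def [simp]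

section \<open>Rewriting in categories and groupoids\<close>

locale cat_axioms =
  fixes C :: "('o, 'm, 'z) cat_scheme" (structure)
  assumes category: "category C"
begin

lemma Src_Obj [simp]: "f \<in> Arr C \<Longrightarrow> Src C f \<in> Obj C"
  and Tgt_Obj [simp]: "f \<in> Arr C \<Longrightarrow> Tgt C f \<in> Obj C"
  and Idn_Arr [simp]: "a \<in> Obj C \<Longrightarrow> Idn C a \<in> Arr C"
  and Src_Idn [simp]: "a \<in> Obj C \<Longrightarrow> Src C (Idn C a) = a"
  and Tgt_Idn [simp]: "a \<in> Obj C \<Longrightarrow> Tgt C (Idn C a) = a"
  and Cmp_Arr [simp]: "\<lbrakk>f \<in> Arr C; g \<in> Arr C; Src C g = Tgt C f\<rbrakk> \<Longrightarrow> g \<cdot> f \<in> Arr C"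
  and Src_Cmp [simp]: "\<lbrakk>f \<in> Arr C; g \<in> Arr C; Src C g = Tgt C f\<rbrakk> \<Longrightarrow> Src C (g \<cdot> f) = Src C f"
  and Tgt_Cmp [simp]: "\<lbrakk>f \<in> Arr C; g \<in> Arr C; Src C g = Tgt C f\<rbrakk> \<Longrightarrow> Tgt C (g \<cdot> f) = Tgt C g"
  and Cmp_Idn [simp]: "\<lbrakk>f \<in> Arr C; Src C f = a\<rbrakk> \<Longrightarrow> f \<cdot> Idn C a = f"
  and Idn_Cmp [simp]: "\<lbrakk>f \<in> Arr C; Tgt C f = a\<rbrakk> \<Longrightarrow> Idn C a \<cdot> f = f"
  and Cmp_assoc: "\<lbrakk>f \<in> Arr C; g \<in> Arr C; h \<in> Arr C; Src C g = Tgt C f; Src C h = Tgt C g\<rbrakk>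
    \<Longrightarrow> (h \<cdot> g) \<cdot> f = h \<cdot> (g \<cdot> f)"
  using category by (auto simp: category_def)

text \<open>Composites are kept nested to the right, so an equation \<open>g \<cdot> f = k\<close>
  cannot rewrite inside \<open>g \<cdot> (f \<cdot> x)\<close>. \<open>Cmp_reassoc[OF eq]\<close> is
  the version of \<open>eq\<close> that can; naturality and coherence equations are mostly applied
  in this form.\<close>

lemma Cmp_reassoc:
  "\<lbrakk>g \<cdot> f = k; f \<in> Arr C; g \<in> Arr C; x \<in> Arr C; Src C g = Tgt C f; Src C f = Tgt C x\<rbrakk>
    \<Longrightarrow> g \<cdot> (f \<cdot> x) = k \<cdot> x"
  using Cmp_assoc by metis

lemma inverse_of_unique:
  assumes "f \<in> Arr C" "inverse_of C f g" "inverse_of C f h"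
  shows "g = h"
proof -
  have "g = g \<cdot> (f \<cdot> h)" using assms by (simp add: inverse_of_def)
  also have "\<dots> = (g \<cdot> f) \<cdot> h" using assms by (subst Cmp_assoc) (simp_all add: inverse_of_def)
  also have "\<dots> = h" using assms by (simp add: inverse_of_def)
  finally show ?thesis .
qed

lemma inv_arr_eq: "f \<in> Arr C \<Longrightarrow> inverse_of C f g \<Longrightarrow> inv_arr C f = g"
  unfolding inv_arr_def using inverse_of_unique by blast

lemma inverse_of_inv_arr: "is_iso C f \<Longrightarrow> inverse_of C f (inv_arr C f)"
  using inv_arr_eq by (auto simp: is_iso_def)

lemma Idn_iso [simp]: "a \<in> Obj C \<Longrightarrow> is_iso C (Idn C a)"
  by (auto simp: is_iso_def inverse_of_def intro!: exI[of _ "Idn C a"])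

end

locale gpd_axioms = cat_axioms +
  assumes isos: "\<And>f. f \<in> Arr C \<Longrightarrow> is_iso C f"
begin

lemma inv_Arr [simp]: "f \<in> Arr C \<Longrightarrow> inv_arr C f \<in> Arr C"
  and Src_inv [simp]: "f \<in> Arr C \<Longrightarrow> Src C (inv_arr C f) = Tgt C f"
  and Tgt_inv [simp]: "f \<in> Arr C \<Longrightarrow> Tgt C (inv_arr C f) = Src C f"
  and inv_Cmp [simp]: "f \<in> Arr C \<Longrightarrow> inv_arr C f \<cdot> f = Idn C (Src C f)"
  and Cmp_inv [simp]: "f \<in> Arr C \<Longrightarrow> f \<cdot> inv_arr C f = Idn C (Tgt C f)"
  using inverse_of_inv_arr[OF isos] by (auto simp: inverse_of_def)

lemma inv_Cmp_reassoc [simp]: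
  "\<lbrakk>f \<in> Arr C; x \<in> Arr C; Src C f = Tgt C x\<rbrakk> \<Longrightarrow> inv_arr C f \<cdot> (f \<cdot> x) = x"
  "\<lbrakk>f \<in> Arr C; x \<in> Arr C; Tgt C f = Tgt C x\<rbrakk> \<Longrightarrow> f \<cdot> (inv_arr C f \<cdot> x) = x"
  by (subst Cmp_assoc[symmetric]; simp)+

lemma Cmp_cancel_left:
  "\<lbrakk>h \<cdot> f = h \<cdot> g; h \<in> Arr C; f \<in> Arr C; g \<in> Arr C; Src C h = Tgt C f; Src C h = Tgt C g\<rbrakk> \<Longrightarrow> f = g"
  by (metis inv_Cmp_reassoc(1))

lemma Cmp_cancel_right:
  "\<lbrakk>f \<cdot> h = g \<cdot> h; h \<in> Arr C; f \<in> Arr C; g \<in> Arr C; Src C f = Tgt C h; Src C g = Tgt C h\<rbrakk> \<Longrightarrow> f = g"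
  by (metis Cmp_Idn Cmp_assoc Cmp_inv Src_inv Tgt_inv inv_Arr)

lemma inv_arrI:
  "\<lbrakk>f \<in> Arr C; g \<in> Arr C; Src C g = Tgt C f; g \<cdot> f = Idn C (Src C f)\<rbrakk> \<Longrightarrow> inv_arr C f = g"
  by (metis Cmp_cancel_right Src_inv inv_Arr inv_Cmp Tgt_Obj)

lemma inv_Idn [simp]: "a \<in> Obj C \<Longrightarrow> inv_arr C (Idn C a) = Idn C a"
  by (rule inv_arrI) simp_all

lemma inv_of_Cmp: "\<lbrakk>f \<in> Arr C; g \<in> Arr C; Src C g = Tgt C f\<rbrakk>
  \<Longrightarrow> inv_arr C (g \<cdot> f) = inv_arr C f \<cdot> inv_arr C g"
  by (rule inv_arrI) (simp_all add: Cmp_assoc)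

lemma inv_inv [simp]: "f \<in> Arr C \<Longrightarrow> inv_arr C (inv_arr C f) = f"
  by (rule inv_arrI) simp_all

end

lemma gpd_axiomsI: "groupoid C \<Longrightarrow> gpd_axioms C"
  by unfold_locales (auto simp: groupoid_def)

section \<open>Symmetric monoidal groupoids, exchanges and \<open>coas\<close>\<close>

locale sym_gpd = gpd_axioms P for P :: "('p, 'q) moncat" (structure) +
  assumes sym_moncat: "sym_moncat P"
begin

lemma osum_Obj [simp]: "a \<in> Obj P \<Longrightarrow> b \<in> Obj P \<Longrightarrow> a \<boxplus> b \<in> Obj P"
  and asum_Arr [simp]: "f \<in> Arr P \<Longrightarrow> g \<in> Arr P \<Longrightarrow> f [+] g \<in> Arr P"
  and Src_asum [simp]: "f \<in> Arr P \<Longrightarrow> g \<in> Arr P \<Longrightarrow> Src P (f [+] g) = Src P f \<boxplus> Src P g"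
  and Tgt_asum [simp]: "f \<in> Arr P \<Longrightarrow> g \<in> Arr P \<Longrightarrow> Tgt P (f [+] g) = Tgt P f \<boxplus> Tgt P g"
  and asum_Idn [simp]: "a \<in> Obj P \<Longrightarrow> b \<in> Obj P \<Longrightarrow> Idn P a [+] Idn P b = Idn P (a \<boxplus> b)"
  and interchange: "\<lbrakk>f \<in> Arr P; g \<in> Arr P; f' \<in> Arr P; g' \<in> Arr P; Src P f' = Tgt P f; Src P g' = Tgt P g\<rbrakk>
    \<Longrightarrow> (f' [+] g') \<cdot> (f [+] g) = (f' \<cdot> f) [+] (g' \<cdot> g)"
  and ounit_Obj [simp]: "ounit P \<in> Obj P"
  using sym_moncat by (auto simp: sym_moncat_def)

lemma assoc_Arr [simp]: "\<lbrakk>a \<in> Obj P; b \<in> Obj P; c \<in> Obj P\<rbrakk> \<Longrightarrow> assoc P a b c \<in> Arr P"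
  and Src_assoc [simp]: "\<lbrakk>a \<in> Obj P; b \<in> Obj P; c \<in> Obj P\<rbrakk> \<Longrightarrow> Src P (assoc P a b c) = (a \<boxplus> b) \<boxplus> c"
  and Tgt_assoc [simp]: "\<lbrakk>a \<in> Obj P; b \<in> Obj P; c \<in> Obj P\<rbrakk> \<Longrightarrow> Tgt P (assoc P a b c) = a \<boxplus> (b \<boxplus> c)"
  and lunit_Arr [simp]: "a \<in> Obj P \<Longrightarrow> lunit P a \<in> Arr P"
  and Src_lunit [simp]: "a \<in> Obj P \<Longrightarrow> Src P (lunit P a) = ounit P \<boxplus> a"
  and Tgt_lunit [simp]: "a \<in> Obj P \<Longrightarrow> Tgt P (lunit P a) = a"
  and runit_Arr [simp]: "a \<in> Obj P \<Longrightarrow> runit P a \<in> Arr P"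
  and Src_runit [simp]: "a \<in> Obj P \<Longrightarrow> Src P (runit P a) = a \<boxplus> ounit P"
  and Tgt_runit [simp]: "a \<in> Obj P \<Longrightarrow> Tgt P (runit P a) = a"
  and symm_Arr [simp]: "\<lbrakk>a \<in> Obj P; b \<in> Obj P\<rbrakk> \<Longrightarrow> symm P a b \<in> Arr P"
  and Src_symm [simp]: "\<lbrakk>a \<in> Obj P; b \<in> Obj P\<rbrakk> \<Longrightarrow> Src P (symm P a b) = a \<boxplus> b"
  and Tgt_symm [simp]: "\<lbrakk>a \<in> Obj P; b \<in> Obj P\<rbrakk> \<Longrightarrow> Tgt P (symm P a b) = b \<boxplus> a"
  using sym_moncat by (auto simp: sym_moncat_def)

lemma assoc_nat: "\<lbrakk>f \<in> Arr P; g \<in> Arr P; h \<in> Arr P; Tgt P f = a; Tgt P g = b; Tgt P h = c\<rbrakk> \<Longrightarrow>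
    assoc P a b c \<cdot> ((f [+] g) [+] h) = (f [+] (g [+] h)) \<cdot> assoc P (Src P f) (Src P g) (Src P h)"
  and lunit_nat: "f \<in> Arr P \<Longrightarrow> lunit P (Tgt P f) \<cdot> (Idn P (ounit P) [+] f) = f \<cdot> lunit P (Src P f)"
  and runit_nat: "f \<in> Arr P \<Longrightarrow> runit P (Tgt P f) \<cdot> (f [+] Idn P (ounit P)) = f \<cdot> runit P (Src P f)"
  and symm_nat: "\<lbrakk>f \<in> Arr P; g \<in> Arr P; Tgt P f = a; Tgt P g = b\<rbrakk> \<Longrightarrow>
    symm P a b \<cdot> (f [+] g) = (g [+] f) \<cdot> symm P (Src P f) (Src P g)"
  using sym_moncat by (auto simp: sym_moncat_def)

lemma pentagon: "\<lbrakk>a \<in> Obj P; b \<in> Obj P; c \<in> Obj P; d \<in> Obj P\<rbrakk> \<Longrightarrow>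
    assoc P a b (c \<boxplus> d) \<cdot> assoc P (a \<boxplus> b) c d =
    (Idn P a [+] assoc P b c d) \<cdot> assoc P a (b \<boxplus> c) d \<cdot> (assoc P a b c [+] Idn P d)"
  and triangle: "\<lbrakk>a \<in> Obj P; b \<in> Obj P\<rbrakk> \<Longrightarrow>
    (Idn P a [+] lunit P b) \<cdot> assoc P a (ounit P) b = runit P a [+] Idn P b"
  and hexagon: "\<lbrakk>a \<in> Obj P; b \<in> Obj P; c \<in> Obj P\<rbrakk> \<Longrightarrow>
    assoc P b c a \<cdot> symm P a (b \<boxplus> c) \<cdot> assoc P a b c =
    (Idn P b [+] symm P a c) \<cdot> assoc P b a c \<cdot> (symm P a b [+] Idn P c)"
  and symm_symm [simp]: "\<lbrakk>a \<in> Obj P; b \<in> Obj P\<rbrakk> \<Longrightarrow> symm P b a \<cdot> symm P a b = Idn P (a \<boxplus> b)"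
  using sym_moncat unfolding sym_moncat_def by blast+

lemma inv_asum: "f \<in> Arr P \<Longrightarrow> g \<in> Arr P \<Longrightarrow> inv_arr P (f [+] g) = inv_arr P f [+] inv_arr P g"
  by (rule inv_arrI) (simp_all add: interchange)

lemma inv_symm: "a \<in> Obj P \<Longrightarrow> b \<in> Obj P \<Longrightarrow> inv_arr P (symm P a b) = symm P b a"
  by (rule inv_arrI) simp_all

text \<open>Oriented against \<open>interchange\<close>: whiskered composites are pulled apart, so
  that coherence equations can meet the single factors.\<close>

lemma lwhisk: "\<lbrakk>a \<in> Obj P; f \<in> Arr P; g \<in> Arr P; Src P g = Tgt P f\<rbrakk> \<Longrightarrow>
    Idn P a [+] (g \<cdot> f) = (Idn P a [+] g) \<cdot> (Idn P a [+] f)"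
  and rwhisk: "\<lbrakk>a \<in> Obj P; f \<in> Arr P; g \<in> Arr P; Src P g = Tgt P f\<rbrakk> \<Longrightarrow>
    (g \<cdot> f) [+] Idn P a = (g [+] Idn P a) \<cdot> (f [+] Idn P a)"
  by (simp_all add: interchange)

text \<open>The braiding of two summands in front of a third one: words of the form \<open>a + (b + (c + ...))\<close>
  and these exchanges reduce coherence to naturality and the two hexagons below.\<close>

definition exch :: "'p \<Rightarrow> 'p \<Rightarrow> 'p \<Rightarrow> 'q" where
  "exch a b x = assoc P b a x \<cdot> (symm P a b [+] Idn P x) \<cdot> inv_arr P (assoc P a b x)"

lemma exch_Arr [simp]: "\<lbrakk>a \<in> Obj P; b \<in> Obj P; x \<in> Obj P\<rbrakk> \<Longrightarrow> exch a b x \<in> Arr P"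
  and Src_exch [simp]: "\<lbrakk>a \<in> Obj P; b \<in> Obj P; x \<in> Obj P\<rbrakk> \<Longrightarrow> Src P (exch a b x) = a \<boxplus> (b \<boxplus> x)"
  and Tgt_exch [simp]: "\<lbrakk>a \<in> Obj P; b \<in> Obj P; x \<in> Obj P\<rbrakk> \<Longrightarrow> Tgt P (exch a b x) = b \<boxplus> (a \<boxplus> x)"
  by (simp_all add: exch_def)

lemma exch_assoc: "\<lbrakk>a \<in> Obj P; b \<in> Obj P; x \<in> Obj P\<rbrakk> \<Longrightarrow>
    exch a b x \<cdot> assoc P a b x = assoc P b a x \<cdot> (symm P a b [+] Idn P x)"
  by (simp add: exch_def Cmp_assoc)

lemma exch_exch [simp]: "\<lbrakk>a \<in> Obj P; b \<in> Obj P; x \<in> Obj P\<rbrakk> \<Longrightarrow> exch b a x \<cdot> exch a b x = Idn P (a \<boxplus> (b \<boxplus> x))"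
  by (simp add: exch_def Cmp_assoc Cmp_reassoc[OF interchange])

text \<open>Naturality of \<open>symm\<close> in the first two places, conjugated by that of
  \<open>assoc\<close>. Both sides are first composed with an associator, which clears the inverse
  one inside \<open>exch\<close>.\<close>

lemma exch_nat: assumes "f \<in> Arr P" "g \<in> Arr P" "h \<in> Arr P" "Tgt P f = a" "Tgt P g = b" "Tgt P h = c"
  shows "exch a b c \<cdot> (f [+] (g [+] h)) = (g [+] (f [+] h)) \<cdot> exch (Src P f) (Src P g) (Src P h)"
proof (rule Cmp_cancel_right[where h = "assoc P (Src P f) (Src P g) (Src P h)"])
  have "(exch a b c \<cdot> (f [+] (g [+] h))) \<cdot> assoc P (Src P f) (Src P g) (Src P h)
      = exch a b c \<cdot> (assoc P a b c \<cdot> ((f [+] g) [+] h))"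
    using assms by (auto simp: Cmp_assoc assoc_nat)
  also have "\<dots> = assoc P b a c \<cdot> ((symm P a b [+] Idn P c) \<cdot> ((f [+] g) [+] h))"
    using assms by (auto simp: Cmp_reassoc[OF exch_assoc] Cmp_assoc)
  also have "(symm P a b [+] Idn P c) \<cdot> ((f [+] g) [+] h) =
      ((g [+] f) [+] h) \<cdot> (symm P (Src P f) (Src P g) [+] Idn P (Src P h))"
    using assms by (auto simp: interchange symm_nat)
  also have "assoc P b a c \<cdot> \<dots> =
      (g [+] (f [+] h)) \<cdot> (assoc P (Src P g) (Src P f) (Src P h) \<cdot> (symm P (Src P f) (Src P g) [+] Idn P (Src P h)))"
    using assms by (subst Cmp_reassoc[OF assoc_nat]) (auto simp: Cmp_assoc)
  also have "\<dots> = ((g [+] (f [+] h)) \<cdot> exch (Src P f) (Src P g) (Src P h)) \<cdot> assoc P (Src P f) (Src P g) (Src P h)"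
    using assms by (simp add: Cmp_assoc exch_assoc)
  finally show "(exch a b c \<cdot> (f [+] (g [+] h))) \<cdot> assoc P (Src P f) (Src P g) (Src P h) = \<dots>" .
qed (use assms in auto)

text \<open>Of the five factors in the definition of \<open>coas\<close>, the middle three form an
  exchange of \<open>b\<close> and \<open>c\<close> in front of \<open>d\<close>. Properties of
  \<open>coas\<close> thereby reduce to those of \<open>exch\<close>.\<close>

lemma coas_exch: "\<lbrakk>a \<in> Obj P; b \<in> Obj P; c \<in> Obj P; d \<in> Obj P\<rbrakk> \<Longrightarrow>
  coas P a b c d = inv_arr P (assoc P a c (b \<boxplus> d)) \<cdot> (Idn P a [+] exch b c d) \<cdot> assoc P a b (c \<boxplus> d)"
  by (simp add: coas_def exch_def lwhisk Cmp_assoc)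

text \<open>The form used for rewriting: composing with an associator on the left removes the
  inverse associator that \<open>coas\<close> ends with.\<close>

lemma assoc_coas: "\<lbrakk>a \<in> Obj P; b \<in> Obj P; c \<in> Obj P; d \<in> Obj P\<rbrakk> \<Longrightarrow>
  assoc P a c (b \<boxplus> d) \<cdot> coas P a b c d = (Idn P a [+] exch b c d) \<cdot> assoc P a b (c \<boxplus> d)"
  by (simp add: coas_exch)

lemma coas_Arr [simp]: "\<lbrakk>a \<in> Obj P; b \<in> Obj P; c \<in> Obj P; d \<in> Obj P\<rbrakk> \<Longrightarrow> coas P a b c d \<in> Arr P"
  and Src_coas [simp]: "\<lbrakk>a \<in> Obj P; b \<in> Obj P; c \<in> Obj P; d \<in> Obj P\<rbrakk> \<Longrightarrow>
    Src P (coas P a b c d) = (a \<boxplus> b) \<boxplus> (c \<boxplus> d)"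
  and Tgt_coas [simp]: "\<lbrakk>a \<in> Obj P; b \<in> Obj P; c \<in> Obj P; d \<in> Obj P\<rbrakk> \<Longrightarrow>
    Tgt P (coas P a b c d) = (a \<boxplus> c) \<boxplus> (b \<boxplus> d)"
  by (simp_all add: coas_exch)

lemma coas_nat:
  assumes "f \<in> Arr P" "g \<in> Arr P" "h \<in> Arr P" "k \<in> Arr P" "Tgt P f = a" "Tgt P g = b" "Tgt P h = c" "Tgt P k = d"
  shows "coas P a b c d \<cdot> ((f [+] g) [+] (h [+] k)) =
    ((f [+] h) [+] (g [+] k)) \<cdot> coas P (Src P f) (Src P g) (Src P h) (Src P k)"
proof (rule Cmp_cancel_left[where h = "assoc P a c (b \<boxplus> d)"])
  have "assoc P a c (b \<boxplus> d) \<cdot> (coas P a b c d \<cdot> ((f [+] g) [+] (h [+] k))) =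
     (Idn P a [+] exch b c d) \<cdot> (assoc P a b (c \<boxplus> d) \<cdot> ((f [+] g) [+] (h [+] k)))"
    using assms by (auto simp: Cmp_reassoc[OF assoc_coas] Cmp_assoc)
  also have "\<dots> = (f [+] (exch b c d \<cdot> (g [+] (h [+] k)))) \<cdot> assoc P (Src P f) (Src P g) (Src P h \<boxplus> Src P k)"
    using assms by (auto simp: assoc_nat Cmp_reassoc[OF interchange])
  also have "\<dots> = (f [+] (h [+] (g [+] k))) \<cdot> ((Idn P (Src P f) [+] exch (Src P g) (Src P h) (Src P k)) \<cdot>
       assoc P (Src P f) (Src P g) (Src P h \<boxplus> Src P k))"
    using assms by (auto simp: exch_nat Cmp_reassoc[OF interchange])
  also have "\<dots> = (f [+] (h [+] (g [+] k))) \<cdot> (assoc P (Src P f) (Src P h) (Src P g \<boxplus> Src P k) \<cdot>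
     coas P (Src P f) (Src P g) (Src P h) (Src P k))"
    using assms by (simp add: assoc_coas)
  also have "\<dots> = assoc P a c (b \<boxplus> d) \<cdot> (((f [+] h) [+] (g [+] k)) \<cdot> coas P (Src P f) (Src P g) (Src P h) (Src P k))"
    using assms by (subst Cmp_reassoc[OF assoc_nat[where f = f and g = h and h = "g [+] k"]]) (auto simp: Cmp_assoc)
  finally show "assoc P a c (b \<boxplus> d) \<cdot> (coas P a b c d \<cdot> ((f [+] g) [+] (h [+] k))) = \<dots>" .
qed (use assms in auto)

text \<open>The exchange of \<open>c\<close> and \<open>b\<close> undoes that of \<open>b\<close>
  and \<open>c\<close>. So the inverse of \<open>coas\<close> is again a \<open>coas\<close>, with
  its middle arguments swapped.\<close>

lemma coas_coas [simp]: "\<lbrakk>a \<in> Obj P; b \<in> Obj P; c \<in> Obj P; d \<in> Obj P\<rbrakk> \<Longrightarrow>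
  coas P a c b d \<cdot> coas P a b c d = Idn P ((a \<boxplus> b) \<boxplus> (c \<boxplus> d))"
  by (simp add: coas_exch Cmp_assoc Cmp_reassoc[OF interchange])

lemma inv_coas: "\<lbrakk>a \<in> Obj P; b \<in> Obj P; c \<in> Obj P; d \<in> Obj P\<rbrakk> \<Longrightarrow> inv_arr P (coas P a b c d) = coas P a c b d"
  by (rule inv_arrI) simp_all

end

section \<open>Hexagons for exchanges; \<open>coas\<close> against symmetry and
  associativity\<close>

context sym_gpd
begin

lemma hexagon_exch:
  assumes [simp]: "a \<in> Obj P" "b \<in> Obj P" "c \<in> Obj P"
  shows "assoc P b c a \<cdot> symm P a (b \<boxplus> c) = (Idn P b [+] symm P a c) \<cdot> exch a b c"
  by (rule Cmp_cancel_right[where h = "assoc P a b c"]) (simp_all add: Cmp_assoc hexagon exch_assoc)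

text \<open>The second hexagon, for a sum in the first argument. It is the inverse of the first one,
  since \<open>symm\<close> and \<open>exch\<close> are inverted by swapping their
  arguments.\<close>

lemma symm_osum:
  assumes [simp]: "a \<in> Obj P" "b \<in> Obj P" "c \<in> Obj P"
  shows "symm P (a \<boxplus> b) c = exch a c b \<cdot> (Idn P a [+] symm P b c) \<cdot> assoc P a b c"
proof -
  have "inv_arr P (assoc P a b c \<cdot> symm P c (a \<boxplus> b)) = inv_arr P ((Idn P a [+] symm P c b) \<cdot> exch c a b)"
    by (simp add: hexagon_exch)
  moreover have "inv_arr P (exch c a b) = exch a c b"
    by (rule inv_arrI) simp_all
  ultimately have "symm P (a \<boxplus> b) c \<cdot> inv_arr P (assoc P a b c) = exch a c b \<cdot> (Idn P a [+] symm P b c)"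
    by (simp add: inv_of_Cmp inv_symm inv_asum)
  then have "(symm P (a \<boxplus> b) c \<cdot> inv_arr P (assoc P a b c)) \<cdot> assoc P a b c =
      (exch a c b \<cdot> (Idn P a [+] symm P b c)) \<cdot> assoc P a b c"
    by simp
  then show ?thesis by (simp add: Cmp_assoc)
qed

text \<open>Precomposing with the associators that start at \<open>((a + b) + c) + x\<close> makes
  the hexagon applicable inside the first summand; pentagons and naturality of \<open>assoc\<close>
  do the rest.\<close>

lemma exch_osum_right:
  assumes [simp]: "a \<in> Obj P" "b \<in> Obj P" "c \<in> Obj P" "x \<in> Obj P"
  shows "assoc P b c (a \<boxplus> x) \<cdot> exch a (b \<boxplus> c) x =
    (Idn P b [+] exch a c x) \<cdot> exch a b (c \<boxplus> x) \<cdot> (Idn P a [+] assoc P b c x)"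
proof (rule Cmp_cancel_right[where h = "assoc P a (b \<boxplus> c) x \<cdot> (assoc P a b c [+] Idn P x)"])
  let ?k = "assoc P a (b \<boxplus> c) x \<cdot> (assoc P a b c [+] Idn P x)"
  have "(assoc P b c (a \<boxplus> x) \<cdot> exch a (b \<boxplus> c) x) \<cdot> ?k =
      assoc P b c (a \<boxplus> x) \<cdot> (assoc P (b \<boxplus> c) a x \<cdot> ((symm P a (b \<boxplus> c) [+] Idn P x) \<cdot> (assoc P a b c [+] Idn P x)))"
    by (simp add: Cmp_assoc Cmp_reassoc[OF exch_assoc])
  also have "\<dots> = (Idn P b [+] assoc P c a x) \<cdot> (assoc P b (c \<boxplus> a) x \<cdot>
      ((assoc P b c a \<cdot> symm P a (b \<boxplus> c) \<cdot> assoc P a b c) [+] Idn P x))"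
    by (simp add: Cmp_reassoc[OF pentagon] Cmp_assoc rwhisk)
  also have "\<dots> = (Idn P b [+] assoc P c a x) \<cdot> (assoc P b (c \<boxplus> a) x \<cdot>
      (((Idn P b [+] symm P a c) [+] Idn P x) \<cdot> ((assoc P b a c [+] Idn P x) \<cdot> ((symm P a b [+] Idn P c) [+] Idn P x))))"
    by (simp add: hexagon rwhisk)
  also have "\<dots> = (Idn P b [+] (assoc P c a x \<cdot> (symm P a c [+] Idn P x))) \<cdot> (assoc P b (a \<boxplus> c) x \<cdot>
      ((assoc P b a c [+] Idn P x) \<cdot> ((symm P a b [+] Idn P c) [+] Idn P x)))"
    by (simp add: Cmp_reassoc[OF assoc_nat] lwhisk Cmp_assoc)
  also have "\<dots> = (Idn P b [+] exch a c x) \<cdot> ((Idn P b [+] assoc P a c x) \<cdot> (assoc P b (a \<boxplus> c) x \<cdot>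
      ((assoc P b a c [+] Idn P x) \<cdot> ((symm P a b [+] Idn P c) [+] Idn P x))))"
    by (simp add: exch_assoc[symmetric] lwhisk Cmp_assoc)
  also have "\<dots> = (Idn P b [+] exch a c x) \<cdot> (assoc P b a (c \<boxplus> x) \<cdot> (assoc P (b \<boxplus> a) c x \<cdot>
      ((symm P a b [+] Idn P c) [+] Idn P x)))"
    by (simp add: Cmp_reassoc[OF pentagon] Cmp_assoc)
  also have "\<dots> = (Idn P b [+] exch a c x) \<cdot> (exch a b (c \<boxplus> x) \<cdot> (assoc P a b (c \<boxplus> x) \<cdot> assoc P (a \<boxplus> b) c x))"
    by (simp add: assoc_nat Cmp_reassoc[OF exch_assoc] Cmp_assoc)
  also have "\<dots> = ((Idn P b [+] exch a c x) \<cdot> exch a b (c \<boxplus> x) \<cdot> (Idn P a [+] assoc P b c x)) \<cdot> ?k"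
    by (simp add: pentagon Cmp_assoc)
  finally show "(assoc P b c (a \<boxplus> x) \<cdot> exch a (b \<boxplus> c) x) \<cdot> ?k = \<dots>" .
qed simp_all

lemma inv_exch: "\<lbrakk>a \<in> Obj P; b \<in> Obj P; x \<in> Obj P\<rbrakk> \<Longrightarrow> inv_arr P (exch a b x) = exch b a x"
  by (rule inv_arrI) simp_all

text \<open>Inverse of \<open>exch_osum_right\<close> with the variables renamed, because exchanges
  are invertible by exchanges.\<close>

lemma exch_osum_left:
  assumes [simp]: "a \<in> Obj P" "b \<in> Obj P" "c \<in> Obj P" "x \<in> Obj P"
  shows "(Idn P c [+] assoc P a b x) \<cdot> exch (a \<boxplus> b) c x =
    exch a c (b \<boxplus> x) \<cdot> (Idn P a [+] exch b c x) \<cdot> assoc P a b (c \<boxplus> x)"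
proof -
  have "inv_arr P (assoc P a b (c \<boxplus> x) \<cdot> exch c (a \<boxplus> b) x) =
      inv_arr P ((Idn P a [+] exch c b x) \<cdot> exch c a (b \<boxplus> x) \<cdot> (Idn P c [+] assoc P a b x))"
    by (simp add: exch_osum_right)
  then have "exch (a \<boxplus> b) c x \<cdot> inv_arr P (assoc P a b (c \<boxplus> x)) =
      (Idn P c [+] inv_arr P (assoc P a b x)) \<cdot> (exch a c (b \<boxplus> x) \<cdot> (Idn P a [+] exch b c x))"
    by (simp add: inv_of_Cmp inv_exch inv_asum Cmp_assoc)
  then have "(Idn P c [+] assoc P a b x) \<cdot> ((exch (a \<boxplus> b) c x \<cdot> inv_arr P (assoc P a b (c \<boxplus> x))) \<cdot> assoc P a b (c \<boxplus> x)) =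
      (Idn P c [+] assoc P a b x) \<cdot> (((Idn P c [+] inv_arr P (assoc P a b x)) \<cdot> (exch a c (b \<boxplus> x) \<cdot> (Idn P a [+] exch b c x))) \<cdot> assoc P a b (c \<boxplus> x))"
    by simp
  then show ?thesis by (simp add: Cmp_assoc Cmp_reassoc[OF interchange])
qed

text \<open>Lets an exchange that happens inside a bracket be carried out after the tail
  \<open>x\<close> has been absorbed into the word. \<open>assoc_coas_coas\<close> needs it because
  there a \<open>coas\<close> is summed with an identity.\<close>

lemma exch_assoc_assoc:
  assumes [simp]: "a \<in> Obj P" "b \<in> Obj P" "c \<in> Obj P" "x \<in> Obj P"
  shows "(Idn P b [+] assoc P a c x) \<cdot> assoc P b (a \<boxplus> c) x \<cdot> (exch a b c [+] Idn P x) =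
    exch a b (c \<boxplus> x) \<cdot> (Idn P a [+] assoc P b c x) \<cdot> assoc P a (b \<boxplus> c) x"
proof (rule Cmp_cancel_right[where h = "assoc P a b c [+] Idn P x"])
  have "((Idn P b [+] assoc P a c x) \<cdot> assoc P b (a \<boxplus> c) x \<cdot> (exch a b c [+] Idn P x)) \<cdot> (assoc P a b c [+] Idn P x)
    = (Idn P b [+] assoc P a c x) \<cdot> (assoc P b (a \<boxplus> c) x \<cdot> ((assoc P b a c [+] Idn P x) \<cdot> ((symm P a b [+] Idn P c) [+] Idn P x)))"
    by (simp add: Cmp_assoc rwhisk[symmetric] exch_assoc)
  also have "\<dots> = assoc P b a (c \<boxplus> x) \<cdot> (assoc P (b \<boxplus> a) c x \<cdot> ((symm P a b [+] Idn P c) [+] Idn P x))"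
    by (simp add: Cmp_reassoc[OF pentagon] Cmp_assoc)
  also have "\<dots> = exch a b (c \<boxplus> x) \<cdot> (assoc P a b (c \<boxplus> x) \<cdot> assoc P (a \<boxplus> b) c x)"
    by (simp add: assoc_nat Cmp_reassoc[OF exch_assoc] Cmp_assoc)
  also have "\<dots> = (exch a b (c \<boxplus> x) \<cdot> (Idn P a [+] assoc P b c x) \<cdot> assoc P a (b \<boxplus> c) x) \<cdot> (assoc P a b c [+] Idn P x)"
    by (simp add: pentagon Cmp_assoc)
  finally show "((Idn P b [+] assoc P a c x) \<cdot> assoc P b (a \<boxplus> c) x \<cdot> (exch a b c [+] Idn P x)) \<cdot> (assoc P a b c [+] Idn P x) = \<dots>" .
qed simp_all

text \<open>This law makes the pointwise symmetry a morphism between the two sums of a pair of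
  models, and lets symmetries pass through \<open>shuffle\<close>.\<close>

lemma symm_coas:
  assumes [simp]: "a \<in> Obj P" "b \<in> Obj P" "c \<in> Obj P" "d \<in> Obj P"
  shows "(symm P a c [+] symm P b d) \<cdot> coas P a b c d = coas P c d a b \<cdot> symm P (a \<boxplus> b) (c \<boxplus> d)"
proof (rule Cmp_cancel_left[where h = "assoc P c a (d \<boxplus> b)"])
  have "assoc P c a (d \<boxplus> b) \<cdot> ((symm P a c [+] symm P b d) \<cdot> coas P a b c d) =
      assoc P c a (d \<boxplus> b) \<cdot> ((symm P a c [+] Idn P (d \<boxplus> b)) \<cdot> ((Idn P (a \<boxplus> c) [+] symm P b d) \<cdot> coas P a b c d))"
    by (simp add: Cmp_reassoc[OF interchange])
  also have "\<dots> = exch a c (d \<boxplus> b) \<cdot> (assoc P a c (d \<boxplus> b) \<cdot> (((Idn P a [+] Idn P c) [+] symm P b d) \<cdot> coas P a b c d))"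
    by (simp add: Cmp_reassoc[OF exch_assoc] Cmp_assoc)
  also have "\<dots> = exch a c (d \<boxplus> b) \<cdot> ((Idn P a [+] (Idn P c [+] symm P b d)) \<cdot> (assoc P a c (b \<boxplus> d) \<cdot> coas P a b c d))"
    by (subst Cmp_reassoc[OF assoc_nat]) (simp_all add: Cmp_assoc del: asum_Idn)
  also have "\<dots> = exch a c (d \<boxplus> b) \<cdot> ((Idn P a [+] ((Idn P c [+] symm P b d) \<cdot> exch b c d)) \<cdot> assoc P a b (c \<boxplus> d))"
    by (simp add: assoc_coas lwhisk Cmp_assoc)
  also have "\<dots> = exch a c (d \<boxplus> b) \<cdot> ((Idn P a [+] assoc P c d b) \<cdot> ((Idn P a [+] symm P b (c \<boxplus> d)) \<cdot> assoc P a b (c \<boxplus> d)))"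
    by (simp add: hexagon_exch[symmetric] lwhisk Cmp_assoc)
  \<comment> \<open>The inserted pair \<open>exch d a b\<close>, \<open>exch a d b\<close> composes
    to an identity; its right half and \<open>exch a c\<close> are the two exchanges that
    \<open>exch_osum_right\<close> merges into one.\<close>
  also have "\<dots> = (Idn P c [+] exch d a b) \<cdot> ((Idn P c [+] exch a d b) \<cdot> (exch a c (d \<boxplus> b) \<cdot> ((Idn P a [+] assoc P c d b) \<cdot>
      ((Idn P a [+] symm P b (c \<boxplus> d)) \<cdot> assoc P a b (c \<boxplus> d)))))"
    by (simp add: Cmp_reassoc[OF interchange])
  also have "\<dots> = (Idn P c [+] exch d a b) \<cdot> (assoc P c d (a \<boxplus> b) \<cdot> (exch a (c \<boxplus> d) b \<cdot>
      ((Idn P a [+] symm P b (c \<boxplus> d)) \<cdot> assoc P a b (c \<boxplus> d))))"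
    by (simp add: Cmp_reassoc[OF exch_osum_right] Cmp_assoc)
  also have "\<dots> = (Idn P c [+] exch d a b) \<cdot> (assoc P c d (a \<boxplus> b) \<cdot> symm P (a \<boxplus> b) (c \<boxplus> d))"
    by (simp add: symm_osum Cmp_assoc)
  also have "\<dots> = assoc P c a (d \<boxplus> b) \<cdot> (coas P c d a b \<cdot> symm P (a \<boxplus> b) (c \<boxplus> d))"
    by (simp add: Cmp_reassoc[OF assoc_coas] Cmp_assoc)
  finally show "assoc P c a (d \<boxplus> b) \<cdot> ((symm P a c [+] symm P b d) \<cdot> coas P a b c d) = \<dots>" .
qed simp_all

text \<open>The associativity coherence of \<open>coas\<close>, from which associators become
  morphisms between sums of models. Both sides are carried to the word
  \<open>a + (c + (e + (b + (d + f))))\<close>, where each is a product of the same three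
  exchanges.\<close>

lemma assoc_coas_coas:
  assumes [simp]: "a \<in> Obj P" "b \<in> Obj P" "c \<in> Obj P" "d \<in> Obj P" "e \<in> Obj P" "f \<in> Obj P"
  shows "(assoc P a c e [+] assoc P b d f) \<cdot> (coas P (a \<boxplus> c) (b \<boxplus> d) e f \<cdot> (coas P a b c d [+] Idn P (e \<boxplus> f))) =
    coas P a b (c \<boxplus> e) (d \<boxplus> f) \<cdot> ((Idn P (a \<boxplus> b) [+] coas P c d e f) \<cdot> assoc P (a \<boxplus> b) (c \<boxplus> d) (e \<boxplus> f))"
    (is "?L = ?R")
proof (rule Cmp_cancel_left[where h = "(Idn P a [+] assoc P c e (b \<boxplus> (d \<boxplus> f))) \<cdot> assoc P a (c \<boxplus> e) (b \<boxplus> (d \<boxplus> f))"])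
  let ?X = "b \<boxplus> (d \<boxplus> f)" and ?ef = "e \<boxplus> f"
  let ?h = "(Idn P a [+] assoc P c e ?X) \<cdot> assoc P a (c \<boxplus> e) ?X"
  have "?h \<cdot> ?L = (Idn P a [+] assoc P c e ?X) \<cdot> (assoc P a (c \<boxplus> e) ?X \<cdot> ((assoc P a c e [+] Idn P ?X) \<cdot>
     ((Idn P ((a \<boxplus> c) \<boxplus> e) [+] assoc P b d f) \<cdot> (coas P (a \<boxplus> c) (b \<boxplus> d) e f \<cdot> (coas P a b c d [+] Idn P ?ef)))))"
    by (simp add: Cmp_assoc Cmp_reassoc[OF interchange])
  also have "\<dots> = assoc P a c (e \<boxplus> ?X) \<cdot> (assoc P (a \<boxplus> c) e ?X \<cdot>
     (((Idn P (a \<boxplus> c) [+] Idn P e) [+] assoc P b d f) \<cdot> (coas P (a \<boxplus> c) (b \<boxplus> d) e f \<cdot> (coas P a b c d [+] Idn P ?ef))))"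
    by (simp add: Cmp_reassoc[OF pentagon] Cmp_assoc)
  also have "\<dots> = assoc P a c (e \<boxplus> ?X) \<cdot> ((Idn P (a \<boxplus> c) [+] (Idn P e [+] assoc P b d f)) \<cdot>
     (assoc P (a \<boxplus> c) e ((b \<boxplus> d) \<boxplus> f) \<cdot> (coas P (a \<boxplus> c) (b \<boxplus> d) e f \<cdot> (coas P a b c d [+] Idn P ?ef))))"
    by (subst Cmp_reassoc[OF assoc_nat]) (simp_all add: Cmp_assoc del: asum_Idn)
  also have "\<dots> = assoc P a c (e \<boxplus> ?X) \<cdot> ((Idn P (a \<boxplus> c) [+] ((Idn P e [+] assoc P b d f) \<cdot> exch (b \<boxplus> d) e f)) \<cdot>
     (assoc P (a \<boxplus> c) (b \<boxplus> d) ?ef \<cdot> (coas P a b c d [+] Idn P ?ef)))"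
    by (simp add: Cmp_reassoc[OF assoc_coas] lwhisk Cmp_assoc)
  also have "\<dots> = assoc P a c (e \<boxplus> ?X) \<cdot> (((Idn P a [+] Idn P c) [+] (exch b e (d \<boxplus> f) \<cdot> (Idn P b [+] exch d e f))) \<cdot>
     ((Idn P (a \<boxplus> c) [+] assoc P b d ?ef) \<cdot> (assoc P (a \<boxplus> c) (b \<boxplus> d) ?ef \<cdot> (coas P a b c d [+] Idn P ?ef))))"
    by (simp add: exch_osum_left lwhisk Cmp_assoc)
  also have "\<dots> = (Idn P a [+] (Idn P c [+] (exch b e (d \<boxplus> f) \<cdot> (Idn P b [+] exch d e f)))) \<cdot>
     (assoc P a c (b \<boxplus> (d \<boxplus> ?ef)) \<cdot> (((Idn P a [+] Idn P c) [+] assoc P b d ?ef) \<cdot> (assoc P (a \<boxplus> c) (b \<boxplus> d) ?ef \<cdot> (coas P a b c d [+] Idn P ?ef))))"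
    by (subst Cmp_reassoc[OF assoc_nat]) (simp_all add: Cmp_assoc del: asum_Idn, simp)
  also have "assoc P a c (b \<boxplus> (d \<boxplus> ?ef)) \<cdot> (((Idn P a [+] Idn P c) [+] assoc P b d ?ef) \<cdot> (assoc P (a \<boxplus> c) (b \<boxplus> d) ?ef \<cdot> (coas P a b c d [+] Idn P ?ef)))
    = (Idn P a [+] (Idn P c [+] assoc P b d ?ef)) \<cdot> (assoc P a c ((b \<boxplus> d) \<boxplus> ?ef) \<cdot> (assoc P (a \<boxplus> c) (b \<boxplus> d) ?ef \<cdot> (coas P a b c d [+] Idn P ?ef)))"
    by (subst Cmp_reassoc[OF assoc_nat]) (simp_all add: Cmp_assoc del: asum_Idn)
  also have "assoc P a c ((b \<boxplus> d) \<boxplus> ?ef) \<cdot> (assoc P (a \<boxplus> c) (b \<boxplus> d) ?ef \<cdot> (coas P a b c d [+] Idn P ?ef))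
    = (Idn P a [+] assoc P c (b \<boxplus> d) ?ef) \<cdot> (assoc P a (c \<boxplus> (b \<boxplus> d)) ?ef \<cdot> ((assoc P a c (b \<boxplus> d) \<cdot> coas P a b c d) [+] Idn P ?ef))"
    by (simp add: Cmp_reassoc[OF pentagon] Cmp_assoc rwhisk)
  also have "\<dots> = (Idn P a [+] assoc P c (b \<boxplus> d) ?ef) \<cdot> ((Idn P a [+] (exch b c d [+] Idn P ?ef)) \<cdot>
     (assoc P a (b \<boxplus> (c \<boxplus> d)) ?ef \<cdot> (assoc P a b (c \<boxplus> d) [+] Idn P ?ef)))"
    by (simp add: assoc_coas Cmp_assoc rwhisk Cmp_reassoc[OF assoc_nat])
  also have "(Idn P a [+] (Idn P c [+] assoc P b d ?ef)) \<cdot> \<dots> =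
     (Idn P a [+] ((Idn P c [+] assoc P b d ?ef) \<cdot> assoc P c (b \<boxplus> d) ?ef \<cdot> (exch b c d [+] Idn P ?ef))) \<cdot>
     (assoc P a (b \<boxplus> (c \<boxplus> d)) ?ef \<cdot> (assoc P a b (c \<boxplus> d) [+] Idn P ?ef))"
    by (simp add: lwhisk Cmp_assoc)
  also have "\<dots> = (Idn P a [+] exch b c (d \<boxplus> ?ef)) \<cdot> ((Idn P a [+] (Idn P b [+] assoc P c d ?ef)) \<cdot>
     ((Idn P a [+] assoc P b (c \<boxplus> d) ?ef) \<cdot>
     (assoc P a (b \<boxplus> (c \<boxplus> d)) ?ef \<cdot> (assoc P a b (c \<boxplus> d) [+] Idn P ?ef))))"
    by (simp add: exch_assoc_assoc lwhisk Cmp_assoc)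
  also have "\<dots> = (Idn P a [+] exch b c (d \<boxplus> ?ef)) \<cdot> ((Idn P a [+] (Idn P b [+] assoc P c d ?ef)) \<cdot>
     (assoc P a b ((c \<boxplus> d) \<boxplus> ?ef) \<cdot> assoc P (a \<boxplus> b) (c \<boxplus> d) ?ef))"
    by (simp add: pentagon)
  finally have L: "?h \<cdot> ?L = (Idn P a [+] (Idn P c [+] (exch b e (d \<boxplus> f) \<cdot> (Idn P b [+] exch d e f)))) \<cdot> \<dots>" .
  have "?h \<cdot> ?R = (Idn P a [+] (assoc P c e ?X \<cdot> exch b (c \<boxplus> e) (d \<boxplus> f))) \<cdot> (assoc P a b ((c \<boxplus> e) \<boxplus> (d \<boxplus> f)) \<cdot>
     (((Idn P a [+] Idn P b) [+] coas P c d e f) \<cdot> assoc P (a \<boxplus> b) (c \<boxplus> d) ?ef))"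
    by (simp add: Cmp_assoc Cmp_reassoc[OF assoc_coas] lwhisk)
  also have "\<dots> = (Idn P a [+] (assoc P c e ?X \<cdot> exch b (c \<boxplus> e) (d \<boxplus> f))) \<cdot> ((Idn P a [+] (Idn P b [+] coas P c d e f)) \<cdot>
     (assoc P a b ((c \<boxplus> d) \<boxplus> ?ef) \<cdot> assoc P (a \<boxplus> b) (c \<boxplus> d) ?ef))"
    by (subst Cmp_reassoc[OF assoc_nat]) (simp_all add: Cmp_assoc del: asum_Idn)
  also have "\<dots> = (Idn P a [+] ((Idn P c [+] exch b e (d \<boxplus> f)) \<cdot> (exch b c (e \<boxplus> (d \<boxplus> f))))) \<cdot>
     ((Idn P a [+] (Idn P b [+] (assoc P c e (d \<boxplus> f) \<cdot> coas P c d e f))) \<cdot>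
     (assoc P a b ((c \<boxplus> d) \<boxplus> ?ef) \<cdot> assoc P (a \<boxplus> b) (c \<boxplus> d) ?ef))"
    by (simp add: exch_osum_right lwhisk Cmp_assoc)
  also have "\<dots> = (Idn P a [+] (Idn P c [+] exch b e (d \<boxplus> f))) \<cdot> ((Idn P a [+] (exch b c (e \<boxplus> (d \<boxplus> f)) \<cdot> (Idn P b [+] (Idn P c [+] exch d e f)))) \<cdot>
     ((Idn P a [+] (Idn P b [+] assoc P c d ?ef)) \<cdot>
     (assoc P a b ((c \<boxplus> d) \<boxplus> ?ef) \<cdot> assoc P (a \<boxplus> b) (c \<boxplus> d) ?ef)))"
    by (simp add: assoc_coas lwhisk Cmp_assoc)
  \<comment> \<open>The exchanges of \<open>b\<close>, \<open>c\<close> and of \<open>d\<close>,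
    \<open>e\<close> concern different summands, so naturality puts them into the order in which the
    left-hand side has them.\<close>
  also have "exch b c (e \<boxplus> (d \<boxplus> f)) \<cdot> (Idn P b [+] (Idn P c [+] exch d e f)) =
     (Idn P c [+] (Idn P b [+] exch d e f)) \<cdot> exch b c (d \<boxplus> ?ef)"
    by (simp add: exch_nat)
  finally have "?h \<cdot> ?R = (Idn P a [+] (Idn P c [+] exch b e (d \<boxplus> f))) \<cdot> ((Idn P a [+] ((Idn P c [+] (Idn P b [+] exch d e f)) \<cdot> exch b c (d \<boxplus> ?ef))) \<cdot>
     ((Idn P a [+] (Idn P b [+] assoc P c d ?ef)) \<cdot>
     (assoc P a b ((c \<boxplus> d) \<boxplus> ?ef) \<cdot> assoc P (a \<boxplus> b) (c \<boxplus> d) ?ef)))" .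
  with L show "?h \<cdot> ?L = ?h \<cdot> ?R"
    by (simp add: lwhisk Cmp_assoc)
qed simp_all

end

section \<open>Cancellation of summands and unit coherence in Picard groupoids\<close>

locale picard_gpd = sym_gpd P for P :: "('p, 'q) moncat" (structure) +
  assumes picard: "picard P"
begin

text \<open>An equivalence is fully faithful. Injectivity lets a common summand be cancelled from an
  equation; surjectivity lets an equation with a summand be solved, which will produce
  units.\<close>

lemma osum_functor_equivalence:
  assumes x: "x \<in> Obj P" and a: "a \<in> Obj P" and b: "b \<in> Obj P"
  shows "inj_on (\<lambda>f. Idn P x [+] f) (Hom P a b)"
    and "(\<lambda>f. Idn P x [+] f) ` Hom P a b = Hom P (x \<boxplus> a) (x \<boxplus> b)"
proof -
  let ?F = "\<lparr>fob = (\<lambda>a. x \<boxplus> a), far = (\<lambda>f. Idn P x [+] f)\<rparr>"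
  have "is_equivalence P P ?F"
    using picard x by (simp add: picard_def)
  then obtain G :: "('p, 'q, 'p, 'q) funct" and \<eta> \<epsilon> where G: "is_functor P P G"
    and \<eta>: "nat_iso P P id_functor (comp_functor G ?F) \<eta>"
    and \<epsilon>: "nat_iso P P (comp_functor ?F G) id_functor \<epsilon>"
    unfolding is_equivalence_def by blast
  have [simp]: "far G f \<in> Arr P" "Src P (far G f) = fob G (Src P f)" "Tgt P (far G f) = fob G (Tgt P f)"
    if "f \<in> Arr P" for f
    using G that by (auto simp: is_functor_def)
  have \<eta>_typ [simp]: "\<eta> c \<in> Arr P" "Src P (\<eta> c) = c" "Tgt P (\<eta> c) = fob G (x \<boxplus> c)" if "c \<in> Obj P" for c
    using \<eta> that by (auto simp: nat_iso_def nat_trans_def PiE_iff id_functor_def comp_functor_def)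
  have \<epsilon>_typ [simp]: "\<epsilon> c \<in> Arr P" "Src P (\<epsilon> c) = x \<boxplus> fob G c" "Tgt P (\<epsilon> c) = c" if "c \<in> Obj P" for c
    using \<epsilon> that by (auto simp: nat_iso_def nat_trans_def PiE_iff id_functor_def comp_functor_def)
  have \<eta>_nat: "far G (Idn P x [+] f) \<cdot> \<eta> (Src P f) = \<eta> (Tgt P f) \<cdot> f" if "f \<in> Arr P" for f
    using \<eta> that by (auto simp: nat_iso_def nat_trans_def id_functor_def comp_functor_def)
  have \<epsilon>_nat: "f \<cdot> \<epsilon> (Src P f) = \<epsilon> (Tgt P f) \<cdot> (Idn P x [+] far G f)" if "f \<in> Arr P" for f
    using \<epsilon> that by (auto simp: nat_iso_def nat_trans_def id_functor_def comp_functor_def)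
  show "inj_on (\<lambda>f. Idn P x [+] f) (Hom P a b)"
  proof (rule inj_onI)
    fix f g assume fg: "f \<in> Hom P a b" "g \<in> Hom P a b" and eq: "Idn P x [+] f = Idn P x [+] g"
    then have "\<eta> b \<cdot> f = \<eta> b \<cdot> g"
      using \<eta>_nat[of f] \<eta>_nat[of g] by simp
    then show "f = g"
      by (rule Cmp_cancel_left) (use fg b in auto)
  qed
  have "h \<in> (\<lambda>f. Idn P x [+] f) ` Hom P a b" if h: "h \<in> Hom P (x \<boxplus> a) (x \<boxplus> b)" for h
  proof
    \<comment> \<open>The preimage of \<open>h\<close> is \<open>far G h\<close> conjugated by the
      unit of the equivalence. Then \<open>Idn P x [+] f\<close> and \<open>h\<close> have the same
      image under \<open>G\<close>, and naturality of the counit makes them equal.\<close>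
    define f where "f = inv_arr P (\<eta> b) \<cdot> (far G h \<cdot> \<eta> a)"
    show f: "f \<in> Hom P a b" using h a b by (simp add: f_def)
    have "far G (Idn P x [+] f) \<cdot> \<eta> a = \<eta> b \<cdot> f"
      using \<eta>_nat[of f] f by simp
    also have "\<dots> = far G h \<cdot> \<eta> a"
      using h a b by (simp add: f_def)
    finally have *: "far G (Idn P x [+] f) = far G h"
      by (rule Cmp_cancel_right) (use f h a b x in auto)
    have "h \<cdot> \<epsilon> (x \<boxplus> a) = (Idn P x [+] f) \<cdot> \<epsilon> (x \<boxplus> a)"
      using \<epsilon>_nat[of h] \<epsilon>_nat[of "Idn P x [+] f"] f h x * by simp
    then show "h = Idn P x [+] f"
      by (rule Cmp_cancel_right) (use f h a b x in auto)
  qed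
  then show "(\<lambda>f. Idn P x [+] f) ` Hom P a b = Hom P (x \<boxplus> a) (x \<boxplus> b)"
    using x a b by auto
qed

lemma asum_cancel_left:
  "\<lbrakk>Idn P x [+] f = Idn P x [+] g; x \<in> Obj P; f \<in> Arr P; g \<in> Arr P; Src P f = Src P g; Tgt P f = Tgt P g\<rbrakk> \<Longrightarrow> f = g"
  using inj_onD[OF osum_functor_equivalence(1)[of x "Src P g" "Tgt P g"]] by simp

lemma asum_cancel_right:
  assumes "f [+] Idn P x = g [+] Idn P x" "x \<in> Obj P" "f \<in> Arr P" "g \<in> Arr P" "Src P f = Src P g" "Tgt P f = Tgt P g"
  shows "f = g"
proof (rule asum_cancel_left[OF _ assms(2-6)])
  have "(Idn P x [+] f) \<cdot> symm P (Src P f) x = (Idn P x [+] g) \<cdot> symm P (Src P f) x"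
    using symm_nat[of f "Idn P x" "Tgt P f" x] symm_nat[of g "Idn P x" "Tgt P g" x] assms by simp
  then show "Idn P x [+] f = Idn P x [+] g"
    by (rule Cmp_cancel_right) (use assms in auto)
qed

text \<open>Kelly's argument: after adding \<open>0\<close> on the left the equation follows from
  pentagon and triangle, and the added summand is cancelled.\<close>

lemma lunit_osum:
  assumes [simp]: "a \<in> Obj P" "b \<in> Obj P"
  shows "lunit P (a \<boxplus> b) \<cdot> assoc P (ounit P) a b = lunit P a [+] Idn P b"
proof (rule asum_cancel_left[where x = "ounit P"])
  let ?u = "ounit P"
  let ?K = "assoc P ?u (?u \<boxplus> a) b \<cdot> (assoc P ?u ?u a [+] Idn P b)"
  have "(Idn P ?u [+] (lunit P (a \<boxplus> b) \<cdot> assoc P ?u a b)) \<cdot> ?K =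
      (Idn P ?u [+] lunit P (a \<boxplus> b)) \<cdot> (assoc P ?u ?u (a \<boxplus> b) \<cdot> assoc P (?u \<boxplus> ?u) a b)"
    by (simp add: lwhisk Cmp_assoc pentagon)
  also have "\<dots> = (runit P ?u [+] (Idn P a [+] Idn P b)) \<cdot> assoc P (?u \<boxplus> ?u) a b"
    by (simp add: Cmp_reassoc[OF triangle])
  also have "\<dots> = assoc P ?u a b \<cdot> ((runit P ?u [+] Idn P a) [+] Idn P b)"
    by (subst assoc_nat) simp_all
  also have "\<dots> = assoc P ?u a b \<cdot> (((Idn P ?u [+] lunit P a) [+] Idn P b) \<cdot> (assoc P ?u ?u a [+] Idn P b))"
    by (simp add: triangle[symmetric] rwhisk)
  also have "\<dots> = (Idn P ?u [+] (lunit P a [+] Idn P b)) \<cdot> ?K"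
    by (simp add: Cmp_reassoc[OF assoc_nat] Cmp_assoc)
  finally show "Idn P ?u [+] (lunit P (a \<boxplus> b) \<cdot> assoc P ?u a b) = Idn P ?u [+] (lunit P a [+] Idn P b)"
    by (rule Cmp_cancel_right) simp_all
qed simp_all

text \<open>After adding \<open>a\<close> on the right, the triangle turns the right unit into a
  left one, and the hexagon with \<open>lunit_osum\<close> brings in the symmetry; then
  \<open>symm P a a\<close> and the summand cancel. This reduces right unit laws of functors to left
  ones.\<close>

lemma runit_symm:
  assumes [simp]: "a \<in> Obj P"
  shows "runit P a = lunit P a \<cdot> symm P a (ounit P)"
proof (rule asum_cancel_right[where x = a])
  let ?u = "ounit P"
  have lunit_symm: "lunit P (a \<boxplus> a) \<cdot> (Idn P ?u [+] symm P a a) = symm P a a \<cdot> lunit P (a \<boxplus> a)"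
    using lunit_nat[of "symm P a a"] by simp
  have "symm P a a \<cdot> (runit P a [+] Idn P a) = symm P a a \<cdot> ((Idn P a [+] lunit P a) \<cdot> assoc P a ?u a)"
    by (simp add: triangle)
  also have "\<dots> = (lunit P a [+] Idn P a) \<cdot> (symm P a (?u \<boxplus> a) \<cdot> assoc P a ?u a)"
    by (simp add: Cmp_reassoc[OF symm_nat] Cmp_assoc)
  also have "\<dots> = lunit P (a \<boxplus> a) \<cdot> (assoc P ?u a a \<cdot> (symm P a (?u \<boxplus> a) \<cdot> assoc P a ?u a))"
    by (simp add: lunit_osum[symmetric] Cmp_assoc)
  also have "\<dots> = lunit P (a \<boxplus> a) \<cdot> ((Idn P ?u [+] symm P a a) \<cdot> (assoc P ?u a a \<cdot> (symm P a ?u [+] Idn P a)))"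
    by (simp add: hexagon Cmp_assoc)
  also have "\<dots> = symm P a a \<cdot> (lunit P (a \<boxplus> a) \<cdot> (assoc P ?u a a \<cdot> (symm P a ?u [+] Idn P a)))"
    by (simp add: Cmp_reassoc[OF lunit_symm] Cmp_assoc)
  also have "\<dots> = symm P a a \<cdot> ((lunit P a \<cdot> symm P a ?u) [+] Idn P a)"
    by (simp add: Cmp_reassoc[OF lunit_osum] rwhisk)
  finally show "runit P a [+] Idn P a = (lunit P a \<cdot> symm P a ?u) [+] Idn P a"
    by (rule Cmp_cancel_left) simp_all
qed simp_all

end

lemma picard_gpdI: "picard P \<Longrightarrow> picard_gpd P"
  by unfold_locales (auto simp: picard_def groupoid_def)

section \<open>Presentations and their models\<close>

text \<open>Bracketed formal sums of objects. There is no formal zero: determinant functors carry no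
  unit data, and the units of monoidal functors are recovered separately.\<close>

datatype 'o tree = Leaf 'o | Node "'o tree" "'o tree"

text \<open>Relations are kept as syntax because their two sides must be evaluated in many models at
  once, and induction on expressions is what shows evaluation to be compatible with morphisms and
  sums of models. Inverse associators are included because \<open>coas\<close> contains
  them.\<close>

datatype ('o, 'm, 't) expr =
  EArr 'm
| ELab 't
| EId "'o tree"
| ESum "('o, 'm, 't) expr" "('o, 'm, 't) expr"
| ECmp "('o, 'm, 't) expr" "('o, 'm, 't) expr"
| EAssoc "'o tree" "'o tree" "'o tree"
| EAssocInv "'o tree" "'o tree" "'o tree"
| ESymm "'o tree" "'o tree"

text \<open>A label \<open>t\<close> is a formal triangle with ends \<open>lx t\<close>, \<open>lz t\<close> and middle term \<open>ly t\<close>.\<close>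

record ('o, 'm, 't) pres =
  base :: "('o, 'm) cat"
  lab :: "'t set"
  lz :: "'t \<Rightarrow> 'o"
  lx :: "'t \<Rightarrow> 'o"
  ly :: "'t \<Rightarrow> 'o"
  rels :: "(('o, 'm, 't) expr \<times> ('o, 'm, 't) expr) set"

primrec esrc :: "('o, 'm, 't) pres \<Rightarrow> ('o, 'm, 't) expr \<Rightarrow> 'o tree" where
  "esrc X (EArr f) = Leaf (Src (base X) f)"
| "esrc X (ELab t) = Node (Leaf (lz X t)) (Leaf (lx X t))"
| "esrc X (EId r) = r"
| "esrc X (ESum d e) = Node (esrc X d) (esrc X e)"
| "esrc X (ECmp d e) = esrc X e"
| "esrc X (EAssoc r s t) = Node (Node r s) t"
| "esrc X (EAssocInv r s t) = Node r (Node s t)"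
| "esrc X (ESymm s t) = Node s t"

primrec etgt :: "('o, 'm, 't) pres \<Rightarrow> ('o, 'm, 't) expr \<Rightarrow> 'o tree" where
  "etgt X (EArr f) = Leaf (Tgt (base X) f)"
| "etgt X (ELab t) = Leaf (ly X t)"
| "etgt X (EId r) = r"
| "etgt X (ESum d e) = Node (etgt X d) (etgt X e)"
| "etgt X (ECmp d e) = etgt X d"
| "etgt X (EAssoc r s t) = Node r (Node s t)"
| "etgt X (EAssocInv r s t) = Node (Node r s) t"
| "etgt X (ESymm s t) = Node t s"

primrec wt :: "('o, 'm, 't) pres \<Rightarrow> ('o, 'm, 't) expr \<Rightarrow> bool" where
  "wt X (EArr f) \<longleftrightarrow> f \<in> Arr (base X)"
| "wt X (ELab t) \<longleftrightarrow> t \<in> lab X"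
| "wt X (EId r) \<longleftrightarrow> set_tree r \<subseteq> Obj (base X)"
| "wt X (ESum d e) \<longleftrightarrow> wt X d \<and> wt X e"
| "wt X (ECmp d e) \<longleftrightarrow> wt X d \<and> wt X e \<and> esrc X d = etgt X e"
| "wt X (EAssoc r s t) \<longleftrightarrow> set_tree r \<union> set_tree s \<union> set_tree t \<subseteq> Obj (base X)"
| "wt X (EAssocInv r s t) \<longleftrightarrow> set_tree r \<union> set_tree s \<union> set_tree t \<subseteq> Obj (base X)"
| "wt X (ESymm s t) \<longleftrightarrow> set_tree s \<union> set_tree t \<subseteq> Obj (base X)"

definition wf_pres :: "('o, 'm, 't) pres \<Rightarrow> bool" where
  "wf_pres X \<longleftrightarrow> category (base X) \<and>
    (\<forall>t\<in>lab X. lz X t \<in> Obj (base X) \<and> lx X t \<in> Obj (base X) \<and> ly X t \<in> Obj (base X)) \<and>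
    (\<forall>(d, e)\<in>rels X. wt X d \<and> wt X e \<and> esrc X d = esrc X e \<and> etgt X d = etgt X e)"

lemma wf_presD:
  assumes "wf_pres X"
  shows "cat_axioms (base X)"
    and "t \<in> lab X \<Longrightarrow> lz X t \<in> Obj (base X)" "t \<in> lab X \<Longrightarrow> lx X t \<in> Obj (base X)"
    and "t \<in> lab X \<Longrightarrow> ly X t \<in> Obj (base X)"
    and "(d, e) \<in> rels X \<Longrightarrow> wt X d" "(d, e) \<in> rels X \<Longrightarrow> wt X e"
    and "(d, e) \<in> rels X \<Longrightarrow> esrc X d = esrc X e" "(d, e) \<in> rels X \<Longrightarrow> etgt X d = etgt X e"
  using assms by (auto simp: wf_pres_def cat_axioms_def)

lemma wt_Obj:
  assumes "wf_pres X" "wt X e"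
  shows "set_tree (esrc X e) \<subseteq> Obj (base X)" "set_tree (etgt X e) \<subseteq> Obj (base X)"
  using assms(2) wf_presD(2-4)[OF assms(1)] cat_axioms.Src_Obj[OF wf_presD(1)[OF assms(1)]]
    cat_axioms.Tgt_Obj[OF wf_presD(1)[OF assms(1)]]
  by (induction e) auto

record ('o, 'm, 't, 'p, 'q) model = "('o, 'm, 'p, 'q) funct" +
  lb :: "'t \<Rightarrow> 'q"

section \<open>Evaluation of formal composites in a model\<close>

context sym_gpd
begin

primrec tval :: "('o \<Rightarrow> 'p) \<Rightarrow> 'o tree \<Rightarrow> 'p" where
  "tval \<phi> (Leaf a) = \<phi> a"
| "tval \<phi> (Node s t) = tval \<phi> s \<boxplus> tval \<phi> t"

primrec tmap :: "('o \<Rightarrow> 'q) \<Rightarrow> 'o tree \<Rightarrow> 'q" where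
  "tmap \<theta> (Leaf a) = \<theta> a"
| "tmap \<theta> (Node s t) = tmap \<theta> s [+] tmap \<theta> t"

primrec eval :: "('o, 'm, 't, 'p, 'q) model \<Rightarrow> ('o, 'm, 't) expr \<Rightarrow> 'q" where
  "eval F (EArr f) = far F f"
| "eval F (ELab t) = lb F t"
| "eval F (EId r) = Idn P (tval (fob F) r)"
| "eval F (ESum d e) = eval F d [+] eval F e"
| "eval F (ECmp d e) = eval F d \<cdot> eval F e"
| "eval F (EAssoc r s t) = assoc P (tval (fob F) r) (tval (fob F) s) (tval (fob F) t)"
| "eval F (EAssocInv r s t) = inv_arr P (assoc P (tval (fob F) r) (tval (fob F) s) (tval (fob F) t))"
| "eval F (ESymm s t) = symm P (tval (fob F) s) (tval (fob F) t)"

definition premodel :: "('o, 'm, 't) pres \<Rightarrow> ('o, 'm, 't, 'p, 'q) model \<Rightarrow> bool" where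
  "premodel X F \<longleftrightarrow> is_functor (base X) P F \<and>
    (\<forall>t\<in>lab X. lb F t \<in> Hom P (fob F (lz X t) \<boxplus> fob F (lx X t)) (fob F (ly X t)))"

definition is_model :: "('o, 'm, 't) pres \<Rightarrow> ('o, 'm, 't, 'p, 'q) model \<Rightarrow> bool" where
  "is_model X F \<longleftrightarrow> premodel X F \<and> (\<forall>(d, e)\<in>rels X. eval F d = eval F e)"

text \<open>Unlike \<open>nat_trans\<close>, this does not ask for extensional families: components
  can be given by plain lambda terms and are compared on objects only.\<close>

definition mor :: "('o, 'm, 't) pres \<Rightarrow> ('o, 'm, 't, 'p, 'q) model \<Rightarrow> ('o, 'm, 't, 'p, 'q) model \<Rightarrow>
    ('o \<Rightarrow> 'q) \<Rightarrow> bool" where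
  "mor X F G \<theta> \<longleftrightarrow> (\<forall>a\<in>Obj (base X). \<theta> a \<in> Hom P (fob F a) (fob G a)) \<and>
    (\<forall>f\<in>Arr (base X). far G f \<cdot> \<theta> (Src (base X) f) = \<theta> (Tgt (base X) f) \<cdot> far F f) \<and>
    (\<forall>t\<in>lab X. \<theta> (ly X t) \<cdot> lb F t = lb G t \<cdot> (\<theta> (lz X t) [+] \<theta> (lx X t)))"

definition psum :: "('o, 'm, 't) pres \<Rightarrow> ('o, 'm, 't, 'p, 'q) model \<Rightarrow> ('o, 'm, 't, 'p, 'q) model \<Rightarrow>
    ('o, 'm, 't, 'p, 'q) model" where
  "psum X F G = \<lparr>fob = (\<lambda>a. fob F a \<boxplus> fob G a), far = (\<lambda>f. far F f [+] far G f),
    lb = (\<lambda>t. (lb F t [+] lb G t) \<cdot> coas P (fob F (lz X t)) (fob G (lz X t)) (fob F (lx X t)) (fob G (lx X t)))\<rparr>"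

lemma premodelD:
  assumes "premodel X F"
  shows "a \<in> Obj (base X) \<Longrightarrow> fob F a \<in> Obj P"
    and "f \<in> Arr (base X) \<Longrightarrow> far F f \<in> Arr P"
    and "f \<in> Arr (base X) \<Longrightarrow> Src P (far F f) = fob F (Src (base X) f)"
    and "f \<in> Arr (base X) \<Longrightarrow> Tgt P (far F f) = fob F (Tgt (base X) f)"
    and "a \<in> Obj (base X) \<Longrightarrow> far F (Idn (base X) a) = Idn P (fob F a)"
    and "\<lbrakk>f \<in> Arr (base X); g \<in> Arr (base X); Src (base X) g = Tgt (base X) f\<rbrakk> \<Longrightarrow>
      far F (Cmp (base X) g f) = far F g \<cdot> far F f"
    and "t \<in> lab X \<Longrightarrow> lb F t \<in> Arr P"
    and "t \<in> lab X \<Longrightarrow> Src P (lb F t) = fob F (lz X t) \<boxplus> fob F (lx X t)"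
    and "t \<in> lab X \<Longrightarrow> Tgt P (lb F t) = fob F (ly X t)"
  using assms by (auto simp: premodel_def is_functor_def)

lemma is_modelD: "is_model X F \<Longrightarrow> premodel X F"
  and is_model_rels: "is_model X F \<Longrightarrow> (d, e) \<in> rels X \<Longrightarrow> eval F d = eval F e"
  by (auto simp: is_model_def)

lemma morD:
  assumes "mor X F G \<theta>"
  shows "a \<in> Obj (base X) \<Longrightarrow> \<theta> a \<in> Arr P"
    and "a \<in> Obj (base X) \<Longrightarrow> Src P (\<theta> a) = fob F a"
    and "a \<in> Obj (base X) \<Longrightarrow> Tgt P (\<theta> a) = fob G a"
    and "f \<in> Arr (base X) \<Longrightarrow> far G f \<cdot> \<theta> (Src (base X) f) = \<theta> (Tgt (base X) f) \<cdot> far F f"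
    and "t \<in> lab X \<Longrightarrow> \<theta> (ly X t) \<cdot> lb F t = lb G t \<cdot> (\<theta> (lz X t) [+] \<theta> (lx X t))"
  using assms by (auto simp: mor_def)

lemma tval_Obj: "(\<And>a. a \<in> Obj C \<Longrightarrow> \<phi> a \<in> Obj P) \<Longrightarrow> set_tree t \<subseteq> Obj C \<Longrightarrow> tval \<phi> t \<in> Obj P"
  by (induction t) auto

lemma tmap_typed:
  assumes "\<And>a. a \<in> Obj C \<Longrightarrow> \<theta> a \<in> Hom P (\<phi> a) (\<psi> a)" "set_tree t \<subseteq> Obj C"
  shows "tmap \<theta> t \<in> Hom P (tval \<phi> t) (tval \<psi> t)"
  using assms by (induction t) auto

lemma eval_typed:
  assumes "wf_pres X" "premodel X F" "wt X e"
  shows "eval F e \<in> Hom P (tval (fob F) (esrc X e)) (tval (fob F) (etgt X e))"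
  using assms(3)
proof (induction e)
  case (ECmp d e)
  then show ?case by (auto simp: wt_Obj[OF assms(1)])
qed (auto simp: premodelD[OF assms(2)] tval_Obj[where \<phi> = "fob F" and C = "base X"])

text \<open>Arrows and labels are natural by the definition of \<open>mor\<close>, structure
  isomorphisms because they are natural in \<open>P\<close>. With invertible components this carries
  the truth of a relation from one model to another.\<close>

lemma eval_mor:
  assumes X: "wf_pres X" and F: "premodel X F" and G: "premodel X G" and \<theta>: "mor X F G \<theta>" and e: "wt X e"
  shows "tmap \<theta> (etgt X e) \<cdot> eval F e = eval G e \<cdot> tmap \<theta> (esrc X e)"
proof -
  have [simp]: "tval (fob F) t \<in> Obj P" "tval (fob G) t \<in> Obj P" if "set_tree t \<subseteq> Obj (base X)" for t
    using that premodelD(1)[OF F] premodelD(1)[OF G] by (auto intro: tval_Obj)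
  have [simp]: "tmap \<theta> t \<in> Arr P" "Src P (tmap \<theta> t) = tval (fob F) t" "Tgt P (tmap \<theta> t) = tval (fob G) t"
    if "set_tree t \<subseteq> Obj (base X)" for t
    using tmap_typed[OF _ that, of \<theta> "fob F" "fob G"] morD[OF \<theta>] by auto
  note ty = eval_typed[OF X F] eval_typed[OF X G] wt_Obj[OF X]
  show ?thesis using e
  proof (induction e)
    case (ESum d e) then show ?case using ty by (simp add: interchange)
  next
    case (ECmp d e)
    have "tmap \<theta> (etgt X d) \<cdot> (eval F d \<cdot> eval F e) = eval G d \<cdot> (tmap \<theta> (esrc X d) \<cdot> eval F e)"
      using ECmp ty[of d] ty[of e] by (subst Cmp_reassoc[OF ECmp.IH(1)]) (auto simp: Cmp_assoc)
    also have "\<dots> = (eval G d \<cdot> eval G e) \<cdot> tmap \<theta> (esrc X e)"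
      using ECmp ty[of d] ty[of e] by (simp add: Cmp_assoc)
    finally show ?case by simp
  next
    case (EAssocInv r s t)
    have "assoc P (tval (fob G) r) (tval (fob G) s) (tval (fob G) t) \<cdot> ((tmap \<theta> r [+] tmap \<theta> s) [+] tmap \<theta> t)
      = (tmap \<theta> r [+] (tmap \<theta> s [+] tmap \<theta> t)) \<cdot> assoc P (tval (fob F) r) (tval (fob F) s) (tval (fob F) t)"
      using EAssocInv by (subst assoc_nat) auto
    then have "inv_arr P (assoc P (tval (fob G) r) (tval (fob G) s) (tval (fob G) t)) \<cdot>
       (((tmap \<theta> r [+] (tmap \<theta> s [+] tmap \<theta> t)) \<cdot> assoc P (tval (fob F) r) (tval (fob F) s) (tval (fob F) t)) \<cdot>
        inv_arr P (assoc P (tval (fob F) r) (tval (fob F) s) (tval (fob F) t))) =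
      inv_arr P (assoc P (tval (fob G) r) (tval (fob G) s) (tval (fob G) t)) \<cdot>
      ((assoc P (tval (fob G) r) (tval (fob G) s) (tval (fob G) t) \<cdot> ((tmap \<theta> r [+] tmap \<theta> s) [+] tmap \<theta> t)) \<cdot>
        inv_arr P (assoc P (tval (fob F) r) (tval (fob F) s) (tval (fob F) t)))"
      by simp
    then show ?case using EAssocInv by (simp add: Cmp_assoc)
  qed (auto simp: morD[OF \<theta>] assoc_nat symm_nat)
qed

end

section \<open>Sums of models\<close>

context sym_gpd
begin

lemma fob_psum [simp]: "fob (psum X F G) a = fob F a \<boxplus> fob G a"
  and far_psum [simp]: "far (psum X F G) f = far F f [+] far G f"
  and lb_psum: "lb (psum X F G) t = (lb F t [+] lb G t) \<cdot>
    coas P (fob F (lz X t)) (fob G (lz X t)) (fob F (lx X t)) (fob G (lx X t))"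
  by (simp_all add: psum_def)

lemma premodel_psum:
  assumes X: "wf_pres X" and F: "premodel X F" and G: "premodel X G"
  shows "premodel X (psum X F G)"
proof -
  note [simp] = wf_presD(2-4)[OF X] premodelD[OF F] premodelD[OF G]
    cat_axioms.Src_Obj[OF wf_presD(1)[OF X]] cat_axioms.Tgt_Obj[OF wf_presD(1)[OF X]]
  have "is_functor (base X) P (psum X F G)"
    using X category by (simp add: is_functor_def wf_pres_def interchange[symmetric])
  then show ?thesis
    by (simp add: premodel_def lb_psum)
qed

text \<open>The canonical isomorphism that separates the two summands throughout a bracketed word,
  obtained by iterating \<open>coas\<close>. A pointwise sum respects bracketed words only up to
  this isomorphism.\<close>

primrec shuffle :: "('o \<Rightarrow> 'p) \<Rightarrow> ('o \<Rightarrow> 'p) \<Rightarrow> 'o tree \<Rightarrow> 'q" where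
  "shuffle \<phi> \<psi> (Leaf a) = Idn P (\<phi> a \<boxplus> \<psi> a)"
| "shuffle \<phi> \<psi> (Node s t) = coas P (tval \<phi> s) (tval \<psi> s) (tval \<phi> t) (tval \<psi> t) \<cdot> (shuffle \<phi> \<psi> s [+] shuffle \<phi> \<psi> t)"

lemma shuffle_typed:
  assumes "\<And>a. a \<in> Obj C \<Longrightarrow> \<phi> a \<in> Obj P" "\<And>a. a \<in> Obj C \<Longrightarrow> \<psi> a \<in> Obj P" "set_tree t \<subseteq> Obj C"
  shows "shuffle \<phi> \<psi> t \<in> Hom P (tval (\<lambda>a. \<phi> a \<boxplus> \<psi> a) t) (tval \<phi> t \<boxplus> tval \<psi> t)"
  using assms(3)
proof (induction t)
  case (Node s t)
  then have "tval \<phi> s \<in> Obj P" "tval \<psi> s \<in> Obj P" "tval \<phi> t \<in> Obj P" "tval \<psi> t \<in> Obj P"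
    using tval_Obj[of C \<phi>] tval_Obj[of C \<psi>] assms(1,2) by auto
  then show ?case using Node by simp
qed (use assms in auto)

text \<open>\<open>assoc_coas_coas\<close> at the values of the three subtrees; the shuffles of the
  subtrees are moved across by naturality of \<open>assoc\<close>.\<close>

lemma shuffle_assoc:
  assumes "\<And>a. a \<in> Obj C \<Longrightarrow> \<phi> a \<in> Obj P" "\<And>a. a \<in> Obj C \<Longrightarrow> \<psi> a \<in> Obj P"
    and "set_tree r \<union> set_tree s \<union> set_tree t \<subseteq> Obj C"
  defines "S \<equiv> tval (\<lambda>a. \<phi> a \<boxplus> \<psi> a)"
  shows "shuffle \<phi> \<psi> (Node r (Node s t)) \<cdot> assoc P (S r) (S s) (S t) =
    (assoc P (tval \<phi> r) (tval \<phi> s) (tval \<phi> t) [+] assoc P (tval \<psi> r) (tval \<psi> s) (tval \<psi> t)) \<cdot>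
    shuffle \<phi> \<psi> (Node (Node r s) t)"
proof -
  have [simp]: "tval \<phi> u \<in> Obj P" "tval \<psi> u \<in> Obj P" "S u \<in> Obj P" if "u \<in> {r, s, t}" for u
    using that assms tval_Obj[of C \<phi> u] tval_Obj[of C \<psi> u] tval_Obj[of C "\<lambda>a. \<phi> a \<boxplus> \<psi> a" u] by auto
  have [simp]: "shuffle \<phi> \<psi> u \<in> Arr P" "Src P (shuffle \<phi> \<psi> u) = S u" "Tgt P (shuffle \<phi> \<psi> u) = tval \<phi> u \<boxplus> tval \<psi> u"
    if "u \<in> {r, s, t}" for u
    using that shuffle_typed[of C \<phi> \<psi> u] assms by auto
  let ?f = "tval \<phi>" and ?g = "tval \<psi>" and ?s = "shuffle \<phi> \<psi>"
  have "shuffle \<phi> \<psi> (Node r (Node s t)) \<cdot> assoc P (S r) (S s) (S t) =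
    coas P (?f r) (?g r) (?f s \<boxplus> ?f t) (?g s \<boxplus> ?g t) \<cdot>
    ((Idn P (?f r \<boxplus> ?g r) [+] coas P (?f s) (?g s) (?f t) (?g t)) \<cdot> ((?s r [+] (?s s [+] ?s t)) \<cdot> assoc P (S r) (S s) (S t)))"
    by (simp add: Cmp_reassoc[OF interchange] Cmp_assoc)
  also have "(?s r [+] (?s s [+] ?s t)) \<cdot> assoc P (S r) (S s) (S t) =
    assoc P (?f r \<boxplus> ?g r) (?f s \<boxplus> ?g s) (?f t \<boxplus> ?g t) \<cdot> ((?s r [+] ?s s) [+] ?s t)"
    by (simp add: assoc_nat)
  also have "coas P (?f r) (?g r) (?f s \<boxplus> ?f t) (?g s \<boxplus> ?g t) \<cdot>
    ((Idn P (?f r \<boxplus> ?g r) [+] coas P (?f s) (?g s) (?f t) (?g t)) \<cdot> (assoc P (?f r \<boxplus> ?g r) (?f s \<boxplus> ?g s) (?f t \<boxplus> ?g t) \<cdot> ((?s r [+] ?s s) [+] ?s t)))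
   = (coas P (?f r) (?g r) (?f s \<boxplus> ?f t) (?g s \<boxplus> ?g t) \<cdot>
    ((Idn P (?f r \<boxplus> ?g r) [+] coas P (?f s) (?g s) (?f t) (?g t)) \<cdot> assoc P (?f r \<boxplus> ?g r) (?f s \<boxplus> ?g s) (?f t \<boxplus> ?g t))) \<cdot> ((?s r [+] ?s s) [+] ?s t)"
    by (simp add: Cmp_assoc)
  also have "\<dots> = (assoc P (?f r) (?f s) (?f t) [+] assoc P (?g r) (?g s) (?g t)) \<cdot>
      (coas P (?f r \<boxplus> ?f s) (?g r \<boxplus> ?g s) (?f t) (?g t) \<cdot>
      ((coas P (?f r) (?g r) (?f s) (?g s) [+] Idn P (?f t \<boxplus> ?g t)) \<cdot> ((?s r [+] ?s s) [+] ?s t)))"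
    by (simp add: assoc_coas_coas[symmetric] Cmp_assoc)
  also have "\<dots> = (assoc P (?f r) (?f s) (?f t) [+] assoc P (?g r) (?g s) (?g t)) \<cdot> shuffle \<phi> \<psi> (Node (Node r s) t)"
    by (simp add: interchange)
  finally show ?thesis .
qed

text \<open>Each constructor uses one law of \<open>coas\<close>: naturality for sums,
  \<open>assoc_coas_coas\<close> for associators, \<open>symm_coas\<close> for symmetries. The label
  case is how \<open>psum\<close> was defined.\<close>

lemma shuffle_eval:
  assumes X: "wf_pres X" and F: "premodel X F" and G: "premodel X G" and e: "wt X e"
  shows "shuffle (fob F) (fob G) (etgt X e) \<cdot> eval (psum X F G) e =
    (eval F e [+] eval G e) \<cdot> shuffle (fob F) (fob G) (esrc X e)"
proof -
  let ?S = "tval (\<lambda>a. fob F a \<boxplus> fob G a)" and ?s = "shuffle (fob F) (fob G)"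
  note FG = premodel_psum[OF X F G]
  have fobs: "fob (psum X F G) = (\<lambda>a. fob F a \<boxplus> fob G a)"
    by (rule ext) simp
  have O: "a \<in> Obj (base X) \<Longrightarrow> fob F a \<in> Obj P" "a \<in> Obj (base X) \<Longrightarrow> fob G a \<in> Obj P" for a
    using premodelD(1)[OF F] premodelD(1)[OF G] by auto
  have [simp]: "tval (fob F) t \<in> Obj P" "tval (fob G) t \<in> Obj P" "?S t \<in> Obj P" if "set_tree t \<subseteq> Obj (base X)" for t
    using that O by (auto intro!: tval_Obj[where C = "base X"])
  have [simp]: "?s t \<in> Arr P" "Src P (?s t) = ?S t" "Tgt P (?s t) = tval (fob F) t \<boxplus> tval (fob G) t"
    if "set_tree t \<subseteq> Obj (base X)" for t
    using shuffle_typed[OF O that] by simp_all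
  note [simp] = wt_Obj[OF X]
  note ty = eval_typed[OF X F] eval_typed[OF X G] eval_typed[OF X FG]
  note [simp] = O wf_presD(2-4)[OF X] premodelD[OF F] premodelD[OF G]
    cat_axioms.Src_Obj[OF wf_presD(1)[OF X]] cat_axioms.Tgt_Obj[OF wf_presD(1)[OF X]]
  show ?thesis using e
  proof (induction e)
    case (ELab t)
    then show ?case by (simp add: lb_psum)
  next
    case (ESum d e)
    then show ?case
      using ty[of d] ty[of e]
      by (simp add: Cmp_assoc interchange fobs coas_nat Cmp_reassoc[OF coas_nat])
        (simp add: Cmp_reassoc[OF coas_nat] interchange[symmetric] Cmp_assoc)
  next
    case (ECmp d e)
    have "?s (etgt X d) \<cdot> (eval (psum X F G) d \<cdot> eval (psum X F G) e) =
      (eval F d [+] eval G d) \<cdot> (?s (esrc X d) \<cdot> eval (psum X F G) e)"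
      using ECmp ty[of d] ty[of e] by (subst Cmp_reassoc[OF ECmp.IH(1)]) (auto simp: Cmp_assoc fobs)
    also have "\<dots> = ((eval F d \<cdot> eval F e) [+] (eval G d \<cdot> eval G e)) \<cdot> ?s (esrc X e)"
      using ECmp ty[of d] ty[of e] by (simp add: Cmp_reassoc[OF interchange])
    finally show ?case by simp
  next
    case (EAssoc r s t)
    then show ?case
      using shuffle_assoc[of "base X" "fob F" "fob G" r s t] by (simp add: fobs)
  next
    case (EAssocInv r s t)
    let ?A = "assoc P (?S r) (?S s) (?S t)"
    let ?B = "assoc P (tval (fob F) r) (tval (fob F) s) (tval (fob F) t) [+] assoc P (tval (fob G) r) (tval (fob G) s) (tval (fob G) t)"
    have "inv_arr P ?B \<cdot> ((?s (Node r (Node s t)) \<cdot> ?A) \<cdot> inv_arr P ?A) = inv_arr P ?B \<cdot> ((?B \<cdot> ?s (Node (Node r s) t)) \<cdot> inv_arr P ?A)"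
      using shuffle_assoc[of "base X" "fob F" "fob G" r s t] EAssocInv by simp
    then have "inv_arr P ?B \<cdot> ?s (Node r (Node s t)) = ?s (Node (Node r s) t) \<cdot> inv_arr P ?A"
      using EAssocInv by (simp add: Cmp_assoc del: shuffle.simps)
    then show ?case
      using EAssocInv by (simp add: fobs inv_asum)
  next
    case (ESymm s t)
    then have "?s (Node t s) \<cdot> symm P (?S s) (?S t) =
        coas P (tval (fob F) t) (tval (fob G) t) (tval (fob F) s) (tval (fob G) s) \<cdot>
        (symm P (tval (fob F) s \<boxplus> tval (fob G) s) (tval (fob F) t \<boxplus> tval (fob G) t) \<cdot> (?s s [+] ?s t))"
      by (simp add: Cmp_assoc symm_nat)
    also have "\<dots> = (symm P (tval (fob F) s) (tval (fob F) t) [+] symm P (tval (fob G) s) (tval (fob G) t)) \<cdot> ?s (Node s t)"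
      using ESymm by (simp add: Cmp_reassoc[OF symm_coas[symmetric]] Cmp_assoc)
    finally show ?case by (simp add: fobs)
  qed (auto simp: fobs)
qed

text \<open>Both sides of a relation have the same ends, hence the same shuffles there. These are
  invertible, so a relation valid in both summands is valid in the sum.\<close>

lemma is_model_psum:
  assumes X: "wf_pres X" and F: "is_model X F" and G: "is_model X G"
  shows "is_model X (psum X F G)"
proof -
  note pF = is_modelD[OF F] and pG = is_modelD[OF G]
  note FG = premodel_psum[OF X pF pG]
  have O: "a \<in> Obj (base X) \<Longrightarrow> fob F a \<in> Obj P" "a \<in> Obj (base X) \<Longrightarrow> fob G a \<in> Obj P" for a
    using premodelD(1)[OF pF] premodelD(1)[OF pG] by auto
  have "eval (psum X F G) d = eval (psum X F G) e" if de: "(d, e) \<in> rels X" for d e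
  proof -
    note de' = wf_presD(5-8)[OF X de]
    have fobs: "fob (psum X F G) = (\<lambda>a. fob F a \<boxplus> fob G a)"
      by (rule ext) simp
    have "shuffle (fob F) (fob G) (etgt X d) \<cdot> eval (psum X F G) d =
        shuffle (fob F) (fob G) (etgt X d) \<cdot> eval (psum X F G) e"
      using shuffle_eval[OF X pF pG de'(1)] shuffle_eval[OF X pF pG de'(2)] de'(3,4)
        is_model_rels[OF F de] is_model_rels[OF G de] by simp
    then show ?thesis
      by (rule Cmp_cancel_left)
        (use eval_typed[OF X FG de'(1)] eval_typed[OF X FG de'(2)] de'(3,4)
          shuffle_typed[OF O wt_Obj(2)[OF X de'(1)]] in \<open>simp_all add: fobs\<close>)
  qed
  with FG show ?thesis by (auto simp: is_model_def)
qed

end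

text \<open>The label \<open>t\<close> need not go to a label over the image of its middle term: it goes to the label \<open>ql t\<close>
  followed by the arrow \<open>qm t\<close>, as \<open>\<Delta> : x \<rightarrow> y \<rightarrow> z\<close> goes to the pair \<open>(det z, det x)\<close> and \<open>det \<Delta>\<close>.\<close>

record ('o, 'm, 't, 'v, 'w, 's) pmap = "('o, 'm, 'v, 'w) funct" +
  qm :: "'t \<Rightarrow> 'w"
  ql :: "'t \<Rightarrow> 's"

definition wf_pmap :: "('o, 'm, 't) pres \<Rightarrow> ('v, 'w, 's) pres \<Rightarrow> ('o, 'm, 't, 'v, 'w, 's) pmap \<Rightarrow> bool" where
  "wf_pmap X Y q \<longleftrightarrow> is_functor (base X) (base Y) q \<and>
    (\<forall>t\<in>lab X. ql q t \<in> lab Y \<and> lz Y (ql q t) = fob q (lz X t) \<and> lx Y (ql q t) = fob q (lx X t) \<and>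
      qm q t \<in> Hom (base Y) (ly Y (ql q t)) (fob q (ly X t)))"

section \<open>Models in two variables\<close>

text \<open>Curried in the first variable: a model \<open>cD r\<close> for every object, and morphisms of models \<open>cA g\<close> and
  \<open>cL u\<close> for every arrow and label.\<close>

record ('r, 'g, 'u, 'o, 'm, 't, 'p, 'q) bidata =
  cD :: "'r \<Rightarrow> ('o, 'm, 't, 'p, 'q) model"
  cA :: "'g \<Rightarrow> 'o \<Rightarrow> 'q"
  cL :: "'u \<Rightarrow> 'o \<Rightarrow> 'q"

definition csl :: "('r, 'g, 'u, 'o, 'm, 't, 'p, 'q) bidata \<Rightarrow> 'o \<Rightarrow> ('r, 'g, 'u, 'p, 'q) model" where
  "csl B s = \<lparr>fob = (\<lambda>r. fob (cD B r) s), far = (\<lambda>g. cA B g s), lb = (\<lambda>u. cL B u s)\<rparr>"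

definition bswap :: "('r, 'g, 'u, 'o, 'm, 't, 'p, 'q) bidata \<Rightarrow> ('o, 'm, 't, 'r, 'g, 'u, 'p, 'q) bidata" where
  "bswap B = \<lparr>cD = csl B, cA = (\<lambda>f r. far (cD B r) f), cL = (\<lambda>t r. lb (cD B r) t)\<rparr>"

lemma csl_simps [simp]: "fob (csl B s) r = fob (cD B r) s" "far (csl B s) g = cA B g s" "lb (csl B s) u = cL B u s"
  by (simp_all add: csl_def)

lemma cD_bswap [simp]: "cD (bswap B) = csl B"
  and cA_bswap [simp]: "cA (bswap B) f = (\<lambda>r. far (cD B r) f)"
  and cL_bswap [simp]: "cL (bswap B) t = (\<lambda>r. lb (cD B r) t)"
  and csl_bswap [simp]: "csl (bswap B) r = cD B r"
  by (simp_all add: bswap_def csl_def)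

section \<open>Equality of models and morphisms between sums of models\<close>

context sym_gpd
begin

text \<open>Agreement on the data of the presentation. Constructed models coincide only in this
  sense, as the HOL functions that carry them are total.\<close>

definition meq :: "('o, 'm, 't) pres \<Rightarrow> ('o, 'm, 't, 'p, 'q) model \<Rightarrow> ('o, 'm, 't, 'p, 'q) model \<Rightarrow> bool" where
  "meq X F G \<longleftrightarrow> (\<forall>a\<in>Obj (base X). fob F a = fob G a) \<and> (\<forall>f\<in>Arr (base X). far F f = far G f) \<and>
    (\<forall>t\<in>lab X. lb F t = lb G t)"

lemma tval_cong: "(\<And>a. a \<in> set_tree t \<Longrightarrow> \<phi> a = \<psi> a) \<Longrightarrow> tval \<phi> t = tval \<psi> t"
  by (induction t) auto

lemma eval_cong:
  assumes "meq X F G" "wt X e"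
  shows "eval F e = eval G e"
proof -
  have *: "tval (fob F) t = tval (fob G) t" if "set_tree t \<subseteq> Obj (base X)" for t
    by (rule tval_cong) (use assms(1) that in \<open>auto simp: meq_def\<close>)
  show ?thesis
    using assms(2) by (induction e) (use assms(1) in \<open>auto simp: meq_def *\<close>)
qed

lemma premodel_cong:
  assumes X: "wf_pres X" and "meq X F G" "premodel X F"
  shows "premodel X G"
  using assms wf_presD(2-4)[OF X] cat_axioms.Src_Obj[OF wf_presD(1)[OF X]] cat_axioms.Tgt_Obj[OF wf_presD(1)[OF X]]
    cat_axioms.Idn_Arr[OF wf_presD(1)[OF X]] cat_axioms.Cmp_Arr[OF wf_presD(1)[OF X]]
  by (auto simp: meq_def premodel_def is_functor_def)

lemma is_model_cong:
  assumes X: "wf_pres X" and FG: "meq X F G" and F: "is_model X F"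
  shows "is_model X G"
proof -
  have "eval G d = eval G e" if de: "(d, e) \<in> rels X" for d e
    using eval_cong[OF FG wf_presD(5)[OF X de]] eval_cong[OF FG wf_presD(6)[OF X de]] is_model_rels[OF F de] by simp
  with premodel_cong[OF X FG is_modelD[OF F]] show ?thesis
    by (auto simp: is_model_def)
qed

lemma mor_cong:
  assumes X: "wf_pres X" and "meq X F F'" "meq X G G'" "\<And>a. a \<in> Obj (base X) \<Longrightarrow> \<theta> a = \<theta>' a" "mor X F G \<theta>"
  shows "mor X F' G' \<theta>'"
  using assms wf_presD(2-4)[OF X] cat_axioms.Src_Obj[OF wf_presD(1)[OF X]] cat_axioms.Tgt_Obj[OF wf_presD(1)[OF X]]
  by (auto simp: meq_def mor_def)

lemma meq_refl [simp]: "meq X F F"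
  by (simp add: meq_def)

lemma meq_sym: "meq X F G \<Longrightarrow> meq X G F"
  by (simp add: meq_def)

lemma psum_cong: "\<lbrakk>wf_pres X; meq X F F'; meq X G G'\<rbrakk> \<Longrightarrow> meq X (psum X F G) (psum X F' G')"
  by (simp add: meq_def lb_psum wf_presD(2-4))

context
  fixes X :: "('o, 'm, 't) pres"
  assumes X: "wf_pres X"
begin

lemmas X_simps = wf_presD(2-4)[OF X] cat_axioms.Src_Obj[OF wf_presD(1)[OF X]] cat_axioms.Tgt_Obj[OF wf_presD(1)[OF X]]

lemma mor_id: "premodel X F \<Longrightarrow> mor X F F (\<lambda>a. Idn P (fob F a))"
  by (simp add: mor_def premodelD X_simps)

lemma mor_comp:
  assumes F: "premodel X F" and G: "premodel X G" and H: "premodel X H" and \<theta>: "mor X F G \<theta>" and \<eta>: "mor X G H \<eta>"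
  shows "mor X F H (\<lambda>a. \<eta> a \<cdot> \<theta> a)"
proof -
  note [simp] = premodelD[OF F] premodelD[OF G] premodelD[OF H] morD(1-3)[OF \<theta>] morD(1-3)[OF \<eta>] X_simps
  show ?thesis
    by (simp add: mor_def Cmp_assoc Cmp_reassoc[OF morD(4)[OF \<eta>]] Cmp_reassoc[OF morD(5)[OF \<eta>]]
      morD(4,5)[OF \<theta>] interchange)
qed

lemma mor_inv:
  assumes F: "premodel X F" and G: "premodel X G" and \<theta>: "mor X F G \<theta>"
  shows "mor X G F (\<lambda>a. inv_arr P (\<theta> a))"
proof -
  note [simp] = premodelD[OF F] premodelD[OF G] morD(1-3)[OF \<theta>] X_simps
  have "far F f \<cdot> inv_arr P (\<theta> (Src (base X) f)) = inv_arr P (\<theta> (Tgt (base X) f)) \<cdot> far G f" if "f \<in> Arr (base X)" for f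
  proof -
    have "inv_arr P (\<theta> (Tgt (base X) f)) \<cdot> ((far G f \<cdot> \<theta> (Src (base X) f)) \<cdot> inv_arr P (\<theta> (Src (base X) f)))
      = inv_arr P (\<theta> (Tgt (base X) f)) \<cdot> ((\<theta> (Tgt (base X) f) \<cdot> far F f) \<cdot> inv_arr P (\<theta> (Src (base X) f)))"
      using that by (simp add: morD(4)[OF \<theta>])
    then show ?thesis using that by (simp add: Cmp_assoc)
  qed
  moreover have "inv_arr P (\<theta> (ly X t)) \<cdot> lb G t = lb F t \<cdot> (inv_arr P (\<theta> (lz X t)) [+] inv_arr P (\<theta> (lx X t)))"
    if "t \<in> lab X" for t
  proof -
    have "inv_arr P (\<theta> (ly X t)) \<cdot> ((\<theta> (ly X t) \<cdot> lb F t) \<cdot> inv_arr P (\<theta> (lz X t) [+] \<theta> (lx X t)))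
      = inv_arr P (\<theta> (ly X t)) \<cdot> ((lb G t \<cdot> (\<theta> (lz X t) [+] \<theta> (lx X t))) \<cdot> inv_arr P (\<theta> (lz X t) [+] \<theta> (lx X t)))"
      using that by (simp add: morD(5)[OF \<theta>])
    then show ?thesis using that by (simp add: Cmp_assoc inv_asum interchange)
  qed
  ultimately show ?thesis by (simp add: mor_def)
qed

lemma mor_psum:
  assumes F: "premodel X F" and G: "premodel X G" and F': "premodel X F'" and G': "premodel X G'"
    and \<theta>: "mor X F G \<theta>" and \<eta>: "mor X F' G' \<eta>"
  shows "mor X (psum X F F') (psum X G G') (\<lambda>a. \<theta> a [+] \<eta> a)"
proof -
  note [simp] = premodelD[OF F] premodelD[OF G] premodelD[OF F'] premodelD[OF G'] morD(1-3)[OF \<theta>] morD(1-3)[OF \<eta>] X_simps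
  show ?thesis
    by (simp add: mor_def Cmp_assoc morD(4,5)[OF \<theta>] morD(4,5)[OF \<eta>] interchange lb_psum coas_nat Cmp_reassoc[OF interchange])
qed

lemma mor_symm:
  assumes F: "premodel X F" and G: "premodel X G"
  shows "mor X (psum X F G) (psum X G F) (\<lambda>a. symm P (fob F a) (fob G a))"
proof -
  note [simp] = premodelD[OF F] premodelD[OF G] X_simps
  \<comment> \<open>\<open>symm_coas\<close> with \<open>coas\<close> moved to the other sides; the
    labels of a sum carry \<open>coas\<close> on their right.\<close>
  have *: "symm P (a \<boxplus> b) (c \<boxplus> d) \<cdot> coas P a c b d = coas P c a d b \<cdot> (symm P a c [+] symm P b d)"
    if [simp]: "a \<in> Obj P" "b \<in> Obj P" "c \<in> Obj P" "d \<in> Obj P" for a b c d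
  proof -
    have "coas P c a d b \<cdot> (((symm P a c [+] symm P b d) \<cdot> coas P a b c d) \<cdot> coas P a c b d) =
      coas P c a d b \<cdot> ((coas P c d a b \<cdot> symm P (a \<boxplus> b) (c \<boxplus> d)) \<cdot> coas P a c b d)"
      by (simp add: symm_coas)
    then show ?thesis by (simp add: Cmp_assoc Cmp_reassoc[OF coas_coas])
  qed
  show ?thesis
    by (simp add: mor_def symm_nat lb_psum Cmp_reassoc[OF symm_nat] Cmp_assoc *)
qed

lemma mor_assoc:
  assumes F: "premodel X F" and G: "premodel X G" and H: "premodel X H"
  shows "mor X (psum X (psum X F G) H) (psum X F (psum X G H)) (\<lambda>a. assoc P (fob F a) (fob G a) (fob H a))"
proof -
  note [simp] = premodelD[OF F] premodelD[OF G] premodelD[OF H] X_simps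
  \<comment> \<open>\<open>assoc_coas_coas\<close> with every \<open>coas\<close> inverted, which is
    the shape in which labels of iterated sums contain them.\<close>
  have *: "assoc P (a \<boxplus> b) (c \<boxplus> d) (e \<boxplus> f) \<cdot> ((coas P a c b d [+] Idn P (e \<boxplus> f)) \<cdot> coas P (a \<boxplus> c) e (b \<boxplus> d) f)
     = (Idn P (a \<boxplus> b) [+] coas P c e d f) \<cdot> (coas P a (c \<boxplus> e) b (d \<boxplus> f) \<cdot> (assoc P a c e [+] assoc P b d f))"
    if [simp]: "a \<in> Obj P" "b \<in> Obj P" "c \<in> Obj P" "d \<in> Obj P" "e \<in> Obj P" "f \<in> Obj P" for a b c d e f
  proof -
    let ?R = "(coas P a c b d [+] Idn P (e \<boxplus> f)) \<cdot> coas P (a \<boxplus> c) e (b \<boxplus> d) f"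
    let ?L = "(Idn P (a \<boxplus> b) [+] coas P c e d f) \<cdot> coas P a (c \<boxplus> e) b (d \<boxplus> f)"
    have "?L \<cdot> (((assoc P a c e [+] assoc P b d f) \<cdot> (coas P (a \<boxplus> c) (b \<boxplus> d) e f \<cdot> (coas P a b c d [+] Idn P (e \<boxplus> f)))) \<cdot> ?R)
      = ?L \<cdot> ((coas P a b (c \<boxplus> e) (d \<boxplus> f) \<cdot> ((Idn P (a \<boxplus> b) [+] coas P c d e f) \<cdot> assoc P (a \<boxplus> b) (c \<boxplus> d) (e \<boxplus> f))) \<cdot> ?R)"
      by (simp add: assoc_coas_coas)
    then show ?thesis
      by (simp add: Cmp_assoc Cmp_reassoc[OF coas_coas] Cmp_reassoc[OF interchange])
  qed
  have "assoc P (fob F (ly X t)) (fob G (ly X t)) (fob H (ly X t)) \<cdot> lb (psum X (psum X F G) H) t =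
    lb (psum X F (psum X G H)) t \<cdot> (assoc P (fob F (lz X t)) (fob G (lz X t)) (fob H (lz X t)) [+]
      assoc P (fob F (lx X t)) (fob G (lx X t)) (fob H (lx X t)))" if t: "t \<in> lab X" for t
  proof -
    let ?a = "fob F (lz X t)" and ?b = "fob F (lx X t)" and ?c = "fob G (lz X t)" and ?d = "fob G (lx X t)"
      and ?e = "fob H (lz X t)" and ?f = "fob H (lx X t)"
    have "assoc P (fob F (ly X t)) (fob G (ly X t)) (fob H (ly X t)) \<cdot> lb (psum X (psum X F G) H) t =
      assoc P (fob F (ly X t)) (fob G (ly X t)) (fob H (ly X t)) \<cdot> (((lb F t [+] lb G t) [+] lb H t) \<cdot>
       ((coas P ?a ?c ?b ?d [+] Idn P (?e \<boxplus> ?f)) \<cdot> coas P (?a \<boxplus> ?c) ?e (?b \<boxplus> ?d) ?f))"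
      using t by (simp add: lb_psum Cmp_reassoc[OF interchange])
    also have "\<dots> = (lb F t [+] (lb G t [+] lb H t)) \<cdot> (assoc P (?a \<boxplus> ?b) (?c \<boxplus> ?d) (?e \<boxplus> ?f) \<cdot>
       ((coas P ?a ?c ?b ?d [+] Idn P (?e \<boxplus> ?f)) \<cdot> coas P (?a \<boxplus> ?c) ?e (?b \<boxplus> ?d) ?f))"
      using t by (simp add: Cmp_reassoc[OF assoc_nat] Cmp_assoc)
    also have "\<dots> = (lb F t [+] (lb G t [+] lb H t)) \<cdot> ((Idn P (?a \<boxplus> ?b) [+] coas P ?c ?e ?d ?f) \<cdot>
       (coas P ?a (?c \<boxplus> ?e) ?b (?d \<boxplus> ?f) \<cdot> (assoc P ?a ?c ?e [+] assoc P ?b ?d ?f)))"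
      using t by (simp add: *)
    also have "\<dots> = lb (psum X F (psum X G H)) t \<cdot> (assoc P ?a ?c ?e [+] assoc P ?b ?d ?f)"
      using t by (simp add: lb_psum Cmp_reassoc[OF interchange] Cmp_assoc)
    finally show ?thesis .
  qed
  then show ?thesis
    by (simp add: mor_def assoc_nat)
qed

end

end

section \<open>Pulling models back; models in two variables\<close>

context sym_gpd
begin

definition pull :: "('o, 'm, 't, 'v, 'w, 's) pmap \<Rightarrow> ('v, 'w, 's, 'p, 'q) model \<Rightarrow> ('o, 'm, 't, 'p, 'q) model" where
  "pull q F = \<lparr>fob = (\<lambda>a. fob F (fob q a)), far = (\<lambda>f. far F (far q f)), lb = (\<lambda>t. far F (qm q t) \<cdot> lb F (ql q t))\<rparr>"

lemma pull_simps [simp]: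
  "fob (pull q F) a = fob F (fob q a)" "far (pull q F) f = far F (far q f)" "lb (pull q F) t = far F (qm q t) \<cdot> lb F (ql q t)"
  by (simp_all add: pull_def)

lemma wf_pmapD:
  assumes "wf_pmap X Y q"
  shows "a \<in> Obj (base X) \<Longrightarrow> fob q a \<in> Obj (base Y)"
    and "f \<in> Arr (base X) \<Longrightarrow> far q f \<in> Arr (base Y)"
    and "f \<in> Arr (base X) \<Longrightarrow> Src (base Y) (far q f) = fob q (Src (base X) f)"
    and "f \<in> Arr (base X) \<Longrightarrow> Tgt (base Y) (far q f) = fob q (Tgt (base X) f)"
    and "a \<in> Obj (base X) \<Longrightarrow> far q (Idn (base X) a) = Idn (base Y) (fob q a)"
    and "\<lbrakk>f \<in> Arr (base X); g \<in> Arr (base X); Src (base X) g = Tgt (base X) f\<rbrakk> \<Longrightarrow>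
      far q (Cmp (base X) g f) = Cmp (base Y) (far q g) (far q f)"
    and "t \<in> lab X \<Longrightarrow> ql q t \<in> lab Y"
    and "t \<in> lab X \<Longrightarrow> lz Y (ql q t) = fob q (lz X t)"
    and "t \<in> lab X \<Longrightarrow> lx Y (ql q t) = fob q (lx X t)"
    and "t \<in> lab X \<Longrightarrow> qm q t \<in> Arr (base Y)"
    and "t \<in> lab X \<Longrightarrow> Src (base Y) (qm q t) = ly Y (ql q t)"
    and "t \<in> lab X \<Longrightarrow> Tgt (base Y) (qm q t) = fob q (ly X t)"
  using assms by (auto simp: wf_pmap_def is_functor_def)

lemma premodel_pull:
  assumes X: "wf_pres X" and Y: "wf_pres Y" and q: "wf_pmap X Y q" and F: "premodel Y F"
  shows "premodel X (pull q F)"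
  using assms category
  by (simp add: premodel_def[of X] is_functor_def[of "base X"] wf_pmapD[OF q] premodelD[OF F] X_simps[OF X] X_simps[OF Y] wf_pres_def[of X])

lemma mor_pull:
  assumes X: "wf_pres X" and Y: "wf_pres Y" and q: "wf_pmap X Y q" and F: "premodel Y F" and G: "premodel Y G"
    and \<theta>: "mor Y F G \<theta>"
  shows "mor X (pull q F) (pull q G) (\<lambda>a. \<theta> (fob q a))"
proof -
  note [simp] = wf_pmapD[OF q] premodelD[OF F] premodelD[OF G] X_simps[OF X] X_simps[OF Y] morD(1-3)[OF \<theta>]
  have "\<theta> (fob q (ly X t)) \<cdot> (far F (qm q t) \<cdot> lb F (ql q t)) =
      (far G (qm q t) \<cdot> lb G (ql q t)) \<cdot> (\<theta> (fob q (lz X t)) [+] \<theta> (fob q (lx X t)))" if "t \<in> lab X" for t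
  proof -
    have "\<theta> (fob q (ly X t)) \<cdot> (far F (qm q t) \<cdot> lb F (ql q t)) = far G (qm q t) \<cdot> (\<theta> (ly Y (ql q t)) \<cdot> lb F (ql q t))"
      using that morD(4)[OF \<theta>, of "qm q t"] by (subst Cmp_reassoc) (auto simp: Cmp_assoc)
    then show ?thesis using that morD(5)[OF \<theta>, of "ql q t"] by (simp add: Cmp_assoc)
  qed
  moreover have "far G (far q f) \<cdot> \<theta> (fob q (Src (base X) f)) = \<theta> (fob q (Tgt (base X) f)) \<cdot> far F (far q f)"
    if "f \<in> Arr (base X)" for f
    using that morD(4)[OF \<theta>, of "far q f"] by simp
  ultimately show ?thesis
    by (simp add: mor_def)
qed

text \<open>The agreement is strict: the ends of \<open>ql q t\<close> are the images of the ends of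
  \<open>t\<close>, so both sides use the same \<open>coas\<close>, and the arrows
  \<open>qm q t\<close> stay to the left of it.\<close>

lemma pull_psum:
  assumes X: "wf_pres X" and Y: "wf_pres Y" and q: "wf_pmap X Y q" and F: "premodel Y F" and G: "premodel Y G"
  shows "meq X (pull q (psum Y F G)) (psum X (pull q F) (pull q G))"
proof -
  note [simp] = wf_pmapD[OF q] premodelD[OF F] premodelD[OF G] X_simps[OF X] X_simps[OF Y]
  show ?thesis
    by (simp add: meq_def lb_psum interchange[symmetric] Cmp_assoc)
qed

text \<open>The statement that the induction propagates: pullback along \<open>q\<close> is
  essentially surjective, full and faithful on models in the fixed groupoid \<open>P\<close>. That
  models pull back to models is a clause of its own, because \<open>wf_pmap\<close> does not mention
  relations.\<close>

definition pequiv :: "('o, 'm, 't) pres \<Rightarrow> ('v, 'w, 's) pres \<Rightarrow> ('o, 'm, 't, 'v, 'w, 's) pmap \<Rightarrow> bool" where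
  "pequiv X Y q \<longleftrightarrow> wf_pmap X Y q \<and>
    (\<forall>F. is_model Y F \<longrightarrow> is_model X (pull q F)) \<and>
    (\<forall>D. is_model X D \<longrightarrow> (\<exists>F \<alpha>. is_model Y F \<and> mor X (pull q F) D \<alpha>)) \<and>
    (\<forall>F G \<theta>. is_model Y F \<longrightarrow> is_model Y G \<longrightarrow> mor X (pull q F) (pull q G) \<theta> \<longrightarrow>
      (\<exists>\<beta>. mor Y F G \<beta> \<and> (\<forall>a\<in>Obj (base X). \<beta> (fob q a) = \<theta> a))) \<and>
    (\<forall>F G \<beta> \<beta>'. is_model Y F \<longrightarrow> is_model Y G \<longrightarrow> mor Y F G \<beta> \<longrightarrow> mor Y F G \<beta>' \<longrightarrow>
      (\<forall>a\<in>Obj (base X). \<beta> (fob q a) = \<beta>' (fob q a)) \<longrightarrow> (\<forall>b\<in>Obj (base Y). \<beta> b = \<beta>' b))"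

lemma pequivD:
  assumes "pequiv X Y q"
  shows "wf_pmap X Y q"
    and "is_model Y F \<Longrightarrow> is_model X (pull q F)"
    and "is_model X D \<Longrightarrow> \<exists>F \<alpha>. is_model Y F \<and> mor X (pull q F) D \<alpha>"
    and "\<lbrakk>is_model Y F; is_model Y G; mor X (pull q F) (pull q G) \<theta>\<rbrakk> \<Longrightarrow>
      \<exists>\<beta>. mor Y F G \<beta> \<and> (\<forall>a\<in>Obj (base X). \<beta> (fob q a) = \<theta> a)"
    and "\<lbrakk>is_model Y F; is_model Y G; mor Y F G \<beta>; mor Y F G \<beta>';
      \<And>a. a \<in> Obj (base X) \<Longrightarrow> \<beta> (fob q a) = \<beta>' (fob q a); b \<in> Obj (base Y)\<rbrakk> \<Longrightarrow> \<beta> b = \<beta>' b"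
  using assms unfolding pequiv_def by blast+

text \<open>The relations of the second variable are imposed, those of the first are not yet: a lift
  reaches this stage before its relations in the first variable are established. The last clause
  encodes the two-triangles axiom, through the \<open>coas\<close> in the labels of
  \<open>psum\<close>.\<close>

definition prebimodel :: "('r, 'g, 'u) pres \<Rightarrow> ('o, 'm, 't) pres \<Rightarrow> ('r, 'g, 'u, 'o, 'm, 't, 'p, 'q) bidata \<Rightarrow> bool" where
  "prebimodel R S B \<longleftrightarrow>
    (\<forall>r\<in>Obj (base R). is_model S (cD B r)) \<and> (\<forall>s\<in>Obj (base S). premodel R (csl B s)) \<and>
    (\<forall>g\<in>Arr (base R). mor S (cD B (Src (base R) g)) (cD B (Tgt (base R) g)) (cA B g)) \<and>
    (\<forall>u\<in>lab R. mor S (psum S (cD B (lz R u)) (cD B (lx R u))) (cD B (ly R u)) (cL B u))"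

definition bimodel :: "('r, 'g, 'u) pres \<Rightarrow> ('o, 'm, 't) pres \<Rightarrow> ('r, 'g, 'u, 'o, 'm, 't, 'p, 'q) bidata \<Rightarrow> bool" where
  "bimodel R S B \<longleftrightarrow> prebimodel R S B \<and> (\<forall>s\<in>Obj (base S). is_model R (csl B s))"

definition bimor :: "('r, 'g, 'u) pres \<Rightarrow> ('o, 'm, 't) pres \<Rightarrow> ('r, 'g, 'u, 'o, 'm, 't, 'p, 'q) bidata \<Rightarrow>
    ('r, 'g, 'u, 'o, 'm, 't, 'p, 'q) bidata \<Rightarrow> ('r \<Rightarrow> 'o \<Rightarrow> 'q) \<Rightarrow> bool" where
  "bimor R S B B' \<theta> \<longleftrightarrow> (\<forall>r\<in>Obj (base R). mor S (cD B r) (cD B' r) (\<theta> r)) \<and>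
    (\<forall>s\<in>Obj (base S). mor R (csl B s) (csl B' s) (\<lambda>r. \<theta> r s))"

definition bpull :: "('o, 'm, 't, 'v, 'w, 's) pmap \<Rightarrow> ('r, 'g, 'u, 'v, 'w, 's, 'p, 'q) bidata \<Rightarrow>
    ('r, 'g, 'u, 'o, 'm, 't, 'p, 'q) bidata" where
  "bpull q B = \<lparr>cD = (\<lambda>r. pull q (cD B r)), cA = (\<lambda>g s. cA B g (fob q s)), cL = (\<lambda>u s. cL B u (fob q s))\<rparr>"

lemma bpull_simps [simp]: "cD (bpull q B) r = pull q (cD B r)" "csl (bpull q B) s = csl B (fob q s)"
  "cA (bpull q B) g s = cA B g (fob q s)" "cL (bpull q B) u s = cL B u (fob q s)"
  by (simp_all add: bpull_def csl_def)

lemma bimor_swap: "bimor R S B B' \<theta> \<Longrightarrow> bimor S R (bswap B) (bswap B') (\<lambda>s r. \<theta> r s)"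
  by (auto simp: bimor_def)

text \<open>The mixed conditions are symmetric: arrows against labels and labels against arrows
  trade places, while labels against labels turns into itself after composition with a
  \<open>coas\<close>, whose inverse is \<open>coas\<close> with swapped middle arguments.\<close>

lemma bimodel_swap:
  assumes R: "wf_pres R" and S: "wf_pres S" and B: "bimodel R S B"
  shows "bimodel S R (bswap B)"
proof -
  note [simp] = X_simps[OF R] X_simps[OF S]
  have cD: "is_model S (cD B r)" if "r \<in> Obj (base R)" for r
    using B that by (auto simp: bimodel_def prebimodel_def)
  have cs: "is_model R (csl B s)" if "s \<in> Obj (base S)" for s
    using B that by (auto simp: bimodel_def)
  have cA: "mor S (cD B (Src (base R) g)) (cD B (Tgt (base R) g)) (cA B g)" if "g \<in> Arr (base R)" for g
    using B that by (auto simp: bimodel_def prebimodel_def)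
  have cL: "mor S (psum S (cD B (lz R u)) (cD B (lx R u))) (cD B (ly R u)) (cL B u)" if "u \<in> lab R" for u
    using B that by (auto simp: bimodel_def prebimodel_def)
  note [simp] = premodelD[OF is_modelD[OF cD]]
  have "mor R (csl B (Src (base S) f)) (csl B (Tgt (base S) f)) (\<lambda>r. far (cD B r) f)" if "f \<in> Arr (base S)" for f
    using that by (simp add: mor_def morD(4)[OF cA] morD(4)[OF cL, simplified])
  moreover have "mor R (psum R (csl B (lz S t)) (csl B (lx S t))) (csl B (ly S t)) (\<lambda>r. lb (cD B r) t)"
    if t: "t \<in> lab S" for t
  proof -
    have "lb (cD B (ly R u)) t \<cdot> lb (psum R (csl B (lz S t)) (csl B (lx S t))) u =
        cL B u (ly S t) \<cdot> (lb (cD B (lz R u)) t [+] lb (cD B (lx R u)) t)" if u: "u \<in> lab R" for u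
    proof -
      have [simp]: "cL B u s \<in> Arr P" "Src P (cL B u s) = fob (cD B (lz R u)) s \<boxplus> fob (cD B (lx R u)) s"
        "Tgt P (cL B u s) = fob (cD B (ly R u)) s" if "s \<in> Obj (base S)" for s
        using morD(1-3)[OF cL[OF u] that] by simp_all
      let ?c = "coas P (fob (cD B (lz R u)) (lz S t)) (fob (cD B (lz R u)) (lx S t)) (fob (cD B (lx R u)) (lz S t)) (fob (cD B (lx R u)) (lx S t))"
      have "(cL B u (ly S t) \<cdot> lb (psum S (cD B (lz R u)) (cD B (lx R u))) t) \<cdot> ?c =
         (lb (cD B (ly R u)) t \<cdot> (cL B u (lz S t) [+] cL B u (lx S t))) \<cdot> ?c"
        using morD(5)[OF cL[OF u] t] by simp
      then show ?thesis using t u by (simp add: lb_psum Cmp_assoc)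
    qed
    then show ?thesis
      using t morD(5)[OF cA t] by (simp add: mor_def)
  qed
  ultimately show ?thesis
    using cD cs is_modelD[OF cD] by (auto simp: bimodel_def prebimodel_def)
qed

lemma bimodel_pull:
  assumes R: "wf_pres R" and S: "wf_pres S" and Y: "wf_pres Y" and q: "pequiv S Y q" and B: "bimodel R Y B"
  shows "bimodel R S (bpull q B)"
proof -
  note q' = pequivD(1)[OF q]
  have cD: "is_model Y (cD B r)" if "r \<in> Obj (base R)" for r
    using B that by (auto simp: bimodel_def prebimodel_def)
  have "mor S (pull q (cD B (Src (base R) g))) (pull q (cD B (Tgt (base R) g))) (\<lambda>s. cA B g (fob q s))"
    if "g \<in> Arr (base R)" for g
    using B that by (intro mor_pull[OF S Y q' is_modelD[OF cD] is_modelD[OF cD]])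
      (auto simp: bimodel_def prebimodel_def X_simps[OF R])
  moreover have "mor S (psum S (pull q (cD B (lz R u))) (pull q (cD B (lx R u)))) (pull q (cD B (ly R u))) (\<lambda>s. cL B u (fob q s))"
    if "u \<in> lab R" for u
  proof (rule mor_cong[OF S _ meq_refl refl])
    show "meq S (pull q (psum Y (cD B (lz R u)) (cD B (lx R u)))) (psum S (pull q (cD B (lz R u))) (pull q (cD B (lx R u))))"
      using that by (intro pull_psum[OF S Y q' is_modelD[OF cD] is_modelD[OF cD]]) (simp_all add: X_simps[OF R])
    show "mor S (pull q (psum Y (cD B (lz R u)) (cD B (lx R u)))) (pull q (cD B (ly R u))) (\<lambda>s. cL B u (fob q s))"
      using B that by (intro mor_pull[OF S Y q' premodel_psum[OF Y is_modelD[OF cD] is_modelD[OF cD]] is_modelD[OF cD]])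
        (auto simp: bimodel_def prebimodel_def X_simps[OF R])
  qed
  ultimately show ?thesis
    using B cD pequivD(2)[OF q] is_modelD wf_pmapD(1)[OF q']
    by (auto simp: bimodel_def prebimodel_def bpull_def csl_def)
qed

primrec tsum :: "('o, 'm, 't) pres \<Rightarrow> ('r \<Rightarrow> ('o, 'm, 't, 'p, 'q) model) \<Rightarrow> 'r tree \<Rightarrow> ('o, 'm, 't, 'p, 'q) model" where
  "tsum S D (Leaf r) = D r"
| "tsum S D (Node s t) = psum S (tsum S D s) (tsum S D t)"

lemma fob_tsum: "fob (tsum S D t) a = tval (\<lambda>r. fob (D r) a) t"
  by (induction t) auto

lemma is_model_tsum:
  "\<lbrakk>wf_pres S; \<And>r. r \<in> O' \<Longrightarrow> is_model S (D r); set_tree t \<subseteq> O'\<rbrakk> \<Longrightarrow> is_model S (tsum S D t)"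
  by (induction t) (auto simp: is_model_psum)

text \<open>Morphisms of models are closed under composition and sums and contain the associators
  and symmetries. Hence an equation between evaluations at \<open>s\<close> is an equation between
  components of two morphisms of models in the second variable, to which faithfulness
  applies.\<close>

lemma mor_eval_csl:
  assumes R: "wf_pres R" and S: "wf_pres S" and B: "prebimodel R S B" and e: "wt R e"
  shows "mor S (tsum S (cD B) (esrc R e)) (tsum S (cD B) (etgt R e)) (\<lambda>s. eval (csl B s) e)"
proof -
  have D: "premodel S (tsum S (cD B) t)" if "set_tree t \<subseteq> Obj (base R)" for t
    using B that by (intro is_modelD is_model_tsum[OF S, where O' = "Obj (base R)"]) (auto simp: prebimodel_def)
  have fobs: "tval (fob (csl B s)) t = fob (tsum S (cD B) t) s" for s t
    by (simp add: fob_tsum)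
      (rule tval_cong, simp)
  show ?thesis using e
  proof (induction e)
  case (EId r)
  then show ?case using mor_id[OF S D] by (simp add: fobs)
next
  case (ESum d e)
  then show ?case using mor_psum[OF S D D D D] by (simp add: wt_Obj[OF R])
next
  case (ECmp d e)
  then show ?case
    using mor_comp[OF S D D D, of "esrc R e" "etgt R e" "etgt R d" "\<lambda>s. eval (csl B s) e" "\<lambda>s. eval (csl B s) d"]
      wt_Obj[OF R, of d] wt_Obj[OF R, of e] by simp
next
  case (EAssoc r s t)
  then show ?case using mor_assoc[OF S D D D] by (simp add: fobs)
next
  case (EAssocInv r s t)
  then show ?case
    using mor_inv[OF S _ _ mor_assoc[OF S D D D]] premodel_psum[OF S] D by (simp add: fobs)
next
  case (ESymm s t)
  then show ?case using mor_symm[OF S D D] by (simp add: fobs)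
  qed (use B in \<open>auto simp: prebimodel_def\<close>)
qed

end

section \<open>Lifting two-variable models along an equivalence in the second variable\<close>

context sym_gpd
begin

context
  fixes R :: "('r, 'g, 'u) pres" and S :: "('o, 'm, 't) pres" and Y :: "('v, 'w, 's) pres" and q
  assumes R: "wf_pres R" and S: "wf_pres S" and Y: "wf_pres Y" and q: "pequiv S Y q"
begin

text \<open>Objects lift by essential surjectivity, arrows and labels by fullness after conjugation
  with \<open>\<alpha>\<close>. The functor laws and the relations of the first variable are
  equations between components of morphisms of models on \<open>Y\<close>; they hold at the objects
  \<open>fob q s\<close> because they hold in \<open>D\<close>, hence everywhere by
  faithfulness.\<close>

lemma bimodel_lift:
  assumes D: "bimodel R S D"
  shows "\<exists>F \<alpha>. bimodel R Y F \<and> bimor R S (bpull q F) D \<alpha>"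
proof -
  note q' = pequivD(1)[OF q] and faithful = pequivD(5)[OF q]
  note [simp] = X_simps[OF R] X_simps[OF S] X_simps[OF Y] wf_pmapD(1)[OF q']
  have DD: "is_model S (cD D r)" if "r \<in> Obj (base R)" for r
    using D that by (auto simp: bimodel_def prebimodel_def)
  have Ds: "is_model R (csl D s)" if "s \<in> Obj (base S)" for s
    using D that by (auto simp: bimodel_def)
  have DA: "mor S (cD D (Src (base R) g)) (cD D (Tgt (base R) g)) (cA D g)" if "g \<in> Arr (base R)" for g
    using D that by (auto simp: bimodel_def prebimodel_def)
  have DL: "mor S (psum S (cD D (lz R u)) (cD D (lx R u))) (cD D (ly R u)) (cL D u)" if "u \<in> lab R" for u
    using D that by (auto simp: bimodel_def prebimodel_def)
  note pDD = is_modelD[OF DD] and pDs = is_modelD[OF Ds]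
  have "\<forall>r\<in>Obj (base R). \<exists>F \<alpha>. is_model Y F \<and> mor S (pull q F) (cD D r) \<alpha>"
    using pequivD(3)[OF q DD] by blast
  then obtain F0 \<alpha> where F0: "\<And>r. r \<in> Obj (base R) \<Longrightarrow> is_model Y (F0 r)"
    and \<alpha>: "\<And>r. r \<in> Obj (base R) \<Longrightarrow> mor S (pull q (F0 r)) (cD D r) (\<alpha> r)"
    by metis
  note pF0 = is_modelD[OF F0]
  note pq = premodel_pull[OF S Y q' pF0]
  note [simp] = premodelD(1)[OF pF0] premodelD(1)[OF pDD]
  have [simp]: "\<alpha> r s \<in> Arr P" "Src P (\<alpha> r s) = fob (F0 r) (fob q s)" "Tgt P (\<alpha> r s) = fob (cD D r) s"
    if "r \<in> Obj (base R)" "s \<in> Obj (base S)" for r s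
    using morD(1-3)[OF \<alpha>[OF that(1)] that(2)] by simp_all
  have [simp]: "cA D g s \<in> Arr P" "Src P (cA D g s) = fob (cD D (Src (base R) g)) s"
    "Tgt P (cA D g s) = fob (cD D (Tgt (base R) g)) s" if "g \<in> Arr (base R)" "s \<in> Obj (base S)" for g s
    using morD(1-3)[OF DA[OF that(1)] that(2)] by simp_all
  have [simp]: "cL D u s \<in> Arr P" "Src P (cL D u s) = fob (cD D (lz R u)) s \<boxplus> fob (cD D (lx R u)) s"
    "Tgt P (cL D u s) = fob (cD D (ly R u)) s" if "u \<in> lab R" "s \<in> Obj (base S)" for u s
    using morD(1-3)[OF DL[OF that(1)] that(2)] by simp_all
  \<comment> \<open>The arrow of \<open>D\<close>, conjugated by the isomorphisms
    \<open>\<alpha>\<close>, is a morphism between pulled-back models and therefore comes from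
    \<open>Y\<close>.\<close>
  have "\<exists>\<beta>. mor Y (F0 (Src (base R) g)) (F0 (Tgt (base R) g)) \<beta> \<and>
      (\<forall>s\<in>Obj (base S). \<beta> (fob q s) = inv_arr P (\<alpha> (Tgt (base R) g) s) \<cdot> (cA D g s \<cdot> \<alpha> (Src (base R) g) s))"
    if "g \<in> Arr (base R)" for g
    by (rule pequivD(4)[OF q F0 F0 mor_comp[OF S pq pDD pq mor_comp[OF S pq pDD pDD \<alpha> DA] mor_inv[OF S pq pDD \<alpha>]]])
      (use that in simp_all)
  then obtain FA where FA: "\<And>g. g \<in> Arr (base R) \<Longrightarrow> mor Y (F0 (Src (base R) g)) (F0 (Tgt (base R) g)) (FA g)"
    and FA_q: "\<And>g s. g \<in> Arr (base R) \<Longrightarrow> s \<in> Obj (base S) \<Longrightarrow>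
      FA g (fob q s) = inv_arr P (\<alpha> (Tgt (base R) g) s) \<cdot> (cA D g s \<cdot> \<alpha> (Src (base R) g) s)"
    by metis
  have "\<exists>\<beta>. mor Y (psum Y (F0 (lz R u)) (F0 (lx R u))) (F0 (ly R u)) \<beta> \<and>
      (\<forall>s\<in>Obj (base S). \<beta> (fob q s) = inv_arr P (\<alpha> (ly R u) s) \<cdot> (cL D u s \<cdot> (\<alpha> (lz R u) s [+] \<alpha> (lx R u) s)))"
    if u: "u \<in> lab R" for u
  proof (rule pequivD(4)[OF q])
    let ?z = "lz R u" and ?x = "lx R u" and ?y = "ly R u"
    have zxy: "?z \<in> Obj (base R)" "?x \<in> Obj (base R)" "?y \<in> Obj (base R)" using u by simp_all
    note s1 = premodel_psum[OF S pq[OF zxy(1)] pq[OF zxy(2)]] and s2 = premodel_psum[OF S pDD[OF zxy(1)] pDD[OF zxy(2)]]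
    show "is_model Y (psum Y (F0 ?z) (F0 ?x))" "is_model Y (F0 ?y)"
      using u by (auto intro!: is_model_psum[OF Y] F0)
    show "mor S (pull q (psum Y (F0 ?z) (F0 ?x))) (pull q (F0 ?y))
      (\<lambda>s. inv_arr P (\<alpha> ?y s) \<cdot> (cL D u s \<cdot> (\<alpha> ?z s [+] \<alpha> ?x s)))"
    \<comment> \<open>The conjugated label starts at a sum of pulled-back models, whereas fullness
      asks for a pulled-back sum; \<open>pull_psum\<close> identifies the two.\<close>
    proof (rule mor_cong[OF S meq_sym meq_refl refl])
      show "meq S (pull q (psum Y (F0 ?z) (F0 ?x))) (psum S (pull q (F0 ?z)) (pull q (F0 ?x)))"
        by (rule pull_psum[OF S Y q' pF0[OF zxy(1)] pF0[OF zxy(2)]])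
      show "mor S (psum S (pull q (F0 ?z)) (pull q (F0 ?x))) (pull q (F0 ?y))
        (\<lambda>s. inv_arr P (\<alpha> ?y s) \<cdot> (cL D u s \<cdot> (\<alpha> ?z s [+] \<alpha> ?x s)))"
        by (rule mor_comp[OF S s1 pDD[OF zxy(3)] pq[OF zxy(3)] mor_comp[OF S s1 s2 pDD[OF zxy(3)]]
              mor_inv[OF S pq[OF zxy(3)] pDD[OF zxy(3)] \<alpha>[OF zxy(3)]]])
          (use u zxy in \<open>simp_all add: DL mor_psum[OF S pq pDD pq pDD] \<alpha>\<close>)
    qed
  qed
  then obtain FL where FL: "\<And>u. u \<in> lab R \<Longrightarrow> mor Y (psum Y (F0 (lz R u)) (F0 (lx R u))) (F0 (ly R u)) (FL u)"
    and FL_q: "\<And>u s. u \<in> lab R \<Longrightarrow> s \<in> Obj (base S) \<Longrightarrow>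
      FL u (fob q s) = inv_arr P (\<alpha> (ly R u) s) \<cdot> (cL D u s \<cdot> (\<alpha> (lz R u) s [+] \<alpha> (lx R u) s))"
    by metis
  define F where "F = \<lparr>cD = F0, cA = FA, cL = FL\<rparr>"
  have F_simps [simp]: "cD F = F0" "cA F = FA" "cL F = FL" by (simp_all add: F_def)
  have [simp]: "FA g y \<in> Arr P" "Src P (FA g y) = fob (F0 (Src (base R) g)) y"
    "Tgt P (FA g y) = fob (F0 (Tgt (base R) g)) y" if "g \<in> Arr (base R)" "y \<in> Obj (base Y)" for g y
    using morD(1-3)[OF FA[OF that(1)] that(2)] by simp_all
  note catR = cat_axioms.Idn_Arr[OF wf_presD(1)[OF R]] cat_axioms.Src_Idn[OF wf_presD(1)[OF R]]
    cat_axioms.Tgt_Idn[OF wf_presD(1)[OF R]] cat_axioms.Cmp_Arr[OF wf_presD(1)[OF R]]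
    cat_axioms.Src_Cmp[OF wf_presD(1)[OF R]] cat_axioms.Tgt_Cmp[OF wf_presD(1)[OF R]]
  have pre: "premodel R (csl F y)" if y: "y \<in> Obj (base Y)" for y
  proof -
    have "FA (Idn (base R) r) y = Idn P (fob (F0 r) y)" if r: "r \<in> Obj (base R)" for r
    proof (rule faithful[OF F0[OF r] F0[OF r] _ _ _ y])
      show "mor Y (F0 r) (F0 r) (FA (Idn (base R) r))" using FA[of "Idn (base R) r"] r catR by simp
      show "mor Y (F0 r) (F0 r) (\<lambda>y. Idn P (fob (F0 r) y))" by (rule mor_id[OF Y pF0[OF r]])
      fix s assume s: "s \<in> Obj (base S)"
      have "cA D (Idn (base R) r) s = Idn P (fob (cD D r) s)"
        using premodelD(5)[OF pDs[OF s] r] by simp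
      then show "FA (Idn (base R) r) (fob q s) = Idn P (fob (F0 r) (fob q s))"
        using r s catR by (simp add: FA_q)
    qed
    moreover have "FA (Cmp (base R) g' g) y = FA g' y \<cdot> FA g y"
      if g: "g \<in> Arr (base R)" "g' \<in> Arr (base R)" "Src (base R) g' = Tgt (base R) g" for g g'
    proof (rule faithful[OF F0 F0 _ _ _ y])
      show "mor Y (F0 (Src (base R) g)) (F0 (Tgt (base R) g')) (FA (Cmp (base R) g' g))"
        using FA[of "Cmp (base R) g' g"] g catR by simp
      show "mor Y (F0 (Src (base R) g)) (F0 (Tgt (base R) g')) (\<lambda>y. FA g' y \<cdot> FA g y)"
        by (rule mor_comp[OF Y _ _ _ FA[OF g(1)]]) (use g FA[OF g(2)] pF0 in auto)
      fix s assume s: "s \<in> Obj (base S)"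
      have "cA D (Cmp (base R) g' g) s = cA D g' s \<cdot> cA D g s"
        using premodelD(6)[OF pDs[OF s] g] by simp
      then show "FA (Cmp (base R) g' g) (fob q s) = FA g' (fob q s) \<cdot> FA g (fob q s)"
        using g s catR by (simp add: FA_q Cmp_assoc)
    qed (use g in auto)
    moreover have "FL u y \<in> Hom P (fob (F0 (lz R u)) y \<boxplus> fob (F0 (lx R u)) y) (fob (F0 (ly R u)) y)" if "u \<in> lab R" for u
      using morD(1-3)[OF FL[OF that] y] by simp
    ultimately show ?thesis
      using y R category by (simp add: premodel_def is_functor_def wf_pres_def)
  qed
  have preF: "prebimodel R Y F"
    using F0 FA FL pre by (simp add: prebimodel_def)
  \<comment> \<open>Immediate from the values of \<open>FA\<close> and \<open>FL\<close> at
    \<open>fob q s\<close>: conjugation by \<open>\<alpha>\<close> was chosen for this.\<close>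
  have \<alpha>R: "mor R (csl F (fob q s)) (csl D s) (\<lambda>r. \<alpha> r s)" if s: "s \<in> Obj (base S)" for s
    using s by (simp add: mor_def FA_q FL_q)
  have "is_model R (csl F y)" if y: "y \<in> Obj (base Y)" for y
  proof -
    have "eval (csl F y) d = eval (csl F y) e" if de: "(d, e) \<in> rels R" for d e
    proof -
      note de' = wf_presD(5-8)[OF R de]
      have F0': "is_model Y (tsum Y F0 t)" if "set_tree t \<subseteq> Obj (base R)" for t
        by (rule is_model_tsum[OF Y F0 that])
      show ?thesis
      proof (rule faithful[OF F0' F0' _ _ _ y])
        show "mor Y (tsum Y F0 (esrc R d)) (tsum Y F0 (etgt R d)) (\<lambda>y. eval (csl F y) d)"
          using mor_eval_csl[OF R Y preF de'(1)] by simp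
        show "mor Y (tsum Y F0 (esrc R d)) (tsum Y F0 (etgt R d)) (\<lambda>y. eval (csl F y) e)"
          using mor_eval_csl[OF R Y preF de'(2)] de'(3,4) by simp
        fix s assume s: "s \<in> Obj (base S)"
        let ?y = "fob q s" and ?t = "tmap (\<lambda>r. \<alpha> r s)"
        have y: "?y \<in> Obj (base Y)" using s by simp
        \<comment> \<open>At \<open>fob q s\<close> the relation is carried over from
          \<open>D\<close> along \<open>\<alpha>\<close>, by naturality of evaluation; the
          invertible \<open>?t\<close> then cancels.\<close>
        have "?t (etgt R d) \<cdot> eval (csl F ?y) d = ?t (etgt R d) \<cdot> eval (csl F ?y) e"
          using eval_mor[OF R pre[OF y] pDs[OF s] \<alpha>R[OF s] de'(1)] eval_mor[OF R pre[OF y] pDs[OF s] \<alpha>R[OF s] de'(2)]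
            de'(3,4) is_model_rels[OF Ds[OF s] de] by simp
        then show "eval (csl F ?y) d = eval (csl F ?y) e"
          by (rule Cmp_cancel_left)
            (use eval_typed[OF R pre[OF y] de'(1)] eval_typed[OF R pre[OF y] de'(2)] de'(3,4)
              tmap_typed[of "base R" "\<lambda>r. \<alpha> r s" "fob (csl F ?y)" "fob (csl D s)" "etgt R d"] wt_Obj(2)[OF R de'(1)] s in auto)
      qed (use wt_Obj[OF R de'(1)] in auto)
    qed
    with pre[OF y] show ?thesis by (auto simp: is_model_def)
  qed
  with preF have "bimodel R Y F" by (simp add: bimodel_def)
  moreover have "bimor R S (bpull q F) D \<alpha>"
    using \<alpha> \<alpha>R by (simp add: bimor_def)
  ultimately show ?thesis by blast
qed

text \<open>Components lift by fullness. Naturality in the first variable is an equation between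
  morphisms of models in the second, so it only has to be checked on the image of
  \<open>q\<close>.\<close>

lemma bimor_lift:
  assumes F: "bimodel R Y F" and G: "bimodel R Y G" and \<theta>: "bimor R S (bpull q F) (bpull q G) \<theta>"
  shows "\<exists>\<beta>. bimor R Y F G \<beta> \<and> (\<forall>r\<in>Obj (base R). \<forall>s\<in>Obj (base S). \<beta> r (fob q s) = \<theta> r s)"
proof -
  note q' = pequivD(1)[OF q] and faithful = pequivD(5)[OF q]
  note [simp] = X_simps[OF R] X_simps[OF S] X_simps[OF Y] wf_pmapD(1)[OF q']
  have FD: "is_model Y (cD F r)" and GD: "is_model Y (cD G r)" if "r \<in> Obj (base R)" for r
    using F G that by (auto simp: bimodel_def prebimodel_def)
  have FA: "mor Y (cD F (Src (base R) g)) (cD F (Tgt (base R) g)) (cA F g)"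
    and GA: "mor Y (cD G (Src (base R) g)) (cD G (Tgt (base R) g)) (cA G g)" if "g \<in> Arr (base R)" for g
    using F G that by (auto simp: bimodel_def prebimodel_def)
  have FL: "mor Y (psum Y (cD F (lz R u)) (cD F (lx R u))) (cD F (ly R u)) (cL F u)"
    and GL: "mor Y (psum Y (cD G (lz R u)) (cD G (lx R u))) (cD G (ly R u)) (cL G u)" if "u \<in> lab R" for u
    using F G that by (auto simp: bimodel_def prebimodel_def)
  note pF = is_modelD[OF FD] and pG = is_modelD[OF GD]
  have \<theta>S: "mor S (pull q (cD F r)) (pull q (cD G r)) (\<theta> r)" if "r \<in> Obj (base R)" for r
    using \<theta> that by (auto simp: bimor_def)
  have \<theta>R: "mor R (csl F (fob q s)) (csl G (fob q s)) (\<lambda>r. \<theta> r s)" if "s \<in> Obj (base S)" for s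
    using \<theta> that by (auto simp: bimor_def)
  have "\<exists>\<beta>. mor Y (cD F r) (cD G r) \<beta> \<and> (\<forall>s\<in>Obj (base S). \<beta> (fob q s) = \<theta> r s)" if "r \<in> Obj (base R)" for r
    by (rule pequivD(4)[OF q FD[OF that] GD[OF that] \<theta>S[OF that]])
  then obtain \<beta> where \<beta>: "\<And>r. r \<in> Obj (base R) \<Longrightarrow> mor Y (cD F r) (cD G r) (\<beta> r)"
    and \<beta>_q: "\<And>r s. r \<in> Obj (base R) \<Longrightarrow> s \<in> Obj (base S) \<Longrightarrow> \<beta> r (fob q s) = \<theta> r s"
    by metis
  have "mor R (csl F y) (csl G y) (\<lambda>r. \<beta> r y)" if y: "y \<in> Obj (base Y)" for y
  proof -
    have "cA G g y \<cdot> \<beta> (Src (base R) g) y = \<beta> (Tgt (base R) g) y \<cdot> cA F g y" if g: "g \<in> Arr (base R)" for g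
    proof (rule faithful[OF FD GD _ _ _ y])
      show "mor Y (cD F (Src (base R) g)) (cD G (Tgt (base R) g)) (\<lambda>y. cA G g y \<cdot> \<beta> (Src (base R) g) y)"
        by (rule mor_comp[OF Y pF pG pG \<beta> GA]) (use g in auto)
      show "mor Y (cD F (Src (base R) g)) (cD G (Tgt (base R) g)) (\<lambda>y. \<beta> (Tgt (base R) g) y \<cdot> cA F g y)"
        by (rule mor_comp[OF Y pF pF pG FA \<beta>]) (use g in auto)
      show "cA G g (fob q s) \<cdot> \<beta> (Src (base R) g) (fob q s) = \<beta> (Tgt (base R) g) (fob q s) \<cdot> cA F g (fob q s)"
        if "s \<in> Obj (base S)" for s
        using morD(4)[OF \<theta>R[OF that] g] g that by (simp add: \<beta>_q)
    qed (use g in auto)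
    moreover have "\<beta> (ly R u) y \<cdot> cL F u y = cL G u y \<cdot> (\<beta> (lz R u) y [+] \<beta> (lx R u) y)" if u: "u \<in> lab R" for u
    proof (rule faithful[OF is_model_psum[OF Y FD FD] GD _ _ _ y])
      show "mor Y (psum Y (cD F (lz R u)) (cD F (lx R u))) (cD G (ly R u)) (\<lambda>y. \<beta> (ly R u) y \<cdot> cL F u y)"
        by (rule mor_comp[OF Y premodel_psum[OF Y pF pF] pF pG FL \<beta>]) (use u in auto)
      show "mor Y (psum Y (cD F (lz R u)) (cD F (lx R u))) (cD G (ly R u)) (\<lambda>y. cL G u y \<cdot> (\<beta> (lz R u) y [+] \<beta> (lx R u) y))"
        by (rule mor_comp[OF Y premodel_psum[OF Y pF pF] premodel_psum[OF Y pG pG] pG mor_psum[OF Y pF pG pF pG \<beta> \<beta>] GL])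
          (use u in auto)
      show "\<beta> (ly R u) (fob q s) \<cdot> cL F u (fob q s) = cL G u (fob q s) \<cdot> (\<beta> (lz R u) (fob q s) [+] \<beta> (lx R u) (fob q s))"
        if "s \<in> Obj (base S)" for s
        using morD(5)[OF \<theta>R[OF that] u] u that by (simp add: \<beta>_q)
    qed (use u in auto)
    ultimately show ?thesis
      using morD(1-3)[OF \<beta> y] by (simp add: mor_def)
  qed
  with \<beta> \<beta>_q show ?thesis unfolding bimor_def by (intro exI[of _ \<beta>]) auto
qed

lemma bimor_unique:
  assumes F: "bimodel R Y F" and G: "bimodel R Y G" and "bimor R Y F G \<beta>" "bimor R Y F G \<beta>'"
    and "\<And>r s. \<lbrakk>r \<in> Obj (base R); s \<in> Obj (base S)\<rbrakk> \<Longrightarrow> \<beta> r (fob q s) = \<beta>' r (fob q s)"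
    and "r \<in> Obj (base R)" "y \<in> Obj (base Y)"
  shows "\<beta> r y = \<beta>' r y"
  by (rule pequivD(5)[OF q, of "cD F r" "cD G r"]) (use assms in \<open>auto simp: bimodel_def prebimodel_def bimor_def\<close>)

end

end

section \<open>Families of variables\<close>

lemma prod_cat_sel:
  "Src (prod_cat I C) f = (\<lambda>i\<in>I. Src (C i) (f i))"
  "Tgt (prod_cat I C) f = (\<lambda>i\<in>I. Tgt (C i) (f i))"
  "Idn (prod_cat I C) x = (\<lambda>i\<in>I. Idn (C i) (x i))"
  "Cmp (prod_cat I C) g f = (\<lambda>i\<in>I. Cmp (C i) (g i) (f i))"
  by (simp_all add: prod_cat_def)

lemma Obj_prod_cat: "Obj (prod_cat I C) = (\<Pi>\<^sub>E i\<in>I. Obj (C i))"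
  and Arr_prod_cat: "Arr (prod_cat I C) = (\<Pi>\<^sub>E i\<in>I. Arr (C i))"
  by (simp_all add: prod_cat_def)

lemma category_prod_cat:
  assumes "\<And>i. i \<in> I \<Longrightarrow> category (C i)"
  shows "category (prod_cat I C)"
proof -
  have c: "cat_axioms (C i)" if "i \<in> I" for i
    using assms[OF that] by (simp add: cat_axioms_def)
  note [simp] = cat_axioms.Src_Obj[OF c] cat_axioms.Tgt_Obj[OF c] cat_axioms.Idn_Arr[OF c] cat_axioms.Src_Idn[OF c]
    cat_axioms.Tgt_Idn[OF c] cat_axioms.Cmp_Arr[OF c] cat_axioms.Src_Cmp[OF c] cat_axioms.Tgt_Cmp[OF c]
    cat_axioms.Cmp_Idn[OF c] cat_axioms.Idn_Cmp[OF c] prod_cat_sel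
  have eqD: "Src (C i) (g i) = Tgt (C i) (f i)" if "(\<lambda>i\<in>I. Src (C i) (g i)) = (\<lambda>i\<in>I. Tgt (C i) (f i))" "i \<in> I" for f g i
    using fun_cong[OF that(1), of i] that(2) by simp
  show ?thesis
    unfolding category_def
    by (auto simp: prod_cat_sel Obj_prod_cat Arr_prod_cat PiE_iff fun_eq_iff restrict_def extensional_def Pi_iff
        cat_axioms.Cmp_assoc[OF c] dest!: eqD split: if_splits intro!: cat_axioms.Cmp_assoc[OF c] cat_axioms.Cmp_Arr[OF c])
qed

lemma upd_Obj: "j \<in> I \<Longrightarrow> x \<in> Obj (prod_cat (I - {j}) C) \<Longrightarrow> a \<in> Obj (C j) \<Longrightarrow> x(j := a) \<in> Obj (prod_cat I C)"
  by (auto simp: Obj_prod_cat PiE_iff extensional_def)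

lemma upd_Obj_insert: "x \<in> Obj (prod_cat I C) \<Longrightarrow> a \<in> Obj (C j) \<Longrightarrow> x(j := a) \<in> Obj (prod_cat (insert j I) C)"
  by (auto simp: Obj_prod_cat PiE_iff extensional_def)

lemma upd_Arr: "j \<in> I \<Longrightarrow> g \<in> Arr (prod_cat (I - {j}) C) \<Longrightarrow> f \<in> Arr (C j) \<Longrightarrow> g(j := f) \<in> Arr (prod_cat I C)"
  by (auto simp: Arr_prod_cat PiE_iff extensional_def)

lemma upd_Arr_insert: "g \<in> Arr (prod_cat I C) \<Longrightarrow> f \<in> Arr (C j) \<Longrightarrow> g(j := f) \<in> Arr (prod_cat (insert j I) C)"
  by (auto simp: Arr_prod_cat PiE_iff extensional_def)

lemma Src_upd: "j \<in> I \<Longrightarrow> Src (prod_cat I C) (g(j := f)) = (Src (prod_cat (I - {j}) C) g)(j := Src (C j) f)"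
  and Tgt_upd: "j \<in> I \<Longrightarrow> Tgt (prod_cat I C) (g(j := f)) = (Tgt (prod_cat (I - {j}) C) g)(j := Tgt (C j) f)"
  and Idn_upd: "j \<in> I \<Longrightarrow> Idn (prod_cat I C) (x(j := a)) = (Idn (prod_cat (I - {j}) C) x)(j := Idn (C j) a)"
  and Cmp_upd: "j \<in> I \<Longrightarrow> Cmp (prod_cat I C) (g(j := f)) (g'(j := f')) = (Cmp (prod_cat (I - {j}) C) g g')(j := Cmp (C j) f f')"
  by (auto simp: prod_cat_sel fun_eq_iff restrict_def)

lemma prod_Obj_split:
  assumes "y \<in> Obj (prod_cat (insert i J) C)" "i \<notin> J"
  obtains x a where "y = x(i := a)" "x \<in> Obj (prod_cat J C)" "a \<in> Obj (C i)"
proof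
  show "y = (restrict y J)(i := y i)" "restrict y J \<in> Obj (prod_cat J C)" "y i \<in> Obj (C i)"
    using assms by (auto simp: Obj_prod_cat PiE_iff extensional_def fun_eq_iff restrict_def)
qed

lemma prod_Arr_split:
  assumes "y \<in> Arr (prod_cat (insert i J) C)" "i \<notin> J"
  obtains x a where "y = x(i := a)" "x \<in> Arr (prod_cat J C)" "a \<in> Arr (C i)"
proof
  show "y = (restrict y J)(i := y i)" "restrict y J \<in> Arr (prod_cat J C)" "y i \<in> Arr (C i)"
    using assms by (auto simp: Arr_prod_cat PiE_iff extensional_def fun_eq_iff restrict_def)
qed

section \<open>The presentation of functors of several variables\<close>

abbreviation bases :: "('i \<Rightarrow> ('o, 'm, 't) pres) \<Rightarrow> 'i \<Rightarrow> ('o, 'm) cat" where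
  "bases M \<equiv> \<lambda>i. base (M i)"

text \<open>Follows the definition of \<open>coas\<close> factor by factor, so that evaluating it
  gives \<open>coas\<close> directly.\<close>

definition ecoas :: "'o tree \<Rightarrow> 'o tree \<Rightarrow> 'o tree \<Rightarrow> 'o tree \<Rightarrow> ('o, 'm, 't) expr" where
  "ecoas a b c d = ECmp (EAssocInv a c (Node b d)) (ECmp (ESum (EId a) (EAssoc c b d))
     (ECmp (ESum (EId a) (ESum (ESymm b c) (EId d))) (ECmp (ESum (EId a) (EAssocInv b c d)) (EAssoc a b (Node c d)))))"

definition expr_at :: "'i set \<Rightarrow> ('i \<Rightarrow> ('o, 'm, 't) pres) \<Rightarrow> 'i \<Rightarrow> ('i \<Rightarrow> 'o) \<Rightarrow> ('o, 'm, 't) expr \<Rightarrow>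
    ('i \<Rightarrow> 'o, 'i \<Rightarrow> 'm, 'i \<times> ('i \<Rightarrow> 'o) \<times> 't) expr" where
  "expr_at I M j x = map_expr (\<lambda>a. x(j := a)) (at_place I (bases M) x j) (\<lambda>t. (j, x, t))"

definition slice_rels :: "'i set \<Rightarrow> ('i \<Rightarrow> ('o, 'm, 't) pres) \<Rightarrow>
    (('i \<Rightarrow> 'o, 'i \<Rightarrow> 'm, 'i \<times> ('i \<Rightarrow> 'o) \<times> 't) expr \<times> ('i \<Rightarrow> 'o, 'i \<Rightarrow> 'm, 'i \<times> ('i \<Rightarrow> 'o) \<times> 't) expr) set" where
  "slice_rels I M =
      {(expr_at I M j x d, expr_at I M j x e) | j x d e.
        j \<in> I \<and> x \<in> Obj (prod_cat (I - {j}) (bases M)) \<and> (d, e) \<in> rels (M j)}"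

text \<open>Here all places other than \<open>j\<close> may move at once. The triangle-function
  axiom moves a single one; \<open>tri_natI\<close> bridges the difference.\<close>

definition nat_rels :: "'i set \<Rightarrow> ('i \<Rightarrow> ('o, 'm, 't) pres) \<Rightarrow>
    (('i \<Rightarrow> 'o, 'i \<Rightarrow> 'm, 'i \<times> ('i \<Rightarrow> 'o) \<times> 't) expr \<times> ('i \<Rightarrow> 'o, 'i \<Rightarrow> 'm, 'i \<times> ('i \<Rightarrow> 'o) \<times> 't) expr) set" where
  "nat_rels I M =
      {(ECmp (EArr (g(j := Idn (base (M j)) (ly (M j) t)))) (ELab (j, Src (prod_cat (I - {j}) (bases M)) g, t)),
        ECmp (ELab (j, Tgt (prod_cat (I - {j}) (bases M)) g, t))
          (ESum (EArr (g(j := Idn (base (M j)) (lz (M j) t)))) (EArr (g(j := Idn (base (M j)) (lx (M j) t)))))) | j g t.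
        j \<in> I \<and> g \<in> Arr (prod_cat (I - {j}) (bases M)) \<and> t \<in> lab (M j)}"

definition two_tri_rels :: "'i set \<Rightarrow> ('i \<Rightarrow> ('o, 'm, 't) pres) \<Rightarrow>
    (('i \<Rightarrow> 'o, 'i \<Rightarrow> 'm, 'i \<times> ('i \<Rightarrow> 'o) \<times> 't) expr \<times> ('i \<Rightarrow> 'o, 'i \<Rightarrow> 'm, 'i \<times> ('i \<Rightarrow> 'o) \<times> 't) expr) set" where
  "two_tri_rels I M =
      {(ECmp (ELab (j, x(i := ly (M i) s), t)) (ESum (ELab (i, x(j := lz (M j) t), s)) (ELab (i, x(j := lx (M j) t), s))),
        ECmp (ELab (i, x(j := ly (M j) t), s)) (ECmp (ESum (ELab (j, x(i := lz (M i) s), t)) (ELab (j, x(i := lx (M i) s), t)))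
          (ecoas (Leaf (x(i := lz (M i) s, j := lz (M j) t))) (Leaf (x(i := lx (M i) s, j := lz (M j) t)))
            (Leaf (x(i := lz (M i) s, j := lx (M j) t))) (Leaf (x(i := lx (M i) s, j := lx (M j) t)))))) | i j x s t.
        i \<in> I \<and> j \<in> I \<and> i \<noteq> j \<and> x \<in> Obj (prod_cat (I - {i, j}) (bases M)) \<and> s \<in> lab (M i) \<and> t \<in> lab (M j)}"

text \<open>Functors of several variables become models of a presentation in their own right, so the
  induction over variables can treat all remaining variables as one. A label is a triangle in one
  place together with objects for the other places.\<close>

definition Fam :: "'i set \<Rightarrow> ('i \<Rightarrow> ('o, 'm, 't) pres) \<Rightarrow> ('i \<Rightarrow> 'o, 'i \<Rightarrow> 'm, 'i \<times> ('i \<Rightarrow> 'o) \<times> 't) pres" where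
  "Fam I M = \<lparr>base = prod_cat I (bases M),
    lab = {(j, x, t). j \<in> I \<and> x \<in> Obj (prod_cat (I - {j}) (bases M)) \<and> t \<in> lab (M j)},
    lz = (\<lambda>(j, x, t). x(j := lz (M j) t)), lx = (\<lambda>(j, x, t). x(j := lx (M j) t)), ly = (\<lambda>(j, x, t). x(j := ly (M j) t)),
    rels = slice_rels I M \<union> nat_rels I M \<union> two_tri_rels I M\<rparr>"

lemma Fam_sel [simp]:
  "base (Fam I M) = prod_cat I (bases M)"
  "lab (Fam I M) = {(j, x, t). j \<in> I \<and> x \<in> Obj (prod_cat (I - {j}) (bases M)) \<and> t \<in> lab (M j)}"
  "lz (Fam I M) (j, x, t) = x(j := lz (M j) t)" "lx (Fam I M) (j, x, t) = x(j := lx (M j) t)"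
  "ly (Fam I M) (j, x, t) = x(j := ly (M j) t)"
  "rels (Fam I M) = slice_rels I M \<union> nat_rels I M \<union> two_tri_rels I M"
  by (simp_all add: Fam_def)

lemma wf_Fam:
  assumes M: "\<And>j. j \<in> I \<Longrightarrow> wf_pres (M j)"
  shows "wf_pres (Fam I M)"
proof -
  let ?C = "bases M"
  have c: "cat_axioms (?C j)" if "j \<in> I" for j
    using wf_presD(1)[OF M[OF that]] .
  note cs [simp] = cat_axioms.Src_Obj[OF c] cat_axioms.Tgt_Obj[OF c] cat_axioms.Idn_Arr[OF c] cat_axioms.Src_Idn[OF c]
    cat_axioms.Tgt_Idn[OF c] wf_presD(2-4)[OF M]
  have Idn_pr: "Idn (prod_cat (I - {j}) ?C) x \<in> Arr (prod_cat (I - {j}) ?C)"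
    "Src (prod_cat (I - {j}) ?C) (Idn (prod_cat (I - {j}) ?C) x) = x"
    "Tgt (prod_cat (I - {j}) ?C) (Idn (prod_cat (I - {j}) ?C) x) = x"
    if "x \<in> Obj (prod_cat (I - {j}) ?C)" for x j
    using that by (auto simp: prod_cat_sel Obj_prod_cat Arr_prod_cat PiE_iff fun_eq_iff restrict_def extensional_def)
  have "Src (prod_cat I ?C) (at_place I ?C x j f) = x(j := Src (?C j) f)"
    "Tgt (prod_cat I ?C) (at_place I ?C x j f) = x(j := Tgt (?C j) f)"
    if "j \<in> I" "x \<in> Obj (prod_cat (I - {j}) ?C)" for j x f
    using that Idn_pr[OF that(2)] unfolding at_place_def by (simp_all add: Src_upd Tgt_upd)
  note ap = this
  have st: "esrc (Fam I M) (expr_at I M j x e) = map_tree (\<lambda>a. x(j := a)) (esrc (M j) e)"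
    "etgt (Fam I M) (expr_at I M j x e) = map_tree (\<lambda>a. x(j := a)) (etgt (M j) e)"
    if "j \<in> I" "x \<in> Obj (prod_cat (I - {j}) ?C)" for j x e
    by (induction e) (simp_all add: expr_at_def ap[OF that])
  have wts: "wt (Fam I M) (expr_at I M j x e)"
    if "j \<in> I" "x \<in> Obj (prod_cat (I - {j}) ?C)" "wt (M j) e" for j x e
    using that(3)
  proof (induction e)
    case (EArr f)
    then show ?case using that Idn_pr[OF that(2)] by (simp add: expr_at_def at_place_def upd_Arr)
  next
    case (ECmp d e)
    then show ?case using st[OF that(1,2)] by (simp add: expr_at_def)
  qed (use that(1,2) in \<open>auto simp: expr_at_def tree.set_map intro!: upd_Obj\<close>)
  have x2: "x(i := a) \<in> Obj (prod_cat (I - {j}) ?C)"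
    if "x \<in> Obj (prod_cat (I - {i, j}) ?C)" "i \<in> I" "i \<noteq> j" "a \<in> Obj (?C i)" for x i j a
    using that by (auto simp: Obj_prod_cat PiE_iff extensional_def)
  have gO: "Src (prod_cat (I - {j}) ?C) g \<in> Obj (prod_cat (I - {j}) ?C)" "Tgt (prod_cat (I - {j}) ?C) g \<in> Obj (prod_cat (I - {j}) ?C)"
    if "g \<in> Arr (prod_cat (I - {j}) ?C)" for g j
    using that by (auto simp: prod_cat_sel Obj_prod_cat Arr_prod_cat PiE_iff)
  have tw: "x(j := a, i := b) = x(i := b, j := a)" if "i \<noteq> j" for x :: "'a \<Rightarrow> 'b" and i j a b
    using that by (rule fun_upd_twist[symmetric])
  have ij: "I - {j, i} = I - {i, j}" for i j
    by auto
  show ?thesis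
    unfolding wf_pres_def
  proof (intro conjI ballI; (elim UnE)?; clarify?)
    show "category (base (Fam I M))"
      using M category_prod_cat[of I ?C] by (simp add: wf_pres_def)
  next
    fix d e assume "(d, e) \<in> rels (Fam I M)"
    then show "wt (Fam I M) d \<and> wt (Fam I M) e \<and> esrc (Fam I M) d = esrc (Fam I M) e \<and> etgt (Fam I M) d = etgt (Fam I M) e"
      unfolding Fam_sel slice_rels_def nat_rels_def two_tri_rels_def
    proof (elim UnE CollectE exE conjE Pair_inject, goal_cases)
      case (1 j x d' e')
      then show ?case using wts st wf_presD(5-8)[OF M, of j d' e'] by simp
    next
      case (2 j g t)
      then show ?case
        by (simp add: upd_Arr Src_upd Tgt_upd gO)
    next
      case (3 i j x s t)
      have xs: "x \<in> Obj (prod_cat (I - {j, i}) ?C)" using 3 by (simp add: ij)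
      show ?case using 3 xs
        by (simp add: ecoas_def x2 upd_Obj tw[of i j])
    qed
  qed (auto intro!: upd_Obj)
qed

context sym_gpd
begin

definition fslice :: "'i set \<Rightarrow> ('i \<Rightarrow> ('o, 'm, 't) pres) \<Rightarrow> 'i \<Rightarrow> ('i \<Rightarrow> 'o) \<Rightarrow>
    ('i \<Rightarrow> 'o, 'i \<Rightarrow> 'm, 'i \<times> ('i \<Rightarrow> 'o) \<times> 't, 'p, 'q) model \<Rightarrow> ('o, 'm, 't, 'p, 'q) model" where
  "fslice I M j x F = \<lparr>fob = (\<lambda>a. fob F (x(j := a))), far = (\<lambda>f. far F (at_place I (bases M) x j f)),
     lb = (\<lambda>t. lb F (j, x, t))\<rparr>"

lemma fslice_sel [simp]: "fob (fslice I M j x F) a = fob F (x(j := a))"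
  "far (fslice I M j x F) f = far F (at_place I (bases M) x j f)" "lb (fslice I M j x F) t = lb F (j, x, t)"
  by (simp_all add: fslice_def)

lemma eval_expr_at: "eval F (expr_at I M j x e) = eval (fslice I M j x F) e"
proof -
  have "tval (fob F) (map_tree (\<lambda>a. x(j := a)) t) = tval (fob (fslice I M j x F)) t" for t
    by (induction t) (auto simp: fun_upd_def)
  then show ?thesis
    unfolding expr_at_def by (induction e) auto
qed

lemma eval_ecoas: "eval F (ecoas a b c d) = coas P (tval (fob F) a) (tval (fob F) b) (tval (fob F) c) (tval (fob F) d)"
  by (simp add: ecoas_def coas_def)

definition tri_nat :: "'i set \<Rightarrow> ('i \<Rightarrow> ('o, 'm, 't) pres) \<Rightarrow> 'i \<Rightarrow>
    ('i \<Rightarrow> 'o, 'i \<Rightarrow> 'm, 'i \<times> ('i \<Rightarrow> 'o) \<times> 't, 'p, 'q) model \<Rightarrow> bool" where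
  "tri_nat I M j F \<longleftrightarrow> (\<forall>g\<in>Arr (prod_cat (I - {j}) (bases M)). \<forall>t\<in>lab (M j).
    far F (g(j := Idn (base (M j)) (ly (M j) t))) \<cdot> lb F (j, Src (prod_cat (I - {j}) (bases M)) g, t) =
    lb F (j, Tgt (prod_cat (I - {j}) (bases M)) g, t) \<cdot>
      (far F (g(j := Idn (base (M j)) (lz (M j) t))) [+] far F (g(j := Idn (base (M j)) (lx (M j) t)))))"

definition two_tri :: "'i set \<Rightarrow> ('i \<Rightarrow> ('o, 'm, 't) pres) \<Rightarrow> 'i \<Rightarrow> 'i \<Rightarrow>
    ('i \<Rightarrow> 'o, 'i \<Rightarrow> 'm, 'i \<times> ('i \<Rightarrow> 'o) \<times> 't, 'p, 'q) model \<Rightarrow> bool" where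
  "two_tri I M i j F \<longleftrightarrow> (\<forall>x\<in>Obj (prod_cat (I - {i, j}) (bases M)). \<forall>s\<in>lab (M i). \<forall>t\<in>lab (M j).
    lb F (j, x(i := ly (M i) s), t) \<cdot> (lb F (i, x(j := lz (M j) t), s) [+] lb F (i, x(j := lx (M j) t), s)) =
    lb F (i, x(j := ly (M j) t), s) \<cdot> ((lb F (j, x(i := lz (M i) s), t) [+] lb F (j, x(i := lx (M i) s), t)) \<cdot>
      coas P (fob F (x(i := lz (M i) s, j := lz (M j) t))) (fob F (x(i := lx (M i) s, j := lz (M j) t)))
        (fob F (x(i := lz (M i) s, j := lx (M j) t))) (fob F (x(i := lx (M i) s, j := lx (M j) t)))))"

lemma is_model_Fam_iff:
  assumes F: "premodel (Fam I M) F"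
  shows "is_model (Fam I M) F \<longleftrightarrow>
    (\<forall>j\<in>I. \<forall>x\<in>Obj (prod_cat (I - {j}) (bases M)). \<forall>(d, e)\<in>rels (M j). eval (fslice I M j x F) d = eval (fslice I M j x F) e) \<and>
    (\<forall>j\<in>I. tri_nat I M j F) \<and> (\<forall>i\<in>I. \<forall>j\<in>I. i \<noteq> j \<longrightarrow> two_tri I M i j F)"
    (is "_ \<longleftrightarrow> ?A \<and> ?B \<and> ?C")
proof -
  have "(\<forall>(d, e)\<in>slice_rels I M. eval F d = eval F e) \<longleftrightarrow> ?A"
    unfolding slice_rels_def by (fastforce simp: eval_expr_at)
  moreover have "(\<forall>(d, e)\<in>nat_rels I M. eval F d = eval F e) \<longleftrightarrow> ?B"
    unfolding nat_rels_def tri_nat_def by fastforce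
  moreover have "(\<forall>(d, e)\<in>two_tri_rels I M. eval F d = eval F e) \<longleftrightarrow> ?C"
  proof
    assume R3: "\<forall>(d, e)\<in>two_tri_rels I M. eval F d = eval F e"
    show ?C
    proof (intro ballI impI, unfold two_tri_def, intro ballI, goal_cases)
      case (1 i j x s t)
      have "(ECmp (ELab (j, x(i := ly (M i) s), t)) (ESum (ELab (i, x(j := lz (M j) t), s)) (ELab (i, x(j := lx (M j) t), s))),
        ECmp (ELab (i, x(j := ly (M j) t), s)) (ECmp (ESum (ELab (j, x(i := lz (M i) s), t)) (ELab (j, x(i := lx (M i) s), t)))
          (ecoas (Leaf (x(i := lz (M i) s, j := lz (M j) t))) (Leaf (x(i := lx (M i) s, j := lz (M j) t)))
            (Leaf (x(i := lz (M i) s, j := lx (M j) t))) (Leaf (x(i := lx (M i) s, j := lx (M j) t)))))) \<in> two_tri_rels I M"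
        unfolding two_tri_rels_def using 1 by blast
      from bspec[OF R3 this] show ?case by (simp add: eval_ecoas)
    qed
  next
    assume ?C
    then show "\<forall>(d, e)\<in>two_tri_rels I M. eval F d = eval F e"
      unfolding two_tri_rels_def two_tri_def by (clarsimp simp: eval_ecoas)
  qed
  ultimately show ?thesis
    using F by (auto simp: is_model_def ball_Un)
qed

lemma premodel_FamI:
  assumes "\<And>j. j \<in> I \<Longrightarrow> category (base (M j))" "is_functor (prod_cat I (bases M)) P F"
    "\<And>j x t. \<lbrakk>j \<in> I; x \<in> Obj (prod_cat (I - {j}) (bases M)); t \<in> lab (M j)\<rbrakk> \<Longrightarrow>
      lb F (j, x, t) \<in> Hom P (fob F (x(j := lz (M j) t)) \<boxplus> fob F (x(j := lx (M j) t))) (fob F (x(j := ly (M j) t)))"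
  shows "premodel (Fam I M) F"
  using assms by (auto simp: premodel_def)

lemma premodel_fslice:
  assumes M: "\<And>j. j \<in> I \<Longrightarrow> wf_pres (M j)" and F: "premodel (Fam I M) F" and j: "j \<in> I"
    and x: "x \<in> Obj (prod_cat (I - {j}) (bases M))"
  shows "premodel (M j) (fslice I M j x F)"
proof -
  let ?K = "prod_cat (I - {j}) (bases M)"
  have K: "cat_axioms ?K"
    unfolding cat_axioms_def by (rule category_prod_cat) (use M in \<open>auto simp: wf_pres_def\<close>)
  note Mj = wf_presD(1)[OF M[OF j]]
  note [simp] = cat_axioms.Src_Obj[OF Mj] cat_axioms.Tgt_Obj[OF Mj] cat_axioms.Idn_Arr[OF Mj] cat_axioms.Src_Idn[OF Mj]
    cat_axioms.Tgt_Idn[OF Mj] wf_presD(2-4)[OF M[OF j]]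
    cat_axioms.Idn_Arr[OF K] cat_axioms.Src_Idn[OF K] cat_axioms.Tgt_Idn[OF K] cat_axioms.Idn_Cmp[OF K]
  note F' = premodelD[OF F, simplified]
  have "far F ((Idn ?K x)(j := Cmp (base (M j)) g f)) = far F ((Idn ?K x)(j := g)) \<cdot> far F ((Idn ?K x)(j := f))"
    if "f \<in> Arr (base (M j))" "g \<in> Arr (base (M j))" "Src (base (M j)) g = Tgt (base (M j)) f" for f g
  proof -
    have "far F (Cmp (prod_cat I (bases M)) ((Idn ?K x)(j := g)) ((Idn ?K x)(j := f))) = far F ((Idn ?K x)(j := g)) \<cdot> far F ((Idn ?K x)(j := f))"
      using that j x by (intro F'(6)) (simp_all add: Src_upd Tgt_upd upd_Arr)
    then show ?thesis using j x by (simp add: Cmp_upd)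
  qed
  then show ?thesis
    using category M[OF j] j x F'(5)[of "x(j := _)"]
    by (simp add: premodel_def is_functor_def wf_pres_def F'(1-4,7-9) upd_Obj upd_Arr Src_upd Tgt_upd at_place_def Idn_upd)
qed

text \<open>Composing with a \<open>coas\<close> cancels the one in the axiom and leaves its inverse
  on the other side, which is the axiom for the opposite order. So it makes no difference whether
  the axiom is imposed for \<open>i < j\<close> or for all distinct places.\<close>

lemma two_tri_swap:
  assumes M: "\<And>j. j \<in> I \<Longrightarrow> wf_pres (M j)" and F: "premodel (Fam I M) F" and ij: "i \<in> I" "j \<in> I" "i \<noteq> j"
    and t: "two_tri I M i j F"
  shows "two_tri I M j i F"
  unfolding two_tri_def
proof (intro ballI)
  fix x t s assume x: "x \<in> Obj (prod_cat (I - {j, i}) (bases M))" and t: "t \<in> lab (M j)" and s: "s \<in> lab (M i)"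
  have [simp]: "I - {j, i} = I - {i, j}" by auto
  have tw [simp]: "x(j := a, i := b) = x(i := b, j := a)" for a b
    using ij by (simp add: fun_upd_twist)
  have [simp]: "x(i := a) \<in> Obj (prod_cat (I - {j}) (bases M))" if "a \<in> Obj (base (M i))" for a
    using x ij that by (auto simp: Obj_prod_cat PiE_iff extensional_def)
  have [simp]: "x(j := a) \<in> Obj (prod_cat (I - {i}) (bases M))" if "a \<in> Obj (base (M j))" for a
    using x ij that by (auto simp: Obj_prod_cat PiE_iff extensional_def)
  have [simp]: "x(i := a, j := b) \<in> Obj (prod_cat I (bases M))" if "a \<in> Obj (base (M i))" "b \<in> Obj (base (M j))" for a b
    using ij that by (simp add: upd_Obj)
  note [simp] = wf_presD(2-4)[OF M[OF ij(1)] s] wf_presD(2-4)[OF M[OF ij(2)] t] premodelD[OF F, simplified]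
  let ?c = "coas P (fob F (x(i := lz (M i) s, j := lz (M j) t))) (fob F (x(i := lz (M i) s, j := lx (M j) t)))
    (fob F (x(i := lx (M i) s, j := lz (M j) t))) (fob F (x(i := lx (M i) s, j := lx (M j) t)))"
  have "(lb F (j, x(i := ly (M i) s), t) \<cdot> (lb F (i, x(j := lz (M j) t), s) [+] lb F (i, x(j := lx (M j) t), s))) \<cdot> ?c =
    (lb F (i, x(j := ly (M j) t), s) \<cdot> ((lb F (j, x(i := lz (M i) s), t) [+] lb F (j, x(i := lx (M i) s), t)) \<cdot>
      coas P (fob F (x(i := lz (M i) s, j := lz (M j) t))) (fob F (x(i := lx (M i) s, j := lz (M j) t)))
        (fob F (x(i := lz (M i) s, j := lx (M j) t))) (fob F (x(i := lx (M i) s, j := lx (M j) t))))) \<cdot> ?c"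
    using \<open>two_tri I M i j F\<close> x s t unfolding two_tri_def by simp
  then show "lb F (i, x(j := ly (M j) t), s) \<cdot> (lb F (j, x(i := lz (M i) s), t) [+] lb F (j, x(i := lx (M i) s), t)) =
    lb F (j, x(i := ly (M i) s), t) \<cdot> ((lb F (i, x(j := lz (M j) t), s) [+] lb F (i, x(j := lx (M j) t), s)) \<cdot>
      coas P (fob F (x(j := lz (M j) t, i := lz (M i) s))) (fob F (x(j := lx (M j) t, i := lz (M i) s)))
        (fob F (x(j := lz (M j) t, i := lx (M i) s))) (fob F (x(j := lx (M j) t, i := lx (M i) s))))"
    using ij s t by (simp add: Cmp_assoc)
qed

end

lemma restrict_prod_cat: "x \<in> Obj (prod_cat J C) \<Longrightarrow> restrict x J = x" "g \<in> Arr (prod_cat J C) \<Longrightarrow> restrict g J = g"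
  by (auto simp: Obj_prod_cat Arr_prod_cat PiE_iff extensional_restrict)

section \<open>Congruence, pullback and composition for models in two variables\<close>

context sym_gpd
begin

definition beq :: "('r, 'g, 'u) pres \<Rightarrow> ('o, 'm, 't) pres \<Rightarrow> ('r, 'g, 'u, 'o, 'm, 't, 'p, 'q) bidata \<Rightarrow>
    ('r, 'g, 'u, 'o, 'm, 't, 'p, 'q) bidata \<Rightarrow> bool" where
  "beq R S B B' \<longleftrightarrow> (\<forall>r\<in>Obj (base R). meq S (cD B r) (cD B' r)) \<and>
    (\<forall>g\<in>Arr (base R). \<forall>s\<in>Obj (base S). cA B g s = cA B' g s) \<and>
    (\<forall>u\<in>lab R. \<forall>s\<in>Obj (base S). cL B u s = cL B' u s)"

lemma beq_sym: "beq R S B B' \<Longrightarrow> beq R S B' B"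
  by (auto simp: beq_def meq_def)

lemma beq_refl [simp]: "beq R S B B"
  by (simp add: beq_def)

lemma beq_csl: "beq R S B B' \<Longrightarrow> s \<in> Obj (base S) \<Longrightarrow> meq R (csl B s) (csl B' s)"
  by (simp add: beq_def meq_def)

lemma bimor_cong:
  assumes R: "wf_pres R" and S: "wf_pres S" and "beq R S B B'" "beq R S D D'"
    and "\<And>r s. \<lbrakk>r \<in> Obj (base R); s \<in> Obj (base S)\<rbrakk> \<Longrightarrow> \<theta> r s = \<theta>' r s"
    and "bimor R S B D \<theta>"
  shows "bimor R S B' D' \<theta>'"
  unfolding bimor_def
proof (intro conjI ballI)
  fix r assume r: "r \<in> Obj (base R)"
  show "mor S (cD B' r) (cD D' r) (\<theta>' r)"
    by (rule mor_cong[OF S, of "cD B r" _ "cD D r" _ "\<theta> r"]) (use r assms in \<open>auto simp: beq_def bimor_def\<close>)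
next
  fix s assume s: "s \<in> Obj (base S)"
  show "mor R (csl B' s) (csl D' s) (\<lambda>r. \<theta>' r s)"
    by (rule mor_cong[OF R, of "csl B s" _ "csl D s" _ "\<lambda>r. \<theta> r s"]) (use s assms in \<open>auto simp: beq_csl bimor_def\<close>)
qed

lemma bimodel_cong:
  assumes R: "wf_pres R" and S: "wf_pres S" and BB: "beq R S B B'" and B: "bimodel R S B"
  shows "bimodel R S B'"
  unfolding bimodel_def prebimodel_def
proof (intro conjI ballI)
  have eq: "meq S (cD B r) (cD B' r)" if "r \<in> Obj (base R)" for r
    using BB that by (simp add: beq_def)
  fix r assume "r \<in> Obj (base R)"
  with B show "is_model S (cD B' r)"
    by (intro is_model_cong[OF S eq]) (auto simp: bimodel_def prebimodel_def)
next
  fix s assume s: "s \<in> Obj (base S)"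
  with B show "is_model R (csl B' s)"
    by (intro is_model_cong[OF R beq_csl[OF BB s]]) (auto simp: bimodel_def)
  then show "premodel R (csl B' s)" by (rule is_modelD)
next
  have eq: "meq S (cD B r) (cD B' r)" if "r \<in> Obj (base R)" for r
    using BB that by (simp add: beq_def)
  {
    fix g assume g: "g \<in> Arr (base R)"
    show "mor S (cD B' (Src (base R) g)) (cD B' (Tgt (base R) g)) (cA B' g)"
      by (rule mor_cong[OF S eq eq, where \<theta> = "cA B g"])
        (use g B BB in \<open>auto simp: beq_def bimodel_def prebimodel_def X_simps[OF R]\<close>)
  next
    fix u assume u: "u \<in> lab R"
    show "mor S (psum S (cD B' (lz R u)) (cD B' (lx R u))) (cD B' (ly R u)) (cL B' u)"
      by (rule mor_cong[OF S psum_cong[OF S eq eq] eq, where \<theta> = "cL B u"])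
        (use u B BB in \<open>auto simp: beq_def bimodel_def prebimodel_def X_simps[OF R]\<close>)
  }
qed

lemma bimor_pull:
  assumes R: "wf_pres R" and S: "wf_pres S" and Y: "wf_pres Y" and q: "pequiv S Y q"
    and F: "bimodel R Y F" and G: "bimodel R Y G" and \<theta>: "bimor R Y F G \<theta>"
  shows "bimor R S (bpull q F) (bpull q G) (\<lambda>r s. \<theta> r (fob q s))"
  unfolding bimor_def
proof (intro conjI ballI)
  fix r assume "r \<in> Obj (base R)"
  with F G \<theta> show "mor S (cD (bpull q F) r) (cD (bpull q G) r) (\<lambda>s. \<theta> r (fob q s))"
    by (simp, intro mor_pull[OF S Y pequivD(1)[OF q]]) (auto simp: bimor_def bimodel_def prebimodel_def is_modelD)
next
  fix s assume "s \<in> Obj (base S)"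
  with \<theta> wf_pmapD(1)[OF pequivD(1)[OF q]] show "mor R (csl (bpull q F) s) (csl (bpull q G) s) (\<lambda>r. \<theta> r (fob q s))"
    by (simp add: bimor_def)
qed

lemma bimor_comp:
  assumes R: "wf_pres R" and S: "wf_pres S" and F: "bimodel R S F" and G: "bimodel R S G" and H: "bimodel R S H"
    and "bimor R S F G \<theta>" "bimor R S G H \<eta>"
  shows "bimor R S F H (\<lambda>r s. \<eta> r s \<cdot> \<theta> r s)"
  unfolding bimor_def
proof (intro conjI ballI)
  fix r assume "r \<in> Obj (base R)"
  with assms show "mor S (cD F r) (cD H r) (\<lambda>s. \<eta> r s \<cdot> \<theta> r s)"
    by (intro mor_comp[OF S, where G = "cD G r"]) (auto simp: bimor_def bimodel_def prebimodel_def is_modelD)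
next
  fix s assume "s \<in> Obj (base S)"
  with assms show "mor R (csl F s) (csl H s) (\<lambda>r. \<eta> r s \<cdot> \<theta> r s)"
    by (intro mor_comp[OF R, where G = "csl G s"]) (auto simp: bimor_def bimodel_def is_modelD)
qed

text \<open>Splits off place \<open>i\<close>: it becomes the second variable, and the family of the
  other places becomes the first.\<close>

definition tob :: "'i set \<Rightarrow> ('i \<Rightarrow> ('o, 'm, 't) pres) \<Rightarrow> 'i \<Rightarrow>
    ('i \<Rightarrow> 'o, 'i \<Rightarrow> 'm, 'i \<times> ('i \<Rightarrow> 'o) \<times> 't, 'p, 'q) model \<Rightarrow>
    ('i \<Rightarrow> 'o, 'i \<Rightarrow> 'm, 'i \<times> ('i \<Rightarrow> 'o) \<times> 't, 'o, 'm, 't, 'p, 'q) bidata" where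
  "tob I M i F = \<lparr>cD = (\<lambda>x. fslice I M i x F), cA = (\<lambda>g a. far F (g(i := Idn (base (M i)) a))),
     cL = (\<lambda>(j, x, t) a. lb F (j, x(i := a), t))\<rparr>"

lemma tob_sel [simp]: "cD (tob I M i F) x = fslice I M i x F" "cA (tob I M i F) g a = far F (g(i := Idn (base (M i)) a))"
  "cL (tob I M i F) (j, x, t) a = lb F (j, x(i := a), t)"
  by (simp_all add: tob_def)

section \<open>Models of a family as models in two variables\<close>

context
  fixes i :: 'i and J :: "'i set" and M :: "'i \<Rightarrow> ('o, 'm, 't) pres"
  assumes iJ: "i \<notin> J" and M: "\<And>j. j \<in> insert i J \<Longrightarrow> wf_pres (M j)"
begin

lemma wf_J: "wf_pres (Fam J M)"
  using M by (auto intro!: wf_Fam)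

lemma i_neq: "j \<in> J \<Longrightarrow> i \<noteq> j" "j \<in> J \<Longrightarrow> j \<noteq> i"
  using iJ by auto

lemma I_minus: "insert i J - {i} = J" "j \<in> J \<Longrightarrow> (insert i J) - {j} = insert i (J - {j})" "insert i (J - {j}) - {i} = J - {j}"
    "j \<in> J \<Longrightarrow> k \<in> J \<Longrightarrow> (insert i J) - {j, k} = insert i (J - {j, k})"
    "j \<in> J \<Longrightarrow> (insert i J) - {i, j} = J - {j}" "j \<in> J \<Longrightarrow> (insert i J) - {j, i} = J - {j}"
    "insert i (J - {j, k}) - {i} = J - {j, k}" "J - {i, j} = J - {j}" "J - {j, i} = J - {j}"
  using iJ by auto

lemma upd_i_last: "j \<in> J \<Longrightarrow> f(j := b, i := a) = f(i := a, j := b)"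
  using iJ by (auto simp: fun_upd_twist)

lemma catI: "j \<in> insert i J \<Longrightarrow> cat_axioms (base (M j))"
  using M wf_presD(1) by blast

lemma cat_prod_sub: "K \<subseteq> (insert i J) \<Longrightarrow> cat_axioms (prod_cat K (bases M))"
  unfolding cat_axioms_def by (rule category_prod_cat) (use M in \<open>auto simp: wf_pres_def\<close>)

lemmas fam_simps =
  cat_axioms.Src_Obj[OF catI] cat_axioms.Tgt_Obj[OF catI] cat_axioms.Idn_Arr[OF catI] cat_axioms.Src_Idn[OF catI]
  cat_axioms.Tgt_Idn[OF catI] cat_axioms.Cmp_Idn[OF catI] cat_axioms.Idn_Cmp[OF catI] wf_presD(2-4)[OF M]
  cat_axioms.Src_Obj[OF cat_prod_sub] cat_axioms.Tgt_Obj[OF cat_prod_sub] cat_axioms.Idn_Arr[OF cat_prod_sub]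
  cat_axioms.Src_Idn[OF cat_prod_sub] cat_axioms.Tgt_Idn[OF cat_prod_sub] cat_axioms.Cmp_Idn[OF cat_prod_sub]
  cat_axioms.Idn_Cmp[OF cat_prod_sub]
  upd_Obj upd_Obj_insert upd_Arr upd_Arr_insert Src_upd Tgt_upd Idn_upd Cmp_upd I_minus i_neq at_place_def

text \<open>Moving place \<open>i\<close> and moving the other places commute in the product
  category, and both composites are the joint move.\<close>

lemma far_split:
  assumes F: "premodel (Fam (insert i J) M) F" and g: "g \<in> Arr (prod_cat J (bases M))" and f: "f \<in> Arr (base (M i))"
  shows "far F (at_place (insert i J) (bases M) (Tgt (prod_cat J (bases M)) g) i f) \<cdot> far F (g(i := Idn (base (M i)) (Src (base (M i)) f))) = far F (g(i := f))"
    and "far F (g(i := Idn (base (M i)) (Tgt (base (M i)) f))) \<cdot> far F (at_place (insert i J) (bases M) (Src (prod_cat J (bases M)) g) i f) = far F (g(i := f))"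
proof -
  note F' = premodelD(6)[OF F, simplified, symmetric]
  have [simp]: "J \<subseteq> insert i J" by blast
  note [simp] = fam_simps
  show "far F (at_place (insert i J) (bases M) (Tgt (prod_cat J (bases M)) g) i f) \<cdot> far F (g(i := Idn (base (M i)) (Src (base (M i)) f))) = far F (g(i := f))"
    using g f by (subst F') simp_all
  show "far F (g(i := Idn (base (M i)) (Tgt (base (M i)) f))) \<cdot> far F (at_place (insert i J) (bases M) (Src (prod_cat J (bases M)) g) i f) = far F (g(i := f))"
    using g f by (subst F') simp_all
qed

lemma premodel_csl_tob:
  assumes F: "premodel (Fam (insert i J) M) F" and a: "a \<in> Obj (base (M i))"
  shows "premodel (Fam J M) (csl (tob (insert i J) M i F) a)"
proof -
  have [simp]: "J \<subseteq> insert i J" "J - K \<subseteq> insert i J" for K by auto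
  note [simp] = fam_simps premodelD(1-5,7-9)[OF F, simplified]
  have "far F ((Cmp (prod_cat J (bases M)) g f)(i := Idn (base (M i)) a)) =
      far F (g(i := Idn (base (M i)) a)) \<cdot> far F (f(i := Idn (base (M i)) a))"
    if "f \<in> Arr (prod_cat J (bases M))" "g \<in> Arr (prod_cat J (bases M))" "Src (prod_cat J (bases M)) g = Tgt (prod_cat J (bases M)) f" for f g
    using that a by (subst premodelD(6)[OF F, simplified, symmetric]) simp_all
  moreover have "far F ((Idn (prod_cat J (bases M)) x)(i := Idn (base (M i)) a)) = Idn P (fob F (x(i := a)))" if "x \<in> Obj (prod_cat J (bases M))" for x
    using that a premodelD(5)[OF F, of "x(i := a)", simplified] by simp
  ultimately show ?thesis
    using a category M cat_prod_sub[of J]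
    by (intro premodel_FamI) (auto simp: is_functor_def wf_pres_def cat_axioms_def upd_i_last)
qed

lemma fslice_csl_tob:
  assumes j: "j \<in> J"
  shows "fslice J M j x (csl (tob (insert i J) M i F) a) = fslice (insert i J) M j (x(i := a)) F"
proof -
  have [simp]: "J \<subseteq> insert i J" "J - K \<subseteq> insert i J" for K by auto
  note [simp] = I_minus i_neq at_place_def Idn_upd
  show ?thesis
    using j by (simp add: fslice_def csl_def upd_i_last)
qed

lemma tri_nat_csl_tob:
  assumes F: "premodel (Fam (insert i J) M) F" and j: "j \<in> J" and t: "tri_nat (insert i J) M j F" and a: "a \<in> Obj (base (M i))"
  shows "tri_nat J M j (csl (tob (insert i J) M i F) a)"
  unfolding tri_nat_def
proof (intro ballI)
  have [simp]: "J \<subseteq> insert i J" "J - K \<subseteq> insert i J" for K by auto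
  note [simp] = fam_simps
  fix g t assume gt: "g \<in> Arr (prod_cat (J - {j}) (bases M))" "t \<in> lab (M j)"
  have "g(i := Idn (base (M i)) a) \<in> Arr (prod_cat ((insert i J) - {j}) (bases M))"
    using gt j a by simp
  from t[unfolded tri_nat_def, rule_format, OF this gt(2)]
  show "far (csl (tob (insert i J) M i F) a) (g(j := Idn (base (M j)) (ly (M j) t))) \<cdot> lb (csl (tob (insert i J) M i F) a) (j, Src (prod_cat (J - {j}) (bases M)) g, t) =
    lb (csl (tob (insert i J) M i F) a) (j, Tgt (prod_cat (J - {j}) (bases M)) g, t) \<cdot>
      (far (csl (tob (insert i J) M i F) a) (g(j := Idn (base (M j)) (lz (M j) t))) [+] far (csl (tob (insert i J) M i F) a) (g(j := Idn (base (M j)) (lx (M j) t))))"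
    using j gt a by (simp add: upd_i_last)
qed

lemma two_tri_csl_tob:
  assumes j: "j \<in> J" and k: "k \<in> J" and jk: "j \<noteq> k" and t: "two_tri (insert i J) M j k F" and a: "a \<in> Obj (base (M i))"
  shows "two_tri J M j k (csl (tob (insert i J) M i F) a)"
  unfolding two_tri_def
proof (intro ballI)
  fix x s t assume x: "x \<in> Obj (prod_cat (J - {j, k}) (bases M))" and st: "s \<in> lab (M j)" "t \<in> lab (M k)"
  have "x(i := a) \<in> Obj (prod_cat ((insert i J) - {j, k}) (bases M))"
    using x j k a by (simp add: I_minus upd_Obj_insert)
  from t[unfolded two_tri_def, rule_format, OF this st]
  show "lb (csl (tob (insert i J) M i F) a) (k, x(j := ly (M j) s), t) \<cdot> (lb (csl (tob (insert i J) M i F) a) (j, x(k := lz (M k) t), s) [+] lb (csl (tob (insert i J) M i F) a) (j, x(k := lx (M k) t), s)) =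
    lb (csl (tob (insert i J) M i F) a) (j, x(k := ly (M k) t), s) \<cdot> ((lb (csl (tob (insert i J) M i F) a) (k, x(j := lz (M j) s), t) [+] lb (csl (tob (insert i J) M i F) a) (k, x(j := lx (M j) s), t)) \<cdot>
      coas P (fob (csl (tob (insert i J) M i F) a) (x(j := lz (M j) s, k := lz (M k) t))) (fob (csl (tob (insert i J) M i F) a) (x(j := lx (M j) s, k := lz (M k) t)))
        (fob (csl (tob (insert i J) M i F) a) (x(j := lz (M j) s, k := lx (M k) t))) (fob (csl (tob (insert i J) M i F) a) (x(j := lx (M j) s, k := lx (M k) t))))"
    using j k by (simp add: upd_i_last)
qed

text \<open>The dictionary for a triangle in place \<open>j\<close> acting on models in place
  \<open>i\<close>: its naturality for arrows is triangle-function, its compatibility with labels is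
  two-triangles.\<close>

lemma mor_cL_tob:
  assumes F: "premodel (Fam (insert i J) M) F" and j: "j \<in> J" and x: "x \<in> Obj (prod_cat (J - {j}) (bases M))" and t: "t \<in> lab (M j)"
  shows "mor (M i) (psum (M i) (cD (tob (insert i J) M i F) (x(j := lz (M j) t))) (cD (tob (insert i J) M i F) (x(j := lx (M j) t))))
      (cD (tob (insert i J) M i F) (x(j := ly (M j) t))) (cL (tob (insert i J) M i F) (j, x, t)) \<longleftrightarrow>
    (\<forall>f\<in>Arr (base (M i)). far F ((Idn (prod_cat (J - {j}) (bases M)) x)(i := f, j := Idn (base (M j)) (ly (M j) t))) \<cdot>
        lb F (j, x(i := Src (base (M i)) f), t) = lb F (j, x(i := Tgt (base (M i)) f), t) \<cdot>
        (far F ((Idn (prod_cat (J - {j}) (bases M)) x)(i := f, j := Idn (base (M j)) (lz (M j) t))) [+]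
         far F ((Idn (prod_cat (J - {j}) (bases M)) x)(i := f, j := Idn (base (M j)) (lx (M j) t))))) \<and>
    (\<forall>s\<in>lab (M i). lb F (j, x(i := ly (M i) s), t) \<cdot> ((lb F (i, x(j := lz (M j) t), s) [+] lb F (i, x(j := lx (M j) t), s)) \<cdot>
      coas P (fob F (x(i := lz (M i) s, j := lz (M j) t))) (fob F (x(i := lz (M i) s, j := lx (M j) t)))
        (fob F (x(i := lx (M i) s, j := lz (M j) t))) (fob F (x(i := lx (M i) s, j := lx (M j) t)))) =
      lb F (i, x(j := ly (M j) t), s) \<cdot> (lb F (j, x(i := lz (M i) s), t) [+] lb F (j, x(i := lx (M i) s), t)))"
proof -
  have [simp]: "J \<subseteq> insert i J" "J - K \<subseteq> insert i J" for K by auto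
  note [simp] = fam_simps premodelD(1-5,7-9)[OF F, simplified]
  show ?thesis
    using j x t by (simp add: mor_def lb_psum upd_i_last)
qed

lemma coas_swap_eq:
  assumes [simp]: "a \<in> Obj P" "b \<in> Obj P" "c \<in> Obj P" "d \<in> Obj P" "f \<in> Arr P" "g \<in> Arr P"
    "Src P f = (a \<boxplus> b) \<boxplus> (c \<boxplus> d)" "Src P g = (a \<boxplus> c) \<boxplus> (b \<boxplus> d)"
  shows "f \<cdot> coas P a c b d = g \<longleftrightarrow> f = g \<cdot> coas P a b c d"
  by (auto simp: Cmp_assoc)

lemma two_tri_tob_iff:
  assumes F: "premodel (Fam (insert i J) M) F" and j: "j \<in> J"
  shows "two_tri (insert i J) M i j F \<longleftrightarrow> (\<forall>x\<in>Obj (prod_cat (J - {j}) (bases M)). \<forall>t\<in>lab (M j). \<forall>s\<in>lab (M i).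
      lb F (j, x(i := ly (M i) s), t) \<cdot> ((lb F (i, x(j := lz (M j) t), s) [+] lb F (i, x(j := lx (M j) t), s)) \<cdot>
      coas P (fob F (x(i := lz (M i) s, j := lz (M j) t))) (fob F (x(i := lz (M i) s, j := lx (M j) t)))
        (fob F (x(i := lx (M i) s, j := lz (M j) t))) (fob F (x(i := lx (M i) s, j := lx (M j) t)))) =
      lb F (i, x(j := ly (M j) t), s) \<cdot> (lb F (j, x(i := lz (M i) s), t) [+] lb F (j, x(i := lx (M i) s), t)))"
proof -
  have [simp]: "J \<subseteq> insert i J" "J - K \<subseteq> insert i J" for K by auto
  note [simp] = fam_simps premodelD(1-5,7-9)[OF F, simplified]
  have "(lb F (j, x(i := ly (M i) s), t) \<cdot> (lb F (i, x(j := lz (M j) t), s) [+] lb F (i, x(j := lx (M j) t), s)) =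
    lb F (i, x(j := ly (M j) t), s) \<cdot> ((lb F (j, x(i := lz (M i) s), t) [+] lb F (j, x(i := lx (M i) s), t)) \<cdot>
      coas P (fob F (x(i := lz (M i) s, j := lz (M j) t))) (fob F (x(i := lx (M i) s, j := lz (M j) t)))
        (fob F (x(i := lz (M i) s, j := lx (M j) t))) (fob F (x(i := lx (M i) s, j := lx (M j) t))))) \<longleftrightarrow>
    (lb F (j, x(i := ly (M i) s), t) \<cdot> ((lb F (i, x(j := lz (M j) t), s) [+] lb F (i, x(j := lx (M j) t), s)) \<cdot>
      coas P (fob F (x(i := lz (M i) s, j := lz (M j) t))) (fob F (x(i := lz (M i) s, j := lx (M j) t)))
        (fob F (x(i := lx (M i) s, j := lz (M j) t))) (fob F (x(i := lx (M i) s, j := lx (M j) t)))) =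
      lb F (i, x(j := ly (M j) t), s) \<cdot> (lb F (j, x(i := lz (M i) s), t) [+] lb F (j, x(i := lx (M i) s), t)))"
    if "x \<in> Obj (prod_cat (J - {j}) (bases M))" "t \<in> lab (M j)" "s \<in> lab (M i)" for x s t
    using that j coas_swap_eq[of "fob F (x(i := lz (M i) s, j := lz (M j) t))" "fob F (x(i := lx (M i) s, j := lz (M j) t))"
        "fob F (x(i := lz (M i) s, j := lx (M j) t))" "fob F (x(i := lx (M i) s, j := lx (M j) t))"
        "lb F (j, x(i := ly (M i) s), t) \<cdot> (lb F (i, x(j := lz (M j) t), s) [+] lb F (i, x(j := lx (M j) t), s))"
        "lb F (i, x(j := ly (M j) t), s) \<cdot> (lb F (j, x(i := lz (M i) s), t) [+] lb F (j, x(i := lx (M i) s), t))"]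
    by (simp add: Cmp_assoc upd_i_last)
  then show ?thesis
    unfolding two_tri_def using j by (auto simp: I_minus)
qed


text \<open>The relations of the family are sorted by their use of place \<open>i\<close>. Those of
  place \<open>i\<close> alone are the relations of \<open>cD\<close>, those among the other places
  are the relations of \<open>csl\<close>, and the mixed ones say that \<open>cA\<close> and
  \<open>cL\<close> consist of morphisms of models.\<close>

lemma bimodel_tob_iff:
  assumes F: "premodel (Fam (insert i J) M) F"
  shows "bimodel (Fam J M) (M i) (tob (insert i J) M i F) \<longleftrightarrow> is_model (Fam (insert i J) M) F"
proof
  have [simp]: "J \<subseteq> insert i J" "J - K \<subseteq> insert i J" for K by auto
  note pc = premodel_csl_tob[OF F]
  {
    assume "is_model (Fam (insert i J) M) F"
    note FI = this[unfolded is_model_Fam_iff[OF F]]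
    then have sl: "\<And>j x d e. \<lbrakk>j \<in> insert i J; x \<in> Obj (prod_cat ((insert i J) - {j}) (bases M)); (d, e) \<in> rels (M j)\<rbrakk> \<Longrightarrow>
        eval (fslice (insert i J) M j x F) d = eval (fslice (insert i J) M j x F) e"
      and tn: "\<And>j. j \<in> insert i J \<Longrightarrow> tri_nat (insert i J) M j F" and tt: "\<And>j k. \<lbrakk>j \<in> insert i J; k \<in> insert i J; j \<noteq> k\<rbrakk> \<Longrightarrow> two_tri (insert i J) M j k F"
      by blast+
    show "bimodel (Fam J M) (M i) (tob (insert i J) M i F)"
      unfolding bimodel_def prebimodel_def
    proof (intro conjI ballI)
      fix x assume "x \<in> Obj (base (Fam J M))"
      then have x: "x \<in> Obj (prod_cat ((insert i J) - {i}) (bases M))" by (simp add: I_minus)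
      then show "is_model (M i) (cD (tob (insert i J) M i F) x)"
        using premodel_fslice[OF M F, of i x] sl[of i x] by (auto simp: is_model_def)
    next
      fix a assume a: "a \<in> Obj (base (M i))"
      show "premodel (Fam J M) (csl (tob (insert i J) M i F) a)" by (rule pc[OF a])
      show "is_model (Fam J M) (csl (tob (insert i J) M i F) a)"
        unfolding is_model_Fam_iff[OF pc[OF a]]
        using a sl tri_nat_csl_tob[OF F _ tn a] two_tri_csl_tob[OF _ _ _ tt a]
        by (auto simp: fslice_csl_tob I_minus upd_Obj_insert)
    next
      fix g assume "g \<in> Arr (base (Fam J M))"
      then have g: "g \<in> Arr (prod_cat J (bases M))" by simp
      have "far (fslice (insert i J) M i (Tgt (prod_cat J (bases M)) g) F) f \<cdot> far F (g(i := Idn (base (M i)) (Src (base (M i)) f))) =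
          far F (g(i := Idn (base (M i)) (Tgt (base (M i)) f))) \<cdot> far (fslice (insert i J) M i (Src (prod_cat J (bases M)) g) F) f"
        if "f \<in> Arr (base (M i))" for f
        using far_split[OF F g that] by simp
      moreover have "far F (g(i := Idn (base (M i)) (ly (M i) t))) \<cdot> lb F (i, Src (prod_cat J (bases M)) g, t) =
          lb F (i, Tgt (prod_cat J (bases M)) g, t) \<cdot> (far F (g(i := Idn (base (M i)) (lz (M i) t))) [+] far F (g(i := Idn (base (M i)) (lx (M i) t))))"
        if "t \<in> lab (M i)" for t
        using tn[of i] g that by (simp add: tri_nat_def I_minus)
      ultimately show "mor (M i) (cD (tob (insert i J) M i F) (Src (base (Fam J M)) g)) (cD (tob (insert i J) M i F) (Tgt (base (Fam J M)) g)) (cA (tob (insert i J) M i F) g)"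
        using g by (simp add: mor_def fam_simps premodelD(1-5,7-9)[OF F, simplified])
    next
      fix u assume "u \<in> lab (Fam J M)"
      then obtain j x t where u: "u = (j, x, t)" and j: "j \<in> J" and x: "x \<in> Obj (prod_cat (J - {j}) (bases M))" and t: "t \<in> lab (M j)"
        by auto
      show "mor (M i) (psum (M i) (cD (tob (insert i J) M i F) (lz (Fam J M) u)) (cD (tob (insert i J) M i F) (lx (Fam J M) u)))
           (cD (tob (insert i J) M i F) (ly (Fam J M) u)) (cL (tob (insert i J) M i F) u)"
        unfolding u Fam_sel mor_cL_tob[OF F j x t]
      proof (intro conjI ballI)
        fix f assume f: "f \<in> Arr (base (M i))"
        have "(Idn (prod_cat (J - {j}) (bases M)) x)(i := f) \<in> Arr (prod_cat ((insert i J) - {j}) (bases M))"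
          using f x j by (simp add: fam_simps)
        from tn[of j, unfolded tri_nat_def, rule_format, OF _ this t]
        show "far F ((Idn (prod_cat (J - {j}) (bases M)) x)(i := f, j := Idn (base (M j)) (ly (M j) t))) \<cdot>
          lb F (j, x(i := Src (base (M i)) f), t) = lb F (j, x(i := Tgt (base (M i)) f), t) \<cdot>
          (far F ((Idn (prod_cat (J - {j}) (bases M)) x)(i := f, j := Idn (base (M j)) (lz (M j) t))) [+]
           far F ((Idn (prod_cat (J - {j}) (bases M)) x)(i := f, j := Idn (base (M j)) (lx (M j) t))))"
          using x j f by (simp add: fam_simps)
      qed (use two_tri_tob_iff[OF F j] tt[of i j] j x t i_neq in auto)
    qed
  next
    assume B: "bimodel (Fam J M) (M i) (tob (insert i J) M i F)"
    then have D: "\<And>x. x \<in> Obj (prod_cat J (bases M)) \<Longrightarrow> is_model (M i) (fslice (insert i J) M i x F)"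
      and c: "\<And>a. a \<in> Obj (base (M i)) \<Longrightarrow> is_model (Fam J M) (csl (tob (insert i J) M i F) a)"
      and A: "\<And>g. g \<in> Arr (prod_cat J (bases M)) \<Longrightarrow> mor (M i) (fslice (insert i J) M i (Src (prod_cat J (bases M)) g) F)
          (fslice (insert i J) M i (Tgt (prod_cat J (bases M)) g) F) (cA (tob (insert i J) M i F) g)"
      by (simp_all add: bimodel_def prebimodel_def)
    have L: "mor (M i) (psum (M i) (cD (tob (insert i J) M i F) (x(j := lz (M j) t))) (cD (tob (insert i J) M i F) (x(j := lx (M j) t))))
      (cD (tob (insert i J) M i F) (x(j := ly (M j) t))) (cL (tob (insert i J) M i F) (j, x, t))"
      if "j \<in> J" "x \<in> Obj (prod_cat (J - {j}) (bases M))" "t \<in> lab (M j)" for j x t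
      using B that by (force simp: bimodel_def prebimodel_def)
    note c' = iffD1[OF is_model_Fam_iff[OF pc] c]
    note L' = mor_cL_tob[OF F, THEN iffD1, OF _ _ _ L]
    have tt_i: "two_tri (insert i J) M i j F" if j: "j \<in> J" for j
      unfolding two_tri_tob_iff[OF F j] using L' j by blast
    have slJ: "eval (fslice (insert i J) M j y F) d = eval (fslice (insert i J) M j y F) e"
      if j: "j \<in> J" and y: "y \<in> Obj (prod_cat ((insert i J) - {j}) (bases M))" and de: "(d, e) \<in> rels (M j)" for j y d e
    proof -
      from y j obtain x a where y: "y = x(i := a)" "x \<in> Obj (prod_cat (J - {j}) (bases M))" "a \<in> Obj (base (M i))"
        using iJ by (auto simp: I_minus elim: prod_Obj_split)
      then show ?thesis
        using c'[of a] j de by (fastforce simp: fslice_csl_tob)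
    qed
    have tnJ: "tri_nat (insert i J) M j F" if j: "j \<in> J" for j
      unfolding tri_nat_def
    proof (intro ballI)
      fix h t assume "h \<in> Arr (prod_cat ((insert i J) - {j}) (bases M))" and t: "t \<in> lab (M j)"
      then obtain g f where h: "h = g(i := f)" and g: "g \<in> Arr (prod_cat (J - {j}) (bases M))" and f: "f \<in> Arr (base (M i))"
        using iJ j by (auto simp: I_minus elim: prod_Arr_split)
      let ?K = "prod_cat (J - {j}) (bases M)" and ?s = "Src (base (M i)) f" and ?t = "Tgt (base (M i)) f"
      let ?x = "Src ?K g" and ?y = "Tgt ?K g"
      note [simp] = fam_simps premodelD(1-5,7-9)[OF F, simplified]
      \<comment> \<open>An arrow of the places other than \<open>j\<close> may move place
        \<open>i\<close> as well. It is factored into a move of the places in \<open>J\<close>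
        followed by a move of \<open>i\<close>; \<open>1\<close> and \<open>2\<close> treat the
        factors separately.\<close>
      have split: "far F (h(j := Idn (base (M j)) b)) =
          far F ((Idn ?K ?y)(i := f, j := Idn (base (M j)) b)) \<cdot> far F (g(i := Idn (base (M i)) ?s, j := Idn (base (M j)) b))"
        if "b \<in> Obj (base (M j))" for b
        using far_split(1)[OF F, of "g(j := Idn (base (M j)) b)" f] that j f g
        by (simp add: h upd_i_last)
      have 1: "far F (g(i := Idn (base (M i)) ?s, j := Idn (base (M j)) (ly (M j) t))) \<cdot> lb F (j, ?x(i := ?s), t) =
        lb F (j, ?y(i := ?s), t) \<cdot> (far F (g(i := Idn (base (M i)) ?s, j := Idn (base (M j)) (lz (M j) t))) [+]
          far F (g(i := Idn (base (M i)) ?s, j := Idn (base (M j)) (lx (M j) t))))"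
        using c'[of ?s] f g t j by (simp add: tri_nat_def upd_i_last)
      have 2: "far F ((Idn ?K ?y)(i := f, j := Idn (base (M j)) (ly (M j) t))) \<cdot>
          lb F (j, ?y(i := ?s), t) = lb F (j, ?y(i := ?t), t) \<cdot>
          (far F ((Idn ?K ?y)(i := f, j := Idn (base (M j)) (lz (M j) t))) [+]
           far F ((Idn ?K ?y)(i := f, j := Idn (base (M j)) (lx (M j) t))))"
        by (rule bspec[OF conjunct1[OF L'] f]) (use j t g in simp_all)
      show "far F (h(j := Idn (base (M j)) (ly (M j) t))) \<cdot> lb F (j, Src (prod_cat ((insert i J) - {j}) (bases M)) h, t) =
        lb F (j, Tgt (prod_cat ((insert i J) - {j}) (bases M)) h, t) \<cdot>
          (far F (h(j := Idn (base (M j)) (lz (M j) t))) [+] far F (h(j := Idn (base (M j)) (lx (M j) t))))"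
        using j f g t 1 2 by (simp add: split) (simp add: h Cmp_assoc interchange[symmetric] Cmp_reassoc[OF 2])
    qed
    show "is_model (Fam (insert i J) M) F"
      unfolding is_model_Fam_iff[OF F]
    proof (intro conjI ballI impI; (clarify)?)
      fix j x d e assume "j \<in> insert i J" "x \<in> Obj (prod_cat ((insert i J) - {j}) (bases M))" "(d, e) \<in> rels (M j)"
      then show "eval (fslice (insert i J) M j x F) d = eval (fslice (insert i J) M j x F) e"
        using slJ is_model_rels[OF D] by (cases "j = i") (auto simp: I_minus)
    next
      fix j assume "j \<in> insert i J"
      moreover have "tri_nat (insert i J) M i F"
        using morD(5)[OF A] by (simp add: tri_nat_def I_minus)
      ultimately show "tri_nat (insert i J) M j F" using tnJ by auto
    next
      fix j k assume jk: "j \<in> insert i J" "k \<in> insert i J" "j \<noteq> k"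
      show "two_tri (insert i J) M j k F"
      proof (cases "j = i \<or> k = i")
        case True
        then show ?thesis using jk tt_i two_tri_swap[OF M F _ _ _ tt_i] by auto
      next
        case False
        then have jk': "j \<in> J" "k \<in> J" using jk by auto
        show ?thesis
          unfolding two_tri_def
        proof (intro ballI)
          fix y s t assume "y \<in> Obj (prod_cat ((insert i J) - {j, k}) (bases M))" and st: "s \<in> lab (M j)" "t \<in> lab (M k)"
          then obtain x a where y: "y = x(i := a)" and x: "x \<in> Obj (prod_cat (J - {j, k}) (bases M))" and a: "a \<in> Obj (base (M i))"
            using iJ jk' by (auto simp: I_minus elim: prod_Obj_split)
          have "two_tri J M j k (csl (tob (insert i J) M i F) a)"
            using c'[OF a a] jk' jk by blast
          from this[unfolded two_tri_def, rule_format, OF x st]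
          show "lb F (k, y(j := ly (M j) s), t) \<cdot> (lb F (j, y(k := lz (M k) t), s) [+] lb F (j, y(k := lx (M k) t), s)) =
            lb F (j, y(k := ly (M k) t), s) \<cdot> ((lb F (k, y(j := lz (M j) s), t) [+] lb F (k, y(j := lx (M j) s), t)) \<cdot>
              coas P (fob F (y(j := lz (M j) s, k := lz (M k) t))) (fob F (y(j := lx (M j) s, k := lz (M k) t)))
                (fob F (y(j := lz (M j) s, k := lx (M k) t))) (fob F (y(j := lx (M j) s, k := lx (M k) t))))"
            using jk' by (simp add: y upd_i_last)
        qed
      qed
    qed
  }
qed


text \<open>Naturality for an arrow of the whole product follows from naturality for the two factors
  of \<open>far_split\<close>, and every label moves either place \<open>i\<close> or a place in
  \<open>J\<close>.\<close>

lemma bimor_tob_iff: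
  assumes F: "premodel (Fam (insert i J) M) F" and G: "premodel (Fam (insert i J) M) G"
  shows "bimor (Fam J M) (M i) (tob (insert i J) M i F) (tob (insert i J) M i G) (\<lambda>x a. \<theta> (x(i := a))) \<longleftrightarrow> mor (Fam (insert i J) M) F G \<theta>"
proof
  have [simp]: "J \<subseteq> insert i J" "J - K \<subseteq> insert i J" for K by auto
  note [simp] = fam_simps premodelD(1-5,7-9)[OF F, simplified] premodelD(1-5,7-9)[OF G, simplified]
  {
    assume B: "bimor (Fam J M) (M i) (tob (insert i J) M i F) (tob (insert i J) M i G) (\<lambda>x a. \<theta> (x(i := a)))"
    then have B1: "\<And>x. x \<in> Obj (prod_cat J (bases M)) \<Longrightarrow> mor (M i) (fslice (insert i J) M i x F) (fslice (insert i J) M i x G) (\<lambda>a. \<theta> (x(i := a)))"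
      and B2: "\<And>a. a \<in> Obj (base (M i)) \<Longrightarrow> mor (Fam J M) (csl (tob (insert i J) M i F) a) (csl (tob (insert i J) M i G) a) (\<lambda>x. \<theta> (x(i := a)))"
      by (auto simp: bimor_def)
    show "mor (Fam (insert i J) M) F G \<theta>"
      unfolding mor_def
    proof (intro conjI ballI)
      fix y assume "y \<in> Obj (base (Fam (insert i J) M))"
      then obtain x a where "y = x(i := a)" "x \<in> Obj (prod_cat J (bases M))" "a \<in> Obj (base (M i))"
        using iJ by (auto elim: prod_Obj_split)
      then show "\<theta> y \<in> Hom P (fob F y) (fob G y)"
        using morD(1-3)[OF B1, of x a] by simp
    next
      fix h assume "h \<in> Arr (base (Fam (insert i J) M))"
      then obtain g f where h: "h = g(i := f)" and g: "g \<in> Arr (prod_cat J (bases M))" and f: "f \<in> Arr (base (M i))"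
        using iJ by (auto elim: prod_Arr_split)
      let ?s = "Src (base (M i)) f" and ?t = "Tgt (base (M i)) f"
      let ?x = "Src (prod_cat J (bases M)) g" and ?y = "Tgt (prod_cat J (bases M)) g"
      have [simp]: "\<theta> (x(i := a)) \<in> Arr P" "Src P (\<theta> (x(i := a))) = fob F (x(i := a))" "Tgt P (\<theta> (x(i := a))) = fob G (x(i := a))"
        if "x \<in> Obj (prod_cat J (bases M))" "a \<in> Obj (base (M i))" for x a
        using that morD(1-3)[OF B1, of x a] by simp_all
      have 1: "far G (g(i := Idn (base (M i)) ?s)) \<cdot> \<theta> (?x(i := ?s)) = \<theta> (?y(i := ?s)) \<cdot> far F (g(i := Idn (base (M i)) ?s))"
        using morD(4)[OF B2, of ?s g] g f by simp
      have 2: "far G (at_place (insert i J) (bases M) ?y i f) \<cdot> \<theta> (?y(i := ?s)) = \<theta> (?y(i := ?t)) \<cdot> far F (at_place (insert i J) (bases M) ?y i f)"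
        using morD(4)[OF B1, of ?y f] g f by (simp del: at_place_def)
      show "far G h \<cdot> \<theta> (Src (base (Fam (insert i J) M)) h) = \<theta> (Tgt (base (Fam (insert i J) M)) h) \<cdot> far F h"
        using g f 1 2 unfolding h far_split(1)[OF F g f, symmetric] far_split(1)[OF G g f, symmetric]
        by (simp add: Cmp_assoc) (simp add: Cmp_assoc Cmp_reassoc[OF 2[simplified]])
    next
      fix u assume "u \<in> lab (Fam (insert i J) M)"
      then obtain j y t where u: "u = (j, y, t)" and j: "j \<in> insert i J" and y: "y \<in> Obj (prod_cat ((insert i J) - {j}) (bases M))" and t: "t \<in> lab (M j)"
        by auto
      show "\<theta> (ly (Fam (insert i J) M) u) \<cdot> lb F u = lb G u \<cdot> (\<theta> (lz (Fam (insert i J) M) u) [+] \<theta> (lx (Fam (insert i J) M) u))"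
      proof (cases "j = i")
        case True
        then show ?thesis using morD(5)[OF B1, of y t] y t by (simp add: u)
      next
        case False
        then have j': "j \<in> J" using j by simp
        then obtain x a where "y = x(i := a)" "x \<in> Obj (prod_cat (J - {j}) (bases M))" "a \<in> Obj (base (M i))"
          using y iJ by (auto elim: prod_Obj_split)
        then show ?thesis using morD(5)[OF B2, of a "(j, x, t)"] j' t by (simp add: u upd_i_last)
      qed
    qed
  next
    assume \<theta>: "mor (Fam (insert i J) M) F G \<theta>"
    note \<theta>' = morD(1-3)[OF \<theta>, simplified]
    show "bimor (Fam J M) (M i) (tob (insert i J) M i F) (tob (insert i J) M i G) (\<lambda>x a. \<theta> (x(i := a)))"
      unfolding bimor_def
    proof (intro conjI ballI)
      fix x assume x: "x \<in> Obj (base (Fam J M))"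
      have "far G ((Idn (prod_cat J (bases M)) x)(i := f)) \<cdot> \<theta> (x(i := Src (base (M i)) f)) =
        \<theta> (x(i := Tgt (base (M i)) f)) \<cdot> far F ((Idn (prod_cat J (bases M)) x)(i := f))" if "f \<in> Arr (base (M i))" for f
        using morD(4)[OF \<theta>, of "(Idn (prod_cat J (bases M)) x)(i := f)"] x that by simp
      then show "mor (M i) (cD (tob (insert i J) M i F) x) (cD (tob (insert i J) M i G) x) (\<lambda>a. \<theta> (x(i := a)))"
        using x \<theta>' morD(5)[OF \<theta>, of "(i, x, _)"] by (simp add: mor_def)
    next
      fix a assume a: "a \<in> Obj (base (M i))"
      have "far G (g(i := Idn (base (M i)) a)) \<cdot> \<theta> ((Src (prod_cat J (bases M)) g)(i := a)) =
        \<theta> ((Tgt (prod_cat J (bases M)) g)(i := a)) \<cdot> far F (g(i := Idn (base (M i)) a))" if "g \<in> Arr (prod_cat J (bases M))" for g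
        using morD(4)[OF \<theta>, of "g(i := Idn (base (M i)) a)"] a that by simp
      moreover have "\<theta> (x(i := a, j := ly (M j) t)) \<cdot> lb F (j, x(i := a), t) =
          lb G (j, x(i := a), t) \<cdot> (\<theta> (x(i := a, j := lz (M j) t)) [+] \<theta> (x(i := a, j := lx (M j) t)))"
        if "j \<in> J" "x \<in> Obj (prod_cat (J - {j}) (bases M))" "t \<in> lab (M j)" for j x t
        using morD(5)[OF \<theta>, of "(j, x(i := a), t)"] a that by simp
      ultimately show "mor (Fam J M) (csl (tob (insert i J) M i F) a) (csl (tob (insert i J) M i G) a) (\<lambda>x. \<theta> (x(i := a)))"
        using a \<theta>' by (auto simp: mor_def upd_i_last)
    qed
  }
qed

text \<open>Inverse to \<open>tob\<close> up to \<open>beq\<close>. The value at an arrow is fixed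
  by one of its two factorizations: the other places move first, then place
  \<open>i\<close>.\<close>

definition fromb :: "('i \<Rightarrow> 'o, 'i \<Rightarrow> 'm, 'i \<times> ('i \<Rightarrow> 'o) \<times> 't, 'o, 'm, 't, 'p, 'q) bidata \<Rightarrow>
    ('i \<Rightarrow> 'o, 'i \<Rightarrow> 'm, 'i \<times> ('i \<Rightarrow> 'o) \<times> 't, 'p, 'q) model" where
  "fromb B = \<lparr>fob = (\<lambda>y. fob (cD B (restrict y J)) (y i)),
    far = (\<lambda>h. far (cD B (Tgt (prod_cat J (bases M)) (restrict h J))) (h i) \<cdot> cA B (restrict h J) (Src (base (M i)) (h i))),
    lb = (\<lambda>(j, y, t). if j = i then lb (cD B y) t else cL B (j, restrict y (J - {j}), t) (y i))\<rparr>"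

lemma fromb_upd:
  "x \<in> Obj (prod_cat J (bases M)) \<Longrightarrow> fob (fromb B) (x(i := a)) = fob (cD B x) a"
  "g \<in> Arr (prod_cat J (bases M)) \<Longrightarrow> far (fromb B) (g(i := f)) =
    far (cD B (Tgt (prod_cat J (bases M)) g)) f \<cdot> cA B g (Src (base (M i)) f)"
  "lb (fromb B) (i, y, s) = lb (cD B y) s"
  "j \<in> J \<Longrightarrow> x \<in> Obj (prod_cat (J - {j}) (bases M)) \<Longrightarrow> lb (fromb B) (j, x(i := a), t) = cL B (j, x, t) a"
  using iJ by (auto simp: fromb_def restrict_prod_cat)

lemma fromb_model:
  assumes B: "bimodel (Fam J M) (M i) B"
  shows "is_model (Fam (insert i J) M) (fromb B)" and "beq (Fam J M) (M i) (tob (insert i J) M i (fromb B)) B"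
proof -
  have [simp]: "J \<subseteq> insert i J" "J - K \<subseteq> insert i J" for K by auto
  have D: "is_model (M i) (cD B x)" if "x \<in> Obj (prod_cat J (bases M))" for x
    using B that by (auto simp: bimodel_def prebimodel_def)
  have c: "is_model (Fam J M) (csl B a)" if "a \<in> Obj (base (M i))" for a
    using B that by (auto simp: bimodel_def)
  have A: "mor (M i) (cD B (Src (prod_cat J (bases M)) g)) (cD B (Tgt (prod_cat J (bases M)) g)) (cA B g)"
    if "g \<in> Arr (prod_cat J (bases M))" for g
    using B that by (auto simp: bimodel_def prebimodel_def)
  have L: "mor (M i) (psum (M i) (cD B (x(j := lz (M j) t))) (cD B (x(j := lx (M j) t)))) (cD B (x(j := ly (M j) t))) (cL B (j, x, t))"
    if "j \<in> J" "x \<in> Obj (prod_cat (J - {j}) (bases M))" "t \<in> lab (M j)" for j x t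
    using B that by (force simp: bimodel_def prebimodel_def)
  note [simp] = fam_simps premodelD(1-5,7-9)[OF is_modelD[OF D]] morD(1-3)[OF A] fromb_upd
    premodelD(5)[OF is_modelD[OF c], simplified]
  have [simp]: "cL B (j, x, t) a \<in> Arr P" "Src P (cL B (j, x, t) a) = fob (cD B (x(j := lz (M j) t))) a \<boxplus> fob (cD B (x(j := lx (M j) t))) a"
    "Tgt P (cL B (j, x, t) a) = fob (cD B (x(j := ly (M j) t))) a"
    if "j \<in> J" "x \<in> Obj (prod_cat (J - {j}) (bases M))" "t \<in> lab (M j)" "a \<in> Obj (base (M i))" for j x t a
    using morD(1-3)[OF L[OF that(1-3)] that(4)] by simp_all
  have "far (fromb B) (Cmp (prod_cat (insert i J) (bases M)) h' h) = far (fromb B) h' \<cdot> far (fromb B) h"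
    if hh: "h \<in> Arr (prod_cat (insert i J) (bases M))" "h' \<in> Arr (prod_cat (insert i J) (bases M))" "Src (prod_cat (insert i J) (bases M)) h' = Tgt (prod_cat (insert i J) (bases M)) h" for h h'
  proof -
    obtain g f where h: "h = g(i := f)" and g: "g \<in> Arr (prod_cat J (bases M))" and f: "f \<in> Arr (base (M i))"
      using hh(1) iJ by (auto elim: prod_Arr_split)
    obtain g' f' where h': "h' = g'(i := f')" and g': "g' \<in> Arr (prod_cat J (bases M))" and f': "f' \<in> Arr (base (M i))"
      using hh(2) iJ by (auto elim: prod_Arr_split)
    have eq: "(Src (prod_cat J (bases M)) g')(i := Src (base (M i)) f') = (Tgt (prod_cat J (bases M)) g)(i := Tgt (base (M i)) f)"
      using hh(3) by (simp add: h h')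
    have s: "Src (base (M i)) f' = Tgt (base (M i)) f"
      using fun_cong[OF eq, of i] by simp
    have s': "Src (prod_cat J (bases M)) g' = Tgt (prod_cat J (bases M)) g"
      using arg_cong[OF eq, of "\<lambda>x. restrict x J"] g g' iJ by (simp add: restrict_prod_cat[where C = "bases M"])
    note K = cat_prod_sub[of J, simplified]
    have "cA B (Cmp (prod_cat J (bases M)) g' g) a = cA B g' a \<cdot> cA B g a" if "a \<in> Obj (base (M i))" for a
      using premodelD(6)[OF is_modelD[OF c[OF that]], of g g'] g g' s' by simp
    moreover have "far (cD B (Tgt (prod_cat J (bases M)) g')) (Cmp (base (M i)) f' f) =
        far (cD B (Tgt (prod_cat J (bases M)) g')) f' \<cdot> far (cD B (Tgt (prod_cat J (bases M)) g')) f"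
      using premodelD(6)[OF is_modelD[OF D]] f f' s g' by simp
    \<comment> \<open>Naturality of \<open>cA\<close> interchanges the inner two of the four
      factors, so that the moves of place \<open>i\<close> and those of the other places can be
      composed separately.\<close>
    moreover note nat = morD(4)[OF A[OF g'] f]
    ultimately show ?thesis
      using f f' g g' s s' cat_axioms.Src_Cmp[OF K g g' s'] cat_axioms.Tgt_Cmp[OF K g g' s'] cat_axioms.Cmp_Arr[OF K g g' s']
        cat_axioms.Src_Cmp[OF catI f f' s]
      by (simp add: h h' Cmp_assoc Cmp_reassoc[OF nat])
  qed
  moreover have "far (fromb B) h \<in> Hom P (fob (fromb B) (Src (prod_cat (insert i J) (bases M)) h)) (fob (fromb B) (Tgt (prod_cat (insert i J) (bases M)) h))"
    if "h \<in> Arr (prod_cat (insert i J) (bases M))" for h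
    using that iJ by (auto elim!: prod_Arr_split)
  moreover have "far (fromb B) (Idn (prod_cat (insert i J) (bases M)) y) = Idn P (fob (fromb B) y)" "fob (fromb B) y \<in> Obj P"
    if "y \<in> Obj (prod_cat (insert i J) (bases M))" for y
    using that iJ by (auto elim!: prod_Obj_split)
  moreover have "lb (fromb B) (j, y, t) \<in> Hom P (fob (fromb B) (y(j := lz (M j) t)) \<boxplus> fob (fromb B) (y(j := lx (M j) t)))
      (fob (fromb B) (y(j := ly (M j) t)))"
    if jyt: "j \<in> insert i J" "y \<in> Obj (prod_cat ((insert i J) - {j}) (bases M))" "t \<in> lab (M j)" for j y t
  proof (cases "j = i")
    case False
    then have j: "j \<in> J" using jyt by simp
    then obtain x a where "y = x(i := a)" "x \<in> Obj (prod_cat (J - {j}) (bases M))" "a \<in> Obj (base (M i))"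
      using jyt(2) iJ by (auto elim: prod_Obj_split)
    then show ?thesis using jyt j by (simp add: upd_i_last[symmetric])
  qed (use jyt in simp)
  ultimately have pre: "premodel (Fam (insert i J) M) (fromb B)"
    using category cat_prod_sub[of "insert i J"] M by (intro premodel_FamI) (auto simp: is_functor_def wf_pres_def cat_axioms_def)
  show beq: "beq (Fam J M) (M i) (tob (insert i J) M i (fromb B)) B"
    by (auto simp: beq_def meq_def premodelD(5)[OF is_modelD[OF D]])
  show "is_model (Fam (insert i J) M) (fromb B)"
    using bimodel_cong[OF wf_J M beq_sym[OF beq] B] bimodel_tob_iff[OF pre] by simp
qed

end

end

section \<open>Induction over the set of variables\<close>

definition Famq :: "'i set \<Rightarrow> ('i \<Rightarrow> ('v, 'w, 's) pres) \<Rightarrow> ('i \<Rightarrow> ('o, 'm, 't, 'v, 'w, 's) pmap) \<Rightarrow>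
    ('i \<Rightarrow> 'o, 'i \<Rightarrow> 'm, 'i \<times> ('i \<Rightarrow> 'o) \<times> 't, 'i \<Rightarrow> 'v, 'i \<Rightarrow> 'w, 'i \<times> ('i \<Rightarrow> 'v) \<times> 's) pmap" where
  "Famq I N q = \<lparr>fob = (\<lambda>x. \<lambda>j\<in>I. fob (q j) (x j)), far = (\<lambda>f. \<lambda>j\<in>I. far (q j) (f j)),
     qm = (\<lambda>(j, x, t). at_place I (bases N) (\<lambda>k\<in>I - {j}. fob (q k) (x k)) j (qm (q j) t)),
     ql = (\<lambda>(j, x, t). (j, \<lambda>k\<in>I - {j}. fob (q k) (x k), ql (q j) t))\<rparr>"

lemma Famq_sel:
  "fob (Famq I N q) x = (\<lambda>j\<in>I. fob (q j) (x j))" "far (Famq I N q) f = (\<lambda>j\<in>I. far (q j) (f j))"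
  "qm (Famq I N q) (j, x, t) = at_place I (bases N) (fob (Famq (I - {j}) N q) x) j (qm (q j) t)"
  "ql (Famq I N q) (j, x, t) = (j, fob (Famq (I - {j}) N q) x, ql (q j) t)"
  by (simp_all add: Famq_def)

lemma Famq_upd: "j \<in> I \<Longrightarrow> fob (Famq I N q) (x(j := a)) = (fob (Famq (I - {j}) N q) x)(j := fob (q j) a)"
  "j \<in> I \<Longrightarrow> far (Famq I N q) (g(j := f)) = (far (Famq (I - {j}) N q) g)(j := far (q j) f)"
  by (auto simp: Famq_def fun_eq_iff restrict_def)

context sym_gpd
begin

lemma Famq_typed:
  assumes "\<And>j. j \<in> I \<Longrightarrow> wf_pmap (M j) (N j) (q j)"
  shows "x \<in> Obj (prod_cat I (bases M)) \<Longrightarrow> fob (Famq I N q) x \<in> Obj (prod_cat I (bases N))"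
    and "g \<in> Arr (prod_cat I (bases M)) \<Longrightarrow> far (Famq I N q) g \<in> Arr (prod_cat I (bases N))"
    and "g \<in> Arr (prod_cat I (bases M)) \<Longrightarrow> Src (prod_cat I (bases N)) (far (Famq I N q) g) = fob (Famq I N q) (Src (prod_cat I (bases M)) g)"
    and "g \<in> Arr (prod_cat I (bases M)) \<Longrightarrow> Tgt (prod_cat I (bases N)) (far (Famq I N q) g) = fob (Famq I N q) (Tgt (prod_cat I (bases M)) g)"
    and "x \<in> Obj (prod_cat I (bases M)) \<Longrightarrow> far (Famq I N q) (Idn (prod_cat I (bases M)) x) = Idn (prod_cat I (bases N)) (fob (Famq I N q) x)"
proof -
  note q = wf_pmapD[OF assms]
  show "x \<in> Obj (prod_cat I (bases M)) \<Longrightarrow> fob (Famq I N q) x \<in> Obj (prod_cat I (bases N))"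
    "g \<in> Arr (prod_cat I (bases M)) \<Longrightarrow> far (Famq I N q) g \<in> Arr (prod_cat I (bases N))"
    "g \<in> Arr (prod_cat I (bases M)) \<Longrightarrow> Src (prod_cat I (bases N)) (far (Famq I N q) g) = fob (Famq I N q) (Src (prod_cat I (bases M)) g)"
    "g \<in> Arr (prod_cat I (bases M)) \<Longrightarrow> Tgt (prod_cat I (bases N)) (far (Famq I N q) g) = fob (Famq I N q) (Tgt (prod_cat I (bases M)) g)"
    "x \<in> Obj (prod_cat I (bases M)) \<Longrightarrow> far (Famq I N q) (Idn (prod_cat I (bases M)) x) = Idn (prod_cat I (bases N)) (fob (Famq I N q) x)"
    using q by (auto simp: Famq_sel prod_cat_sel Obj_prod_cat Arr_prod_cat PiE_iff fun_eq_iff restrict_def extensional_def)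
qed

lemma wf_pmap_Famq:
  assumes M: "\<And>j. j \<in> I \<Longrightarrow> wf_pres (M j)" and N: "\<And>j. j \<in> I \<Longrightarrow> wf_pres (N j)"
    and q: "\<And>j. j \<in> I \<Longrightarrow> wf_pmap (M j) (N j) (q j)"
  shows "wf_pmap (Fam I M) (Fam I N) (Famq I N q)"
  unfolding wf_pmap_def
proof (intro conjI ballI)
  have catN: "cat_axioms (prod_cat (I - {j}) (bases N))" for j
    unfolding cat_axioms_def by (rule category_prod_cat) (use N in \<open>auto simp: wf_pres_def\<close>)
  have "far (Famq I N q) (Cmp (prod_cat I (bases M)) g f) = Cmp (prod_cat I (bases N)) (far (Famq I N q) g) (far (Famq I N q) f)"
    if "f \<in> Arr (prod_cat I (bases M))" "g \<in> Arr (prod_cat I (bases M))" "Src (prod_cat I (bases M)) g = Tgt (prod_cat I (bases M)) f" for f g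
  proof -
    have "Src (base (M j)) (g j) = Tgt (base (M j)) (f j)" if "j \<in> I" for j
      using fun_cong[OF \<open>Src (prod_cat I (bases M)) g = _\<close>, of j] that by (simp add: prod_cat_sel)
    then show ?thesis
      using that wf_pmapD(6)[OF q] by (auto simp: Famq_sel prod_cat_sel Arr_prod_cat PiE_iff fun_eq_iff restrict_def extensional_def)
  qed
  then show "is_functor (base (Fam I M)) (base (Fam I N)) (Famq I N q)"
    using category_prod_cat[of I "bases M"] category_prod_cat[of I "bases N"] M N Famq_typed[of I M N q, OF q]
    by (simp add: is_functor_def wf_pres_def)
  fix u assume "u \<in> lab (Fam I M)"
  then obtain j x t where u: "u = (j, x, t)" and j: "j \<in> I" and x: "x \<in> Obj (prod_cat (I - {j}) (bases M))" and t: "t \<in> lab (M j)"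
    by auto
  have x': "fob (Famq (I - {j}) N q) x \<in> Obj (prod_cat (I - {j}) (bases N))"
    using Famq_typed(1)[of "I - {j}" M N q, OF q] x by simp
  note [simp] = wf_pmapD[OF q[OF j]] Famq_sel(3,4) Famq_upd
  show "ql (Famq I N q) u \<in> lab (Fam I N)" "lz (Fam I N) (ql (Famq I N q) u) = fob (Famq I N q) (lz (Fam I M) u)"
    "lx (Fam I N) (ql (Famq I N q) u) = fob (Famq I N q) (lx (Fam I M) u)"
    "qm (Famq I N q) u \<in> Hom (base (Fam I N)) (ly (Fam I N) (ql (Famq I N q) u)) (fob (Famq I N q) (ly (Fam I M) u))"
    using j x t x' by (simp_all add: u at_place_def upd_Arr Src_upd Tgt_upd cat_axioms.Idn_Arr[OF catN]
        cat_axioms.Src_Idn[OF catN] cat_axioms.Tgt_Idn[OF catN])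
qed

lemma bswap_bswap [simp]: "bswap (bswap B) = B"
  by (rule bidata.equality) (auto simp: fun_eq_iff)

text \<open>Pulls back in both variables, one after the other; the swaps are there because
  \<open>bpull\<close> acts on the second variable.\<close>

definition dpull :: "('r, 'g, 'u, 'v1, 'w1, 's1) pmap \<Rightarrow> ('o, 'm, 't, 'v, 'w, 's) pmap \<Rightarrow>
    ('v1, 'w1, 's1, 'v, 'w, 's, 'p, 'q) bidata \<Rightarrow> ('r, 'g, 'u, 'o, 'm, 't, 'p, 'q) bidata" where
  "dpull qR q B = bpull q (bswap (bpull qR (bswap B)))"

context
  fixes i :: 'i and J :: "'i set" and M :: "'i \<Rightarrow> ('o, 'm, 't) pres" and N :: "'i \<Rightarrow> ('v, 'w, 's) pres"
    and q :: "'i \<Rightarrow> ('o, 'm, 't, 'v, 'w, 's) pmap"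
  assumes iJ: "i \<notin> J" and M: "\<And>j. j \<in> insert i J \<Longrightarrow> wf_pres (M j)" and N: "\<And>j. j \<in> insert i J \<Longrightarrow> wf_pres (N j)"
    and q: "\<And>j. j \<in> insert i J \<Longrightarrow> pequiv (M j) (N j) (q j)" and qJ: "pequiv (Fam J M) (Fam J N) (Famq J N q)"
begin

text \<open>Pulling back all places at once or in two steps gives the same data on the presentation.
  The identities that fill the other places match because the maps preserve identities.\<close>

lemma tob_pull:
  assumes F: "premodel (Fam (insert i J) N) F"
  shows "beq (Fam J M) (M i) (tob (insert i J) M i (pull (Famq (insert i J) N q) F))
    (dpull (Famq J N q) (q i) (tob (insert i J) N i F))"
proof -
  let ?I = "insert i J"
  have qw: "wf_pmap (M j) (N j) (q j)" if "j \<in> ?I" for j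
    using q[OF that] by (rule pequivD)
  have [simp]: "J \<subseteq> insert i J" "J - K \<subseteq> insert i J" for K by auto
  have sub: "j \<in> J - K \<Longrightarrow> wf_pmap (M j) (N j) (q j)" for j K
    using qw by auto
  have Famq_typed1: "fob (Famq (J - K) N q) x \<in> Obj (prod_cat (J - K) (bases N))" if "x \<in> Obj (prod_cat (J - K) (bases M))" for x K
    using Famq_typed(1)[of "J - K" M N q, OF sub that] .
  have Famq_typed2: "far (Famq J N q) (Idn (prod_cat J (bases M)) x) = Idn (prod_cat J (bases N)) (fob (Famq J N q) x)"
    if "x \<in> Obj (prod_cat J (bases M))" for x
    using Famq_typed(5)[of J M N q, OF qw that] by simp
  have [simp]: "insert i J - {i} = J" using iJ by simp
  have 1: "meq (M i) (cD (tob ?I M i (pull (Famq ?I N q) F)) x) (cD (dpull (Famq J N q) (q i) (tob ?I N i F)) x)"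
    if x: "x \<in> Obj (prod_cat J (bases M))" for x
    using x Famq_typed2[OF x] iJ
    by (simp add: meq_def dpull_def Famq_sel(3,4) Famq_upd at_place_def)
  have 2: "cA (tob ?I M i (pull (Famq ?I N q) F)) g a = cA (dpull (Famq J N q) (q i) (tob ?I N i F)) g a"
    if "a \<in> Obj (base (M i))" for g a
    using that iJ wf_pmapD(5)[OF qw] by (simp add: dpull_def Famq_upd)
  have 3: "cL (tob ?I M i (pull (Famq ?I N q) F)) (j, x, t) a = cL (dpull (Famq J N q) (q i) (tob ?I N i F)) (j, x, t) a"
    if j: "j \<in> J" for j x t a
  proof -
    have ji: "j \<noteq> i" and minus: "insert i J - {j} = insert i (J - {j})" "insert i (J - {j}) - {i} = J - {j}"
      using j iJ by auto
    show ?thesis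
      using j ji by (simp add: dpull_def Famq_sel(3,4) Famq_upd minus at_place_def Idn_upd fun_upd_twist[OF ji])
  qed
  show ?thesis
    unfolding beq_def using 1 2 3 by auto
qed

text \<open>Two lifts in succession, through models in two variables over \<open>Fam J M\<close> and
  \<open>N i\<close>: first along \<open>q i\<close> in the second variable, then, after a swap,
  along the equivalence for \<open>J\<close>.\<close>

lemma pequiv_Fam_insert: "pequiv (Fam (insert i J) M) (Fam (insert i J) N) (Famq (insert i J) N q)"
proof -
  let ?I = "insert i J"
  let ?Q = "Famq ?I N q" and ?QJ = "Famq J N q"
  have wMI: "wf_pres (Fam ?I M)" and wMJ: "wf_pres (Fam J M)" and wNI: "wf_pres (Fam ?I N)" and wNJ: "wf_pres (Fam J N)"
    and wMi: "wf_pres (M i)" and wNi: "wf_pres (N i)"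
    using M N by (auto intro: wf_Fam)
  have qi: "pequiv (M i) (N i) (q i)" using q by simp
  have qw: "wf_pmap (M j) (N j) (q j)" if "j \<in> ?I" for j
    using q[OF that] by (rule pequivD)
  have Q: "wf_pmap (Fam ?I M) (Fam ?I N) ?Q"
    by (rule wf_pmap_Famq[OF M N qw])
  have toM: "bimodel (Fam J M) (M i) (tob ?I M i F) \<longleftrightarrow> is_model (Fam ?I M) F" if "premodel (Fam ?I M) F" for F
    by (rule bimodel_tob_iff[OF iJ M that])
  have toN: "bimodel (Fam J N) (N i) (tob ?I N i F) \<longleftrightarrow> is_model (Fam ?I N) F" if "premodel (Fam ?I N) F" for F
    by (rule bimodel_tob_iff[OF iJ N that])
  have morM: "bimor (Fam J M) (M i) (tob ?I M i F) (tob ?I M i G) (\<lambda>x a. \<theta> (x(i := a))) \<longleftrightarrow> mor (Fam ?I M) F G \<theta>"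
    if "premodel (Fam ?I M) F" "premodel (Fam ?I M) G" for F G \<theta>
    by (rule bimor_tob_iff[OF iJ M that])
  have morN: "bimor (Fam J N) (N i) (tob ?I N i F) (tob ?I N i G) (\<lambda>x a. \<theta> (x(i := a))) \<longleftrightarrow> mor (Fam ?I N) F G \<theta>"
    if "premodel (Fam ?I N) F" "premodel (Fam ?I N) G" for F G \<theta>
    by (rule bimor_tob_iff[OF iJ N that])
  have dp: "bimodel (Fam J M) (N i) (bswap (bpull ?QJ (bswap B)))" if "bimodel (Fam J N) (N i) B" for B
    by (intro bimodel_swap[OF wNi wMJ] bimodel_pull[OF wNi wMJ wNJ qJ] bimodel_swap[OF wNJ wNi] that)
  have dpm: "bimodel (Fam J M) (M i) (dpull ?QJ (q i) B)" if "bimodel (Fam J N) (N i) B" for B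
    unfolding dpull_def by (rule bimodel_pull[OF wMJ wMi wNi qi dp[OF that]])
  have pm: "is_model (Fam ?I M) (pull ?Q F)" if F: "is_model (Fam ?I N) F" for F
  proof -
    have "bimodel (Fam J M) (M i) (tob ?I M i (pull ?Q F))"
      by (rule bimodel_cong[OF wMJ wMi beq_sym[OF tob_pull[OF is_modelD[OF F]]] dpm])
        (use toN[OF is_modelD[OF F]] F in simp)
    then show ?thesis
      using toM[OF premodel_pull[OF wMI wNI Q is_modelD[OF F]]] by simp
  qed
  have ess: "\<exists>F \<alpha>. is_model (Fam ?I N) F \<and> mor (Fam ?I M) (pull ?Q F) D \<alpha>" if D: "is_model (Fam ?I M) D" for D
  proof -
    have tD: "bimodel (Fam J M) (M i) (tob ?I M i D)"
      using toM[OF is_modelD[OF D]] D by simp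
    obtain G \<alpha> where G: "bimodel (Fam J M) (N i) G" and \<alpha>: "bimor (Fam J M) (M i) (bpull (q i) G) (tob ?I M i D) \<alpha>"
      using bimodel_lift[OF wMJ wMi wNi qi tD] by blast
    obtain H \<alpha>' where H: "bimodel (N i) (Fam J N) H" and \<alpha>': "bimor (N i) (Fam J M) (bpull ?QJ H) (bswap G) \<alpha>'"
      using bimodel_lift[OF wNi wMJ wNJ qJ bimodel_swap[OF wMJ wNi G]] by blast
    let ?F = "fromb i J N (bswap H)"
    note K = bimodel_swap[OF wNi wNJ H]
    have F: "is_model (Fam ?I N) ?F" "beq (Fam J N) (N i) (tob ?I N i ?F) (bswap H)"
      by (rule fromb_model[OF iJ N K], assumption)+
    have H': "bimodel (Fam J M) (N i) (bswap (bpull ?QJ H))"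
      using dp[OF K] by simp
    have "bimor (Fam J M) (N i) (bswap (bpull ?QJ H)) G (\<lambda>r s. \<alpha>' s r)"
      using bimor_swap[OF \<alpha>'] by simp
    from bimor_pull[OF wMJ wMi wNi qi H' G this]
    have 1: "bimor (Fam J M) (M i) (dpull ?QJ (q i) (bswap H)) (bpull (q i) G) (\<lambda>r s. \<alpha>' (fob (q i) s) r)"
      by (simp add: dpull_def)
    have 2: "bimor (Fam J M) (M i) (dpull ?QJ (q i) (bswap H)) (tob ?I M i D) (\<lambda>r s. \<alpha> r s \<cdot> \<alpha>' (fob (q i) s) r)"
      by (rule bimor_comp[OF wMJ wMi dpm[OF K] bimodel_pull[OF wMJ wMi wNi qi G] tD 1 \<alpha>])
    \<comment> \<open>The composite of the comparisons from the two lifts, rewritten as a function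
      of whole families of objects.\<close>
    define \<theta> where "\<theta> y = \<alpha> (restrict y J) (y i) \<cdot> \<alpha>' (fob (q i) (y i)) (restrict y J)" for y
    have "beq (Fam J M) (M i) (dpull ?QJ (q i) (tob ?I N i ?F)) (dpull ?QJ (q i) (bswap H))"
      using F(2) wf_pmapD[OF pequivD(1)[OF qi]] wf_pmapD[OF pequivD(1)[OF qJ]]
      unfolding beq_def dpull_def meq_def by (auto simp del: Fam_sel)
    then have "bimor (Fam J M) (M i) (dpull ?QJ (q i) (tob ?I N i ?F)) (tob ?I M i D) (\<lambda>r s. \<alpha> r s \<cdot> \<alpha>' (fob (q i) s) r)"
      by (rule bimor_cong[OF wMJ wMi beq_sym beq_refl refl 2])
    then have "bimor (Fam J M) (M i) (tob ?I M i (pull ?Q ?F)) (tob ?I M i D) (\<lambda>x a. \<theta> (x(i := a)))"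
      by (rule bimor_cong[OF wMJ wMi beq_sym[OF tob_pull[OF is_modelD[OF F(1)]]] beq_refl, rotated])
        (use iJ in \<open>auto simp: \<theta>_def restrict_prod_cat\<close>)
    then have "mor (Fam ?I M) (pull ?Q ?F) D \<theta>"
      using morM[OF premodel_pull[OF wMI wNI Q is_modelD[OF F(1)]] is_modelD[OF D]] by simp
    with F(1) show ?thesis by blast
  qed
  have tob2: "bimodel (Fam J N) (N i) (tob ?I N i F)" if "is_model (Fam ?I N) F" for F
    using toN[OF is_modelD[OF that]] that by simp
  have full: "\<exists>\<beta>. mor (Fam ?I N) F G \<beta> \<and> (\<forall>y\<in>Obj (base (Fam ?I M)). \<beta> (fob ?Q y) = \<theta> y)"
    if F: "is_model (Fam ?I N) F" and G: "is_model (Fam ?I N) G" and \<theta>: "mor (Fam ?I M) (pull ?Q F) (pull ?Q G) \<theta>" for F G \<theta>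
  proof -
    note tF = tob2[OF F] and tG = tob2[OF G]
    have "bimor (Fam J M) (M i) (tob ?I M i (pull ?Q F)) (tob ?I M i (pull ?Q G)) (\<lambda>x a. \<theta> (x(i := a)))"
      using morM[OF premodel_pull[OF wMI wNI Q is_modelD[OF F]] premodel_pull[OF wMI wNI Q is_modelD[OF G]]] \<theta>
      by simp
    then have "bimor (Fam J M) (M i) (dpull ?QJ (q i) (tob ?I N i F)) (dpull ?QJ (q i) (tob ?I N i G)) (\<lambda>x a. \<theta> (x(i := a)))"
      by (rule bimor_cong[OF wMJ wMi tob_pull[OF is_modelD[OF F]] tob_pull[OF is_modelD[OF G]] refl])
    then obtain \<beta>1 where \<beta>1: "bimor (Fam J M) (N i) (bswap (bpull ?QJ (bswap (tob ?I N i F)))) (bswap (bpull ?QJ (bswap (tob ?I N i G)))) \<beta>1"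
      and \<beta>1_q: "\<And>x a. \<lbrakk>x \<in> Obj (base (Fam J M)); a \<in> Obj (base (M i))\<rbrakk> \<Longrightarrow> \<beta>1 x (fob (q i) a) = \<theta> (x(i := a))"
      unfolding dpull_def using bimor_lift[OF wMJ wMi wNi qi dp[OF tF] dp[OF tG]] by blast
    have "bimor (N i) (Fam J M) (bpull ?QJ (bswap (tob ?I N i F))) (bpull ?QJ (bswap (tob ?I N i G))) (\<lambda>a x. \<beta>1 x a)"
      using bimor_swap[OF \<beta>1] by simp
    then obtain \<beta>2 where \<beta>2: "bimor (N i) (Fam J N) (bswap (tob ?I N i F)) (bswap (tob ?I N i G)) \<beta>2"
      and \<beta>2_q: "\<And>x a. \<lbrakk>a \<in> Obj (base (N i)); x \<in> Obj (base (Fam J M))\<rbrakk> \<Longrightarrow> \<beta>2 a (fob ?QJ x) = \<beta>1 x a"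
      using bimor_lift[OF wNi wMJ wNJ qJ bimodel_swap[OF wNJ wNi tF] bimodel_swap[OF wNJ wNi tG]] by blast
    define \<beta> where "\<beta> y = \<beta>2 (y i) (restrict y J)" for y
    have "bimor (Fam J N) (N i) (tob ?I N i F) (tob ?I N i G) (\<lambda>x a. \<beta>2 a x)"
      using bimor_swap[OF \<beta>2] by simp
    then have "bimor (Fam J N) (N i) (tob ?I N i F) (tob ?I N i G) (\<lambda>x a. \<beta> (x(i := a)))"
      by (rule bimor_cong[OF wNJ wNi beq_refl beq_refl, rotated]) (use iJ in \<open>auto simp: \<beta>_def restrict_prod_cat\<close>)
    then have "mor (Fam ?I N) F G \<beta>"
      using morN[OF is_modelD[OF F] is_modelD[OF G]] by simp
    moreover have "\<beta> (fob ?Q y) = \<theta> y" if yI: "y \<in> Obj (base (Fam ?I M))" for y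
    proof -
      obtain x a where y: "y = x(i := a)" and x: "x \<in> Obj (prod_cat J (bases M))" and a: "a \<in> Obj (base (M i))"
        using yI iJ by (auto elim: prod_Obj_split)
      have "fob ?Q y = (fob ?QJ x)(i := fob (q i) a)"
        using iJ by (simp add: y Famq_upd)
      moreover have "restrict (fob ?QJ x) J = fob ?QJ x"
        by (simp add: Famq_sel)
      ultimately have "\<beta> (fob ?Q y) = \<beta>2 (fob (q i) a) (fob ?QJ x)"
        using iJ by (simp add: \<beta>_def)
      then show ?thesis
        using \<beta>2_q[of "fob (q i) a" x] \<beta>1_q[of x a] x a wf_pmapD(1)[OF pequivD(1)[OF qi]] by (simp add: y)
    qed
    ultimately show ?thesis by blast
  qed
  have faithful: "\<beta> y = \<beta>' y"
    if F: "is_model (Fam ?I N) F" and G: "is_model (Fam ?I N) G" and \<beta>: "mor (Fam ?I N) F G \<beta>" and \<beta>': "mor (Fam ?I N) F G \<beta>'"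
      and eq: "\<And>y. y \<in> Obj (base (Fam ?I M)) \<Longrightarrow> \<beta> (fob ?Q y) = \<beta>' (fob ?Q y)" and y: "y \<in> Obj (base (Fam ?I N))" for F G \<beta> \<beta>' y
  proof -
    note tF = tob2[OF F] and tG = tob2[OF G]
    note sF = bimodel_swap[OF wNJ wNi tF] and sG = bimodel_swap[OF wNJ wNi tG]
    have b: "bimor (N i) (Fam J N) (bswap (tob ?I N i F)) (bswap (tob ?I N i G)) (\<lambda>a x. \<gamma> (x(i := a)))" if "mor (Fam ?I N) F G \<gamma>" for \<gamma>
      using morN[OF is_modelD[OF F] is_modelD[OF G]] that by (intro bimor_swap) simp
    have b': "bimor (Fam J M) (N i) (bswap (bpull ?QJ (bswap (tob ?I N i F)))) (bswap (bpull ?QJ (bswap (tob ?I N i G)))) (\<lambda>x a. \<gamma> ((fob ?QJ x)(i := a)))"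
      if "mor (Fam ?I N) F G \<gamma>" for \<gamma>
      using bimor_swap[OF bimor_pull[OF wNi wMJ wNJ qJ sF sG b[OF that]]] by simp
    obtain x a where y': "y = x(i := a)" and x: "x \<in> Obj (prod_cat J (bases N))" and a: "a \<in> Obj (base (N i))"
      using y iJ by (auto elim: prod_Obj_split)
    \<comment> \<open>Agreement first spreads to all objects of place \<open>i\<close> while the
      other places stay in the image of \<open>?QJ\<close>; the last step then removes that
      restriction.\<close>
    have 1: "\<beta> ((fob ?QJ x)(i := a)) = \<beta>' ((fob ?QJ x)(i := a))" if "x \<in> Obj (base (Fam J M))" "a \<in> Obj (base (N i))" for x a
    proof (rule bimor_unique[OF wMJ wMi wNi qi dp[OF tF] dp[OF tG] b'[OF \<beta>] b'[OF \<beta>'] _ that])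
      fix x a assume "x \<in> Obj (base (Fam J M))" "a \<in> Obj (base (M i))"
      then show "\<beta> ((fob ?QJ x)(i := fob (q i) a)) = \<beta>' ((fob ?QJ x)(i := fob (q i) a))"
        using eq[of "x(i := a)"] iJ by (simp add: Famq_upd upd_Obj_insert)
    qed
    show ?thesis
      unfolding y'
      by (rule bimor_unique[OF wNi wMJ wNJ qJ sF sG b[OF \<beta>] b[OF \<beta>'], of a x]) (use 1 x a in auto)
  qed
  show ?thesis
    unfolding pequiv_def using Q pm ess full faithful by blast
qed

end

text \<open>Without variables both presentations consist of one object and its identity, so a model
  is an object of \<open>P\<close> and a morphism of models an arrow of \<open>P\<close>.\<close>

lemma pequiv_Fam_empty:
  fixes M :: "'i \<Rightarrow> ('o, 'm, 't) pres" and N :: "'i \<Rightarrow> ('v, 'w, 's) pres"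
  shows "pequiv (Fam {} M) (Fam {} N) (Famq {} N q)"
proof -
  have [simp]: "Obj (prod_cat {} C) = {\<lambda>_. undefined}" "Arr (prod_cat {} C) = {\<lambda>_. undefined}" for C :: "'i \<Rightarrow> ('a, 'b) cat"
    by (simp_all add: Obj_prod_cat Arr_prod_cat)
  have sel [simp]: "Src (prod_cat {} C) f = (\<lambda>_. undefined)" "Tgt (prod_cat {} C) f = (\<lambda>_. undefined)"
    "Idn (prod_cat {} C) x = (\<lambda>_. undefined)" "Cmp (prod_cat {} C) g f = (\<lambda>_. undefined)" for C :: "'i \<Rightarrow> ('a, 'b) cat" and f g x
    by (auto simp: prod_cat_sel)
  have [simp]: "fob (Famq {} N q) x = (\<lambda>_. undefined)" "far (Famq {} N q) g = (\<lambda>_. undefined)" for x g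
    by (auto simp: Famq_sel)
  have [simp]: "category (prod_cat {} C)" for C :: "'i \<Rightarrow> ('a, 'b) cat"
    by (rule category_prod_cat) simp
  have rM: "rels (Fam {} M) = {}" and rN: "rels (Fam {} N) = {}"
    by (auto simp: slice_rels_def nat_rels_def two_tri_rels_def)
  have lM: "lab (Fam {} M) = {}" and lN: "lab (Fam {} N) = {}"
    by auto
  have mM: "is_model (Fam {} M) D \<longleftrightarrow> fob D (\<lambda>_. undefined) \<in> Obj P \<and> far D (\<lambda>_. undefined) = Idn P (fob D (\<lambda>_. undefined))" for D
    unfolding is_model_def premodel_def rM lM using category by (auto simp: is_functor_def)
  have mN: "is_model (Fam {} N) D \<longleftrightarrow> fob D (\<lambda>_. undefined) \<in> Obj P \<and> far D (\<lambda>_. undefined) = Idn P (fob D (\<lambda>_. undefined))" for D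
    unfolding is_model_def premodel_def rN lN using category by (auto simp: is_functor_def)
  have ess: "\<exists>F \<alpha>. is_model (Fam {} N) F \<and> mor (Fam {} M) (pull (Famq {} N q) F) D \<alpha>" if "is_model (Fam {} M) D" for D
    using that
    by (intro exI[of _ "\<lparr>fob = (\<lambda>_. fob D (\<lambda>_. undefined)), far = (\<lambda>_. far D (\<lambda>_. undefined)), lb = undefined\<rparr>"]
        exI[of _ "\<lambda>_. Idn P (fob D (\<lambda>_. undefined))"])
      (auto simp: mM mN mor_def)
  have full: "\<exists>\<beta>. mor (Fam {} N) F G \<beta> \<and> (\<forall>a\<in>Obj (base (Fam {} M)). \<beta> (fob (Famq {} N q) a) = \<theta> a)"
    if "mor (Fam {} M) (pull (Famq {} N q) F) (pull (Famq {} N q) G) \<theta>" for F G \<theta>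
    using that by (intro exI[of _ "\<lambda>_. \<theta> (\<lambda>_. undefined)"]) (auto simp: mor_def)
  show ?thesis
    unfolding pequiv_def
    using wf_pmap_Famq[of "{}" M N q] ess full by (auto simp: mM mN)
qed

lemma pequiv_Fam:
  assumes "finite I" and "\<And>j. j \<in> I \<Longrightarrow> wf_pres (M j)" "\<And>j. j \<in> I \<Longrightarrow> wf_pres (N j)" "\<And>j. j \<in> I \<Longrightarrow> pequiv (M j) (N j) (q j)"
  shows "pequiv (Fam I M) (Fam I N) (Famq I N q)"
  using assms
proof (induction I)
  case empty
  show ?case by (rule pequiv_Fam_empty)
next
  case (insert i J)
  then show ?case by (intro pequiv_Fam_insert) auto
qed

end

section \<open>Split triangles\<close>

locale tri_cat =
  fixes T :: "('o, 'm, 'z) tricat_scheme" (structure)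
  assumes triangulated: "triangulated T"

sublocale tri_cat \<subseteq> cat_axioms T
  using triangulated by unfold_locales (simp add: triangulated_def additive_category_def preadditive_def)

context tri_cat
begin

abbreviation shift_ob :: "'o \<Rightarrow> 'o" ("\<Sigma>") where "\<Sigma> a \<equiv> fob (shift T) a"
abbreviation shift_ar :: "'m \<Rightarrow> 'm" ("\<Sigma>'_ar") where "\<Sigma>_ar f \<equiv> far (shift T) f"

lemma tri_axioms:
  "\<forall>a\<in>Obj T. \<forall>b\<in>Obj T. comm_group (hom_group T a b)"
  "\<forall>a\<in>Obj T. \<forall>b\<in>Obj T. \<forall>c\<in>Obj T.
      (\<forall>f\<in>Hom T a b. \<forall>g\<in>Hom T b c. \<forall>g'\<in>Hom T b c. hadd T g g' \<cdot> f = hadd T (g \<cdot> f) (g' \<cdot> f)) \<and>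
      (\<forall>f\<in>Hom T a b. \<forall>f'\<in>Hom T a b. \<forall>g\<in>Hom T b c. g \<cdot> hadd T f f' = hadd T (g \<cdot> f) (g \<cdot> f'))"
  "\<exists>z. zero_object T z"
  "\<forall>a\<in>Obj T. \<forall>b\<in>Obj T. \<forall>f\<in>Hom T a b. \<forall>g\<in>Hom T a b. \<Sigma>_ar (hadd T f g) = hadd T (\<Sigma>_ar f) (\<Sigma>_ar g)"
  "\<forall>\<Delta>\<in>dist T. is_triangle T \<Delta>"
  "\<forall>\<Delta>\<in>dist T. \<forall>\<Delta>' u v w. is_triangle T \<Delta>' \<and> triangle_iso T \<Delta> \<Delta>' u v w \<longrightarrow> \<Delta>' \<in> dist T"
  "\<forall>x\<in>Obj T. \<forall>z. zero_object T z \<longrightarrow> (Idn T x, hzero T x z, hzero T z (\<Sigma> x)) \<in> dist T"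
  "\<forall>f\<in>Arr T. \<exists>g h. (f, g, h) \<in> dist T"
  "\<forall>f g h. is_triangle T (f, g, h) \<longrightarrow>
     ((f, g, h) \<in> dist T \<longleftrightarrow> (g, h, inv\<^bsub>hom_group T (\<Sigma> (Src T f)) (\<Sigma> (Tgt T f))\<^esub> (\<Sigma>_ar f)) \<in> dist T)"
  "\<forall>f g h f' g' h' u v. (f, g, h) \<in> dist T \<and> (f', g', h') \<in> dist T \<and>
     u \<in> Hom T (Src T f) (Src T f') \<and> v \<in> Hom T (Tgt T f) (Tgt T f') \<and> v \<cdot> f = f' \<cdot> u \<longrightarrow>
     (\<exists>w. triangle_morphism T (f, g, h) (f', g', h') u v w)"
  using triangulated unfolding triangulated_def additive_category_def preadditive_def by - (elim conjE, assumption)+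

lemma hom_group: "a \<in> Obj T \<Longrightarrow> b \<in> Obj T \<Longrightarrow> group (hom_group T a b)"
  using tri_axioms(1) by (simp add: comm_group.axioms(2))

lemma hom_group_sel [simp]: "carrier (hom_group T a b) = Hom T a b" "mult (hom_group T a b) = hadd T"
  "one (hom_group T a b) = hzero T a b"
  by (simp_all add: hom_group_def)

lemma hzero_Hom: "a \<in> Obj T \<Longrightarrow> b \<in> Obj T \<Longrightarrow> hzero T a b \<in> Hom T a b"
  using group.is_monoid[OF hom_group, THEN monoid.one_closed, of a b] by simp

lemma hadd_Hom: "a \<in> Obj T \<Longrightarrow> b \<in> Obj T \<Longrightarrow> f \<in> Hom T a b \<Longrightarrow> g \<in> Hom T a b \<Longrightarrow> hadd T f g \<in> Hom T a b"
  using group.is_monoid[OF hom_group, THEN monoid.m_closed, of a b f g] by simp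

lemma hadd_hzero: "a \<in> Obj T \<Longrightarrow> b \<in> Obj T \<Longrightarrow> f \<in> Hom T a b \<Longrightarrow> hadd T f (hzero T a b) = f"
  "a \<in> Obj T \<Longrightarrow> b \<in> Obj T \<Longrightarrow> f \<in> Hom T a b \<Longrightarrow> hadd T (hzero T a b) f = f"
  using group.is_monoid[OF hom_group, THEN monoid.r_one, of a b f] group.is_monoid[OF hom_group, THEN monoid.l_one, of a b f]
  by simp_all

lemma hadd_idem: "a \<in> Obj T \<Longrightarrow> b \<in> Obj T \<Longrightarrow> f \<in> Hom T a b \<Longrightarrow> hadd T f f = f \<Longrightarrow> f = hzero T a b"
  using group.l_cancel_one[OF hom_group, of a b f f] by simp

lemma hadd_Cmp:
  assumes "f \<in> Hom T a b" "g \<in> Hom T b c" "g' \<in> Hom T b c"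
  shows "hadd T g g' \<cdot> f = hadd T (g \<cdot> f) (g' \<cdot> f)"
proof -
  have "a \<in> Obj T" "b \<in> Obj T" "c \<in> Obj T" using assms by auto
  then show ?thesis
    using tri_axioms(2) assms by blast
qed

lemma Cmp_hadd:
  assumes "f \<in> Hom T a b" "f' \<in> Hom T a b" "g \<in> Hom T b c"
  shows "g \<cdot> hadd T f f' = hadd T (g \<cdot> f) (g \<cdot> f')"
proof -
  have "a \<in> Obj T" "b \<in> Obj T" "c \<in> Obj T" using assms by auto
  then show ?thesis
    using tri_axioms(2) assms by blast
qed

lemma Cmp_hzero: "a \<in> Obj T \<Longrightarrow> g \<in> Hom T b c \<Longrightarrow> g \<cdot> hzero T a b = hzero T a c"
  using hzero_Hom[of a b] Cmp_hadd[of "hzero T a b" a b "hzero T a b" g c] hadd_hzero[of a b "hzero T a b"]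
  by (intro hadd_idem) auto

lemma hzero_Cmp: "c \<in> Obj T \<Longrightarrow> f \<in> Hom T a b \<Longrightarrow> hzero T b c \<cdot> f = hzero T a c"
  using hzero_Hom[of b c] hadd_Cmp[of f a b "hzero T b c" c "hzero T b c"] hadd_hzero[of b c "hzero T b c"]
  by (intro hadd_idem) auto

lemma shift_functor: "is_functor T T (shift T)"
  using triangulated by (simp add: triangulated_def is_equivalence_def)

lemma shift_typed: "a \<in> Obj T \<Longrightarrow> \<Sigma> a \<in> Obj T" "f \<in> Hom T a b \<Longrightarrow> \<Sigma>_ar f \<in> Hom T (\<Sigma> a) (\<Sigma> b)"
  "a \<in> Obj T \<Longrightarrow> \<Sigma>_ar (Idn T a) = Idn T (\<Sigma> a)"
  "f \<in> Hom T a b \<Longrightarrow> g \<in> Hom T b c \<Longrightarrow> \<Sigma>_ar (g \<cdot> f) = \<Sigma>_ar g \<cdot> \<Sigma>_ar f"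
  using shift_functor by (auto simp: is_functor_def)

lemma shift_hzero:
  assumes "a \<in> Obj T" "b \<in> Obj T"
  shows "\<Sigma>_ar (hzero T a b) = hzero T (\<Sigma> a) (\<Sigma> b)"
proof (rule hadd_idem)
  have "hzero T a b \<in> Hom T a b" using assms by (rule hzero_Hom)
  then have "\<Sigma>_ar (hadd T (hzero T a b) (hzero T a b)) = hadd T (\<Sigma>_ar (hzero T a b)) (\<Sigma>_ar (hzero T a b))"
    using tri_axioms(4) assms by blast
  then show "hadd T (\<Sigma>_ar (hzero T a b)) (\<Sigma>_ar (hzero T a b)) = \<Sigma>_ar (hzero T a b)"
    using hadd_hzero(1)[OF assms hzero_Hom[OF assms]] by simp
qed (use assms shift_typed hzero_Hom in auto)

text \<open>An arrow into or out of \<open>w\<close> equals its composite with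
  \<open>Idn T w\<close>, which is a zero arrow.\<close>

lemma zero_objectI:
  assumes "w \<in> Obj T" "Idn T w = hzero T w w"
  shows "zero_object T w"
proof -
  have "f = hzero T a w" if "f \<in> Hom T a w" for f a
    using hzero_Cmp[OF assms(1) that] assms(2)[symmetric] that by simp
  moreover have "f = hzero T w a" if "f \<in> Hom T w a" for f a
    using Cmp_hzero[OF assms(1) that] assms(2)[symmetric] that by simp
  ultimately show ?thesis
    using assms hzero_Hom unfolding zero_object_def by blast
qed

text \<open>Makes the identity triangle of \<open>w\<close> with third vertex
  \<open>\<Sigma> z\<close> available; read backwards by rotation, it gives the triangle
  \<open>z \<rightarrow> w \<rightarrow> w\<close> that weak cokernels need.\<close>

lemma zero_object_shift:
  assumes "zero_object T z"
  shows "zero_object T (\<Sigma> z)"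
proof (rule zero_objectI)
  have z: "z \<in> Obj T" using assms by (simp add: zero_object_def)
  have "Idn T z = hzero T z z"
    using assms z hzero_Hom[OF z z] Idn_Arr[OF z] Src_Idn[OF z] Tgt_Idn[OF z] unfolding zero_object_def Hom_def by blast
  then show "Idn T (\<Sigma> z) = hzero T (\<Sigma> z) (\<Sigma> z)"
    using shift_typed(3)[OF z] shift_hzero[OF z z] by simp
  show "\<Sigma> z \<in> Obj T" using z by (rule shift_typed)
qed

lemma distD: "(f, g, h) \<in> dist T \<Longrightarrow> f \<in> Arr T" "(f, g, h) \<in> dist T \<Longrightarrow> g \<in> Hom T (Tgt T f) (Tgt T g)"
  "(f, g, h) \<in> dist T \<Longrightarrow> h \<in> Hom T (Tgt T g) (\<Sigma> (Src T f))"
  using tri_axioms(5) unfolding is_triangle_def by fastforce+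

lemma dist_rotate:
  assumes "is_triangle T (f, g, h)"
  shows "(f, g, h) \<in> dist T \<longleftrightarrow> (g, h, inv\<^bsub>hom_group T (\<Sigma> (Src T f)) (\<Sigma> (Tgt T f))\<^esub> (\<Sigma>_ar f)) \<in> dist T"
  using tri_axioms(9) assms by blast

lemma dist_Idn: "x \<in> Obj T \<Longrightarrow> zero_object T z \<Longrightarrow> (Idn T x, hzero T x z, hzero T z (\<Sigma> x)) \<in> dist T"
  using tri_axioms(7) by blast

lemma dist_morphism:
  assumes "(f, g, h) \<in> dist T" "(f', g', h') \<in> dist T" "u \<in> Hom T (Src T f) (Src T f')" "v \<in> Hom T (Tgt T f) (Tgt T f')"
    "v \<cdot> f = f' \<cdot> u"
  obtains w where "triangle_morphism T (f, g, h) (f', g', h') u v w"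
  using tri_axioms(10) assms by blast

lemma dist_triangle: "\<Delta> \<in> dist T \<Longrightarrow> is_triangle T \<Delta>"
  using tri_axioms(5) by blast

text \<open>The identity triangle on the first vertex maps to the given triangle, and its third
  component shows that the composite factors through a zero object.\<close>

lemma dist_Cmp_zero:
  assumes d: "(f, g, h) \<in> dist T"
  shows "g \<cdot> f = hzero T (Src T f) (Tgt T g)"
proof -
  obtain z where z: "zero_object T z" using tri_axioms(3) by blast
  have f: "f \<in> Arr T" "Src T f \<in> Obj T" "z \<in> Obj T" using distD(1)[OF d] z by (auto simp: zero_object_def)
  obtain w where "triangle_morphism T (Idn T (Src T f), hzero T (Src T f) z, hzero T z (\<Sigma> (Src T f))) (f, g, h) (Idn T (Src T f)) f w"
    by (rule dist_morphism[OF dist_Idn[OF f(2) z] d, where u = "Idn T (Src T f)" and v = f]) (use f in auto)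
  then have "w \<in> Hom T z (Tgt T g)" "w \<cdot> hzero T (Src T f) z = g \<cdot> f"
    using hzero_Hom[OF f(2,3)] by (auto simp: triangle_morphism_def)
  then show ?thesis using Cmp_hzero[OF f(2)] by simp
qed

text \<open>An arrow that kills \<open>f\<close> extends to a morphism of triangles into
  \<open>z \<rightarrow> w \<rightarrow> w\<close> with \<open>z\<close> zero; its third component
  is the factorization.\<close>

lemma dist_weak_cokernel:
  assumes d: "(f, g, h) \<in> dist T" and \<phi>: "\<phi> \<in> Hom T (Tgt T f) w" "\<phi> \<cdot> f = hzero T (Src T f) w"
  obtains k where "k \<in> Hom T (Tgt T g) w" "k \<cdot> g = \<phi>"
proof -
  obtain z where z: "zero_object T z" using tri_axioms(3) by blast
  have f: "f \<in> Arr T" "Src T f \<in> Obj T" "z \<in> Obj T" "w \<in> Obj T" "\<Sigma> z \<in> Obj T" "\<Sigma> w \<in> Obj T"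
    using distD(1)[OF d] z \<phi> shift_typed(1) by (auto simp: zero_object_def)
  note [simp] = hzero_Hom[OF f(3,4), simplified] hzero_Hom[OF f(4,5), simplified] hzero_Hom[OF f(2,3), simplified]
  \<comment> \<open>The sign introduced by rotation does not change a zero arrow.\<close>
  have "inv\<^bsub>hom_group T (\<Sigma> z) (\<Sigma> w)\<^esub> (\<Sigma>_ar (hzero T z w)) = hzero T (\<Sigma> z) (\<Sigma> w)"
    using shift_hzero[OF f(3,4)] group.is_monoid[OF hom_group[OF f(5,6)], THEN monoid.inv_one] by simp
  moreover have "(Idn T w, hzero T w (\<Sigma> z), hzero T (\<Sigma> z) (\<Sigma> w)) \<in> dist T"
    by (rule dist_Idn[OF f(4) zero_object_shift[OF z]])
  moreover have "is_triangle T (hzero T z w, Idn T w, hzero T w (\<Sigma> z))"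
    using f by (simp add: is_triangle_def)
  ultimately have 0: "(hzero T z w, Idn T w, hzero T w (\<Sigma> z)) \<in> dist T"
    using dist_rotate[of "hzero T z w" "Idn T w" "hzero T w (\<Sigma> z)"] by simp
  obtain k where "triangle_morphism T (f, g, h) (hzero T z w, Idn T w, hzero T w (\<Sigma> z)) (hzero T (Src T f) z) \<phi> k"
    by (rule dist_morphism[OF d 0, where u = "hzero T (Src T f) z" and v = \<phi>]) (use f \<phi> Cmp_hzero[of "Src T f" "hzero T z w" z w] in auto)
  then show ?thesis
    using f \<phi> by (intro that[of k]) (auto simp: triangle_morphism_def)
qed

text \<open>Complete \<open>i1\<close> to a distinguished triangle with arrows \<open>g\<close>,
  \<open>h\<close>. The retraction \<open>p1\<close> forces \<open>h = 0\<close>; then the third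
  vertex is isomorphic to \<open>y\<close> compatibly with \<open>g\<close> and \<open>p2\<close>,
  and distinguished triangles are closed under isomorphism.\<close>

lemma split_triangle_dist:
  assumes b: "biproduct T x y s i1 i2 p1 p2"
  shows "(i1, p2, hzero T y (\<Sigma> x)) \<in> dist T"
proof -
  have ob: "x \<in> Obj T" "y \<in> Obj T" "s \<in> Obj T" "\<Sigma> x \<in> Obj T" "\<Sigma> s \<in> Obj T"
    and ar [simp]: "i1 \<in> Arr T" "Src T i1 = x" "Tgt T i1 = s" "i2 \<in> Arr T" "Src T i2 = y" "Tgt T i2 = s"
      "p1 \<in> Arr T" "Src T p1 = s" "Tgt T p1 = x" "p2 \<in> Arr T" "Src T p2 = s" "Tgt T p2 = y"
    and eq: "p1 \<cdot> i1 = Idn T x" "p2 \<cdot> i2 = Idn T y" "p2 \<cdot> i1 = hzero T x y" "hadd T (i1 \<cdot> p1) (i2 \<cdot> p2) = Idn T s"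
    using b shift_typed(1) by (auto simp: biproduct_def)
  note [simp] = ob
  obtain g h where d: "(i1, g, h) \<in> dist T"
    using tri_axioms(8) \<open>i1 \<in> Arr T\<close> by blast
  define c where "c = Tgt T g"
  have [simp]: "g \<in> Arr T" "Src T g = s" "Tgt T g = c" "c \<in> Obj T" "h \<in> Arr T" "Src T h = c" "Tgt T h = \<Sigma> x"
    using distD[OF d] by (auto simp: c_def)
  let ?n = "inv\<^bsub>hom_group T (\<Sigma> x) (\<Sigma> s)\<^esub> (\<Sigma>_ar i1)"
  have Si: "\<Sigma>_ar i1 \<in> Hom T (\<Sigma> x) (\<Sigma> s)" "\<Sigma>_ar p1 \<in> Hom T (\<Sigma> s) (\<Sigma> x)"
    by (auto intro!: shift_typed(2)[unfolded Hom_def, simplified])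
  have n: "?n \<in> Hom T (\<Sigma> x) (\<Sigma> s)" "hadd T (\<Sigma>_ar i1) ?n = hzero T (\<Sigma> x) (\<Sigma> s)"
    using group.inv_closed[OF hom_group, of "\<Sigma> x" "\<Sigma> s" "\<Sigma>_ar i1"] group.r_inv[OF hom_group, of "\<Sigma> x" "\<Sigma> s" "\<Sigma>_ar i1"] Si by simp_all
  have d2: "(g, h, ?n) \<in> dist T"
    using dist_rotate[OF dist_triangle[OF d]] d by simp
  have "\<exists>r. (h, ?n, r) \<in> dist T"
    using dist_rotate[OF dist_triangle[OF d2]] d2 by blast
  then have nh: "?n \<cdot> h = hzero T c (\<Sigma> s)"
    using dist_Cmp_zero n(1) by fastforce
  have "\<Sigma>_ar i1 \<cdot> h = hadd T (\<Sigma>_ar i1 \<cdot> h) (?n \<cdot> h)"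
    unfolding nh using Si by (subst hadd_hzero) auto
  also have "\<dots> = hadd T (\<Sigma>_ar i1) ?n \<cdot> h"
    by (rule hadd_Cmp[symmetric, of h c "\<Sigma> x"]) (use Si n in auto)
  also have "\<dots> = hzero T c (\<Sigma> s)"
    unfolding n(2) by (rule hzero_Cmp) auto
  finally have ih: "\<Sigma>_ar i1 \<cdot> h = hzero T c (\<Sigma> s)" .
  \<comment> \<open>The shift of \<open>p1\<close> is still a retraction of the shift of
    \<open>i1\<close>, which kills \<open>h\<close>.\<close>
  have "h = (\<Sigma>_ar p1 \<cdot> \<Sigma>_ar i1) \<cdot> h"
    using shift_typed(4)[of i1 x s p1 x] shift_typed(3)[of x] by (simp add: eq flip: shift_typed(4)[of i1 x s p1 x, simplified])
  also have "\<dots> = hzero T c (\<Sigma> x)"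
    using Si by (subst Cmp_assoc) (auto simp: ih intro: Cmp_hzero)
  finally have h0: "h = hzero T c (\<Sigma> x)" .
  obtain k where k: "k \<in> Hom T c y" "k \<cdot> g = p2"
    by (rule dist_weak_cokernel[OF d, of p2 y]) (use eq in auto)
  have kg: "k \<cdot> (g \<cdot> i2) = Idn T y"
    using k eq by (subst Cmp_assoc[symmetric]) auto
  have g_eq: "g = (g \<cdot> i2) \<cdot> (k \<cdot> g)"
  proof -
    have "g = g \<cdot> hadd T (i1 \<cdot> p1) (i2 \<cdot> p2)" by (simp add: eq)
    also have "\<dots> = hadd T (g \<cdot> (i1 \<cdot> p1)) (g \<cdot> (i2 \<cdot> p2))"
      by (rule Cmp_hadd[of _ s s]) auto
    also have "g \<cdot> (i1 \<cdot> p1) = hzero T s c"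
      using dist_Cmp_zero[OF d] hzero_Cmp[of c p1 s x] by (subst Cmp_assoc[symmetric]) auto
    also have "hadd T (hzero T s c) (g \<cdot> (i2 \<cdot> p2)) = g \<cdot> (i2 \<cdot> p2)"
      by (rule hadd_hzero) auto
    finally show ?thesis using k by (simp add: Cmp_assoc)
  qed
  \<comment> \<open>\<open>k\<close> already has the right inverse \<open>g \<cdot> i2\<close>. For
    the other composite \<open>?e\<close>, the difference of \<open>?e\<close> and the identity
    kills \<open>g\<close>, hence factors through \<open>h = 0\<close>.\<close>
  let ?e = "(g \<cdot> i2) \<cdot> k"
  let ?m = "inv\<^bsub>hom_group T c c\<^esub> (Idn T c)"
  have e: "?e \<in> Hom T c c" using k by auto
  have m: "?m \<in> Hom T c c" "hadd T (Idn T c) ?m = hzero T c c"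
    using group.inv_closed[OF hom_group, of c c "Idn T c"] group.r_inv[OF hom_group, of c c "Idn T c"] by simp_all
  have \<delta>: "hadd T ?e ?m \<in> Hom T c c" by (rule hadd_Hom) (use e m in auto)
  have "hadd T ?e ?m \<cdot> g = hadd T (?e \<cdot> g) (?m \<cdot> g)"
    by (rule hadd_Cmp[of _ s c _ c]) (use e m in auto)
  also have "?e \<cdot> g = Idn T c \<cdot> g"
    using g_eq k by (simp add: Cmp_assoc)
  also have "hadd T (Idn T c \<cdot> g) (?m \<cdot> g) = hadd T (Idn T c) ?m \<cdot> g"
    by (rule hadd_Cmp[symmetric, of _ s c _ c]) (use m in auto)
  also have "\<dots> = hzero T s c"
    unfolding m(2) by (rule hzero_Cmp) auto
  finally have "hadd T ?e ?m \<cdot> g = hzero T s c" .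
  then obtain r where "r \<in> Hom T (\<Sigma> x) c" "r \<cdot> h = hadd T ?e ?m"
    using dist_weak_cokernel[OF d2, of "hadd T ?e ?m" c] \<delta> by auto
  then have "hadd T ?e ?m = hzero T c c"
    unfolding h0 using Cmp_hzero[of c r "\<Sigma> x" c] by simp
  then have ek: "?e = Idn T c"
    using group.right_cancel[OF hom_group, of c c ?m ?e "Idn T c"] e m by simp
  have "is_iso T k"
    unfolding is_iso_def inverse_of_def using k kg ek by (intro conjI exI[of _ "g \<cdot> i2"]) auto
  then have "triangle_iso T (i1, g, h) (i1, p2, hzero T y (\<Sigma> x)) (Idn T x) (Idn T s) k"
    using k hzero_Cmp[of "\<Sigma> x" k c y] hzero_Hom[of c "\<Sigma> x"] shift_typed(3)[of x]
    by (auto simp: triangle_iso_def triangle_morphism_def h0)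
  moreover have "is_triangle T (i1, p2, hzero T y (\<Sigma> x))"
    using hzero_Hom[of y "\<Sigma> x"] by (simp add: is_triangle_def)
  ultimately show ?thesis
    using tri_axioms(6) d by blast
qed

end

section \<open>Determinant functors and monoidal functors as models\<close>

lemma (in tri_cat) biproduct_swap: "biproduct T x y s i1 i2 p1 p2 \<Longrightarrow> biproduct T y x s i2 i1 p2 p1"
proof -
  assume b: "biproduct T x y s i1 i2 p1 p2"
  then have s: "s \<in> Obj T" "i1 \<cdot> p1 \<in> Hom T s s" "i2 \<cdot> p2 \<in> Hom T s s"
    by (auto simp: biproduct_def)
  then have "hadd T (i2 \<cdot> p2) (i1 \<cdot> p1) = hadd T (i1 \<cdot> p1) (i2 \<cdot> p2)"
    using tri_axioms(1) comm_monoid.m_comm[of "hom_group T s s" "i2 \<cdot> p2" "i1 \<cdot> p1"] by (simp add: comm_group_def)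
  with b show ?thesis by (simp add: biproduct_def)
qed

lemma (in tri_cat) category_isom: "category (isom T)"
proof -
  have iso: "is_iso T (g \<cdot> f)" if fg: "is_iso T f" "is_iso T g" "Src T g = Tgt T f" for f g
  proof -
    obtain f' g' where "inverse_of T f f'" "inverse_of T g g'" using fg by (auto simp: is_iso_def)
    moreover from this have "f' \<cdot> g' \<cdot> g \<cdot> f = Idn T (Src T f)" "g \<cdot> f \<cdot> f' \<cdot> g' = Idn T (Tgt T g)"
      using fg by (simp_all add: inverse_of_def is_iso_def Cmp_reassoc[of g' g] Cmp_reassoc[of f f'])
    ultimately have "inverse_of T (g \<cdot> f) (f' \<cdot> g')"
      using fg by (auto simp: inverse_of_def is_iso_def Cmp_assoc)
    then show ?thesis using fg by (auto simp: is_iso_def)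
  qed
  have "is_iso T f \<Longrightarrow> f \<in> Arr T" for f by (simp add: is_iso_def)
  then show ?thesis
    unfolding category_def using iso by (auto simp: isom_def Cmp_assoc)
qed

lemma isom_sel [simp]: "Obj (isom C) = Obj C" "f \<in> Arr (isom C) \<longleftrightarrow> is_iso C f" "Src (isom C) = Src C" "Tgt (isom C) = Tgt C"
  "Idn (isom C) = Idn C" "Cmp (isom C) = Cmp C"
  by (simp_all add: isom_def)

context tri_cat
begin

lemma vertex_Obj: "\<Delta> \<in> dist T \<Longrightarrow> vx T \<Delta> \<in> Obj T \<and> vy T \<Delta> \<in> Obj T \<and> vz T \<Delta> \<in> Obj T"
  using dist_triangle[of \<Delta>] by (cases \<Delta>) (auto simp: is_triangle_def vx_def vy_def vz_def)

lemma triangle_iso_typed: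
  "triangle_iso T \<Delta> \<Delta>' u v w \<Longrightarrow> is_iso T u \<and> is_iso T v \<and> is_iso T w \<and> Src T u = vx T \<Delta> \<and> Tgt T u = vx T \<Delta>' \<and>
    Src T v = vy T \<Delta> \<and> Tgt T v = vy T \<Delta>' \<and> Src T w = vz T \<Delta> \<and> Tgt T w = vz T \<Delta>'"
  by (cases \<Delta>; cases \<Delta>') (auto simp: triangle_iso_def triangle_morphism_def vx_def vy_def vz_def)

lemma octahedron_typed:
  assumes "octahedron T \<Delta>1 \<Delta>2 \<Delta>3 \<Delta>4"
  shows "\<Delta>1 \<in> dist T \<and> \<Delta>2 \<in> dist T \<and> \<Delta>3 \<in> dist T \<and> \<Delta>4 \<in> dist T \<and> vz T \<Delta>2 = vy T \<Delta>4 \<and> vx T \<Delta>2 = vx T \<Delta>1 \<and>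
    vz T \<Delta>4 = vz T \<Delta>3 \<and> vx T \<Delta>4 = vz T \<Delta>1 \<and> vy T \<Delta>2 = vy T \<Delta>3 \<and> vx T \<Delta>3 = vy T \<Delta>1"
proof -
  obtain f a1 b1 e a2 b2 g a3 b3 u v w where \<Delta>: "\<Delta>1 = (f, a1, b1)" "\<Delta>2 = (e, a2, b2)" "\<Delta>3 = (g, a3, b3)" "\<Delta>4 = (u, v, w)"
    by (cases \<Delta>1; cases \<Delta>2; cases \<Delta>3; cases \<Delta>4)
  then have "f \<in> Arr T" "g \<in> Arr T"
    using assms by (auto simp: octahedron_def intro: distD)
  then show ?thesis
    using assms by (auto simp: \<Delta> octahedron_def vx_def vy_def vz_def)
qed

text \<open>That both split triangles are distinguished is what makes the commutativity relation of
  \<open>presT\<close> a pair of well-typed expressions.\<close>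

lemma biproduct_triangles:
  assumes b: "biproduct T x y s i1 i2 p1 p2"
  shows "(i1, p2, hzero T y (\<Sigma> x)) \<in> dist T \<and> (i2, p1, hzero T x (\<Sigma> y)) \<in> dist T \<and>
    x \<in> Obj T \<and> y \<in> Obj T \<and> vx T (i1, p2, hzero T y (\<Sigma> x)) = x \<and> vy T (i1, p2, hzero T y (\<Sigma> x)) = s \<and>
    vz T (i1, p2, hzero T y (\<Sigma> x)) = y \<and> vx T (i2, p1, hzero T x (\<Sigma> y)) = y \<and>
    vy T (i2, p1, hzero T x (\<Sigma> y)) = s \<and> vz T (i2, p1, hzero T x (\<Sigma> y)) = x"
  using split_triangle_dist[OF b] split_triangle_dist[OF biproduct_swap[OF b]] b
  by (auto simp: biproduct_def vx_def vy_def vz_def)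

end

text \<open>Its models in \<open>P\<close> are the determinant functors. The three sets of relations
  are naturality for isomorphisms of triangles, commutativity and associativity.\<close>

definition presT :: "('o, 'm) tricat \<Rightarrow> ('o, 'm, 'm triangle) pres" where
  "presT T = \<lparr>base = isom T, lab = dist T, lz = vz T, lx = vx T, ly = vy T,
    rels =
      {(ECmp (EArr v) (ELab \<Delta>), ECmp (ELab \<Delta>') (ESum (EArr w) (EArr u))) | \<Delta> \<Delta>' u v w.
        \<Delta> \<in> dist T \<and> \<Delta>' \<in> dist T \<and> triangle_iso T \<Delta> \<Delta>' u v w} \<union>
      {(ELab (i2, p1, hzero T x (fob (shift T) y)), ECmp (ELab (i1, p2, hzero T y (fob (shift T) x))) (ESymm (Leaf x) (Leaf y))) |
        x y s i1 i2 p1 p2. biproduct T x y s i1 i2 p1 p2} \<union>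
      {(ECmp (ELab \<Delta>2) (ESum (ELab \<Delta>4) (EId (Leaf (vx T \<Delta>1)))),
        ECmp (ELab \<Delta>3) (ECmp (ESum (EId (Leaf (vz T \<Delta>3))) (ELab \<Delta>1))
          (EAssoc (Leaf (vz T \<Delta>3)) (Leaf (vz T \<Delta>1)) (Leaf (vx T \<Delta>1))))) | \<Delta>1 \<Delta>2 \<Delta>3 \<Delta>4. octahedron T \<Delta>1 \<Delta>2 \<Delta>3 \<Delta>4}\<rparr>"

lemma presT_sel [simp]: "base (presT T) = isom T" "lab (presT T) = dist T" "lz (presT T) = vz T" "lx (presT T) = vx T"
  "ly (presT T) = vy T"
  by (simp_all add: presT_def)

lemma wf_presT:
  assumes "triangulated T"
  shows "wf_pres (presT T)"
proof -
  interpret tri_cat T by unfold_locales (rule assms)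
  have "wt (presT T) d \<and> wt (presT T) e \<and> esrc (presT T) d = esrc (presT T) e \<and> etgt (presT T) d = etgt (presT T) e"
    if "(d, e) \<in> rels (presT T)" for d e
    using that unfolding presT_def pres.select_convs
  proof (elim UnE CollectE exE conjE Pair_inject, fold presT_def, goal_cases)
    case (1 \<Delta> \<Delta>' u v w)
    then show ?case by (auto dest!: triangle_iso_typed)
  next
    case (2 x y s i1 i2 p1 p2)
    then show ?case by (auto dest!: biproduct_triangles)
  next
    case (3 \<Delta>1 \<Delta>2 \<Delta>3 \<Delta>4)
    then show ?case using vertex_Obj by (auto dest!: octahedron_typed)
  qed
  then show ?thesis
    using category_isom vertex_Obj by (auto simp: wf_pres_def)
qed

text \<open>Its models are symmetric monoidal functors without units; the relations are naturality,
  associativity and symmetry of \<open>fadd\<close>. Invertibility of \<open>fadd\<close> is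
  automatic in a groupoid. \<open>cat.truncate\<close> forgets the monoidal fields, since a base is
  a bare category.\<close>

definition presV :: "('v, 'w) moncat \<Rightarrow> ('v, 'w, 'v \<times> 'v) pres" where
  "presV V = \<lparr>base = cat.truncate V, lab = Obj V \<times> Obj V, lz = fst, lx = snd, ly = (\<lambda>(a, b). a \<boxplus>\<^bsub>V\<^esub> b),
    rels =
      {(ECmp (ELab (Tgt V f, Tgt V g)) (ESum (EArr f) (EArr g)), ECmp (EArr (f [+]\<^bsub>V\<^esub> g)) (ELab (Src V f, Src V g))) | f g.
        f \<in> Arr V \<and> g \<in> Arr V} \<union>
      {(ECmp (EArr (assoc V a b c)) (ECmp (ELab (a \<boxplus>\<^bsub>V\<^esub> b, c)) (ESum (ELab (a, b)) (EId (Leaf c)))),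
        ECmp (ELab (a, b \<boxplus>\<^bsub>V\<^esub> c)) (ECmp (ESum (EId (Leaf a)) (ELab (b, c))) (EAssoc (Leaf a) (Leaf b) (Leaf c)))) | a b c.
        a \<in> Obj V \<and> b \<in> Obj V \<and> c \<in> Obj V} \<union>
      {(ECmp (EArr (symm V a b)) (ELab (a, b)), ECmp (ELab (b, a)) (ESymm (Leaf a) (Leaf b))) | a b. a \<in> Obj V \<and> b \<in> Obj V}\<rparr>"

lemma truncate_sel [simp]: "Obj (cat.truncate C) = Obj C" "Arr (cat.truncate C) = Arr C" "Src (cat.truncate C) = Src C"
  "Tgt (cat.truncate C) = Tgt C" "Idn (cat.truncate C) = Idn C" "Cmp (cat.truncate C) = Cmp C"
  by (simp_all add: cat.defs)

lemma category_truncate [simp]: "category (cat.truncate C) = category C"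
  by (simp add: category_def)

lemma presV_sel [simp]: "base (presV V) = cat.truncate V" "lab (presV V) = Obj V \<times> Obj V" "lz (presV V) = fst" "lx (presV V) = snd"
  "ly (presV V) (a, b) = a \<boxplus>\<^bsub>V\<^esub> b"
  by (simp_all add: presV_def)

lemma wf_presV:
  assumes "picard V"
  shows "wf_pres (presV V)"
proof -
  interpret picard_gpd V by (rule picard_gpdI[OF assms])
  have "wt (presV V) d \<and> wt (presV V) e \<and> esrc (presV V) d = esrc (presV V) e \<and> etgt (presV V) d = etgt (presV V) e"
    if "(d, e) \<in> rels (presV V)" for d e
    using that unfolding presV_def pres.select_convs
    by (elim UnE CollectE exE conjE Pair_inject, fold presV_def) auto
  then show ?thesis
    using category by (auto simp: wf_pres_def)
qed

context sym_gpd
begin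

definition det_model :: "('o, 'm, 'p, 'q, 'x) detfunct_scheme \<Rightarrow> ('o, 'm, 'm triangle, 'p, 'q) model" where
  "det_model d = \<lparr>fob = fob d, far = far d, lb = dadd d\<rparr>"

lemma det_model_sel [simp]: "fob (det_model d) = fob d" "far (det_model d) = far d" "lb (det_model d) = dadd d"
  by (simp_all add: det_model_def)

lemma is_functor_cong:
  "\<lbrakk>Obj C = Obj C'; Arr C = Arr C'; Src C = Src C'; Tgt C = Tgt C'; Idn C = Idn C'; Cmp C = Cmp C'; fob F = fob G; far F = far G\<rbrakk>
    \<Longrightarrow> is_functor C D F \<longleftrightarrow> is_functor C' D G"
  by (simp add: is_functor_def category_def)

lemma ball_rels:
  "(\<forall>(d, e)\<in>{(A x y, B x y) | x y. Q x y}. E d = E e) \<longleftrightarrow> (\<forall>x y. Q x y \<longrightarrow> E (A x y) = E (B x y))"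
  "(\<forall>(d, e)\<in>{(A' x y z, B' x y z) | x y z. Q' x y z}. E d = E e) \<longleftrightarrow> (\<forall>x y z. Q' x y z \<longrightarrow> E (A' x y z) = E (B' x y z))"
  "(\<forall>(d, e)\<in>{(A4 x y z t, B4 x y z t) | x y z t. Q4 x y z t}. E d = E e) \<longleftrightarrow>
    (\<forall>x y z t. Q4 x y z t \<longrightarrow> E (A4 x y z t) = E (B4 x y z t))"
  "(\<forall>(d, e)\<in>{(A5 x y z t u, B5 x y z t u) | x y z t u. Q5 x y z t u}. E d = E e) \<longleftrightarrow>
    (\<forall>x y z t u. Q5 x y z t u \<longrightarrow> E (A5 x y z t u) = E (B5 x y z t u))"
  "(\<forall>(d, e)\<in>{(A7 x y z t u v w, B7 x y z t u v w) | x y z t u v w. Q7 x y z t u v w}. E d = E e) \<longleftrightarrow>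
    (\<forall>x y z t u v w. Q7 x y z t u v w \<longrightarrow> E (A7 x y z t u v w) = E (B7 x y z t u v w))"
  by blast+

lemma is_model_presT_iff: "is_model (presT T) (det_model d) \<longleftrightarrow> det_functor T P d"
proof -
  have f: "is_functor (isom T) P (det_model d) \<longleftrightarrow> is_functor (isom T) P d"
    by (rule is_functor_cong) simp_all
  have "(\<forall>(d1, d2)\<in>rels (presT T). eval (det_model d) d1 = eval (det_model d) d2) \<longleftrightarrow>
    (\<forall>\<Delta>\<in>dist T. \<forall>\<Delta>'\<in>dist T. \<forall>u v w. triangle_iso T \<Delta> \<Delta>' u v w \<longrightarrow>
       far d v \<cdot> dadd d \<Delta> = dadd d \<Delta>' \<cdot> (far d w [+] far d u)) \<and>
    (\<forall>x y s i1 i2 p1 p2. biproduct T x y s i1 i2 p1 p2 \<longrightarrow>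
       dadd d (i2, p1, hzero T x (fob (shift T) y)) =
       dadd d (i1, p2, hzero T y (fob (shift T) x)) \<cdot> symm P (fob d x) (fob d y)) \<and>
    (\<forall>\<Delta>1 \<Delta>2 \<Delta>3 \<Delta>4. octahedron T \<Delta>1 \<Delta>2 \<Delta>3 \<Delta>4 \<longrightarrow>
       dadd d \<Delta>2 \<cdot> (dadd d \<Delta>4 [+] Idn P (fob d (vx T \<Delta>1))) =
       dadd d \<Delta>3 \<cdot> (Idn P (fob d (vz T \<Delta>3)) [+] dadd d \<Delta>1) \<cdot>
         assoc P (fob d (vz T \<Delta>3)) (fob d (vz T \<Delta>1)) (fob d (vx T \<Delta>1)))"
    unfolding presT_def pres.select_convs ball_Un ball_rels eval.simps tval.simps det_model_sel conj_assoc
    by (intro arg_cong2[where f = "(\<and>)"]) blast+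
  with f show ?thesis
    unfolding is_model_def premodel_def det_functor_def presT_sel det_model_sel by simp
qed

definition sm_model :: "('v, 'w, 'p, 'q, 'x) smfunct_scheme \<Rightarrow> ('v, 'w, 'v \<times> 'v, 'p, 'q) model" where
  "sm_model f = \<lparr>fob = fob f, far = far f, lb = (\<lambda>(a, b). fadd f a b)\<rparr>"

lemma sm_model_sel [simp]: "fob (sm_model f) = fob f" "far (sm_model f) = far f" "lb (sm_model f) (a, b) = fadd f a b"
  by (simp_all add: sm_model_def)

lemma is_model_presV_iff: "is_model (presV V) (sm_model F) \<longleftrightarrow> is_functor V P F \<and>
    (\<forall>a\<in>Obj V. \<forall>b\<in>Obj V. fadd F a b \<in> Hom P (fob F a \<boxplus> fob F b) (fob F (a \<boxplus>\<^bsub>V\<^esub> b))) \<and>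
    (\<forall>f\<in>Arr V. \<forall>g\<in>Arr V. fadd F (Tgt V f) (Tgt V g) \<cdot> (far F f [+] far F g) = far F (f [+]\<^bsub>V\<^esub> g) \<cdot> fadd F (Src V f) (Src V g)) \<and>
    (\<forall>a\<in>Obj V. \<forall>b\<in>Obj V. \<forall>c\<in>Obj V.
       far F (assoc V a b c) \<cdot> fadd F (a \<boxplus>\<^bsub>V\<^esub> b) c \<cdot> (fadd F a b [+] Idn P (fob F c)) =
       fadd F a (b \<boxplus>\<^bsub>V\<^esub> c) \<cdot> (Idn P (fob F a) [+] fadd F b c) \<cdot> assoc P (fob F a) (fob F b) (fob F c)) \<and>
    (\<forall>a\<in>Obj V. \<forall>b\<in>Obj V. far F (symm V a b) \<cdot> fadd F a b = fadd F b a \<cdot> symm P (fob F a) (fob F b))"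
proof -
  have f: "is_functor (cat.truncate V) P (sm_model F) \<longleftrightarrow> is_functor V P F"
    by (rule is_functor_cong) simp_all
  have "(\<forall>(d1, d2)\<in>rels (presV V). eval (sm_model F) d1 = eval (sm_model F) d2) \<longleftrightarrow>
    (\<forall>f\<in>Arr V. \<forall>g\<in>Arr V. fadd F (Tgt V f) (Tgt V g) \<cdot> (far F f [+] far F g) = far F (f [+]\<^bsub>V\<^esub> g) \<cdot> fadd F (Src V f) (Src V g)) \<and>
    (\<forall>a\<in>Obj V. \<forall>b\<in>Obj V. \<forall>c\<in>Obj V.
       far F (assoc V a b c) \<cdot> fadd F (a \<boxplus>\<^bsub>V\<^esub> b) c \<cdot> (fadd F a b [+] Idn P (fob F c)) =
       fadd F a (b \<boxplus>\<^bsub>V\<^esub> c) \<cdot> (Idn P (fob F a) [+] fadd F b c) \<cdot> assoc P (fob F a) (fob F b) (fob F c)) \<and>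
    (\<forall>a\<in>Obj V. \<forall>b\<in>Obj V. far F (symm V a b) \<cdot> fadd F a b = fadd F b a \<cdot> symm P (fob F a) (fob F b))"
    unfolding presV_def pres.select_convs ball_Un ball_rels eval.simps tval.simps sm_model_sel conj_assoc
    by (intro arg_cong2[where f = "(\<and>)"]) blast+
  moreover have "(\<forall>t\<in>Obj V \<times> Obj V. lb (sm_model F) t \<in> Hom P (fob F (fst t) \<boxplus> fob F (snd t)) (fob F (ly (presV V) t))) \<longleftrightarrow>
    (\<forall>a\<in>Obj V. \<forall>b\<in>Obj V. fadd F a b \<in> Hom P (fob F a \<boxplus> fob F b) (fob F (a \<boxplus>\<^bsub>V\<^esub> b)))"
    by auto
  ultimately show ?thesis
    using f unfolding is_model_def premodel_def presV_sel sm_model_sel by argo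
qed

text \<open>Isolates the unit data: everything else in the definition of a monoidal functor is a
  relation of \<open>presV\<close>.\<close>

lemma sm_functor_iff: "sm_functor V P F \<longleftrightarrow> is_model (presV V) (sm_model F) \<and>
    funit F \<in> Hom P (ounit P) (fob F (ounit V)) \<and>
    (\<forall>a\<in>Obj V. far F (lunit V a) \<cdot> fadd F (ounit V) a \<cdot> (funit F [+] Idn P (fob F a)) = lunit P (fob F a)) \<and>
    (\<forall>a\<in>Obj V. far F (runit V a) \<cdot> fadd F a (ounit V) \<cdot> (Idn P (fob F a) [+] funit F) = runit P (fob F a))"
proof -
  have "is_iso P f" if "f \<in> Hom P a b" for f a b
    using that isos by simp
  then show ?thesis
    unfolding is_model_presV_iff sm_functor_def by blast
qed

end

section \<open>Units in Picard groupoids\<close>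

locale picard_pair = picard_gpd P + V: picard_gpd V
  for P :: "('p, 'q) moncat" (structure) and V :: "('v, 'w) moncat"
begin

abbreviation zero :: 'v ("\<zero>") where "\<zero> \<equiv> ounit V"

lemma presV_modelD:
  assumes "is_model (presV V) F"
  shows "\<lbrakk>f \<in> Arr V; g \<in> Arr V\<rbrakk> \<Longrightarrow>
      lb F (Tgt V f, Tgt V g) \<cdot> (far F f [+] far F g) = far F (f [+]\<^bsub>V\<^esub> g) \<cdot> lb F (Src V f, Src V g)"
    and "\<lbrakk>a \<in> Obj V; b \<in> Obj V; c \<in> Obj V\<rbrakk> \<Longrightarrow>
      far F (assoc V a b c) \<cdot> lb F (a \<boxplus>\<^bsub>V\<^esub> b, c) \<cdot> (lb F (a, b) [+] Idn P (fob F c)) =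
       lb F (a, b \<boxplus>\<^bsub>V\<^esub> c) \<cdot> (Idn P (fob F a) [+] lb F (b, c)) \<cdot> assoc P (fob F a) (fob F b) (fob F c)"
    and "\<lbrakk>a \<in> Obj V; b \<in> Obj V\<rbrakk> \<Longrightarrow> far F (symm V a b) \<cdot> lb F (a, b) = lb F (b, a) \<cdot> symm P (fob F a) (fob F b)"
proof -
  \<comment> \<open>The model dressed up as a monoidal functor with an arbitrary unit, so that the
    relations can be read off from \<open>is_model_presV_iff\<close>.\<close>
  define K where "K = \<lparr>fob = fob F, far = far F, fadd = (\<lambda>a b. lb F (a, b)), funit = undefined :: 'q\<rparr>"
  have "sm_model K = F"
    by (simp add: sm_model_def K_def)
  then have "is_model (presV V) (sm_model K)" using assms by simp
  note this[unfolded is_model_presV_iff]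
  then show "\<lbrakk>f \<in> Arr V; g \<in> Arr V\<rbrakk> \<Longrightarrow>
      lb F (Tgt V f, Tgt V g) \<cdot> (far F f [+] far F g) = far F (f [+]\<^bsub>V\<^esub> g) \<cdot> lb F (Src V f, Src V g)"
    "\<lbrakk>a \<in> Obj V; b \<in> Obj V; c \<in> Obj V\<rbrakk> \<Longrightarrow>
      far F (assoc V a b c) \<cdot> lb F (a \<boxplus>\<^bsub>V\<^esub> b, c) \<cdot> (lb F (a, b) [+] Idn P (fob F c)) =
       lb F (a, b \<boxplus>\<^bsub>V\<^esub> c) \<cdot> (Idn P (fob F a) [+] lb F (b, c)) \<cdot> assoc P (fob F a) (fob F b) (fob F c)"
    "\<lbrakk>a \<in> Obj V; b \<in> Obj V\<rbrakk> \<Longrightarrow> far F (symm V a b) \<cdot> lb F (a, b) = lb F (b, a) \<cdot> symm P (fob F a) (fob F b)"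
    by (simp_all add: K_def)
qed

definition is_unit :: "('v, 'w, 'v \<times> 'v, 'p, 'q) model \<Rightarrow> 'q \<Rightarrow> bool" where
  "is_unit F u \<longleftrightarrow> u \<in> Hom P (ounit P) (fob F \<zero>) \<and>
    (\<forall>a\<in>Obj V. far F (lunit V a) \<cdot> lb F (\<zero>, a) \<cdot> (u [+] Idn P (fob F a)) = lunit P (fob F a)) \<and>
    (\<forall>a\<in>Obj V. far F (runit V a) \<cdot> lb F (a, \<zero>) \<cdot> (Idn P (fob F a) [+] u) = runit P (fob F a))"

text \<open>In a Picard groupoid the unit constraint is the unique solution \<open>u\<close> of its right unit law at \<open>0\<close>,
  so that additive structure determines it.\<close>

lemma unit_ex:
  assumes F: "is_model (presV V) F"
  shows "\<exists>u. is_unit F u"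
proof -
  note pF = premodelD[OF is_modelD[OF F], simplified]
  have [simp]: "fob F a \<in> Obj P" if "a \<in> Obj V" for a using pF(1) that .
  have [simp]: "far F f \<in> Arr P" "Src P (far F f) = fob F (Src V f)" "Tgt P (far F f) = fob F (Tgt V f)" if "f \<in> Arr V" for f
    using pF(2-4) that by auto
  have [simp]: "lb F (a, b) \<in> Arr P" "Src P (lb F (a, b)) = fob F a \<boxplus> fob F b" "Tgt P (lb F (a, b)) = fob F (a \<boxplus>\<^bsub>V\<^esub> b)"
    if "a \<in> Obj V" "b \<in> Obj V" for a b
    using pF(7-9)[of "(a, b)"] that by simp_all
  have FI [simp]: "far F (Idn V a) = Idn P (fob F a)" if "a \<in> Obj V" for a using pF(5) that .
  have FC: "far F g \<cdot> far F f = far F (g \<cdot>\<^bsub>V\<^esub> f)" if "f \<in> Arr V" "g \<in> Arr V" "Src V g = Tgt V f" for f g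
    using pF(6) that by simp
  note nat = presV_modelD(1)[OF F] and asc = presV_modelD(2)[OF F] and sym = presV_modelD(3)[OF F]
  let ?e = "fob F \<zero>" and ?o = "ounit P"
  \<comment> \<open>The multiplication that \<open>F\<close> induces on its value at
    \<open>0\<close>.\<close>
  define m where "m = far F (runit V \<zero>) \<cdot> lb F (\<zero>, \<zero>)"
  have m [simp]: "m \<in> Arr P" "Src P m = ?e \<boxplus> ?e" "Tgt P m = ?e" by (simp_all add: m_def)
  \<comment> \<open>The right unit law at \<open>0\<close> is solvable because adding
    \<open>F 0\<close> on the left is surjective on arrows.\<close>
  have "(\<lambda>f. Idn P ?e [+] f) ` Hom P ?o ?e = Hom P (?e \<boxplus> ?o) (?e \<boxplus> ?e)"
    by (rule osum_functor_equivalence(2)) simp_all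
  moreover have "inv_arr P m \<cdot> runit P ?e \<in> Hom P (?e \<boxplus> ?o) (?e \<boxplus> ?e)"
    by simp
  ultimately have "inv_arr P m \<cdot> runit P ?e \<in> (\<lambda>f. Idn P ?e [+] f) ` Hom P ?o ?e"
    by (simp only:)
  then obtain u where u [simp]: "u \<in> Arr P" "Src P u = ?o" "Tgt P u = ?e" and u_eq: "inv_arr P m \<cdot> runit P ?e = Idn P ?e [+] u"
    by auto
  have mu: "m \<cdot> (Idn P ?e [+] u) = runit P ?e"
    by (simp flip: u_eq)
  have left: "far F (lunit V a) \<cdot> lb F (\<zero>, a) \<cdot> (u [+] Idn P (fob F a)) = lunit P (fob F a)" if a [simp]: "a \<in> Obj V" for a
  proof -
    let ?A = "fob F a"
    \<comment> \<open>The action of \<open>F 0\<close> on \<open>F a\<close>. Equation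
      \<open>1\<close> says that acting twice is acting by the product \<open>m\<close>. With
      \<open>u\<close> inserted in the middle, the law for \<open>m\<close> applies; cancelling the
      outer \<open>\<phi>\<close> and then the summand \<open>F 0\<close> leaves the left unit
      law.\<close>
    define \<phi> where "\<phi> = far F (lunit V a) \<cdot> lb F (\<zero>, a)"
    have \<phi> [simp]: "\<phi> \<in> Arr P" "Src P \<phi> = ?e \<boxplus> ?A" "Tgt P \<phi> = ?A" by (simp_all add: \<phi>_def)
    have "\<phi> \<cdot> (Idn P ?e [+] \<phi>) \<cdot> assoc P ?e ?e ?A = far F (lunit V a) \<cdot> (lb F (\<zero>, a) \<cdot> (far F (Idn V \<zero>) [+] far F (lunit V a))) \<cdot>
       ((Idn P ?e [+] lb F (\<zero>, a)) \<cdot> assoc P ?e ?e ?A)"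
      by (simp add: \<phi>_def lwhisk Cmp_assoc)
    also have "lb F (\<zero>, a) \<cdot> (far F (Idn V \<zero>) [+] far F (lunit V a)) = far F (Idn V \<zero> [+]\<^bsub>V\<^esub> lunit V a) \<cdot> lb F (\<zero>, \<zero> \<boxplus>\<^bsub>V\<^esub> a)"
      using nat[of "Idn V \<zero>" "lunit V a"] by simp
    also have "far F (lunit V a) \<cdot> (far F (Idn V \<zero> [+]\<^bsub>V\<^esub> lunit V a) \<cdot> lb F (\<zero>, \<zero> \<boxplus>\<^bsub>V\<^esub> a)) \<cdot> ((Idn P ?e [+] lb F (\<zero>, a)) \<cdot> assoc P ?e ?e ?A)
      = far F (lunit V a) \<cdot> (far F (Idn V \<zero> [+]\<^bsub>V\<^esub> lunit V a) \<cdot> (lb F (\<zero>, \<zero> \<boxplus>\<^bsub>V\<^esub> a) \<cdot> (Idn P ?e [+] lb F (\<zero>, a)) \<cdot> assoc P ?e ?e ?A))"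
      by (simp add: Cmp_assoc)
    also have "\<dots> = far F (lunit V a) \<cdot> (far F (Idn V \<zero> [+]\<^bsub>V\<^esub> lunit V a) \<cdot> far F (assoc V \<zero> \<zero> a)) \<cdot> (lb F (\<zero> \<boxplus>\<^bsub>V\<^esub> \<zero>, a) \<cdot> (lb F (\<zero>, \<zero>) [+] Idn P ?A))"
      by (simp add: asc[symmetric] Cmp_assoc)
    also have "far F (Idn V \<zero> [+]\<^bsub>V\<^esub> lunit V a) \<cdot> far F (assoc V \<zero> \<zero> a) = far F (runit V \<zero> [+]\<^bsub>V\<^esub> Idn V a)"
      by (simp add: FC V.triangle)
    also have "far F (lunit V a) \<cdot> far F (runit V \<zero> [+]\<^bsub>V\<^esub> Idn V a) \<cdot> (lb F (\<zero> \<boxplus>\<^bsub>V\<^esub> \<zero>, a) \<cdot> (lb F (\<zero>, \<zero>) [+] Idn P ?A)) =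
       far F (lunit V a) \<cdot> (far F (runit V \<zero> [+]\<^bsub>V\<^esub> Idn V a) \<cdot> lb F (\<zero> \<boxplus>\<^bsub>V\<^esub> \<zero>, a)) \<cdot> (lb F (\<zero>, \<zero>) [+] Idn P ?A)"
      by (simp add: Cmp_assoc)
    also have "far F (runit V \<zero> [+]\<^bsub>V\<^esub> Idn V a) \<cdot> lb F (\<zero> \<boxplus>\<^bsub>V\<^esub> \<zero>, a) = lb F (\<zero>, a) \<cdot> (far F (runit V \<zero>) [+] Idn P ?A)"
      using nat[of "runit V \<zero>" "Idn V a"] by simp
    also have "far F (lunit V a) \<cdot> (lb F (\<zero>, a) \<cdot> (far F (runit V \<zero>) [+] Idn P ?A)) \<cdot> (lb F (\<zero>, \<zero>) [+] Idn P ?A) = \<phi> \<cdot> (m [+] Idn P ?A)"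
      by (simp add: \<phi>_def m_def rwhisk Cmp_assoc)
    finally have 1: "\<phi> \<cdot> (Idn P ?e [+] \<phi>) \<cdot> assoc P ?e ?e ?A = \<phi> \<cdot> (m [+] Idn P ?A)" .
    have "(\<phi> \<cdot> (Idn P ?e [+] (\<phi> \<cdot> (u [+] Idn P ?A)))) \<cdot> assoc P ?e ?o ?A =
        \<phi> \<cdot> (Idn P ?e [+] \<phi>) \<cdot> ((Idn P ?e [+] (u [+] Idn P ?A)) \<cdot> assoc P ?e ?o ?A)"
      by (simp add: lwhisk Cmp_assoc)
    also have "\<dots> = (\<phi> \<cdot> (Idn P ?e [+] \<phi>) \<cdot> assoc P ?e ?e ?A) \<cdot> ((Idn P ?e [+] u) [+] Idn P ?A)"
      using assoc_nat[of "Idn P ?e" u "Idn P ?A" ?e ?e ?A] by (simp add: Cmp_assoc)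
    also have "\<dots> = \<phi> \<cdot> ((m \<cdot> (Idn P ?e [+] u)) [+] Idn P ?A)"
      unfolding 1 by (simp add: rwhisk Cmp_assoc)
    also have "\<dots> = (\<phi> \<cdot> (Idn P ?e [+] lunit P ?A)) \<cdot> assoc P ?e ?o ?A"
      by (simp add: mu triangle[symmetric] Cmp_assoc)
    finally have "\<phi> \<cdot> (Idn P ?e [+] (\<phi> \<cdot> (u [+] Idn P ?A))) = \<phi> \<cdot> (Idn P ?e [+] lunit P ?A)"
      by (rule Cmp_cancel_right) simp_all
    then have "Idn P ?e [+] (\<phi> \<cdot> (u [+] Idn P ?A)) = Idn P ?e [+] lunit P ?A"
      by (rule Cmp_cancel_left) simp_all
    then have "\<phi> \<cdot> (u [+] Idn P ?A) = lunit P ?A"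
      by (rule asum_cancel_left) simp_all
    then show ?thesis by (simp add: \<phi>_def Cmp_assoc)
  qed
  \<comment> \<open>The right unit law is the left one conjugated by the symmetry, using
    \<open>runit_symm\<close> in \<open>V\<close> as well as in \<open>P\<close>.\<close>
  have "far F (runit V a) \<cdot> lb F (a, \<zero>) \<cdot> (Idn P (fob F a) [+] u) = runit P (fob F a)" if a [simp]: "a \<in> Obj V" for a
  proof -
    have "far F (runit V a) \<cdot> lb F (a, \<zero>) \<cdot> (Idn P (fob F a) [+] u) =
        far F (lunit V a) \<cdot> (far F (symm V a \<zero>) \<cdot> lb F (a, \<zero>)) \<cdot> (Idn P (fob F a) [+] u)"
      by (simp add: V.runit_symm FC[symmetric] Cmp_assoc)
    also have "\<dots> = (far F (lunit V a) \<cdot> lb F (\<zero>, a) \<cdot> (u [+] Idn P (fob F a))) \<cdot> symm P (fob F a) ?o"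
      using symm_nat[of "Idn P (fob F a)" u "fob F a" ?e] by (simp add: sym Cmp_assoc)
    also have "\<dots> = runit P (fob F a)"
      by (simp add: left runit_symm)
    finally show ?thesis .
  qed
  with left u have "is_unit F u"
    by (simp add: is_unit_def)
  then show ?thesis ..
qed

text \<open>\<open>\<theta>\<close> respects the multiplications on the values at \<open>0\<close>,
  so \<open>\<theta> \<zero> \<cdot> u\<close> solves the equation that determines
  \<open>u'\<close>.\<close>

lemma unit_natural:
  assumes F: "is_model (presV V) F" and G: "is_model (presV V) G" and \<theta>: "mor (presV V) F G \<theta>"
    and u: "is_unit F u" and u': "is_unit G u'"
  shows "\<theta> \<zero> \<cdot> u = u'"
proof -
  note pF = premodelD[OF is_modelD[OF F], simplified] and pG = premodelD[OF is_modelD[OF G], simplified]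
  let ?e = "fob F \<zero>" and ?e' = "fob G \<zero>" and ?o = "ounit P"
  have [simp]: "?e \<in> Obj P" "?e' \<in> Obj P" using pF(1) pG(1) by simp_all
  have [simp]: "\<theta> \<zero> \<in> Arr P" "Src P (\<theta> \<zero>) = ?e" "Tgt P (\<theta> \<zero>) = ?e'"
    using morD(1-3)[OF \<theta>, of \<zero>] by simp_all
  have [simp]: "u \<in> Arr P" "Src P u = ?o" "Tgt P u = ?e" "u' \<in> Arr P" "Src P u' = ?o" "Tgt P u' = ?e'"
    using u u' by (auto simp: is_unit_def)
  define m where "m = far F (runit V \<zero>) \<cdot> lb F (\<zero>, \<zero>)"
  define m' where "m' = far G (runit V \<zero>) \<cdot> lb G (\<zero>, \<zero>)"
  have F_typ [simp]: "far F (runit V \<zero>) \<in> Arr P" "Src P (far F (runit V \<zero>)) = fob F (\<zero> \<boxplus>\<^bsub>V\<^esub> \<zero>)" "Tgt P (far F (runit V \<zero>)) = ?e"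
    "lb F (\<zero>, \<zero>) \<in> Arr P" "Src P (lb F (\<zero>, \<zero>)) = ?e \<boxplus> ?e" "Tgt P (lb F (\<zero>, \<zero>)) = fob F (\<zero> \<boxplus>\<^bsub>V\<^esub> \<zero>)"
    using pF(2-4)[of "runit V \<zero>"] pF(7-9)[of "(\<zero>, \<zero>)"] by simp_all
  have G_typ [simp]: "far G (runit V \<zero>) \<in> Arr P" "Src P (far G (runit V \<zero>)) = fob G (\<zero> \<boxplus>\<^bsub>V\<^esub> \<zero>)" "Tgt P (far G (runit V \<zero>)) = ?e'"
    "lb G (\<zero>, \<zero>) \<in> Arr P" "Src P (lb G (\<zero>, \<zero>)) = ?e' \<boxplus> ?e'" "Tgt P (lb G (\<zero>, \<zero>)) = fob G (\<zero> \<boxplus>\<^bsub>V\<^esub> \<zero>)"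
    using pG(2-4)[of "runit V \<zero>"] pG(7-9)[of "(\<zero>, \<zero>)"] by simp_all
  have mu: "m \<cdot> (Idn P ?e [+] u) = runit P ?e" "m' \<cdot> (Idn P ?e' [+] u') = runit P ?e'"
    using u u' by (simp_all add: is_unit_def m_def m'_def Cmp_assoc)
  have [simp]: "m \<in> Arr P" "Src P m = ?e \<boxplus> ?e" "Tgt P m = ?e" "m' \<in> Arr P" "Src P m' = ?e' \<boxplus> ?e'" "Tgt P m' = ?e'"
    by (simp_all add: m_def m'_def)
  have [simp]: "\<theta> (\<zero> \<boxplus>\<^bsub>V\<^esub> \<zero>) \<in> Arr P" "Src P (\<theta> (\<zero> \<boxplus>\<^bsub>V\<^esub> \<zero>)) = fob F (\<zero> \<boxplus>\<^bsub>V\<^esub> \<zero>)" "Tgt P (\<theta> (\<zero> \<boxplus>\<^bsub>V\<^esub> \<zero>)) = fob G (\<zero> \<boxplus>\<^bsub>V\<^esub> \<zero>)"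
    using morD(1-3)[OF \<theta>, of "\<zero> \<boxplus>\<^bsub>V\<^esub> \<zero>"] by simp_all
  have 1: "far G (runit V \<zero>) \<cdot> \<theta> (\<zero> \<boxplus>\<^bsub>V\<^esub> \<zero>) = \<theta> \<zero> \<cdot> far F (runit V \<zero>)"
    and 2: "\<theta> (\<zero> \<boxplus>\<^bsub>V\<^esub> \<zero>) \<cdot> lb F (\<zero>, \<zero>) = lb G (\<zero>, \<zero>) \<cdot> (\<theta> \<zero> [+] \<theta> \<zero>)"
    using morD(4)[OF \<theta>, of "runit V \<zero>"] morD(5)[OF \<theta>, of "(\<zero>, \<zero>)"] by simp_all
  have m\<theta>: "m' \<cdot> (\<theta> \<zero> [+] \<theta> \<zero>) = \<theta> \<zero> \<cdot> m"
    by (simp add: m_def m'_def Cmp_assoc 2[symmetric] Cmp_reassoc[OF 1])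
  have "m' \<cdot> ((Idn P ?e' [+] (\<theta> \<zero> \<cdot> u)) \<cdot> (\<theta> \<zero> [+] Idn P ?o)) = (m' \<cdot> (\<theta> \<zero> [+] \<theta> \<zero>)) \<cdot> (Idn P ?e [+] u)"
    by (simp add: interchange Cmp_assoc)
  also have "\<dots> = \<theta> \<zero> \<cdot> runit P ?e"
    by (simp add: m\<theta> mu Cmp_assoc)
  also have "\<dots> = runit P ?e' \<cdot> (\<theta> \<zero> [+] Idn P ?o)"
    using runit_nat[of "\<theta> \<zero>"] by simp
  also have "\<dots> = m' \<cdot> ((Idn P ?e' [+] u') \<cdot> (\<theta> \<zero> [+] Idn P ?o))"
    by (simp add: mu(2)[symmetric] Cmp_assoc)
  finally have "(Idn P ?e' [+] (\<theta> \<zero> \<cdot> u)) \<cdot> (\<theta> \<zero> [+] Idn P ?o) = (Idn P ?e' [+] u') \<cdot> (\<theta> \<zero> [+] Idn P ?o)"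
    by (rule Cmp_cancel_left) simp_all
  then have "Idn P ?e' [+] (\<theta> \<zero> \<cdot> u) = Idn P ?e' [+] u'"
    by (rule Cmp_cancel_right) simp_all
  then show ?thesis
    by (rule asum_cancel_left) simp_all
qed

end

section \<open>Universality as an equivalence between categories of models\<close>

definition det_pmap :: "('o, 'm, 'z) cat_scheme \<Rightarrow> ('o, 'm, 'v, 'w) detfunct \<Rightarrow> ('o, 'm, 'm triangle, 'v, 'w, 'v \<times> 'v) pmap" where
  "det_pmap T d = \<lparr>fob = fob d, far = far d, qm = dadd d, ql = (\<lambda>\<Delta>. (fob d (vz T \<Delta>), fob d (vx T \<Delta>)))\<rparr>"

lemma det_pmap_sel [simp]: "fob (det_pmap T d) = fob d" "far (det_pmap T d) = far d" "qm (det_pmap T d) = dadd d"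
  "ql (det_pmap T d) \<Delta> = (fob d (vz T \<Delta>), fob d (vx T \<Delta>))"
  by (simp_all add: det_pmap_def)

context picard_pair
begin

definition sm_of :: "('v, 'w, 'v \<times> 'v, 'p, 'q) model \<Rightarrow> ('v, 'w, 'p, 'q) smfunct" where
  "sm_of F = \<lparr>fob = fob F, far = far F, fadd = (\<lambda>a b. lb F (a, b)), funit = (SOME u. is_unit F u)\<rparr>"

lemma sm_model_sm_of [simp]: "sm_model (sm_of F) = F"
  by (simp add: sm_model_def sm_of_def)

lemma is_unit_iff: "is_model (presV V) (sm_model f) \<Longrightarrow> sm_functor V P f \<longleftrightarrow> is_unit (sm_model f) (funit f)"
  by (simp add: sm_functor_iff is_unit_def)

lemma sm_functor_sm_of:
  assumes "is_model (presV V) F"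
  shows "sm_functor V P (sm_of F)"
proof -
  have "funit (sm_of F) = (SOME u. is_unit F u)" by (simp add: sm_of_def)
  then show ?thesis
    using someI_ex[OF unit_ex[OF assms]] is_unit_iff[of "sm_of F"] assms by simp
qed

lemma sm_functor_model: "sm_functor V P f \<Longrightarrow> is_model (presV V) (sm_model f)"
  by (simp add: sm_functor_iff)

text \<open>The unit condition on a monoidal transformation is a consequence of additivity, by
  \<open>unit_natural\<close>.\<close>

lemma mon_trans_iff:
  assumes f: "sm_functor V P f" and g: "sm_functor V P g"
  shows "mon_trans V P f g \<eta> \<longleftrightarrow> \<eta> \<in> extensional (Obj V) \<and> mor (presV V) (sm_model f) (sm_model g) \<eta>"
proof -
  have "\<eta> \<zero> \<cdot> funit f = funit g" if "mor (presV V) (sm_model f) (sm_model g) \<eta>"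
    by (rule unit_natural[OF sm_functor_model[OF f] sm_functor_model[OF g] that
      iffD1[OF is_unit_iff[OF sm_functor_model[OF f]] f] iffD1[OF is_unit_iff[OF sm_functor_model[OF g]] g]])
  then show ?thesis
    by (auto simp: mon_trans_def nat_trans_def mor_def PiE_iff)
qed

context
  fixes T :: "('o, 'm) tricat" and d :: "('o, 'm, 'v, 'w) detfunct"
  assumes T: "triangulated T" and d: "det_functor T V d"
begin

interpretation T: tri_cat T
  by unfold_locales (rule T)

lemma det_typed:
  "a \<in> Obj T \<Longrightarrow> fob d a \<in> Obj V"
  "is_iso T f \<Longrightarrow> far d f \<in> Arr V" "is_iso T f \<Longrightarrow> Src V (far d f) = fob d (Src T f)" "is_iso T f \<Longrightarrow> Tgt V (far d f) = fob d (Tgt T f)"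
  "\<Delta> \<in> dist T \<Longrightarrow> dadd d \<Delta> \<in> Arr V" "\<Delta> \<in> dist T \<Longrightarrow> Src V (dadd d \<Delta>) = fob d (vz T \<Delta>) \<boxplus>\<^bsub>V\<^esub> fob d (vx T \<Delta>)"
  "\<Delta> \<in> dist T \<Longrightarrow> Tgt V (dadd d \<Delta>) = fob d (vy T \<Delta>)"
  using d by (auto simp: det_functor_def is_functor_def)

lemma wf_det_pmap: "wf_pmap (presT T) (presV V) (det_pmap T d)"
proof -
  have "is_functor (isom T) V d" using d by (simp add: det_functor_def)
  then have "is_functor (isom T) (cat.truncate V) (det_pmap T d)"
    by (simp add: is_functor_def)
  then show ?thesis
    using T.vertex_Obj det_typed by (simp add: wf_pmap_def)
qed

text \<open>Each axiom is the image under \<open>F\<close> of the same axiom for \<open>d\<close>,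
  moved past the additivity arrows of \<open>F\<close> by the matching relation of
  \<open>presV\<close>: naturality, symmetry or associativity.\<close>

lemma pull_det_model:
  assumes F: "is_model (presV V) F"
  shows "is_model (presT T) (pull (det_pmap T d) F)"
proof -
  define E where "E = \<lparr>fob = (\<lambda>a. fob F (fob d a)), far = (\<lambda>f. far F (far d f)),
    dadd = (\<lambda>\<Delta>. far F (dadd d \<Delta>) \<cdot> lb F (fob d (vz T \<Delta>), fob d (vx T \<Delta>)))\<rparr>"
  have E: "det_model E = pull (det_pmap T d) F"
    by (simp add: det_model_def pull_def E_def)
  have E_sel: "fob E a = fob F (fob d a)" "far E f = far F (far d f)"
    "dadd E \<Delta> = far F (dadd d \<Delta>) \<cdot> lb F (fob d (vz T \<Delta>), fob d (vx T \<Delta>))" for a f \<Delta>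
    by (simp_all add: E_def)
  have picV: "picard V" by (rule V.picard)
  have pre: "premodel (presT T) (det_model E)"
    unfolding E using premodel_pull[OF wf_presT[OF T] wf_presV[OF picV] wf_det_pmap is_modelD[OF F]] .
  note pF = premodelD[OF is_modelD[OF F], simplified]
  have [simp]: "fob F a \<in> Obj P" if "a \<in> Obj V" for a using pF(1) that .
  have [simp]: "far F f \<in> Arr P" "Src P (far F f) = fob F (Src V f)" "Tgt P (far F f) = fob F (Tgt V f)" if "f \<in> Arr V" for f
    using pF(2-4) that by auto
  have [simp]: "lb F (a, b) \<in> Arr P" "Src P (lb F (a, b)) = fob F a \<boxplus> fob F b" "Tgt P (lb F (a, b)) = fob F (a \<boxplus>\<^bsub>V\<^esub> b)"
    if "a \<in> Obj V" "b \<in> Obj V" for a b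
    using pF(7-9)[of "(a, b)"] that by simp_all
  have FI [simp]: "far F (Idn V a) = Idn P (fob F a)" if "a \<in> Obj V" for a using pF(5) that .
  have FC: "far F (g \<cdot>\<^bsub>V\<^esub> f) = far F g \<cdot> far F f" if "f \<in> Arr V" "g \<in> Arr V" "Src V g = Tgt V f" for f g
    using pF(6) that by simp
  note nat = presV_modelD(1)[OF F] and asc = presV_modelD(2)[OF F] and sym = presV_modelD(3)[OF F]
  note [simp] = det_typed
  have "far E v \<cdot> dadd E \<Delta> = dadd E \<Delta>' \<cdot> (far E w [+] far E u)"
    if \<Delta>: "\<Delta> \<in> dist T" "\<Delta>' \<in> dist T" and uvw: "triangle_iso T \<Delta> \<Delta>' u v w" for \<Delta> \<Delta>' u v w
  proof -
    have "far d v \<cdot>\<^bsub>V\<^esub> dadd d \<Delta> = dadd d \<Delta>' \<cdot>\<^bsub>V\<^esub> (far d w [+]\<^bsub>V\<^esub> far d u)"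
      using d \<Delta> uvw unfolding det_functor_def by blast
    note eq = arg_cong[OF this, of "far F"]
    note ty = T.triangle_iso_typed[OF uvw] T.vertex_Obj[OF \<Delta>(1)] T.vertex_Obj[OF \<Delta>(2)]
    have "far E v \<cdot> dadd E \<Delta> = far F (far d v \<cdot>\<^bsub>V\<^esub> dadd d \<Delta>) \<cdot> lb F (fob d (vz T \<Delta>), fob d (vx T \<Delta>))"
      using ty \<Delta> by (simp add: E_sel FC Cmp_assoc)
    also have "\<dots> = far F (dadd d \<Delta>') \<cdot> (far F (far d w [+]\<^bsub>V\<^esub> far d u) \<cdot> lb F (fob d (vz T \<Delta>), fob d (vx T \<Delta>)))"
      using ty \<Delta> unfolding eq by (simp add: FC Cmp_assoc)
    also have "\<dots> = dadd E \<Delta>' \<cdot> (far E w [+] far E u)"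
      using ty \<Delta> nat[of "far d w" "far d u"] by (simp add: E_sel Cmp_assoc)
    finally show ?thesis .
  qed
  moreover have "dadd E (i2, p1, hzero T x (fob (shift T) y)) = dadd E (i1, p2, hzero T y (fob (shift T) x)) \<cdot> symm P (fob E x) (fob E y)"
    if b: "biproduct T x y s i1 i2 p1 p2" for x y s i1 i2 p1 p2
  proof -
    have "dadd d (i2, p1, hzero T x (fob (shift T) y)) = dadd d (i1, p2, hzero T y (fob (shift T) x)) \<cdot>\<^bsub>V\<^esub> symm V (fob d x) (fob d y)"
      using d b unfolding det_functor_def by blast
    then show ?thesis
      using T.biproduct_triangles[OF b] sym[of "fob d x" "fob d y"] by (simp add: E_sel FC Cmp_assoc)
  qed
  moreover have "dadd E \<Delta>2 \<cdot> (dadd E \<Delta>4 [+] Idn P (fob E (vx T \<Delta>1))) =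
       dadd E \<Delta>3 \<cdot> (Idn P (fob E (vz T \<Delta>3)) [+] dadd E \<Delta>1) \<cdot>
         assoc P (fob E (vz T \<Delta>3)) (fob E (vz T \<Delta>1)) (fob E (vx T \<Delta>1))"
    if o: "octahedron T \<Delta>1 \<Delta>2 \<Delta>3 \<Delta>4" for \<Delta>1 \<Delta>2 \<Delta>3 \<Delta>4
  proof -
    let ?z = "fob d (vz T \<Delta>3)" and ?y = "fob d (vz T \<Delta>1)" and ?x = "fob d (vx T \<Delta>1)"
    have "dadd d \<Delta>2 \<cdot>\<^bsub>V\<^esub> (dadd d \<Delta>4 [+]\<^bsub>V\<^esub> Idn V ?x) = dadd d \<Delta>3 \<cdot>\<^bsub>V\<^esub> (Idn V ?z [+]\<^bsub>V\<^esub> dadd d \<Delta>1) \<cdot>\<^bsub>V\<^esub> assoc V ?z ?y ?x"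
      using d o unfolding det_functor_def by blast
    note eq = arg_cong[OF this, of "far F"]
    note ty = T.octahedron_typed[OF o]
    have ob: "vz T \<Delta>3 \<in> Obj T" "vz T \<Delta>1 \<in> Obj T" "vx T \<Delta>1 \<in> Obj T" "vy T \<Delta>1 \<in> Obj T" "vy T \<Delta>4 \<in> Obj T"
      using ty T.vertex_Obj by auto
    have "dadd E \<Delta>2 \<cdot> (dadd E \<Delta>4 [+] Idn P (fob E (vx T \<Delta>1))) =
      far F (dadd d \<Delta>2) \<cdot> ((lb F (fob d (vy T \<Delta>4), ?x) \<cdot> (far F (dadd d \<Delta>4) [+] far F (Idn V ?x))) \<cdot> (lb F (?z, ?y) [+] Idn P (fob F ?x)))"
      using ty ob by (simp add: E_sel rwhisk Cmp_assoc)
    also have "lb F (fob d (vy T \<Delta>4), ?x) \<cdot> (far F (dadd d \<Delta>4) [+] far F (Idn V ?x)) =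
        far F (dadd d \<Delta>4 [+]\<^bsub>V\<^esub> Idn V ?x) \<cdot> lb F (?z \<boxplus>\<^bsub>V\<^esub> ?y, ?x)"
      using ty ob nat[of "dadd d \<Delta>4" "Idn V ?x"] by simp
    also have "far F (dadd d \<Delta>2) \<cdot> ((far F (dadd d \<Delta>4 [+]\<^bsub>V\<^esub> Idn V ?x) \<cdot> lb F (?z \<boxplus>\<^bsub>V\<^esub> ?y, ?x)) \<cdot> (lb F (?z, ?y) [+] Idn P (fob F ?x)))
      = far F (dadd d \<Delta>2 \<cdot>\<^bsub>V\<^esub> (dadd d \<Delta>4 [+]\<^bsub>V\<^esub> Idn V ?x)) \<cdot> (lb F (?z \<boxplus>\<^bsub>V\<^esub> ?y, ?x) \<cdot> (lb F (?z, ?y) [+] Idn P (fob F ?x)))"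
      using ty ob by (simp add: FC Cmp_assoc)
    also have "\<dots> = far F (dadd d \<Delta>3) \<cdot> (far F (Idn V ?z [+]\<^bsub>V\<^esub> dadd d \<Delta>1) \<cdot>
        (far F (assoc V ?z ?y ?x) \<cdot> (lb F (?z \<boxplus>\<^bsub>V\<^esub> ?y, ?x) \<cdot> (lb F (?z, ?y) [+] Idn P (fob F ?x)))))"
      using ty ob unfolding eq by (simp add: FC Cmp_assoc)
    also have "\<dots> = far F (dadd d \<Delta>3) \<cdot> ((far F (Idn V ?z [+]\<^bsub>V\<^esub> dadd d \<Delta>1) \<cdot> lb F (?z, ?y \<boxplus>\<^bsub>V\<^esub> ?x)) \<cdot>
        ((Idn P (fob F ?z) [+] lb F (?y, ?x)) \<cdot> assoc P (fob F ?z) (fob F ?y) (fob F ?x)))"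
      using ty ob by (simp add: asc Cmp_assoc)
    also have "far F (Idn V ?z [+]\<^bsub>V\<^esub> dadd d \<Delta>1) \<cdot> lb F (?z, ?y \<boxplus>\<^bsub>V\<^esub> ?x) = lb F (?z, fob d (vy T \<Delta>1)) \<cdot> (Idn P (fob F ?z) [+] far F (dadd d \<Delta>1))"
      using ty ob nat[of "Idn V ?z" "dadd d \<Delta>1"] by simp
    also have "far F (dadd d \<Delta>3) \<cdot> ((lb F (?z, fob d (vy T \<Delta>1)) \<cdot> (Idn P (fob F ?z) [+] far F (dadd d \<Delta>1))) \<cdot>
        ((Idn P (fob F ?z) [+] lb F (?y, ?x)) \<cdot> assoc P (fob F ?z) (fob F ?y) (fob F ?x)))
      = dadd E \<Delta>3 \<cdot> (Idn P (fob E (vz T \<Delta>3)) [+] dadd E \<Delta>1) \<cdot> assoc P (fob E (vz T \<Delta>3)) (fob E (vz T \<Delta>1)) (fob E (vx T \<Delta>1))"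
      using ty ob by (simp add: E_sel lwhisk Cmp_assoc)
    finally show ?thesis .
  qed
  moreover have "is_functor (isom T) P E"
    using pre unfolding premodel_def by (simp add: is_functor_def)
  moreover have "\<forall>\<Delta>\<in>dist T. dadd E \<Delta> \<in> Hom P (fob E (vz T \<Delta>) \<boxplus> fob E (vx T \<Delta>)) (fob E (vy T \<Delta>))"
    using pre unfolding premodel_def by simp
  ultimately have "det_functor T P E"
    unfolding det_functor_def by blast
  then show ?thesis
    unfolding E[symmetric] is_model_presT_iff .
qed

end

text \<open>Universality provides an initial pair over every determinant functor, and its existence
  is essential surjectivity. For the rest, take the pullback of \<open>G\<close> as the determinant
  functor: \<open>F\<close> with \<open>\<theta>\<close> and \<open>G\<close> with the identity are
  both pairs over it, so both receive unique arrows from the initial pair.\<close>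

lemma pequiv_det:
  fixes T :: "('o, 'm) tricat" and d :: "('o, 'm, 'v, 'w) detfunct"
  assumes T: "triangulated T" and u: "universal_det TYPE('p \<times> 'q) T V d"
  shows "pequiv (presT T) (presV V) (det_pmap T d)"
proof -
  let ?q = "det_pmap T d"
  have d: "det_functor T V d" using u by (simp add: universal_det_def)
  note wT = wf_presT[OF T] and wV = wf_presV[OF V.picard]
  note wq = wf_det_pmap[OF T d]
  have dO: "fob d x \<in> Obj V" if "x \<in> Obj T" for x using det_typed[OF T d] that by simp
  define dm where "dm D = \<lparr>fob = fob D, far = far D, dadd = lb D\<rparr>" for D :: "('o, 'm, 'm triangle, 'p, 'q) model"
  have dm: "det_model (dm D) = D" for D by (simp add: det_model_def dm_def)
  have init: "\<exists>f \<alpha>. det_factorization T V d P (dm D) f \<alpha> \<and>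
      (\<forall>f' \<alpha>'. det_factorization T V d P (dm D) f' \<alpha>' \<longrightarrow>
        (\<exists>!\<beta>. mon_trans V P f f' \<beta> \<and> (\<forall>x\<in>Obj T. \<alpha>' x \<cdot> \<beta> (fob d x) = \<alpha> x)))" if "is_model (presT T) D" for D
  proof -
    have "picard P \<and> det_functor T P (dm D)"
      using picard that is_model_presT_iff[of T "dm D"] unfolding dm by blast
    from mp[OF spec[OF spec[OF conjunct2[OF conjunct2[OF u[unfolded universal_det_def]]], of P], of "dm D"] this]
    show ?thesis .
  qed
  \<comment> \<open>A factorization is a morphism of models out of the pullback of \<open>f\<close>,
    up to the extensionality that \<open>nat_trans\<close> demands.\<close>
  have fact: "det_factorization T V d P (dm D) f \<alpha> \<longleftrightarrow> sm_functor V P f \<and> \<alpha> \<in> extensional (Obj T) \<and>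
      mor (presT T) (pull ?q (sm_model f)) D \<alpha>" if "is_model (presT T) D" for D f \<alpha>
  proof -
    have lb_eq: "lb (pull ?q (sm_model f)) \<Delta> = far f (dadd d \<Delta>) \<cdot> fadd f (fob d (vz T \<Delta>)) (fob d (vx T \<Delta>))" for \<Delta>
      by simp
    show ?thesis
      unfolding det_factorization_def nat_trans_def mor_def lb_eq presT_sel isom_sel
      by (simp only: PiE_iff comp_functor_def dm_def pull_simps det_pmap_sel sm_model_sel funct.select_convs
          detfunct.select_convs conj_assoc) blast
  qed
  have mon: "mor (presV V) F G (restrict \<beta> (Obj V)) \<longleftrightarrow> mor (presV V) F G \<beta>" for F G \<beta>
    by (auto simp: mor_def)
  have morT: "mor (presT T) D E (restrict \<theta> (Obj T)) \<longleftrightarrow> mor (presT T) D E \<theta>" for D E \<theta>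
    using X_simps[OF wT] by (auto simp: mor_def)
  have ess: "\<exists>F \<alpha>. is_model (presV V) F \<and> mor (presT T) (pull ?q F) D \<alpha>" if D: "is_model (presT T) D" for D
    using init[OF D] fact[OF D] sm_functor_model by blast
  have pm: "is_model (presT T) (pull ?q F)" if "is_model (presV V) F" for F
    by (rule pull_det_model[OF T d that])
  \<comment> \<open>Universality restated for models: \<open>funit\<close> is dropped, and
    uniqueness is asserted on objects only.\<close>
  have initial: "\<exists>H \<gamma>. is_model (presV V) H \<and> mor (presT T) (pull ?q H) D \<gamma> \<and> (\<forall>F \<theta>. is_model (presV V) F \<longrightarrow> mor (presT T) (pull ?q F) D \<theta> \<longrightarrow>
      (\<exists>\<beta>. mor (presV V) H F \<beta> \<and> (\<forall>x\<in>Obj T. \<theta> x \<cdot> \<beta> (fob d x) = \<gamma> x) \<and>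
        (\<forall>\<beta>'. mor (presV V) H F \<beta>' \<and> (\<forall>x\<in>Obj T. \<theta> x \<cdot> \<beta>' (fob d x) = \<gamma> x) \<longrightarrow> (\<forall>v\<in>Obj V. \<beta>' v = \<beta> v))))"
    if D: "is_model (presT T) D" for D
  proof -
    from init[OF D] obtain f \<alpha> where f0: "det_factorization T V d P (dm D) f \<alpha>"
      and univ: "\<forall>f' \<alpha>'. det_factorization T V d P (dm D) f' \<alpha>' \<longrightarrow>
        (\<exists>!\<beta>. mon_trans V P f f' \<beta> \<and> (\<forall>x\<in>Obj T. \<alpha>' x \<cdot> \<beta> (fob d x) = \<alpha> x))"
      by (elim exE conjE)
    have f: "sm_functor V P f" "mor (presT T) (pull ?q (sm_model f)) D \<alpha>"
      using f0 unfolding fact[OF D] by simp_all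
    have "\<exists>\<beta>. mor (presV V) (sm_model f) F \<beta> \<and> (\<forall>x\<in>Obj T. \<theta> x \<cdot> \<beta> (fob d x) = \<alpha> x) \<and>
        (\<forall>\<beta>'. mor (presV V) (sm_model f) F \<beta>' \<and> (\<forall>x\<in>Obj T. \<theta> x \<cdot> \<beta>' (fob d x) = \<alpha> x) \<longrightarrow> (\<forall>v\<in>Obj V. \<beta>' v = \<beta> v))"
      if F: "is_model (presV V) F" and \<theta>: "mor (presT T) (pull ?q F) D \<theta>" for F \<theta>
    proof -
      note sF = sm_functor_sm_of[OF F]
      have "det_factorization T V d P (dm D) (sm_of F) (restrict \<theta> (Obj T))"
        unfolding fact[OF D] using sF \<theta> by (simp add: morT)
      from univ[rule_format, OF this] obtain \<beta> where \<beta>: "mon_trans V P f (sm_of F) \<beta>" "\<forall>x\<in>Obj T. restrict \<theta> (Obj T) x \<cdot> \<beta> (fob d x) = \<alpha> x"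
        and uniq: "\<And>\<beta>'. mon_trans V P f (sm_of F) \<beta>' \<Longrightarrow> (\<forall>x\<in>Obj T. restrict \<theta> (Obj T) x \<cdot> \<beta>' (fob d x) = \<alpha> x) \<Longrightarrow> \<beta>' = \<beta>"
        by (elim ex1E) blast
      have "\<beta>' v = \<beta> v" if \<beta>': "mor (presV V) (sm_model f) F \<beta>'" "\<forall>x\<in>Obj T. \<theta> x \<cdot> \<beta>' (fob d x) = \<alpha> x" and v: "v \<in> Obj V" for \<beta>' v
      proof -
        have "restrict \<beta>' (Obj V) = \<beta>"
          by (rule uniq) (use \<beta>' dO in \<open>simp_all add: mon_trans_iff[OF f(1) sF] mon\<close>)
        then show ?thesis using v by auto
      qed
      with \<beta> show ?thesis
        unfolding mon_trans_iff[OF f(1) sF] by (intro exI[of _ \<beta>]) auto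
    qed
    then show ?thesis
      using f(2) sm_functor_model[OF f(1)] by (intro exI[of _ "sm_model f"] exI[of _ \<alpha>] conjI) simp_all
  qed
  have id: "mor (presT T) (pull ?q F) (pull ?q F) (\<lambda>x. Idn P (fob F (fob d x)))" if "is_model (presV V) F" for F
    using mor_id[OF wT is_modelD[OF pm[OF that]]] by simp
  have ty: "\<beta> (fob d x) \<in> Arr P" "Src P (\<beta> (fob d x)) = fob F (fob d x)" "Tgt P (\<beta> (fob d x)) = fob G (fob d x)"
    if "mor (presV V) F G \<beta>" "x \<in> Obj T" for F G \<beta> x
    using morD(1-3)[OF that(1), of "fob d x"] dO[OF that(2)] by simp_all
  have full: "\<exists>\<beta>. mor (presV V) F G \<beta> \<and> (\<forall>x\<in>Obj (base (presT T)). \<beta> (fob ?q x) = \<theta> x)"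
    if F: "is_model (presV V) F" and G: "is_model (presV V) G" and \<theta>: "mor (presT T) (pull ?q F) (pull ?q G) \<theta>" for F G \<theta>
  proof -
    obtain H \<gamma> where H: "is_model (presV V) H" and univ: "\<And>F \<theta>. is_model (presV V) F \<Longrightarrow> mor (presT T) (pull ?q F) (pull ?q G) \<theta> \<Longrightarrow>
        \<exists>\<beta>. mor (presV V) H F \<beta> \<and> (\<forall>x\<in>Obj T. \<theta> x \<cdot> \<beta> (fob d x) = \<gamma> x)"
      using initial[OF pm[OF G]] by blast
    obtain \<beta>1 where \<beta>1: "mor (presV V) H F \<beta>1" "\<And>x. x \<in> Obj T \<Longrightarrow> \<theta> x \<cdot> \<beta>1 (fob d x) = \<gamma> x"
      using univ[OF F \<theta>] by blast
    obtain \<beta>2 where \<beta>2: "mor (presV V) H G \<beta>2" "\<And>x. x \<in> Obj T \<Longrightarrow> Idn P (fob G (fob d x)) \<cdot> \<beta>2 (fob d x) = \<gamma> x"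
      using univ[OF G id[OF G]] by blast
    note pF = is_modelD[OF F] and pG = is_modelD[OF G] and pH = is_modelD[OF H]
    \<comment> \<open>The two arrows out of the initial \<open>H\<close> differ by
      \<open>\<theta>\<close> on the image of \<open>d\<close>, so inverting the first one yields
      the lift.\<close>
    have "mor (presV V) F G (\<lambda>v. \<beta>2 v \<cdot> inv_arr P (\<beta>1 v))"
      by (rule mor_comp[OF wV pF pH pG mor_inv[OF wV pH pF \<beta>1(1)] \<beta>2(1)])
    moreover have "\<beta>2 (fob d x) \<cdot> inv_arr P (\<beta>1 (fob d x)) = \<theta> x" if x: "x \<in> Obj T" for x
    proof -
      have "\<theta> x \<in> Arr P" "Src P (\<theta> x) = fob F (fob d x)" "Tgt P (\<theta> x) = fob G (fob d x)"
        using morD(1-3)[OF \<theta>, of x] x by simp_all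
      then show ?thesis
        using \<beta>1(2)[OF x, symmetric] \<beta>2(2)[OF x] ty[OF \<beta>1(1) x] ty[OF \<beta>2(1) x] by (simp add: Cmp_assoc)
    qed
    ultimately show ?thesis by (intro exI[of _ "\<lambda>v. \<beta>2 v \<cdot> inv_arr P (\<beta>1 v)"]) simp
  qed
  have faithful: "\<beta> v = \<beta>' v"
    if F: "is_model (presV V) F" and G: "is_model (presV V) G" and \<beta>: "mor (presV V) F G \<beta>" and \<beta>': "mor (presV V) F G \<beta>'"
      and eq: "\<And>x. x \<in> Obj T \<Longrightarrow> \<beta> (fob d x) = \<beta>' (fob d x)" and v: "v \<in> Obj V" for F G \<beta> \<beta>' v
  proof -
    obtain H \<gamma> where H: "is_model (presV V) H" and univ: "\<And>F \<theta>. is_model (presV V) F \<Longrightarrow> mor (presT T) (pull ?q F) (pull ?q G) \<theta> \<Longrightarrow>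
        \<exists>\<beta>. mor (presV V) H F \<beta> \<and> (\<forall>x\<in>Obj T. \<theta> x \<cdot> \<beta> (fob d x) = \<gamma> x) \<and>
        (\<forall>\<beta>'. mor (presV V) H F \<beta>' \<and> (\<forall>x\<in>Obj T. \<theta> x \<cdot> \<beta>' (fob d x) = \<gamma> x) \<longrightarrow> (\<forall>v\<in>Obj V. \<beta>' v = \<beta> v))"
      using initial[OF pm[OF G]] by blast
    note pF = is_modelD[OF F] and pG = is_modelD[OF G] and pH = is_modelD[OF H]
    have "mor (presT T) (pull ?q F) (pull ?q G) (\<lambda>x. \<beta> (fob d x))"
      using mor_pull[OF wT wV wq pF pG \<beta>] by simp
    from univ[OF F this] obtain \<beta>1 where \<beta>1: "mor (presV V) H F \<beta>1" "\<And>x. x \<in> Obj T \<Longrightarrow> \<beta> (fob d x) \<cdot> \<beta>1 (fob d x) = \<gamma> x"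
      by blast
    obtain \<beta>2 where \<beta>2: "\<And>\<beta>'. mor (presV V) H G \<beta>' \<Longrightarrow> (\<forall>x\<in>Obj T. Idn P (fob G (fob d x)) \<cdot> \<beta>' (fob d x) = \<gamma> x) \<Longrightarrow> \<forall>v\<in>Obj V. \<beta>' v = \<beta>2 v"
      using univ[OF G id[OF G]] by blast
    \<comment> \<open>Any \<open>\<delta>\<close> that agrees with \<open>\<beta>\<close> on the
      image of \<open>d\<close> gives, after \<open>\<beta>1\<close>, the unique arrow from
      \<open>H\<close> to \<open>G\<close>. Applied to \<open>\<beta>\<close> and
      \<open>\<beta>'\<close>, this identifies them, since \<open>\<beta>1\<close> is
      invertible.\<close>
    have comp: "\<forall>v\<in>Obj V. \<delta> v \<cdot> \<beta>1 v = \<beta>2 v"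
      if \<delta>: "mor (presV V) F G \<delta>" and \<delta>_eq: "\<And>x. x \<in> Obj T \<Longrightarrow> \<delta> (fob d x) = \<beta> (fob d x)" for \<delta>
    proof (rule \<beta>2[OF mor_comp[OF wV pH pF pG \<beta>1(1) \<delta>]], intro ballI)
      fix x assume x: "x \<in> Obj T"
      have "Idn P (fob G (fob d x)) \<cdot> (\<delta> (fob d x) \<cdot> \<beta>1 (fob d x)) = \<delta> (fob d x) \<cdot> \<beta>1 (fob d x)"
        using ty[OF \<beta>1(1) x] ty[OF \<delta> x] by simp
      also have "\<dots> = \<gamma> x"
        using \<beta>1(2)[OF x] \<delta>_eq[OF x] by simp
      finally show "Idn P (fob G (fob d x)) \<cdot> (\<delta> (fob d x) \<cdot> \<beta>1 (fob d x)) = \<gamma> x" .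
    qed
    have "\<beta> v \<cdot> \<beta>1 v = \<beta>' v \<cdot> \<beta>1 v"
      using comp[OF \<beta> refl] comp[OF \<beta>' eq[symmetric]] v by simp
    then show ?thesis
      by (rule Cmp_cancel_right) (use v morD(1-3)[OF \<beta>1(1), of v] morD(1-3)[OF \<beta>, of v] morD(1-3)[OF \<beta>', of v] in simp_all)
  qed
  show ?thesis
    unfolding pequiv_def
  proof (intro conjI allI impI ballI)
    fix F G \<beta> \<beta>' b
    assume "is_model (presV V) F" "is_model (presV V) G" "mor (presV V) F G \<beta>" "mor (presV V) F G \<beta>'"
      "\<forall>a\<in>Obj (base (presT T)). \<beta> (fob ?q a) = \<beta>' (fob ?q a)" "b \<in> Obj (base (presV V))"
    then show "\<beta> b = \<beta>' b" by (intro faithful[of F G \<beta> \<beta>' b]) simp_all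
  qed (use wq pm ess full in blast)+
qed

end

text \<open>The quasi-inverse consists of chosen preimages of objects and of the unique lifts of
  conjugated arrows. As \<open>D\<close> is a groupoid, essential surjectivity can ask for a mere
  arrow.\<close>

lemma is_equivalenceI:
  assumes C: "category C" and D: "groupoid D" and F: "is_functor C D F"
    and full: "\<And>a b h. \<lbrakk>a \<in> Obj C; b \<in> Obj C; h \<in> Hom D (fob F a) (fob F b)\<rbrakk> \<Longrightarrow> \<exists>f\<in>Hom C a b. far F f = h"
    and faithful: "\<And>a b f g. \<lbrakk>f \<in> Hom C a b; g \<in> Hom C a b; far F f = far F g\<rbrakk> \<Longrightarrow> f = g"
    and ess: "\<And>d. d \<in> Obj D \<Longrightarrow> \<exists>a\<in>Obj C. \<exists>e. e \<in> Hom D (fob F a) d"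
  shows "is_equivalence C D F"
proof -
  interpret C: cat_axioms C by unfold_locales (rule C)
  interpret D: gpd_axioms D by (rule gpd_axiomsI[OF D])
  have FO [simp]: "fob F a \<in> Obj D" if "a \<in> Obj C" for a using F that by (simp add: is_functor_def)
  have FA [simp]: "far F f \<in> Arr D" "Src D (far F f) = fob F (Src C f)" "Tgt D (far F f) = fob F (Tgt C f)" if "f \<in> Arr C" for f
    using F that by (auto simp: is_functor_def)
  have FI: "far F (Idn C a) = Idn D (fob F a)" if "a \<in> Obj C" for a using F that by (simp add: is_functor_def)
  have FC: "far F (g \<cdot>\<^bsub>C\<^esub> f) = far F g \<cdot>\<^bsub>D\<^esub> far F f" if "f \<in> Arr C" "g \<in> Arr C" "Src C g = Tgt C f" for f g
    using F that by (simp add: is_functor_def)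
  obtain o\<^sub>G \<epsilon> where oG [simp]: "\<And>d. d \<in> Obj D \<Longrightarrow> o\<^sub>G d \<in> Obj C" and \<epsilon>: "\<And>d. d \<in> Obj D \<Longrightarrow> \<epsilon> d \<in> Hom D (fob F (o\<^sub>G d)) d"
    using ess by metis
  note [simp] = \<epsilon>[simplified]
  have "\<exists>f\<in>Hom C a b. far F f = h" if "a \<in> Obj C" "b \<in> Obj C" "h \<in> Hom D (fob F a) (fob F b)" for a b h
    using full that by blast
  then obtain l where l: "\<And>a b h. \<lbrakk>a \<in> Obj C; b \<in> Obj C; h \<in> Hom D (fob F a) (fob F b)\<rbrakk> \<Longrightarrow> l a b h \<in> Hom C a b \<and> far F (l a b h) = h"
    by metis
  have l_typ [simp]: "l a b h \<in> Arr C" "Src C (l a b h) = a" "Tgt C (l a b h) = b" "far F (l a b h) = h"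
    if "a \<in> Obj C" "b \<in> Obj C" "h \<in> Arr D" "Src D h = fob F a" "Tgt D h = fob F b" for a b h
    using l[of a b h] that by simp_all
  define G where "G = \<lparr>fob = o\<^sub>G, far = (\<lambda>h. l (o\<^sub>G (Src D h)) (o\<^sub>G (Tgt D h)) (inv_arr D (\<epsilon> (Tgt D h)) \<cdot>\<^bsub>D\<^esub> (h \<cdot>\<^bsub>D\<^esub> \<epsilon> (Src D h))))\<rparr>"
  have G [simp]: "fob G d = o\<^sub>G d" "far G h = l (o\<^sub>G (Src D h)) (o\<^sub>G (Tgt D h)) (inv_arr D (\<epsilon> (Tgt D h)) \<cdot>\<^bsub>D\<^esub> (h \<cdot>\<^bsub>D\<^esub> \<epsilon> (Src D h)))" for d h
    by (simp_all add: G_def)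
  have eqI: "f = g" if "far F f = far F g" "f \<in> Arr C" "g \<in> Arr C" "Src C f = Src C g" "Tgt C f = Tgt C g" for f g
    using faithful[of f "Src C g" "Tgt C g" g] that by simp
  have "is_functor D C G"
    unfolding is_functor_def
  proof (intro conjI ballI impI)
    fix d assume d: "d \<in> Obj D"
    show "far G (Idn D d) = Idn C (fob G d)"
      by (rule eqI) (use d in \<open>simp_all add: FI\<close>)
  next
    fix f g assume "f \<in> Arr D" "g \<in> Arr D" "Src D g = Tgt D f"
    then show "far G (g \<cdot>\<^bsub>D\<^esub> f) = far G g \<cdot>\<^bsub>C\<^esub> far G f"
      by (intro eqI) (simp_all add: FC D.Cmp_assoc)
  qed (use C D.category in auto)
  moreover have "nat_iso C C id_functor (comp_functor G F) (\<lambda>a\<in>Obj C. l a (o\<^sub>G (fob F a)) (inv_arr D (\<epsilon> (fob F a))))"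
    unfolding nat_iso_def nat_trans_def
  proof (intro conjI ballI)
    fix f assume "f \<in> Arr C"
    then show "far (comp_functor G F) f \<cdot>\<^bsub>C\<^esub> (\<lambda>a\<in>Obj C. l a (o\<^sub>G (fob F a)) (inv_arr D (\<epsilon> (fob F a)))) (Src C f) =
        (\<lambda>a\<in>Obj C. l a (o\<^sub>G (fob F a)) (inv_arr D (\<epsilon> (fob F a)))) (Tgt C f) \<cdot>\<^bsub>C\<^esub> far id_functor f"
      by (intro eqI) (simp_all add: comp_functor_def id_functor_def FC D.Cmp_assoc)
  next
    fix a assume a: "a \<in> Obj C"
    let ?b = "o\<^sub>G (fob F a)"
    let ?f = "l a ?b (inv_arr D (\<epsilon> (fob F a)))" and ?g = "l ?b a (\<epsilon> (fob F a))"
    have "?g \<cdot>\<^bsub>C\<^esub> ?f = Idn C a" "?f \<cdot>\<^bsub>C\<^esub> ?g = Idn C ?b"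
      using a by (intro eqI; simp add: FC FI)+
    then show "is_iso C ((\<lambda>a\<in>Obj C. l a (o\<^sub>G (fob F a)) (inv_arr D (\<epsilon> (fob F a)))) a)"
      using a unfolding is_iso_def inverse_of_def by (intro conjI exI[of _ ?g]) simp_all
  qed (auto simp: comp_functor_def id_functor_def)
  moreover have "nat_iso D D (comp_functor F G) id_functor (restrict \<epsilon> (Obj D))"
    by (auto simp: nat_iso_def nat_trans_def comp_functor_def id_functor_def D.isos)
  ultimately show ?thesis
    using F unfolding is_equivalence_def by blast
qed

lemma (in gpd_axioms) groupoid_trans_cat:
  assumes Fs: "\<And>F a. F \<in> Fs \<Longrightarrow> a \<in> Obj B \<Longrightarrow> fob F a \<in> Obj C"
    and typed: "\<And>F G \<eta>. \<lbrakk>F \<in> Fs; G \<in> Fs; Trans F G \<eta>\<rbrakk> \<Longrightarrow> \<eta> \<in> (\<Pi>\<^sub>E a\<in>Obj B. Hom C (fob F a) (fob G a))"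
    and id: "\<And>F. F \<in> Fs \<Longrightarrow> Trans F F (\<lambda>a\<in>Obj B. Idn C (fob F a))"
    and comp: "\<And>F G H \<eta> \<theta>. \<lbrakk>F \<in> Fs; G \<in> Fs; H \<in> Fs; Trans F G \<eta>; Trans G H \<theta>\<rbrakk> \<Longrightarrow> Trans F H (\<lambda>a\<in>Obj B. \<theta> a \<cdot> \<eta> a)"
    and inv: "\<And>F G \<eta>. \<lbrakk>F \<in> Fs; G \<in> Fs; Trans F G \<eta>\<rbrakk> \<Longrightarrow> Trans G F (\<lambda>a\<in>Obj B. inv_arr C (\<eta> a))"
  shows "groupoid (trans_cat B C Fs Trans)"
proof -
  let ?X = "trans_cat B C Fs Trans"
  have ext: "\<eta> = \<theta>" if "\<eta> \<in> extensional (Obj B)" "\<theta> \<in> extensional (Obj B)" "\<And>a. a \<in> Obj B \<Longrightarrow> \<eta> a = \<theta> a" for \<eta> \<theta>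
    using extensionalityI[OF that(1,2)] that(3) by blast
  have typed': "\<eta> a \<in> Arr C" "Src C (\<eta> a) = fob F a" "Tgt C (\<eta> a) = fob G a"
    if "F \<in> Fs" "G \<in> Fs" "Trans F G \<eta>" "a \<in> Obj B" for F G \<eta> a
    using typed[OF that(1-3)] that(4) by (auto simp: PiE_iff)
  have exts: "\<eta> \<in> extensional (Obj B)" if "F \<in> Fs" "G \<in> Fs" "Trans F G \<eta>" for F G \<eta>
    using typed[OF that] by (simp add: PiE_iff)
  have "category ?X"
    unfolding category_def
  proof (intro conjI ballI impI)
    fix f assume f: "f \<in> Arr ?X"
    then obtain F G \<eta> where f': "f = (F, G, \<eta>)" "F \<in> Fs" "G \<in> Fs" "Trans F G \<eta>" by (auto simp: trans_cat_def)
    then show "Src ?X f \<in> Obj ?X" "Tgt ?X f \<in> Obj ?X" by (auto simp: trans_cat_def)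
    show "f \<cdot>\<^bsub>?X\<^esub> Idn ?X (Src ?X f) = f" "Idn ?X (Tgt ?X f) \<cdot>\<^bsub>?X\<^esub> f = f"
      using f' typed'[OF f'(2-4)] exts[OF f'(2-4)] Fs by (auto simp: trans_cat_def intro!: ext)
    fix g assume "g \<in> Arr ?X" and s: "Src ?X g = Tgt ?X f"
    then obtain H \<theta> where g': "g = (G, H, \<theta>)" "H \<in> Fs" "Trans G H \<theta>" using f' by (auto simp: trans_cat_def)
    then show "g \<cdot>\<^bsub>?X\<^esub> f \<in> Hom ?X (Src ?X f) (Tgt ?X g)" using f' comp by (auto simp: trans_cat_def)
  next
    fix f g h assume fgh: "f \<in> Arr ?X" "g \<in> Arr ?X" "h \<in> Arr ?X" "Src ?X g = Tgt ?X f \<and> Src ?X h = Tgt ?X g"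
    then obtain F G \<eta> where f': "f = (F, G, \<eta>)" "F \<in> Fs" "G \<in> Fs" "Trans F G \<eta>" by (auto simp: trans_cat_def)
    then obtain H \<theta> where g': "g = (G, H, \<theta>)" "H \<in> Fs" "Trans G H \<theta>" using fgh by (auto simp: trans_cat_def)
    then obtain K \<kappa> where h': "h = (H, K, \<kappa>)" "K \<in> Fs" "Trans H K \<kappa>" using fgh by (auto simp: trans_cat_def)
    show "(h \<cdot>\<^bsub>?X\<^esub> g) \<cdot>\<^bsub>?X\<^esub> f = h \<cdot>\<^bsub>?X\<^esub> (g \<cdot>\<^bsub>?X\<^esub> f)"
      using typed'[OF f'(2-4)] typed'[OF f'(3) g'(2,3)] typed'[OF g'(2) h'(2,3)]
      by (auto simp: trans_cat_def f'(1) g'(1) h'(1) Cmp_assoc intro!: ext)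
  qed (use id in \<open>auto simp: trans_cat_def\<close>)
  moreover have "is_iso ?X f" if f: "f \<in> Arr ?X" for f
  proof -
    obtain F G \<eta> where f': "f = (F, G, \<eta>)" "F \<in> Fs" "G \<in> Fs" "Trans F G \<eta>" using f by (auto simp: trans_cat_def)
    have "inverse_of ?X f (G, F, \<lambda>a\<in>Obj B. inv_arr C (\<eta> a))"
      using f' inv[OF f'(2-4)] typed'[OF f'(2-4)] by (auto simp: inverse_of_def trans_cat_def intro!: ext)
    then show ?thesis using f by (auto simp: is_iso_def)
  qed
  ultimately show ?thesis by (simp add: groupoid_def)
qed

text \<open>Every arrow of a finite product is a composite of arrows that move one coordinate at a
  time.\<close>

lemma prod_cat_Arr_induct:
  assumes K: "finite K" and C: "\<And>k. k \<in> K \<Longrightarrow> category (C k)"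
    and id: "\<And>x. x \<in> Obj (prod_cat K C) \<Longrightarrow> Q (Idn (prod_cat K C) x)"
    and comp: "\<And>f g. \<lbrakk>f \<in> Arr (prod_cat K C); g \<in> Arr (prod_cat K C); Src (prod_cat K C) g = Tgt (prod_cat K C) f; Q f; Q g\<rbrakk>
      \<Longrightarrow> Q (Cmp (prod_cat K C) g f)"
    and single: "\<And>k x f. \<lbrakk>k \<in> K; x \<in> Obj (prod_cat (K - {k}) C); f \<in> Arr (C k)\<rbrakk> \<Longrightarrow> Q ((Idn (prod_cat (K - {k}) C) x)(k := f))"
    and g: "g \<in> Arr (prod_cat K C)"
  shows "Q g"
proof -
  have c: "cat_axioms (C k)" if "k \<in> K" for k using C[OF that] by (simp add: cat_axioms_def)
  note [simp] = cat_axioms.Src_Obj[OF c] cat_axioms.Tgt_Obj[OF c] cat_axioms.Idn_Arr[OF c] cat_axioms.Src_Idn[OF c]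
    cat_axioms.Tgt_Idn[OF c] cat_axioms.Cmp_Idn[OF c] cat_axioms.Idn_Cmp[OF c]
  have gk [simp]: "g k \<in> Arr (C k)" if "k \<in> K" for k using g that by (auto simp: Arr_prod_cat)
  \<comment> \<open>The partial move: coordinates in \<open>A\<close> have moved, the others rest at
    their sources.\<close>
  define h where "h A = (\<lambda>k\<in>K. if k \<in> A then g k else Idn (C k) (Src (C k) (g k)))" for A
  have "Q (h A)" if "finite A" "A \<subseteq> K" for A
    using that
  proof (induction A)
    case empty
    have "h {} = Idn (prod_cat K C) (Src (prod_cat K C) g)"
      by (auto simp: h_def prod_cat_sel fun_eq_iff)
    moreover have "Src (prod_cat K C) g \<in> Obj (prod_cat K C)"
      by (auto simp: prod_cat_sel Obj_prod_cat)
    ultimately show ?case using id by simp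
  next
    case (insert a A)
    \<comment> \<open>The other coordinates at the moment when \<open>a\<close> moves: those in
      \<open>A\<close> have reached their targets, the rest are still at their sources.\<close>
    define x where "x = (\<lambda>k\<in>K - {a}. if k \<in> A then Tgt (C k) (g k) else Src (C k) (g k))"
    let ?s = "(Idn (prod_cat (K - {a}) C) x)(a := g a)"
    have a: "a \<in> K" "a \<notin> A" using insert by auto
    have x: "x \<in> Obj (prod_cat (K - {a}) C)" by (auto simp: x_def Obj_prod_cat)
    have "h (insert a A) = Cmp (prod_cat K C) ?s (h A)"
      using a by (auto simp: h_def x_def prod_cat_sel fun_eq_iff)
    moreover have "h A \<in> Arr (prod_cat K C)" "?s \<in> Arr (prod_cat K C)" "Src (prod_cat K C) ?s = Tgt (prod_cat K C) (h A)"
      using a x by (auto simp: h_def x_def prod_cat_sel Arr_prod_cat fun_eq_iff PiE_iff extensional_def)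
    ultimately show ?case
      using comp[of "h A" ?s] single[OF a(1) x gk[OF a(1)]] insert by simp
  qed
  from this[OF K subset_refl] show ?thesis
    using g by (simp add: h_def Arr_prod_cat PiE_iff extensional_restrict cong: restrict_cong)
qed

section \<open>Multi-determinant and multiexact functors as models\<close>

lemma prod_cat_truncate [simp]: "prod_cat I (\<lambda>i. cat.truncate (C i)) = prod_cat I C"
  by (simp add: prod_cat_def)

lemma at_place_truncate [simp]: "at_place I (\<lambda>i. cat.truncate (C i)) = at_place I C"
  by (simp add: at_place_def fun_eq_iff)

context sym_gpd
begin

text \<open>Naturality of a triangle holds for identities and is closed under composition in the
  other places, so \<open>prod_cat_Arr_induct\<close> reduces it to arrows moving one place, the
  case of the triangle-function axiom.\<close>

lemma tri_natI:
  assumes I: "finite I" and M: "\<And>k. k \<in> I \<Longrightarrow> wf_pres (M k)" and F: "premodel (Fam I M) F" and j: "j \<in> I"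
    and single: "\<And>k x f t. \<lbrakk>k \<in> I; k \<noteq> j; x \<in> Obj (prod_cat (I - {k, j}) (bases M)); f \<in> Arr (base (M k)); t \<in> lab (M j)\<rbrakk> \<Longrightarrow>
      far F ((Idn (prod_cat (I - {k, j}) (bases M)) x)(k := f, j := Idn (base (M j)) (ly (M j) t))) \<cdot> lb F (j, x(k := Src (base (M k)) f), t) =
      lb F (j, x(k := Tgt (base (M k)) f), t) \<cdot>
        (far F ((Idn (prod_cat (I - {k, j}) (bases M)) x)(k := f, j := Idn (base (M j)) (lz (M j) t))) [+]
         far F ((Idn (prod_cat (I - {k, j}) (bases M)) x)(k := f, j := Idn (base (M j)) (lx (M j) t))))"
  shows "tri_nat I M j F"
proof -
  let ?K = "I - {j}"
  have c: "category (base (M k))" if "k \<in> I" for k using M[OF that] by (simp add: wf_pres_def)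
  have K: "cat_axioms (prod_cat ?K (bases M))" and Kk: "cat_axioms (prod_cat (I - {k, j}) (bases M))" for k
    unfolding cat_axioms_def by (auto intro!: category_prod_cat c)
  have cj: "cat_axioms (base (M j))" using c[OF j] by (simp add: cat_axioms_def)
  define Q where "Q g \<longleftrightarrow> (\<forall>t\<in>lab (M j).
    far F (g(j := Idn (base (M j)) (ly (M j) t))) \<cdot> lb F (j, Src (prod_cat ?K (bases M)) g, t) =
    lb F (j, Tgt (prod_cat ?K (bases M)) g, t) \<cdot>
      (far F (g(j := Idn (base (M j)) (lz (M j) t))) [+] far F (g(j := Idn (base (M j)) (lx (M j) t)))))" for g
  note [simp] = premodelD(1-5,7-9)[OF F, simplified] wf_presD(2-4)[OF M[OF j]]
    cat_axioms.Src_Obj[OF K] cat_axioms.Tgt_Obj[OF K] cat_axioms.Idn_Arr[OF K]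
    cat_axioms.Src_Idn[OF K] cat_axioms.Tgt_Idn[OF K]
    cat_axioms.Idn_Arr[OF Kk] cat_axioms.Src_Idn[OF Kk] cat_axioms.Tgt_Idn[OF Kk]
    cat_axioms.Src_Obj[OF cj] cat_axioms.Tgt_Obj[OF cj] cat_axioms.Idn_Arr[OF cj]
    cat_axioms.Src_Idn[OF cj] cat_axioms.Tgt_Idn[OF cj] cat_axioms.Idn_Cmp[OF cj]
    upd_Obj upd_Arr Src_upd Tgt_upd
  have FI: "far F ((Idn (prod_cat ?K (bases M)) x)(j := Idn (base (M j)) a)) = Idn P (fob F (x(j := a)))"
    if "x \<in> Obj (prod_cat ?K (bases M))" "a \<in> Obj (base (M j))" for x a
    using premodelD(5)[OF F, of "x(j := a)"] that j by (simp add: Idn_upd)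
  have FC: "far F ((Cmp (prod_cat ?K (bases M)) g f)(j := Idn (base (M j)) a)) = far F (g(j := Idn (base (M j)) a)) \<cdot> far F (f(j := Idn (base (M j)) a))"
    if "f \<in> Arr (prod_cat ?K (bases M))" "g \<in> Arr (prod_cat ?K (bases M))" "Src (prod_cat ?K (bases M)) g = Tgt (prod_cat ?K (bases M)) f"
      "a \<in> Obj (base (M j))" for f g a
    using premodelD(6)[OF F, of "f(j := Idn (base (M j)) a)" "g(j := Idn (base (M j)) a)"] that j by (simp add: Cmp_upd)
  have "Q g" if "g \<in> Arr (prod_cat ?K (bases M))" for g
  proof (rule prod_cat_Arr_induct[where K = ?K and C = "bases M"])
    fix x assume "x \<in> Obj (prod_cat ?K (bases M))"
    then show "Q (Idn (prod_cat ?K (bases M)) x)"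
      using j by (simp add: Q_def FI)
  next
    fix f g assume fg: "f \<in> Arr (prod_cat ?K (bases M))" "g \<in> Arr (prod_cat ?K (bases M))"
      "Src (prod_cat ?K (bases M)) g = Tgt (prod_cat ?K (bases M)) f" and Q: "Q f" "Q g"
    note cf = cat_axioms.Src_Cmp[OF K fg] cat_axioms.Tgt_Cmp[OF K fg]
    show "Q (Cmp (prod_cat ?K (bases M)) g f)"
      unfolding Q_def cf
    proof
      fix t assume t: "t \<in> lab (M j)"
      let ?i = "Idn (base (M j))" and ?z = "lz (M j) t" and ?x = "lx (M j) t" and ?y = "ly (M j) t"
      let ?a = "Src (prod_cat ?K (bases M)) f" and ?b = "Tgt (prod_cat ?K (bases M)) f" and ?c = "Tgt (prod_cat ?K (bases M)) g"
      have 1: "far F (f(j := ?i ?y)) \<cdot> lb F (j, ?a, t) = lb F (j, ?b, t) \<cdot> (far F (f(j := ?i ?z)) [+] far F (f(j := ?i ?x)))"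
        and 2: "far F (g(j := ?i ?y)) \<cdot> lb F (j, ?b, t) = lb F (j, ?c, t) \<cdot> (far F (g(j := ?i ?z)) [+] far F (g(j := ?i ?x)))"
        using Q t fg(3) by (auto simp: Q_def)
      show "far F ((Cmp (prod_cat ?K (bases M)) g f)(j := ?i ?y)) \<cdot> lb F (j, ?a, t) =
        lb F (j, ?c, t) \<cdot> (far F ((Cmp (prod_cat ?K (bases M)) g f)(j := ?i ?z)) [+] far F ((Cmp (prod_cat ?K (bases M)) g f)(j := ?i ?x)))"
        using fg t j by (simp add: FC Cmp_assoc 1 Cmp_reassoc[OF 2] interchange)
    qed
  next
    fix k x f assume k: "k \<in> ?K" and x: "x \<in> Obj (prod_cat (?K - {k}) (bases M))" and f: "f \<in> Arr (base (M k))"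
    have [simp]: "?K - {k} = I - {k, j}" by auto
    show "Q ((Idn (prod_cat (?K - {k}) (bases M)) x)(k := f))"
      using k x f single[of k x f] by (simp add: Q_def)
  qed (use I c that in auto)
  then show ?thesis
    unfolding tri_nat_def Q_def by blast
qed

definition mdet_model :: "('i, 'o, 'm, 'p, 'q) mdetfunct \<Rightarrow> ('i \<Rightarrow> 'o, 'i \<Rightarrow> 'm, 'i \<times> ('i \<Rightarrow> 'o) \<times> 'm triangle, 'p, 'q) model" where
  "mdet_model D = \<lparr>fob = fob D, far = far D, lb = (\<lambda>(i, x, \<Delta>). mdadd D i x \<Delta>)\<rparr>"

lemma mdet_model_sel [simp]: "fob (mdet_model D) = fob D" "far (mdet_model D) = far D" "lb (mdet_model D) (i, x, \<Delta>) = mdadd D i x \<Delta>"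
  by (simp_all add: mdet_model_def)

lemma multi_det_unfold:
  "multi_det I T P D \<longleftrightarrow> is_functor (prod_cat I (isoms T)) P D \<and>
    (\<forall>i\<in>I. \<forall>x\<in>Obj (prod_cat (I - {i}) (isoms T)). det_functor (T i) P (det_slice I T D i x)) \<and>
    (\<forall>i\<in>I. \<forall>j\<in>I. i \<noteq> j \<longrightarrow> two_tri I (\<lambda>i. presT (T i)) i j (mdet_model D)) \<and>
    (\<forall>i\<in>I. \<forall>j\<in>I. i \<noteq> j \<longrightarrow> (\<forall>x\<in>Obj (prod_cat (I - {i, j}) (isoms T)). \<forall>f\<in>Arr (isom (T i)). \<forall>t\<in>dist (T j).
      far D (at_place I (isoms T) (x(j := vy (T j) t)) i f) \<cdot> mdadd D j (x(i := Src (T i) f)) t =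
        mdadd D j (x(i := Tgt (T i) f)) t \<cdot>
        (far D (at_place I (isoms T) (x(j := vz (T j) t)) i f) [+] far D (at_place I (isoms T) (x(j := vx (T j) t)) i f))))"
  unfolding multi_det_def two_tri_def Let_def presT_sel mdet_model_sel by (rule refl)

text \<open>The axioms match the relations of \<open>Fam\<close> one by one, except that
  triangle-function has to be extended by \<open>tri_natI\<close> to arrows moving several
  places.\<close>

lemma multi_det_iff:
  fixes T :: "'i \<Rightarrow> ('o, 'm) tricat"
  assumes I: "finite I" and T: "\<And>i. i \<in> I \<Longrightarrow> triangulated (T i)"
  shows "multi_det I T P D \<longleftrightarrow> is_model (Fam I (\<lambda>i. presT (T i))) (mdet_model D)"
proof -
  let ?M = "\<lambda>i. presT (T i)" and ?C = "isoms T"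
  have M: "wf_pres (?M i)" if "i \<in> I" for i using wf_presT[OF T[OF that]] .
  have cat: "category (?C i)" if "i \<in> I" for i using M[OF that] by (simp add: wf_pres_def)
  have slice: "fslice I ?M i x (mdet_model D) = det_model (det_slice I T D i x)" for i x
    by (simp add: fslice_def det_model_def det_slice_def)
  have ins: "I - {k, j} = I - {j, k}" for j k by auto
  have fD: "is_functor (prod_cat I ?C) P (mdet_model D) \<longleftrightarrow> is_functor (prod_cat I ?C) P D"
    by (rule is_functor_cong) simp_all
  show ?thesis
  proof
    assume "multi_det I T P D"
    note D = this[unfolded multi_det_unfold, THEN conjunct1] this[unfolded multi_det_unfold, THEN conjunct2, THEN conjunct1, rule_format]
      this[unfolded multi_det_unfold, THEN conjunct2, THEN conjunct2, THEN conjunct1, rule_format]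
      this[unfolded multi_det_unfold, THEN conjunct2, THEN conjunct2, THEN conjunct2, rule_format]
    have sl: "is_model (?M i) (fslice I ?M i x (mdet_model D))" if "i \<in> I" "x \<in> Obj (prod_cat (I - {i}) ?C)" for i x
      unfolding slice is_model_presT_iff by (rule D(2)[OF that])
    have pre: "premodel (Fam I ?M) (mdet_model D)"
    proof (rule premodel_FamI)
      show "is_functor (prod_cat I (bases ?M)) P (mdet_model D)"
        using D(1) fD by simp
      fix j x t assume "j \<in> I" "x \<in> Obj (prod_cat (I - {j}) (bases ?M))" "t \<in> lab (?M j)"
      then show "lb (mdet_model D) (j, x, t) \<in> Hom P (fob (mdet_model D) (x(j := lz (?M j) t)) \<boxplus> fob (mdet_model D) (x(j := lx (?M j) t)))
          (fob (mdet_model D) (x(j := ly (?M j) t)))"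
        using premodelD(7-9)[OF is_modelD[OF sl], of j x t] by simp
    qed (use cat in simp)
    have "tri_nat I ?M j (mdet_model D)" if j: "j \<in> I" for j
    proof (rule tri_natI[OF I M pre j])
      fix k x f t
      assume *: "k \<in> I" "k \<noteq> j" "x \<in> Obj (prod_cat (I - {k, j}) (bases ?M))" "f \<in> Arr (base (?M k))" "t \<in> lab (?M j)"
      have tf: "far D (at_place I ?C (x(j := vy (T j) t)) k f) \<cdot> mdadd D j (x(k := Src (T k) f)) t =
        mdadd D j (x(k := Tgt (T k) f)) t \<cdot> (far D (at_place I ?C (x(j := vz (T j) t)) k f) [+] far D (at_place I ?C (x(j := vx (T j) t)) k f))"
        using D(4)[of k j x f t] * j by simp
      have ap: "at_place I ?C (x(j := c)) k f = (Idn (prod_cat (I - {k, j}) ?C) x)(k := f, j := Idn (?C j) c)" for c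
        using * j Idn_upd[of j "I - {k}" ?C x c] by (simp add: at_place_def fun_upd_twist Diff_insert[of I j "{k}", symmetric] ins)
      show "far (mdet_model D) ((Idn (prod_cat (I - {k, j}) (bases ?M)) x)(k := f, j := Idn (base (?M j)) (ly (?M j) t))) \<cdot>
          lb (mdet_model D) (j, x(k := Src (base (?M k)) f), t) =
        lb (mdet_model D) (j, x(k := Tgt (base (?M k)) f), t) \<cdot>
        (far (mdet_model D) ((Idn (prod_cat (I - {k, j}) (bases ?M)) x)(k := f, j := Idn (base (?M j)) (lz (?M j) t))) [+]
         far (mdet_model D) ((Idn (prod_cat (I - {k, j}) (bases ?M)) x)(k := f, j := Idn (base (?M j)) (lx (?M j) t))))"
        using tf unfolding ap by simp
    qed
    then show "is_model (Fam I ?M) (mdet_model D)"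
      unfolding is_model_Fam_iff[OF pre] using D(3) is_model_rels[OF sl]
      by (intro conjI ballI impI) auto
  next
    assume m: "is_model (Fam I ?M) (mdet_model D)"
    note pre = is_modelD[OF m] and m' = m[unfolded is_model_Fam_iff[OF is_modelD[OF m]]]
    have "det_functor (T i) P (det_slice I T D i x)" if "i \<in> I" "x \<in> Obj (prod_cat (I - {i}) ?C)" for i x
    proof -
      have "premodel (?M i) (fslice I ?M i x (mdet_model D))"
        by (rule premodel_fslice[OF M pre]) (use that in auto)
      then have "is_model (?M i) (fslice I ?M i x (mdet_model D))"
        using m' that unfolding is_model_def by simp
      then show ?thesis unfolding slice is_model_presT_iff .
    qed
    moreover have "far D (at_place I ?C (x(j := vy (T j) t)) k f) \<cdot> mdadd D j (x(k := Src (T k) f)) t =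
        mdadd D j (x(k := Tgt (T k) f)) t \<cdot> (far D (at_place I ?C (x(j := vz (T j) t)) k f) [+] far D (at_place I ?C (x(j := vx (T j) t)) k f))"
      if *: "k \<in> I" "j \<in> I" "k \<noteq> j" "x \<in> Obj (prod_cat (I - {k, j}) ?C)" "f \<in> Arr (isom (T k))" "t \<in> dist (T j)" for k j x f t
    proof -
      have K: "cat_axioms (prod_cat (I - {k, j}) ?C)"
        unfolding cat_axioms_def by (auto intro!: category_prod_cat cat)
      have ap: "at_place I ?C (x(j := c)) k f = (Idn (prod_cat (I - {k, j}) ?C) x)(k := f, j := Idn (?C j) c)" for c
        using * Idn_upd[of j "I - {k}" ?C x c] by (simp add: at_place_def fun_upd_twist Diff_insert[of I j "{k}", symmetric] ins)
      let ?g = "(Idn (prod_cat (I - {k, j}) ?C) x)(k := f)"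
      have kj: "k \<in> I - {j}" and minus: "I - {j} - {k} = I - {k, j}" using * by auto
      have g: "?g \<in> Arr (prod_cat (I - {j}) ?C)" "Src (prod_cat (I - {j}) ?C) ?g = x(k := Src (T k) f)"
        "Tgt (prod_cat (I - {j}) ?C) ?g = x(k := Tgt (T k) f)"
        using upd_Arr[OF kj, of _ ?C f] Src_upd[OF kj, of ?C _ f] Tgt_upd[OF kj, of ?C _ f] * cat_axioms.Idn_Arr[OF K]
          cat_axioms.Src_Idn[OF K] cat_axioms.Tgt_Idn[OF K] unfolding minus by simp_all
      have "tri_nat I ?M j (mdet_model D)" using m' * by blast
      from this[unfolded tri_nat_def, rule_format, of ?g t] g *
      show ?thesis unfolding ap by simp
    qed
    moreover have "is_functor (prod_cat I ?C) P D"
      using pre fD by (simp add: premodel_def)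
    ultimately show "multi_det I T P D"
      unfolding multi_det_unfold using m'[THEN conjunct2, THEN conjunct2] by (intro conjI ballI impI) simp_all
  qed
qed

lemma multi_det_trans_iff:
  fixes T :: "'i \<Rightarrow> ('o, 'm) tricat"
  shows "multi_det_trans I T P D E \<theta> \<longleftrightarrow> \<theta> \<in> extensional (Obj (prod_cat I (isoms T))) \<and>
    mor (Fam I (\<lambda>i. presT (T i))) (mdet_model D) (mdet_model E) \<theta>"
  unfolding multi_det_trans_def nat_trans_def mor_def by (auto simp: PiE_iff)

end

lemma (in picard_pair) is_unit_cong:
  assumes "meq (presV V) F G"
  shows "is_unit F u \<longleftrightarrow> is_unit G u"
proof -
  have "fob F a = fob G a" "far F (lunit V a) = far G (lunit V a)" "far F (runit V a) = far G (runit V a)"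
    "lb F (\<zero>, a) = lb G (\<zero>, a)" "lb F (a, \<zero>) = lb G (a, \<zero>)" if "a \<in> Obj V" for a
    using assms that by (simp_all add: meq_def)
  then show ?thesis by (simp add: is_unit_def)
qed

section \<open>Multiexact functors as models\<close>

context picard_gpd
begin

definition mf_model :: "('i, 'v, 'w, 'p, 'q) mfunct \<Rightarrow> ('i \<Rightarrow> 'v, 'i \<Rightarrow> 'w, 'i \<times> ('i \<Rightarrow> 'v) \<times> 'v \<times> 'v, 'p, 'q) model" where
  "mf_model F = \<lparr>fob = fob F, far = far F, lb = (\<lambda>(i, x, a, b). madd F i x a b)\<rparr>"

lemma mf_model_sel [simp]: "fob (mf_model F) = fob F" "far (mf_model F) = far F" "lb (mf_model F) (i, x, a, b) = madd F i x a b"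
  by (simp_all add: mf_model_def)

text \<open>Multiexactness is stated with the inverses of the additivity arrows, two-triangles with
  the arrows themselves; inverting both sides of the equation translates one into the other.\<close>

lemma two_tri_inverse_iff:
  assumes [simp]: "w \<in> Obj P" "y \<in> Obj P" "z \<in> Obj P" "v \<in> Obj P"
    "p \<in> Arr P" "q1 \<in> Arr P" "q2 \<in> Arr P" "r \<in> Arr P" "s1 \<in> Arr P" "s2 \<in> Arr P"
    "Src P q1 = w \<boxplus> y" "Src P q2 = z \<boxplus> v" "Src P s1 = w \<boxplus> z" "Src P s2 = y \<boxplus> v"
    "Src P p = Tgt P q1 \<boxplus> Tgt P q2" "Src P r = Tgt P s1 \<boxplus> Tgt P s2" "Tgt P p = Tgt P r"
  shows "p \<cdot> (q1 [+] q2) = r \<cdot> ((s1 [+] s2) \<cdot> coas P w y z v) \<longleftrightarrow>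
    coas P w z y v \<cdot> (inv_arr P s1 [+] inv_arr P s2) \<cdot> inv_arr P r = (inv_arr P q1 [+] inv_arr P q2) \<cdot> inv_arr P p"
proof -
  have "inv_arr P (p \<cdot> (q1 [+] q2)) = (inv_arr P q1 [+] inv_arr P q2) \<cdot> inv_arr P p"
    "inv_arr P (r \<cdot> ((s1 [+] s2) \<cdot> coas P w y z v)) = coas P w z y v \<cdot> (inv_arr P s1 [+] inv_arr P s2) \<cdot> inv_arr P r"
    by (simp_all add: inv_of_Cmp inv_asum inv_coas Cmp_assoc)
  moreover have "p \<cdot> (q1 [+] q2) = r \<cdot> ((s1 [+] s2) \<cdot> coas P w y z v) \<longleftrightarrow>
      inv_arr P (p \<cdot> (q1 [+] q2)) = inv_arr P (r \<cdot> ((s1 [+] s2) \<cdot> coas P w y z v))"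
  proof
    assume "inv_arr P (p \<cdot> (q1 [+] q2)) = inv_arr P (r \<cdot> ((s1 [+] s2) \<cdot> coas P w y z v))"
    then have "inv_arr P (inv_arr P (p \<cdot> (q1 [+] q2))) = inv_arr P (inv_arr P (r \<cdot> ((s1 [+] s2) \<cdot> coas P w y z v)))"
      by (rule arg_cong)
    then show "p \<cdot> (q1 [+] q2) = r \<cdot> ((s1 [+] s2) \<cdot> coas P w y z v)" by simp
  qed simp
  ultimately show ?thesis by (auto simp only:)
qed

context
  fixes I :: "'i set" and V :: "'i \<Rightarrow> ('v, 'w) moncat"
  assumes V: "\<And>i. i \<in> I \<Longrightarrow> picard (V i)"
begin

abbreviation (input) "M \<equiv> \<lambda>i. presV (V i)"

lemma wf_M: "i \<in> I \<Longrightarrow> wf_pres (M i)"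
  by (rule wf_presV[OF V])

lemma pair: "i \<in> I \<Longrightarrow> picard_pair P (V i)"
  by (intro picard_pair.intro picard_gpdI V picard)

lemma slice_mf_model: "fslice I M i x (mf_model F) = sm_model (sm_slice I V F i x)"
  by (simp add: fslice_def sm_model_def sm_slice_def mf_model_def fun_eq_iff)

lemma tri_nat_mf_model_iff: "tri_nat I M j (mf_model F) \<longleftrightarrow> (\<forall>g\<in>Arr (prod_cat (I - {j}) V). \<forall>a\<in>Obj (V j). \<forall>b\<in>Obj (V j).
    far F (g(j := Idn (V j) (a \<boxplus>\<^bsub>V j\<^esub> b))) \<cdot> madd F j (Src (prod_cat (I - {j}) V) g) a b =
    madd F j (Tgt (prod_cat (I - {j}) V) g) a b \<cdot> (far F (g(j := Idn (V j) a)) [+] far F (g(j := Idn (V j) b))))"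
  by (simp add: tri_nat_def)

lemma premodel_mf_typed:
  assumes F: "premodel (Fam I M) (mf_model F)"
  shows "x \<in> Obj (prod_cat I V) \<Longrightarrow> fob F x \<in> Obj P"
    and "\<lbrakk>i \<in> I; x \<in> Obj (prod_cat (I - {i}) V); a \<in> Obj (V i); b \<in> Obj (V i)\<rbrakk> \<Longrightarrow> madd F i x a b \<in> Arr P"
    and "\<lbrakk>i \<in> I; x \<in> Obj (prod_cat (I - {i}) V); a \<in> Obj (V i); b \<in> Obj (V i)\<rbrakk> \<Longrightarrow> Src P (madd F i x a b) = fob F (x(i := a)) \<boxplus> fob F (x(i := b))"
    and "\<lbrakk>i \<in> I; x \<in> Obj (prod_cat (I - {i}) V); a \<in> Obj (V i); b \<in> Obj (V i)\<rbrakk> \<Longrightarrow> Tgt P (madd F i x a b) = fob F (x(i := a \<boxplus>\<^bsub>V i\<^esub> b))"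
  using premodelD(1)[OF F] premodelD(7-9)[OF F, of "(i, x, a, b)"] by simp_all

lemma two_tri_mf_model_iff:
  assumes F: "premodel (Fam I M) (mf_model F)" and ij: "i \<in> I" "j \<in> I" "i \<noteq> j"
  shows "two_tri I M i j (mf_model F) \<longleftrightarrow> (\<forall>x\<in>Obj (prod_cat (I - {i, j}) V).
      \<forall>a\<in>Obj (V i). \<forall>b\<in>Obj (V i). \<forall>c\<in>Obj (V j). \<forall>d\<in>Obj (V j).
       coas P (fob F (x(i := a, j := c))) (fob F (x(i := a, j := d))) (fob F (x(i := b, j := c))) (fob F (x(i := b, j := d))) \<cdot>
         (inv_arr P (madd F j (x(i := a)) c d) [+] inv_arr P (madd F j (x(i := b)) c d)) \<cdot> inv_arr P (madd F i (x(j := c \<boxplus>\<^bsub>V j\<^esub> d)) a b) =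
       (inv_arr P (madd F i (x(j := c)) a b) [+] inv_arr P (madd F i (x(j := d)) a b)) \<cdot> inv_arr P (madd F j (x(i := a \<boxplus>\<^bsub>V i\<^esub> b)) c d))"
proof -
  note F' = premodel_mf_typed[OF F]
  interpret Vi: picard_gpd "V i" by (rule picard_gpdI[OF V[OF ij(1)]])
  interpret Vj: picard_gpd "V j" by (rule picard_gpdI[OF V[OF ij(2)]])
  have "(madd F j (x(i := a \<boxplus>\<^bsub>V i\<^esub> b)) c d \<cdot> (madd F i (x(j := c)) a b [+] madd F i (x(j := d)) a b) =
      madd F i (x(j := c \<boxplus>\<^bsub>V j\<^esub> d)) a b \<cdot> ((madd F j (x(i := a)) c d [+] madd F j (x(i := b)) c d) \<cdot>
      coas P (fob F (x(i := a, j := c))) (fob F (x(i := b, j := c))) (fob F (x(i := a, j := d))) (fob F (x(i := b, j := d))))) \<longleftrightarrow>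
      (coas P (fob F (x(i := a, j := c))) (fob F (x(i := a, j := d))) (fob F (x(i := b, j := c))) (fob F (x(i := b, j := d))) \<cdot>
         (inv_arr P (madd F j (x(i := a)) c d) [+] inv_arr P (madd F j (x(i := b)) c d)) \<cdot> inv_arr P (madd F i (x(j := c \<boxplus>\<^bsub>V j\<^esub> d)) a b) =
       (inv_arr P (madd F i (x(j := c)) a b) [+] inv_arr P (madd F i (x(j := d)) a b)) \<cdot> inv_arr P (madd F j (x(i := a \<boxplus>\<^bsub>V i\<^esub> b)) c d))"
    if x: "x \<in> Obj (prod_cat (I - {i, j}) V)" and abcd: "a \<in> Obj (V i)" "b \<in> Obj (V i)" "c \<in> Obj (V j)" "d \<in> Obj (V j)" for x a b c d
  proof -
    have tw: "x(j := c, i := a) = x(i := a, j := c)" for a c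
      using ij(3) by (rule fun_upd_twist[symmetric])
    have xi: "x(i := a) \<in> Obj (prod_cat (I - {j}) V)" if "a \<in> Obj (V i)" for a
      using x that ij by (auto simp: Obj_prod_cat PiE_iff extensional_def)
    have xj: "x(j := c) \<in> Obj (prod_cat (I - {i}) V)" if "c \<in> Obj (V j)" for c
      using x that ij by (auto simp: Obj_prod_cat PiE_iff extensional_def)
    show ?thesis
      by (rule two_tri_inverse_iff) (use ij abcd xi xj in \<open>simp_all add: F' tw upd_Obj\<close>)
  qed
  then show ?thesis
    unfolding two_tri_def by simp
qed

lemma multiexact_unfold: "multiexact I V P F \<longleftrightarrow> is_functor (prod_cat I V) P F \<and>
    (\<forall>i\<in>I. \<forall>x\<in>Obj (prod_cat (I - {i}) V). sm_functor (V i) P (sm_slice I V F i x)) \<and>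
    (\<forall>i\<in>I. \<forall>g\<in>Arr (prod_cat (I - {i}) V).
       (\<forall>a\<in>Obj (V i). \<forall>b\<in>Obj (V i).
          far F (g(i := Idn (V i) (a \<boxplus>\<^bsub>V i\<^esub> b))) \<cdot> madd F i (Src (prod_cat (I - {i}) V) g) a b =
          madd F i (Tgt (prod_cat (I - {i}) V) g) a b \<cdot> (far F (g(i := Idn (V i) a)) [+] far F (g(i := Idn (V i) b)))) \<and>
       far F (g(i := Idn (V i) (ounit (V i)))) \<cdot> munit F i (Src (prod_cat (I - {i}) V) g) = munit F i (Tgt (prod_cat (I - {i}) V) g)) \<and>
    (\<forall>i\<in>I. \<forall>j\<in>I. i \<noteq> j \<longrightarrow> (\<forall>x\<in>Obj (prod_cat (I - {i, j}) V).
      \<forall>a\<in>Obj (V i). \<forall>b\<in>Obj (V i). \<forall>c\<in>Obj (V j). \<forall>d\<in>Obj (V j).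
       coas P (fob F (x(i := a, j := c))) (fob F (x(i := a, j := d))) (fob F (x(i := b, j := c))) (fob F (x(i := b, j := d))) \<cdot>
         (inv_arr P (madd F j (x(i := a)) c d) [+] inv_arr P (madd F j (x(i := b)) c d)) \<cdot> inv_arr P (madd F i (x(j := c \<boxplus>\<^bsub>V j\<^esub> d)) a b) =
       (inv_arr P (madd F i (x(j := c)) a b) [+] inv_arr P (madd F i (x(j := d)) a b)) \<cdot> inv_arr P (madd F j (x(i := a \<boxplus>\<^bsub>V i\<^esub> b)) c d)))"
  unfolding multiexact_def Let_def by (rule refl)

lemma is_functor_mf_model: "is_functor (prod_cat I V) P (mf_model F) \<longleftrightarrow> is_functor (prod_cat I V) P F"
  by (rule is_functor_cong) simp_all

lemma multiexact_model:
  assumes "multiexact I V P F"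
  shows "is_model (Fam I M) (mf_model F)"
proof -
  note F = assms[unfolded multiexact_unfold]
  have sl: "is_model (M i) (fslice I M i x (mf_model F))" if "i \<in> I" "x \<in> Obj (prod_cat (I - {i}) V)" for i x
    unfolding slice_mf_model using F[THEN conjunct2, THEN conjunct1] that by (simp add: sm_functor_iff)
  have pre: "premodel (Fam I M) (mf_model F)"
  proof (rule premodel_FamI)
    show "is_functor (prod_cat I (bases M)) P (mf_model F)"
      using F is_functor_mf_model by simp
    fix j x t assume "j \<in> I" "x \<in> Obj (prod_cat (I - {j}) (bases M))" "t \<in> lab (M j)"
    then show "lb (mf_model F) (j, x, t) \<in> Hom P (fob (mf_model F) (x(j := lz (M j) t)) \<boxplus> fob (mf_model F) (x(j := lx (M j) t)))
        (fob (mf_model F) (x(j := ly (M j) t)))"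
      using premodelD(7-9)[OF is_modelD[OF sl], of j x t] by simp
  qed (use wf_M in \<open>auto simp: wf_pres_def\<close>)
  have "tri_nat I M j (mf_model F)" if "j \<in> I" for j
    unfolding tri_nat_mf_model_iff using F[THEN conjunct2, THEN conjunct2, THEN conjunct1] that by blast
  moreover have "two_tri I M i j (mf_model F)" if "i \<in> I" "j \<in> I" "i \<noteq> j" for i j
    unfolding two_tri_mf_model_iff[OF pre that] using F[THEN conjunct2, THEN conjunct2, THEN conjunct2] that by blast
  ultimately show ?thesis
    unfolding is_model_Fam_iff[OF pre] using is_model_rels[OF sl] by (intro conjI ballI impI) auto
qed

text \<open>With \<open>I\<close> written as \<open>insert i (I - {i})\<close>, place
  \<open>i\<close> can be split off, and both claims are clauses of \<open>bimodel\<close>.\<close>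

lemma slice_model:
  assumes F: "is_model (Fam I M) F" and i: "i \<in> I"
  shows "x \<in> Obj (prod_cat (I - {i}) V) \<Longrightarrow> is_model (M i) (fslice I M i x F)"
    and "g \<in> Arr (prod_cat (I - {i}) V) \<Longrightarrow> mor (M i) (fslice I M i (Src (prod_cat (I - {i}) V) g) F)
      (fslice I M i (Tgt (prod_cat (I - {i}) V) g) F) (\<lambda>a. far F (g(i := Idn (V i) a)))"
proof -
  have Ii: "insert i (I - {i}) = I" using i by auto
  have pre: "premodel (Fam (insert i (I - {i})) M) F" and F': "is_model (Fam (insert i (I - {i})) M) F"
    using F is_modelD[OF F] unfolding Ii by auto
  have "bimodel (Fam (I - {i}) M) (M i) (tob (insert i (I - {i})) M i F)"
    using F' by (subst bimodel_tob_iff[OF _ _ pre]) (use wf_M i in auto)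
  then have B: "bimodel (Fam (I - {i}) M) (M i) (tob I M i F)"
    unfolding Ii .
  show "x \<in> Obj (prod_cat (I - {i}) V) \<Longrightarrow> is_model (M i) (fslice I M i x F)"
    using B by (simp add: bimodel_def prebimodel_def)
  have "cA (tob I M i F) g = (\<lambda>a. far F (g(i := Idn (V i) a)))" for g
    by (simp add: fun_eq_iff)
  then show "g \<in> Arr (prod_cat (I - {i}) V) \<Longrightarrow> mor (M i) (fslice I M i (Src (prod_cat (I - {i}) V) g) F)
      (fslice I M i (Tgt (prod_cat (I - {i}) V) g) F) (\<lambda>a. far F (g(i := Idn (V i) a)))"
    using B by (simp add: bimodel_def prebimodel_def)
qed

text \<open>Units have to be supplied. They exist in every slice by \<open>unit_ex\<close>; an arrow
  of the other places induces a morphism of slices, so their naturality is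
  \<open>unit_natural\<close>.\<close>

lemma multiexact_ex:
  assumes G: "is_model (Fam I M) G"
  shows "\<exists>F. multiexact I V P F \<and> mfunct_extensional I V F \<and> meq (Fam I M) (mf_model F) G"
proof -
  define F where "F = \<lparr>fob = restrict (fob G) (Obj (prod_cat I V)), far = restrict (far G) (Arr (prod_cat I V)),
    madd = (\<lambda>i x a b. if i \<in> I \<and> x \<in> Obj (prod_cat (I - {i}) V) \<and> a \<in> Obj (V i) \<and> b \<in> Obj (V i) then lb G (i, x, a, b) else undefined),
    munit = (\<lambda>i x. if i \<in> I \<and> x \<in> Obj (prod_cat (I - {i}) V) then SOME u. picard_pair.is_unit P (V i) (fslice I M i x G) u else undefined)\<rparr>"
  have F_sel [simp]: "fob F = restrict (fob G) (Obj (prod_cat I V))" "far F = restrict (far G) (Arr (prod_cat I V))"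
    "madd F i x a b = (if i \<in> I \<and> x \<in> Obj (prod_cat (I - {i}) V) \<and> a \<in> Obj (V i) \<and> b \<in> Obj (V i) then lb G (i, x, a, b) else undefined)"
    "munit F i x = (if i \<in> I \<and> x \<in> Obj (prod_cat (I - {i}) V) then SOME u. picard_pair.is_unit P (V i) (fslice I M i x G) u else undefined)" for i x a b
    by (simp_all only: F_def funct.select_convs mfunct.select_convs)
  have eq: "meq (Fam I M) (mf_model F) G"
    unfolding meq_def
  proof (intro conjI ballI)
    fix t assume "t \<in> lab (Fam I M)"
    then obtain i x a b where "t = (i, x, a, b)" "i \<in> I" "x \<in> Obj (prod_cat (I - {i}) V)" "a \<in> Obj (V i)" "b \<in> Obj (V i)"
      by (cases t) auto
    then show "lb (mf_model F) t = lb G t" by simp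
  qed simp_all
  have wf: "wf_pres (Fam I M)" by (rule wf_Fam[OF wf_M])
  have mF: "is_model (Fam I M) (mf_model F)"
    by (rule is_model_cong[OF wf meq_sym[OF eq] G])
  note pre = is_modelD[OF mF] and mF' = mF[unfolded is_model_Fam_iff[OF is_modelD[OF mF]]]
  have cat: "cat_axioms (prod_cat (I - {i}) V)" for i
    unfolding cat_axioms_def by (rule category_prod_cat) (use V in \<open>auto simp: picard_def groupoid_def\<close>)
  have munit_eq: "munit F i x = (SOME u. picard_pair.is_unit P (V i) (fslice I M i x G) u)"
    if "i \<in> I" "x \<in> Obj (prod_cat (I - {i}) V)" for i x
    unfolding F_sel using that by (simp only: simp_thms if_True)
  have unit: "picard_pair.is_unit P (V i) (fslice I M i x (mf_model F)) (munit F i x)"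
    if i: "i \<in> I" and x: "x \<in> Obj (prod_cat (I - {i}) V)" for i x
  proof -
    interpret picard_pair P "V i" by (rule pair[OF i])
    have "meq (M i) (fslice I M i x (mf_model F)) (fslice I M i x G)"
      using i x by (simp add: meq_def upd_Obj upd_Arr at_place_def cat_axioms.Idn_Arr[OF cat])
    from is_unit_cong[OF this] someI_ex[OF unit_ex[OF slice_model(1)[OF G i x]]]
    show ?thesis unfolding munit_eq[OF i x] by (rule iffD2)
  qed
  have "sm_functor (V i) P (sm_slice I V F i x)" if i: "i \<in> I" and x: "x \<in> Obj (prod_cat (I - {i}) V)" for i x
  proof -
    interpret picard_pair P "V i" by (rule pair[OF i])
    show ?thesis
      using iffD2[OF is_unit_iff[OF slice_model(1)[OF mF i x, unfolded slice_mf_model]]] unit[OF i x]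
      unfolding slice_mf_model sm_slice_def smfunct.select_convs by blast
  qed
  moreover have "far F (g(i := Idn (V i) (ounit (V i)))) \<cdot> munit F i (Src (prod_cat (I - {i}) V) g) = munit F i (Tgt (prod_cat (I - {i}) V) g)"
    if i: "i \<in> I" and g: "g \<in> Arr (prod_cat (I - {i}) V)" for i g
  proof -
    interpret picard_pair P "V i" by (rule pair[OF i])
    have s: "Src (prod_cat (I - {i}) V) g \<in> Obj (prod_cat (I - {i}) V)" "Tgt (prod_cat (I - {i}) V) g \<in> Obj (prod_cat (I - {i}) V)"
      using cat_axioms.Src_Obj[OF cat g] cat_axioms.Tgt_Obj[OF cat g] .
    show ?thesis
      using unit_natural[OF slice_model(1)[OF mF i s(1)] slice_model(1)[OF mF i s(2)] slice_model(2)[OF mF i g] unit[OF i s(1)] unit[OF i s(2)]]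
      by (simp del: F_sel)
  qed
  moreover have "is_functor (prod_cat I V) P F"
    using pre is_functor_mf_model[of F] by (simp add: premodel_def)
  moreover have "tri_nat I M i (mf_model F)" if "i \<in> I" for i
    using mF'[THEN conjunct2, THEN conjunct1] that by blast
  moreover have "two_tri I M i j (mf_model F)" if "i \<in> I" "j \<in> I" "i \<noteq> j" for i j
    using mF'[THEN conjunct2, THEN conjunct2] that by blast
  ultimately have "multiexact I V P F"
    unfolding multiexact_unfold tri_nat_mf_model_iff
    using two_tri_mf_model_iff[OF pre] by (simp del: F_sel)
  moreover have "mfunct_extensional I V F"
    by (simp add: mfunct_extensional_def)
  ultimately show ?thesis using eq by blast
qed

lemma multi_mon_trans_iff:
  assumes F: "multiexact I V P F" and G: "multiexact I V P G"
  shows "multi_mon_trans I V P F G \<eta> \<longleftrightarrow> \<eta> \<in> extensional (Obj (prod_cat I V)) \<and> mor (Fam I M) (mf_model F) (mf_model G) \<eta>"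
proof
  note mF = multiexact_model[OF F] and mG = multiexact_model[OF G]
  have slF: "sm_functor (V i) P (sm_slice I V F i x)" and slG: "sm_functor (V i) P (sm_slice I V G i x)"
    if "i \<in> I" "x \<in> Obj (prod_cat (I - {i}) V)" for i x
    using F G that by (simp_all add: multiexact_unfold)
  {
    assume \<eta>: "multi_mon_trans I V P F G \<eta>"
    have "\<eta> (x(i := a \<boxplus>\<^bsub>V i\<^esub> b)) \<cdot> madd F i x a b = madd G i x a b \<cdot> (\<eta> (x(i := a)) [+] \<eta> (x(i := b)))"
      if "i \<in> I" "x \<in> Obj (prod_cat (I - {i}) V)" "a \<in> Obj (V i)" "b \<in> Obj (V i)" for i x a b
      using \<eta> that by (simp add: multi_mon_trans_def mon_trans_def sm_slice_def)
    then show "\<eta> \<in> extensional (Obj (prod_cat I V)) \<and> mor (Fam I M) (mf_model F) (mf_model G) \<eta>"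
      using \<eta> by (auto simp: multi_mon_trans_def nat_trans_def mor_def PiE_iff)
  next
    assume \<eta>: "\<eta> \<in> extensional (Obj (prod_cat I V)) \<and> mor (Fam I M) (mf_model F) (mf_model G) \<eta>"
    have "mon_trans (V i) P (sm_slice I V F i x) (sm_slice I V G i x) (\<lambda>a. \<eta> (x(i := a)))"
      if i: "i \<in> I" and x: "x \<in> Obj (prod_cat (I - {i}) V)" for i x
    proof -
      interpret picard_pair P "V i" by (rule pair[OF i])
      have Ii: "insert i (I - {i}) = I" using i by auto
      have "mor (Fam (insert i (I - {i})) M) (mf_model F) (mf_model G) \<eta>" using \<eta> unfolding Ii by simp
      then have "bimor (Fam (I - {i}) M) (M i) (tob (insert i (I - {i})) M i (mf_model F)) (tob (insert i (I - {i})) M i (mf_model G)) (\<lambda>x a. \<eta> (x(i := a)))"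
        by (subst bimor_tob_iff) (use wf_M i is_modelD[OF mF] is_modelD[OF mG] Ii in auto)
      then have "mor (M i) (fslice I M i x (mf_model F)) (fslice I M i x (mf_model G)) (\<lambda>a. \<eta> (x(i := a)))"
        using x unfolding Ii by (simp add: bimor_def)
      \<comment> \<open>Slices inherit extensionality: with a non-object in place \<open>i\<close>
        the whole family is not an object of the product.\<close>
      moreover have "(\<lambda>a. \<eta> (x(i := a))) \<in> extensional (Obj (V i))"
      proof -
        have "\<eta> (x(i := a)) = undefined" if "a \<notin> Obj (V i)" for a
        proof -
          have "x(i := a) \<notin> Obj (prod_cat I V)"
            using that i PiE_mem[of "x(i := a)" I "\<lambda>i. Obj (V i)" i] by (auto simp: Obj_prod_cat)
          then show ?thesis using \<eta> by (auto simp: extensional_def)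
        qed
        then show ?thesis by (simp add: extensional_def)
      qed
      ultimately show ?thesis
        unfolding mon_trans_iff[OF slF[OF i x] slG[OF i x]] slice_mf_model by simp
    qed
    then show "multi_mon_trans I V P F G \<eta>"
      using \<eta> by (auto simp: multi_mon_trans_def nat_trans_def mor_def PiE_iff)
  }
qed

end

end

section \<open>The groupoids \<open>Det\<close> and \<open>Pic\<close> and the pullback
  functor\<close>

context sym_gpd
begin

lemma mor_restrict:
  assumes X: "wf_pres X"
  shows "mor X F G (restrict \<theta> (Obj (base X))) \<longleftrightarrow> mor X F G \<theta>"
  using X_simps[OF X] by (auto simp: mor_def)

text \<open>Treats \<open>Det\<close> and \<open>Pic\<close> together: through \<open>\<Phi>\<close>
  their arrows are morphisms of models, and these are invertible because \<open>P\<close> is a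
  groupoid.\<close>

lemma groupoid_models:
  assumes X: "wf_pres X" and Fs: "\<And>F. F \<in> Fs \<Longrightarrow> is_model X (\<Phi> F)" and B: "Obj B = Obj (base X)"
    and fob: "\<And>F. fob (\<Phi> F) = fob F"
    and Trans: "\<And>F G \<eta>. \<lbrakk>F \<in> Fs; G \<in> Fs\<rbrakk> \<Longrightarrow> Trans F G \<eta> \<longleftrightarrow> \<eta> \<in> extensional (Obj B) \<and> mor X (\<Phi> F) (\<Phi> G) \<eta>"
  shows "groupoid (trans_cat B P Fs Trans)"
proof (rule groupoid_trans_cat)
  note pre = is_modelD[OF Fs]
  show "fob F a \<in> Obj P" if "F \<in> Fs" "a \<in> Obj B" for F a
    using premodelD(1)[OF pre[OF that(1)], of a] that(2) by (simp add: B fob)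
  show "\<eta> \<in> (\<Pi>\<^sub>E a\<in>Obj B. Hom P (fob F a) (fob G a))" if "F \<in> Fs" "G \<in> Fs" "Trans F G \<eta>" for F G \<eta>
    using that Trans[OF that(1,2)] by (auto simp: PiE_iff mor_def B fob)
  show "Trans F F (\<lambda>a\<in>Obj B. Idn P (fob F a))" if "F \<in> Fs" for F
    using mor_id[OF X pre[OF that]] that by (simp add: Trans B fob mor_restrict[OF X])
  show "Trans F H (\<lambda>a\<in>Obj B. \<theta> a \<cdot> \<eta> a)" if "F \<in> Fs" "G \<in> Fs" "H \<in> Fs" "Trans F G \<eta>" "Trans G H \<theta>" for F G H \<eta> \<theta>
    using mor_comp[OF X pre[OF that(1)] pre[OF that(2)] pre[OF that(3)], of \<eta> \<theta>] that
    by (simp add: Trans B mor_restrict[OF X])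
  show "Trans G F (\<lambda>a\<in>Obj B. inv_arr P (\<eta> a))" if "F \<in> Fs" "G \<in> Fs" "Trans F G \<eta>" for F G \<eta>
    using mor_inv[OF X pre[OF that(1)] pre[OF that(2)], of \<eta>] that
    by (simp add: Trans B mor_restrict[OF X])
qed

end

context picard_gpd
begin

context
  fixes I :: "'i set" and T :: "'i \<Rightarrow> ('o, 'm) tricat" and V :: "'i \<Rightarrow> ('v, 'w) moncat"
    and d :: "'i \<Rightarrow> ('o, 'm, 'v, 'w) detfunct"
  assumes I: "finite I" and T: "\<And>i. i \<in> I \<Longrightarrow> triangulated (T i)"
    and d: "\<And>i. i \<in> I \<Longrightarrow> universal_det TYPE('p \<times> 'q) (T i) (V i) (d i)"
begin

lemma picard_V: "i \<in> I \<Longrightarrow> picard (V i)"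
  using d by (simp add: universal_det_def)

lemma wf_FamT: "wf_pres (Fam I (\<lambda>i. presT (T i)))" and wf_FamV: "wf_pres (Fam I (\<lambda>i. presV (V i)))"
  using wf_presT[OF T] wf_presV[OF picard_V] by (auto intro: wf_Fam)

lemma pequiv_Fam_det:
  "pequiv (Fam I (\<lambda>i. presT (T i))) (Fam I (\<lambda>i. presV (V i))) (Famq I (\<lambda>i. presV (V i)) (\<lambda>i. det_pmap (T i) (d i)))"
proof (rule pequiv_Fam[OF I])
  fix i assume i: "i \<in> I"
  show "wf_pres (presT (T i))" "wf_pres (presV (V i))"
    using wf_presT[OF T[OF i]] wf_presV[OF picard_V[OF i]] .
  show "pequiv (presT (T i)) (presV (V i)) (det_pmap (T i) (d i))"
    by (intro picard_pair.pequiv_det picard_pair.intro picard_gpdI picard picard_V T d i)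
qed

lemma fob_prod_det: "fob (prod_det J d) x = fob (Famq J N (\<lambda>i. det_pmap (T i) (d i))) x"
  and far_prod_det: "far (prod_det J d) f = far (Famq J N (\<lambda>i. det_pmap (T i) (d i))) f"
  by (simp_all add: prod_det_def Famq_sel)

text \<open>Only \<open>meq\<close> can be expected, since \<open>pullback\<close> is
  \<open>undefined\<close> off its domain while \<open>pull\<close> is not.\<close>

lemma pullback_model:
  "meq (Fam I (\<lambda>i. presT (T i))) (mdet_model (pullback I T V P d F))
    (pull (Famq I (\<lambda>i. presV (V i)) (\<lambda>i. det_pmap (T i) (d i))) (mf_model F))"
  unfolding meq_def
proof (intro conjI ballI)
  fix t assume "t \<in> lab (Fam I (\<lambda>i. presT (T i)))"
  then obtain i x \<Delta> where "t = (i, x, \<Delta>)" "i \<in> I" "x \<in> Obj (prod_cat (I - {i}) (isoms T))" "\<Delta> \<in> dist (T i)"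
    by auto
  then show "lb (mdet_model (pullback I T V P d F)) t = lb (pull (Famq I (\<lambda>i. presV (V i)) (\<lambda>i. det_pmap (T i) (d i))) (mf_model F)) t"
    by (simp add: pullback_def Famq_sel(3,4) Let_def fob_prod_det[where N = "\<lambda>i. presV (V i)"])
qed (simp_all add: pullback_def fob_prod_det[where N = "\<lambda>i. presV (V i)"] far_prod_det[where N = "\<lambda>i. presV (V i)"])

lemmas multi_det_iff_T = multi_det_iff[where I = I and T = T, OF I T, simplified]

lemma Pic_models:
  shows "multiexact I V P F \<Longrightarrow> is_model (Fam I (\<lambda>i. presV (V i))) (mf_model F)"
    and "is_model (Fam I (\<lambda>i. presV (V i))) G \<Longrightarrow>
      \<exists>F. multiexact I V P F \<and> mfunct_extensional I V F \<and> meq (Fam I (\<lambda>i. presV (V i))) (mf_model F) G"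
    and "\<lbrakk>multiexact I V P F; multiexact I V P F'\<rbrakk> \<Longrightarrow> multi_mon_trans I V P F F' \<eta> \<longleftrightarrow>
      \<eta> \<in> extensional (Obj (prod_cat I V)) \<and> mor (Fam I (\<lambda>i. presV (V i))) (mf_model F) (mf_model F') \<eta>"
  by (rule multiexact_model multiexact_ex multi_mon_trans_iff; simp add: picard_V)+

lemma Det_sel: "Obj (Det I T P) = {D. multi_det I T P D \<and> mdetfunct_extensional I T D}"
  "Arr (Det I T P) = {(D, E, \<theta>). D \<in> Obj (Det I T P) \<and> E \<in> Obj (Det I T P) \<and> multi_det_trans I T P D E \<theta>}"
  "Src (Det I T P) = (\<lambda>(D, E, \<theta>). D)" "Tgt (Det I T P) = (\<lambda>(D, E, \<theta>). E)"
  "Idn (Det I T P) D = (D, D, \<lambda>x\<in>Obj (prod_cat I (isoms T)). Idn P (fob D x))"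
  "Cmp (Det I T P) (D, E, \<theta>) (D', E', \<eta>) = (D', E, \<lambda>x\<in>Obj (prod_cat I (isoms T)). \<theta> x \<cdot> \<eta> x)"
  by (simp_all add: Det_def trans_cat_def)

lemma Pic_sel: "Obj (Pic I V P) = {F. multiexact I V P F \<and> mfunct_extensional I V F}"
  "Arr (Pic I V P) = {(F, G, \<eta>). F \<in> Obj (Pic I V P) \<and> G \<in> Obj (Pic I V P) \<and> multi_mon_trans I V P F G \<eta>}"
  "Src (Pic I V P) = (\<lambda>(F, G, \<eta>). F)" "Tgt (Pic I V P) = (\<lambda>(F, G, \<eta>). G)"
  "Idn (Pic I V P) F = (F, F, \<lambda>x\<in>Obj (prod_cat I V). Idn P (fob F x))"
  "Cmp (Pic I V P) (F, G, \<theta>) (F', G', \<eta>) = (F', G, \<lambda>x\<in>Obj (prod_cat I V). \<theta> x \<cdot> \<eta> x)"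
  by (simp_all add: Pic_def trans_cat_def)

lemma Det_model: "D \<in> Obj (Det I T P) \<Longrightarrow> is_model (Fam I (\<lambda>i. presT (T i))) (mdet_model D)"
  using multi_det_iff_T by (simp add: Det_sel)

lemma Pic_model: "F \<in> Obj (Pic I V P) \<Longrightarrow> is_model (Fam I (\<lambda>i. presV (V i))) (mf_model F)"
  using Pic_models(1) by (simp add: Pic_sel)

lemma groupoid_Det: "groupoid (Det I T P)"
  unfolding Det_def
  by (rule groupoid_models[OF wf_FamT, where \<Phi> = mdet_model])
    (use multi_det_iff_T in \<open>auto simp: multi_det_trans_iff\<close>)

lemma groupoid_Pic: "groupoid (Pic I V P)"
  unfolding Pic_def
  by (rule groupoid_models[OF wf_FamV, where \<Phi> = mf_model])
    (use Pic_models(1,3) in auto)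

text \<open>The clauses of \<open>pequiv\<close> for the family of all variables become the
  hypotheses of \<open>is_equivalenceI\<close>; lifted components are restricted to objects to make
  them extensional.\<close>

theorem det_pullback_equivalence: "is_equivalence (Pic I V P) (Det I T P) (det_pullback I T V P d)"
proof (rule is_equivalenceI)
  let ?X = "Fam I (\<lambda>i. presT (T i))" and ?Y = "Fam I (\<lambda>i. presV (V i))"
  let ?q = "Famq I (\<lambda>i. presV (V i)) (\<lambda>i. det_pmap (T i) (d i))" and ?B = "prod_cat I (isoms T)"
  let ?\<Pi> = "pullback I T V P d" and ?\<Phi> = "det_pullback I T V P d"
  note eqv = pequiv_Fam_det and q = pequivD(1)[OF pequiv_Fam_det]
  show gP: "category (Pic I V P)" and gD: "groupoid (Det I T P)"
    using groupoid_Pic groupoid_Det by (simp_all add: groupoid_def)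
  have ob: "fob (prod_det I d) x \<in> Obj (prod_cat I V)" if "x \<in> Obj ?B" for x
    using wf_pmapD(1)[OF q, of x] that by (simp add: fob_prod_det[where N = "\<lambda>i. presV (V i)"])
  have \<Phi>: "fob ?\<Phi> F = ?\<Pi> F" "far ?\<Phi> (F, G, \<eta>) = (?\<Pi> F, ?\<Pi> G, \<lambda>x\<in>Obj ?B. \<eta> (fob ?q x))" for F G \<eta>
    by (simp_all add: det_pullback_def fob_prod_det[where N = "\<lambda>i. presV (V i)"])
  have \<Pi>_Obj: "?\<Pi> F \<in> Obj (Det I T P)" if F: "F \<in> Obj (Pic I V P)" for F
  proof -
    have "is_model ?X (mdet_model (?\<Pi> F))"
      by (rule is_model_cong[OF wf_FamT meq_sym[OF pullback_model] pequivD(2)[OF eqv Pic_model[OF F]]])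
    moreover have "mdetfunct_extensional I T (?\<Pi> F)"
      by (simp add: mdetfunct_extensional_def pullback_def)
    ultimately show ?thesis
      using multi_det_iff_T by (simp add: Det_sel)
  qed
  have \<Pi>_mor: "mor ?X (mdet_model (?\<Pi> F)) (mdet_model (?\<Pi> G)) \<theta> \<longleftrightarrow> mor ?X (pull ?q (mf_model F)) (pull ?q (mf_model G)) \<theta>" for F G \<theta>
    using mor_cong[OF wf_FamT pullback_model pullback_model refl] mor_cong[OF wf_FamT meq_sym[OF pullback_model] meq_sym[OF pullback_model] refl]
    by blast
  have Pic_trans: "multi_mon_trans I V P F G \<eta> \<longleftrightarrow> \<eta> \<in> extensional (Obj (prod_cat I V)) \<and> mor ?Y (mf_model F) (mf_model G) \<eta>"
    if "F \<in> Obj (Pic I V P)" "G \<in> Obj (Pic I V P)" for F G \<eta>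
    using Pic_models(3)[of F G \<eta>] that by (simp add: Pic_sel)
  have \<Phi>_Hom: "far ?\<Phi> (F, G, \<eta>) \<in> Hom (Det I T P) (?\<Pi> F) (?\<Pi> G)" if "(F, G, \<eta>) \<in> Arr (Pic I V P)" for F G \<eta>
  proof -
    have FG: "F \<in> Obj (Pic I V P)" "G \<in> Obj (Pic I V P)" and \<eta>: "mor ?Y (mf_model F) (mf_model G) \<eta>"
      using that Pic_trans by (auto simp: Pic_sel(2))
    have "mor ?X (mdet_model (?\<Pi> F)) (mdet_model (?\<Pi> G)) (\<lambda>x\<in>Obj ?B. \<eta> (fob ?q x))"
      using mor_pull[OF wf_FamT wf_FamV q is_modelD[OF Pic_model[OF FG(1)]] is_modelD[OF Pic_model[OF FG(2)]] \<eta>]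
        mor_restrict[OF wf_FamT] by (simp add: \<Pi>_mor)
    then show ?thesis
      using \<Pi>_Obj[OF FG(1)] \<Pi>_Obj[OF FG(2)] by (simp add: Det_sel(2-4) \<Phi> multi_det_trans_iff)
  qed
  show "is_functor (Pic I V P) (Det I T P) ?\<Phi>"
    unfolding is_functor_def
  proof (intro conjI ballI impI)
    show "category (Pic I V P)" "category (Det I T P)"
      using gP gD by (simp_all add: groupoid_def)
    show "fob ?\<Phi> F \<in> Obj (Det I T P)" if "F \<in> Obj (Pic I V P)" for F
      using \<Pi>_Obj[OF that] by (simp add: \<Phi>)
    show "far ?\<Phi> f \<in> Hom (Det I T P) (fob ?\<Phi> (Src (Pic I V P) f)) (fob ?\<Phi> (Tgt (Pic I V P) f))" if "f \<in> Arr (Pic I V P)" for f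
      using \<Phi>_Hom that by (cases f) (simp add: \<Phi>(1) Pic_sel(3,4))
    show "far ?\<Phi> (Idn (Pic I V P) F) = Idn (Det I T P) (fob ?\<Phi> F)" if "F \<in> Obj (Pic I V P)" for F
      using ob by (auto simp: \<Phi> Pic_sel(5) Det_sel(5) pullback_def fob_prod_det[where N = "\<lambda>i. presV (V i)"] intro!: restrict_ext)
    show "far ?\<Phi> (Cmp (Pic I V P) g f) = Cmp (Det I T P) (far ?\<Phi> g) (far ?\<Phi> f)" for f g
      using ob by (cases f; cases g) (auto simp: \<Phi> Pic_sel(6) Det_sel(6) fob_prod_det[where N = "\<lambda>i. presV (V i)"] intro!: restrict_ext)
  qed
  show "\<exists>f\<in>Hom (Pic I V P) F G. far ?\<Phi> f = h"
    if FG: "F \<in> Obj (Pic I V P)" "G \<in> Obj (Pic I V P)" and h: "h \<in> Hom (Det I T P) (fob ?\<Phi> F) (fob ?\<Phi> G)" for F G h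
  proof -
    obtain \<theta> where h': "h = (?\<Pi> F, ?\<Pi> G, \<theta>)" and \<theta>: "\<theta> \<in> extensional (Obj ?B)" "mor ?X (mdet_model (?\<Pi> F)) (mdet_model (?\<Pi> G)) \<theta>"
      using h by (cases h) (auto simp: Det_sel(2-4) \<Phi> multi_det_trans_iff)
    obtain \<beta> where \<beta>: "mor ?Y (mf_model F) (mf_model G) \<beta>" "\<And>x. x \<in> Obj ?B \<Longrightarrow> \<beta> (fob ?q x) = \<theta> x"
      using pequivD(4)[OF eqv Pic_model[OF FG(1)] Pic_model[OF FG(2)] \<theta>(2)[unfolded \<Pi>_mor]] by auto
    let ?\<beta> = "restrict \<beta> (Obj (prod_cat I V))"
    have "(F, G, ?\<beta>) \<in> Hom (Pic I V P) F G"
      using FG \<beta>(1) mor_restrict[OF wf_FamV, of "mf_model F" "mf_model G" \<beta>] by (simp add: Pic_sel(2-4) Pic_trans)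
    moreover have "(\<lambda>x\<in>Obj ?B. ?\<beta> (fob ?q x)) = \<theta>"
      by (rule extensionalityI[OF restrict_extensional \<theta>(1)])
        (use \<beta>(2) ob in \<open>simp add: fob_prod_det[where N = "\<lambda>i. presV (V i)"]\<close>)
    ultimately show ?thesis
      by (intro bexI[of _ "(F, G, ?\<beta>)"]) (simp_all add: \<Phi> h')
  qed
  show "f = g" if fg: "f \<in> Hom (Pic I V P) F G" "g \<in> Hom (Pic I V P) F G" and eq: "far ?\<Phi> f = far ?\<Phi> g" for F G f g
  proof -
    obtain \<beta> \<beta>' where f: "f = (F, G, \<beta>)" and g: "g = (F, G, \<beta>')"
      and FG: "F \<in> Obj (Pic I V P)" "G \<in> Obj (Pic I V P)" and "multi_mon_trans I V P F G \<beta>" "multi_mon_trans I V P F G \<beta>'"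
      using fg by (cases f; cases g) (auto simp: Pic_sel(2-4))
    then have \<beta>: "\<beta> \<in> extensional (Obj (prod_cat I V))" "mor ?Y (mf_model F) (mf_model G) \<beta>"
      and \<beta>': "\<beta>' \<in> extensional (Obj (prod_cat I V))" "mor ?Y (mf_model F) (mf_model G) \<beta>'"
      by (simp_all add: Pic_trans)
    have res: "(\<lambda>x\<in>Obj ?B. \<beta> (fob ?q x)) = (\<lambda>x\<in>Obj ?B. \<beta>' (fob ?q x))"
      using eq by (simp add: f g \<Phi>)
    have q_eq: "\<beta> (fob ?q x) = \<beta>' (fob ?q x)" if "x \<in> Obj (base ?X)" for x
      using fun_cong[OF res, of x] that by simp
    have "\<beta> = \<beta>'"
    proof (rule extensionalityI[OF \<beta>(1) \<beta>'(1)])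
      fix y assume y: "y \<in> Obj (prod_cat I V)"
      show "\<beta> y = \<beta>' y"
        by (rule pequivD(5)[OF eqv Pic_model[OF FG(1)] Pic_model[OF FG(2)] \<beta>(2) \<beta>'(2)], erule q_eq) (use y in simp)
    qed
    then show ?thesis by (simp add: f g)
  qed
  show "\<exists>F\<in>Obj (Pic I V P). \<exists>e. e \<in> Hom (Det I T P) (fob ?\<Phi> F) D" if D: "D \<in> Obj (Det I T P)" for D
  proof -
    obtain G \<alpha> where G: "is_model ?Y G" and \<alpha>: "mor ?X (pull ?q G) (mdet_model D) \<alpha>"
      using pequivD(3)[OF eqv Det_model[OF D]] by blast
    obtain F where F: "F \<in> Obj (Pic I V P)" and FG: "meq ?Y (mf_model F) G"
      using Pic_models(2)[OF G] by (auto simp: Pic_sel)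
    \<comment> \<open>The multiexact functor realizes the model \<open>G\<close> only up to
      \<open>meq\<close>, which pulling back preserves.\<close>
    have "meq ?X (pull ?q (mf_model F)) (pull ?q G)"
      using FG wf_pmapD[OF q] by (simp add: meq_def del: Fam_sel)
    then have "meq ?X (mdet_model (?\<Pi> F)) (pull ?q G)"
      using pullback_model[of F] by (simp add: meq_def del: Fam_sel)
    from mor_cong[OF wf_FamT meq_sym[OF this] meq_refl refl \<alpha>]
    have "mor ?X (mdet_model (?\<Pi> F)) (mdet_model D) (restrict \<alpha> (Obj ?B))"
      using mor_restrict[OF wf_FamT] by simp
    then have "(?\<Pi> F, D, restrict \<alpha> (Obj ?B)) \<in> Hom (Det I T P) (fob ?\<Phi> F) D"
      using \<Pi>_Obj[OF F] D by (simp add: Det_sel(2-4) \<Phi> multi_det_trans_iff)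
    with F show ?thesis by blast
  qed
qed

end

end

theorem corollary4p2:
  fixes n :: nat
    and T :: "nat \<Rightarrow> ('o, 'm) tricat"
    and V :: "nat \<Rightarrow> ('v, 'w) moncat"
    and det :: "nat \<Rightarrow> ('o, 'm, 'v, 'w) detfunct"
    and P :: "('p, 'q) moncat"
  assumes "\<And>i. i \<le> n \<Longrightarrow> triangulated (T i)"
    and "\<And>i. i \<le> n \<Longrightarrow> universal_det TYPE('p \<times> 'q) (T i) (V i) (det i)"
    and "picard P"
  shows "groupoid (Det {..n} T P) \<and> groupoid (Pic {..n} V P) \<and>
    is_equivalence (Pic {..n} V P) (Det {..n} T P) (det_pullback {..n} T V P det)"
proof -
  interpret picard_gpd P by (rule picard_gpdI[OF assms(3)])
  show ?thesis
    using groupoid_Det[of "{..n}" T V det] groupoid_Pic[of "{..n}" T V det] det_pullback_equivalence[of "{..n}" T V det] assms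
    by simp
qed

end
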